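(* Let $G$ be a locally compact group, let $B$ be a Banach algebra having a bounded approximate identity, and let $\Phi\colon L^1(G)\to B$ be a surjective continuous linear map which preserves two-sided zero products. Then $\Phi$ is a weighted Jordan homomorphism.
   Context: Banach algebras are complex and associative, not assumed unital. Bounded approximate identities are two-sided. $L^1(G)$ is the group algebra of $G$ (with respect to Haar measure), with convolution as product. The notation $a\circ b$ stands for the Jordan product $ab+ba$. For Banach algebras $A$ and $B$: a linear map $\Phi\colon A\to B$ preserves two-sided zero products if for all $a,b\in A$, $ab=ba=0$ implies $\Phi(a)\Phi(b)=\Phi(b)\Phi(a)=0$. A Jordan homomorphism is a linear map $\Psi\colon A\to B$ with $\Psi(a\circ b)=\Psi(a)\circ\Psi(b)$ for all $a,b\in A$. A centralizer of $B$ is a linear map $W\colon B\to B$ with $W(ab)=W(a)b=aW(b)$ for all $a,b\in B$. A linear map $\Phi\colon A\to B$ is a weighted Jordan homomorphism if there exist an invertible centralizer $W$ of $B$ and a Jordan homomorphism $\Psi$ from $A$ to $B$ such that $\Phi=W\Psi$. *)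

theory Defs
  imports "HOL-Analysis.Analysis"
begin

section \<open>Complex Banach algebras\<close>

class complex_vector = real_vector +
  fixes scaleC :: "complex \<Rightarrow> 'a \<Rightarrow> 'a"  (infixr "*\<^sub>C" 75)
  assumes scaleR_scaleC: "r *\<^sub>R x = complex_of_real r *\<^sub>C x"
    and scaleC_add_right: "c *\<^sub>C (x + y) = c *\<^sub>C x + c *\<^sub>C y"
    and scaleC_add_left: "(c + d) *\<^sub>C x = c *\<^sub>C x + d *\<^sub>C x"
    and scaleC_scaleC: "c *\<^sub>C d *\<^sub>C x = (c * d) *\<^sub>C x"

class complex_normed_vector = complex_vector + real_normed_vector +
  assumes norm_scaleC: "norm (c *\<^sub>C x) = cmod c * norm x"

text \<open>Algebras are associative but not assumed unital.\<close>

class complex_normed_algebra = complex_normed_vector + real_normed_algebra +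
  assumes mult_scaleC_left: "(c *\<^sub>C x) * y = c *\<^sub>C (x * y)"
    and mult_scaleC_right: "x * (c *\<^sub>C y) = c *\<^sub>C (x * y)"

class complex_banach_algebra = complex_normed_algebra + banach

abbreviation clinear :: "('a::complex_vector \<Rightarrow> 'b::complex_vector) \<Rightarrow> bool"
  where "clinear \<equiv> Vector_Spaces.linear scaleC scaleC"

lemma vector_space_scaleC: "vector_space (scaleC :: complex \<Rightarrow> 'a::complex_vector \<Rightarrow> 'a)"
proof
  show "1 *\<^sub>C x = x" for x :: 'a
    using scaleR_scaleC[of 1 x] by simp
qed (auto simp: scaleC_add_right scaleC_add_left scaleC_scaleC)

lemma clinear_iff:
  fixes f :: "'a::complex_vector \<Rightarrow> 'b::complex_vector"
  shows   "clinear f \<longleftrightarrow> (\<forall>x y. f (x + y) = f x + f y) \<and> (\<forall>c x. f (c *\<^sub>C x) = c *\<^sub>C f x)"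
  using vector_space_scaleC[where 'a = 'a] vector_space_scaleC[where 'a = 'b]
  by (simp add: Vector_Spaces.linear_iff)

text \<open>A net is encoded, as usual in the library, by a family \<open>e\<close> together with a nontrivial
  filter \<open>F\<close> on its index type.\<close>

definition bounded_approximate_identity :: "('i \<Rightarrow> 'a::real_normed_algebra) \<Rightarrow> 'i filter \<Rightarrow> bool"
  where "bounded_approximate_identity e F \<longleftrightarrow>
    F \<noteq> bot \<and> bounded (range e) \<and>
    (\<forall>a. ((\<lambda>i. e i * a) \<longlongrightarrow> a) F \<and> ((\<lambda>i. a * e i) \<longlongrightarrow> a) F)"


section \<open>Zero products and weighted Jordan homomorphisms\<close>

definition preserves_two_sided_zero_products ::
    "('a::{complex_vector, times} \<Rightarrow> 'b::{complex_vector, times}) \<Rightarrow> bool"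
  where "preserves_two_sided_zero_products \<Phi> \<longleftrightarrow>
    (\<forall>a b. a * b = 0 \<and> b * a = 0 \<longrightarrow> \<Phi> a * \<Phi> b = 0 \<and> \<Phi> b * \<Phi> a = 0)"

definition jordan_product :: "'a::{plus, times} \<Rightarrow> 'a \<Rightarrow> 'a"  (infixl "\<circ>\<^sub>J" 70)
  where "a \<circ>\<^sub>J b = a * b + b * a"

definition jordan_hom ::
    "('a::{complex_vector, times} \<Rightarrow> 'b::{complex_vector, times}) \<Rightarrow> bool"
  where "jordan_hom \<Psi> \<longleftrightarrow> clinear \<Psi> \<and> (\<forall>a b. \<Psi> (a \<circ>\<^sub>J b) = \<Psi> a \<circ>\<^sub>J \<Psi> b)"

definition centralizer :: "('b::{complex_vector, times} \<Rightarrow> 'b) \<Rightarrow> bool"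
  where "centralizer W \<longleftrightarrow>
    clinear W \<and> (\<forall>a b. W (a * b) = W a * b \<and> W (a * b) = a * W b)"

definition weighted_jordan_hom ::
    "('a::{complex_vector, times} \<Rightarrow> 'b::{complex_vector, times}) \<Rightarrow> bool"
  where "weighted_jordan_hom \<Phi> \<longleftrightarrow>
    clinear \<Phi> \<and> (\<exists>W \<Psi>. centralizer W \<and> bij W \<and> jordan_hom \<Psi> \<and> \<Phi> = W \<circ> \<Psi>)"


section \<open>Locally compact groups and Haar measure\<close>

text \<open>Groups are written additively, as in the library class \<^class>\<open>topological_group_add\<close>, but are
  not assumed to be commutative.\<close>

class locally_compact_group = topological_group_add + t2_space +
  assumes locally_compact: "\<exists>U K. open U \<and> compact K \<and> x \<in> U \<and> U \<subseteq> K"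

lemma locally_compact_space_euclidean:
  "locally_compact_space (euclidean :: 'g::locally_compact_group topology)"
  using locally_compact[where 'a = 'g] by (simp add: locally_compact_space_def)

text \<open>A left Haar measure: a nonzero left-invariant Radon measure on the Borel sets. There is no
  countability assumption on the group, so the measure need not be sigma-finite; regularity is
  outer on Borel sets and inner on open sets. The Borel sets are spelled out because the constant
  \<^const>\<open>borel\<close> is not available inside the class specification below.\<close>

definition (in locally_compact_group) left_haar_measure :: "'a measure \<Rightarrow> bool"
  where "left_haar_measure M \<longleftrightarrow>
    space M = UNIV \<and> sets M = sigma_sets UNIV {U. open U} \<and>
    emeasure M UNIV \<noteq> 0 \<and>
    (\<forall>K. compact K \<longrightarrow> emeasure M K < \<infinity>) \<and>
    (\<forall>A\<in>sets M. emeasure M A = (INF U\<in>{U. open U \<and> A \<subseteq> U}. emeasure M U)) \<and>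
    (\<forall>U. open U \<longrightarrow> emeasure M U = (SUP K\<in>{K. compact K \<and> K \<subseteq> U}. emeasure M K)) \<and>
    (\<forall>x. \<forall>A\<in>sets M. emeasure M ((\<lambda>y. x + y) ` A) = emeasure M A)"

text \<open>A locally compact group together with an arbitrary choice of left Haar measure.\<close>

class haar_group = locally_compact_group +
  fixes haar :: "'a measure"
  assumes left_haar_measure_haar: "left_haar_measure haar"

lemma sets_haar: "sets (haar :: 'g::haar_group measure) = sets borel"
proof -
  have "sets (haar :: 'g measure) = sigma_sets UNIV {U. open U}"
    using left_haar_measure_haar[where 'a = 'g] unfolding left_haar_measure_def by (elim conjE)
  then show ?thesis by (simp add: borel_def)
qed


section \<open>The group algebra\<close>

quotient_type (overloaded) 'g L1 = "'g::haar_group \<Rightarrow> complex" / partial: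
  "\<lambda>f g. integrable haar f \<and> integrable haar g \<and> (AE x in haar. f x = g x)"
proof (rule part_equivpI)
  show "\<exists>f::'g \<Rightarrow> complex. integrable haar f \<and> integrable haar f \<and> (AE x in haar. f x = f x)"
    by (rule exI[of _ "\<lambda>_. 0"]) auto
next
  show "symp (\<lambda>f g::'g \<Rightarrow> complex. integrable haar f \<and> integrable haar g \<and> (AE x in haar. f x = g x))"
    by (rule sympI) (auto simp: eq_commute)
next
  show "transp (\<lambda>f g::'g \<Rightarrow> complex. integrable haar f \<and> integrable haar g \<and> (AE x in haar. f x = g x))"
  proof (rule transpI, elim conjE, intro conjI)
    fix f g h :: "'g \<Rightarrow> complex"
    assume "AE x in haar. f x = g x" "AE x in haar. g x = h x"
    then show "AE x in haar. f x = h x" by eventually_elim simp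
  qed
qed

instantiation L1 :: (haar_group) complex_normed_vector
begin

lift_definition zero_L1 :: "'a L1" is "\<lambda>_. 0" by simp

lift_definition plus_L1 :: "'a L1 \<Rightarrow> 'a L1 \<Rightarrow> 'a L1" is "\<lambda>f g x. f x + g x" by auto

lift_definition minus_L1 :: "'a L1 \<Rightarrow> 'a L1 \<Rightarrow> 'a L1" is "\<lambda>f g x. f x - g x" by auto

lift_definition uminus_L1 :: "'a L1 \<Rightarrow> 'a L1" is "\<lambda>f x. - f x" by auto

lift_definition scaleC_L1 :: "complex \<Rightarrow> 'a L1 \<Rightarrow> 'a L1" is "\<lambda>c f x. c * f x" by auto

lift_definition scaleR_L1 :: "real \<Rightarrow> 'a L1 \<Rightarrow> 'a L1" is "\<lambda>r f x. r *\<^sub>R f x" by auto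

lift_definition norm_L1 :: "'a L1 \<Rightarrow> real" is "\<lambda>f. \<integral>x. cmod (f x) \<partial>haar"
  by (rule integral_cong_AE) auto

definition dist_L1 :: "'a L1 \<Rightarrow> 'a L1 \<Rightarrow> real"
  where "dist_L1 a b = norm (a - b)"

definition sgn_L1 :: "'a L1 \<Rightarrow> 'a L1"
  where "sgn_L1 a = scaleR (inverse (norm a)) a"

definition uniformity_L1 :: "('a L1 \<times> 'a L1) filter"
  where "uniformity_L1 = (INF e\<in>{0<..}. principal {(x, y). dist x y < e})"

definition open_L1 :: "'a L1 set \<Rightarrow> bool"
  where "open_L1 U \<longleftrightarrow> (\<forall>x\<in>U. eventually (\<lambda>(x', y). x' = x \<longrightarrow> y \<in> U) uniformity)"

instance
proof
  fix a b c :: "'a L1" and r s :: real and z w :: complex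
  show "a + b + c = a + (b + c)" by transfer (auto simp: algebra_simps)
  show "a + b = b + a" by transfer (auto simp: algebra_simps)
  show "0 + a = a" by transfer auto
  show "- a + a = 0" by transfer auto
  show "a - b = a + - b" by transfer auto
  show "r *\<^sub>R (a + b) = r *\<^sub>R a + r *\<^sub>R b" by transfer (auto simp: algebra_simps)
  show "(r + s) *\<^sub>R a = r *\<^sub>R a + s *\<^sub>R a" by transfer (auto simp: algebra_simps)
  show "r *\<^sub>R s *\<^sub>R a = (r * s) *\<^sub>R a" by transfer auto
  show "1 *\<^sub>R a = a" by transfer auto
  show "r *\<^sub>R a = complex_of_real r *\<^sub>C a" by transfer (auto simp: scaleR_conv_of_real)
  show "z *\<^sub>C (a + b) = z *\<^sub>C a + z *\<^sub>C b" by transfer (auto simp: algebra_simps)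
  show "(z + w) *\<^sub>C a = z *\<^sub>C a + w *\<^sub>C a" by transfer (auto simp: algebra_simps)
  show "z *\<^sub>C w *\<^sub>C a = (z * w) *\<^sub>C a" by transfer (auto simp: algebra_simps)
  show "dist a b = norm (a - b)" by (rule dist_L1_def)
  show "sgn a = scaleR (inverse (norm a)) a" by (rule sgn_L1_def)
  show "uniformity = (INF e\<in>{0<..}. principal {(x :: 'a L1, y). dist x y < e})"
    by (rule uniformity_L1_def)
  show "open U \<longleftrightarrow> (\<forall>x\<in>U. eventually (\<lambda>(x', y). x' = x \<longrightarrow> y \<in> U) uniformity)"
    for U :: "'a L1 set" by (rule open_L1_def)
  show "norm a = 0 \<longleftrightarrow> a = 0"
  proof transfer
    fix f :: "'a \<Rightarrow> complex"
    assume "integrable haar f \<and> integrable haar f \<and> (AE x in haar. f x = f x)"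
    then show "((\<integral>x. cmod (f x) \<partial>haar) = 0) \<longleftrightarrow>
        (integrable haar f \<and> integrable haar (\<lambda>_::'a. 0::complex) \<and> (AE x in haar. f x = 0))"
      by (subst integral_nonneg_eq_0_iff_AE) auto
  qed
  show "norm (a + b) \<le> norm a + norm b"
  proof transfer
    fix f g :: "'a \<Rightarrow> complex"
    assume "integrable haar f \<and> integrable haar f \<and> (AE x in haar. f x = f x)"
      and "integrable haar g \<and> integrable haar g \<and> (AE x in haar. g x = g x)"
    then have fg: "integrable haar f" "integrable haar g" by auto
    have "(\<integral>x. cmod (f x + g x) \<partial>haar) \<le> (\<integral>x. cmod (f x) + cmod (g x) \<partial>haar)"
      by (rule integral_mono) (use fg in \<open>auto intro: norm_triangle_ineq\<close>)
    also have "\<dots> = (\<integral>x. cmod (f x) \<partial>haar) + (\<integral>x. cmod (g x) \<partial>haar)"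
      using fg by simp
    finally show "(\<integral>x. cmod (f x + g x) \<partial>haar) \<le> (\<integral>x. cmod (f x) \<partial>haar) + (\<integral>x. cmod (g x) \<partial>haar)" .
  qed
  show "norm (r *\<^sub>R a) = \<bar>r\<bar> * norm a" by transfer simp
  show "norm (z *\<^sub>C a) = cmod z * norm a" by transfer (simp add: norm_mult)
qed

end

text \<open>Convolution, in multiplicative notation \<open>(f * g)(x) = \<integral> f(y) g(y\<inverse> x) dy\<close>. The class of the
  result does not depend on the representatives.\<close>

definition convolution :: "('g::haar_group \<Rightarrow> complex) \<Rightarrow> ('g \<Rightarrow> complex) \<Rightarrow> 'g \<Rightarrow> complex"
  where "convolution f g x = (\<integral>y. f y * g (- y + x) \<partial>haar)"

instantiation L1 :: (haar_group) times
begin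

definition times_L1 :: "'a L1 \<Rightarrow> 'a L1 \<Rightarrow> 'a L1"
  where "a * b = abs_L1 (convolution (rep_L1 a) (rep_L1 b))"

instance ..

end

end

theory Submission
  imports Defs
begin

text \<open>Write \<open>L\<^sub>t\<close> and \<open>R\<^sub>t\<close> for left translation and normalised right translation on \<open>L\<^sup>1(G)\<close>, so
  that \<open>R\<^sub>t a * b = a * L\<^sub>t b\<close>. Let \<open>\<psi>\<close> be a bounded bilinear map with \<open>\<psi>(a, b) = 0\<close> whenever
  \<open>a * b = 0\<close>. Absolutely summable sequences \<open>f, g\<close> on the integers with \<open>f * g = 0\<close> yield zero
  products \<open>(\<Sum>\<^sub>m f(m) R\<^sub>m\<^sub>t a) (\<Sum>\<^sub>n g(n) L\<^sub>n\<^sub>t b)\<close>, and Fourier series with disjoint supports provide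
  enough of them to force \<open>\<psi>(R\<^sub>t a, b) = \<psi>(a, L\<^sub>t b)\<close>. As convolution operators are approximated by
  linear combinations of translations, also \<open>\<psi>(a x, b) = \<psi>(a, x b)\<close>.

  If \<open>a b = 0\<close> and \<open>c d = 0\<close>, then \<open>b c\<close> and \<open>d a\<close> have zero product on both sides, so the previous
  step can be applied twice to \<open>\<Phi>(b c) \<Phi>(d a)\<close>. The resulting four-term identity shows that
  \<open>W b = lim \<Phi>(u\<^sub>j) b\<close> exists for an approximate identity \<open>u\<close> of \<open>L\<^sup>1(G)\<close>, and that
  \<open>W (\<Phi> (x \<circ> y)) = \<Phi> x \<circ> \<Phi> y\<close> once \<open>W\<close> is known to be a centralizer; the latter is proved by
  averaging over the translates of \<open>u\<close> by a cyclic subgroup. Since the approximate identity of the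
  target has bounded preimages by Baire's theorem, \<open>W\<close> is bounded below with dense range, hence
  bijective, and \<open>\<Phi> = W \<circ> (W\<^sup>-\<^sup>1 \<circ> \<Phi>)\<close>.\<close>

subsection \<open>Fourier series with disjoint supports\<close>

text \<open>In general \<open>G\<close> is neither sigma-compact nor second countable, so Haar
  measure need not be sigma-finite and \<open>g(y\<^sup>-\<^sup>1 x)\<close> need not be jointly
  measurable. Fubini arguments therefore use representatives that are pointwise limits of functions
  from \<open>Cc\<close> and so vanish off a sigma-compact set. Associativity of convolution comes
  from approximating \<open>a * b\<close> by combinations of translates of \<open>b\<close>.

  Only the powers of one element \<open>t\<close> are moved through \<open>\<psi>\<close> at a time.
  They form a commutative group even if \<open>G\<close> is not commutative, so the harmonic
  analysis takes place on the circle.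

  \<open>\<Phi>\<close> controls only pairs with both products zero, so \<open>\<Phi>(R\<^sub>t a)
  \<Phi>(b) = \<Phi>(a) \<Phi>(L\<^sub>t b)\<close> may fail. The difference of the two sides,
  \<open>defect\<close>, satisfies a cocycle identity and a shift identity. These make it vanish in
  the limit along \<open>u\<close>, which is why left and right limits agree and \<open>W\<close> is
  a centralizer.

  \<open>W\<close> is bounded below because \<open>W (\<Phi> (a * a)) = \<Phi> a * \<Phi> a\<close>
  gives \<open>b * \<Phi> a * \<Phi> a = W b * \<Phi> (a * a)\<close>, where \<open>\<Phi> a\<close>
  may be taken close to a unit with \<open>a\<close> bounded.\<close>

lemma summable_inverse_square: "summable (\<lambda>n. 1 / (real n)^2)"
  using inverse_power_summable[of 2, where 'a=real] by (simp add: field_simps)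

text \<open>The mean value inequality is applied twice: to \<open>h'\<close> on
  \<open>[x - d, x + d]\<close>, then to \<open>h (x + t) + h (x - t)\<close> on
  \<open>[0, d]\<close>. The constant \<open>2\<close> is not optimal, but in the application
  \<open>M\<close> tends to \<open>0\<close>.\<close>

lemma second_difference_bound:
  fixes h h' h'' :: "real \<Rightarrow> real"
  assumes "0 \<le> d"
    and h: "\<And>t. (h has_real_derivative h' t) (at t)"
    and h': "\<And>t. (h' has_real_derivative h'' t) (at t)"
    and bd: "\<And>t. x - d \<le> t \<Longrightarrow> t \<le> x + d \<Longrightarrow> \<bar>h'' t\<bar> \<le> M"
  shows "\<bar>h (x + d) + h (x - d) - 2 * h x\<bar> \<le> 2 * d\<^sup>2 * M"
proof -
  have b1: "\<bar>h' (x + t) - h' (x - t)\<bar> \<le> 2 * d * M" if t: "0 \<le> t" "t \<le> d" for t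
  proof -
    have "norm (h' (x + t) - h' (x - t)) \<le> M * norm ((x + t) - (x - t))"
      by (rule field_differentiable_bound[where S="{x-d..x+d}" and f'=h''])
        (use t bd in \<open>auto intro!: DERIV_subset[OF h']\<close>)
    also have "\<dots> \<le> M * (2 * d)"
      using t bd[of x] \<open>0 \<le> d\<close> by (intro mult_left_mono) auto
    finally show ?thesis by (simp add: mult_ac)
  qed
  define k where "k t = h (x + t) + h (x - t)" for t
  have k: "(k has_real_derivative (h' (x + t) - h' (x - t))) (at t)" for t
    unfolding k_def
    by (auto intro!: derivative_eq_intros DERIV_chain'[where g=h, OF _ h] simp: h)
  have "norm (k d - k 0) \<le> 2 * d * M * norm (d - 0)"
    by (rule field_differentiable_bound[where S="{0..d}" and f'="\<lambda>t. h' (x + t) - h' (x - t)"])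
      (use b1 \<open>0 \<le> d\<close> in \<open>auto intro!: DERIV_subset[OF k]\<close>)
  then show ?thesis using \<open>0 \<le> d\<close> by (simp add: k_def power2_eq_square mult_ac)
qed

text \<open>Two termwise differentiations of the Abel-regularised series remove the denominators and
  leave \<open>1/2\<close> minus half the Poisson kernel. The term \<open>n = 0\<close> of
  \<open>g\<close> is \<open>1 / 0 = 0\<close>, so the series really starts at
  \<open>n = 1\<close>.\<close>

lemma abel_cosine_series:
  fixes r :: real
  assumes r: "0 < r" "r < 1"
  defines "g \<equiv> \<lambda>x. \<Sum>n. r ^ n * cos (real n * x) / (real n)\<^sup>2"
  shows "\<exists>g'. (\<forall>x. (g has_real_derivative g' x) (at x)) \<and>
    (\<forall>x. (g' has_real_derivative (1/2 - (1 - r\<^sup>2) / (2 * (1 - 2 * r * cos x + r\<^sup>2)))) (at x))"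
proof -
  have summ0: "summable (\<lambda>n. r ^ n)" using r by (intro summable_geometric) auto
  have le1: "real n / (real n)\<^sup>2 \<le> 1" for n
    by (cases "n = 0") (auto simp: power2_eq_square)
  have "uniformly_convergent_on UNIV (\<lambda>n x. \<Sum>i<n. - (r ^ i * (real i * sin (real i * x)) / (real i)\<^sup>2))"
    (is "uniformly_convergent_on _ (\<lambda>n x. \<Sum>i<n. ?f1 i x)")
  proof (rule Weierstrass_m_test'[OF _ summ0])
    fix n :: nat and x :: real
    have "norm (?f1 n x) = r ^ n * \<bar>sin (real n * x)\<bar> * (real n / (real n)\<^sup>2)"
      using r by (simp add: abs_mult)
    also have "\<dots> \<le> r ^ n * 1 * 1"
      using r le1[of n] by (intro mult_mono) auto
    finally show "norm (?f1 n x) \<le> r ^ n" by simp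
  qed
  then obtain g1 where g1: "uniform_limit UNIV (\<lambda>n x. \<Sum>i<n. ?f1 i x) g1 sequentially"
    by (auto simp: uniformly_convergent_on_def)
  have "\<exists>G. \<forall>x\<in>UNIV. (\<lambda>n. r ^ n * cos (real n * x) / (real n)\<^sup>2) sums G x \<and>
     (G has_real_derivative g1 x) (at x within UNIV)"
  proof (rule has_field_derivative_series[where f'="?f1" and ?x0.0=0])
    show "summable (\<lambda>n. r ^ n * cos (real n * 0) / (real n)\<^sup>2)"
      by (rule summable_comparison_test'[OF summable_inverse_square, of 0])
        (use r in \<open>auto simp: abs_mult power_le_one divide_right_mono\<close>)
  next
    fix n :: nat and x :: real
    have "((\<lambda>x. cos (real n * x)) has_field_derivative - (real n * sin (real n * x))) (at x within UNIV)"
      by (auto intro!: derivative_eq_intros)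
    from DERIV_cmult[OF this, of "r ^ n / (real n)\<^sup>2"]
    show "((\<lambda>x. r ^ n * cos (real n * x) / (real n)\<^sup>2) has_field_derivative ?f1 n x) (at x within UNIV)"
      by simp
  qed (use g1 in auto)
  then obtain G where G: "\<And>x. (\<lambda>n. r ^ n * cos (real n * x) / (real n)\<^sup>2) sums G x"
     "\<And>x. (G has_real_derivative g1 x) (at x)" by auto
  have gG: "g = G" using G(1) by (auto simp: g_def sums_iff)
  have g1s: "(\<lambda>i. ?f1 i x) sums g1 x" for x
    using tendsto_uniform_limitI[OF g1, of x] by (simp add: sums_def)
  \<comment> \<open>The derivative of the vanishing term \<open>n = 0\<close> is \<open>0\<close>,
    whereas the general formula would give \<open>- 1\<close>.\<close>
  define f2 where "f2 n x = (if n = 0 then 0 else - (r ^ n * cos (real n * x)))" for n x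
  have "uniformly_convergent_on UNIV (\<lambda>n x. \<Sum>i<n. f2 i x)"
  proof (rule Weierstrass_m_test'[OF _ summ0])
    fix n :: nat and x :: real
    show "norm (f2 n x) \<le> r ^ n" using r abs_cos_le_one[of "real n * x"]
      by (auto simp: f2_def abs_mult mult_left_le)
  qed
  then obtain g2 where g2: "uniform_limit UNIV (\<lambda>n x. \<Sum>i<n. f2 i x) g2 sequentially"
    by (auto simp: uniformly_convergent_on_def)
  have "\<exists>G. \<forall>x\<in>UNIV. (\<lambda>n. ?f1 n x) sums G x \<and>
     (G has_real_derivative g2 x) (at x within UNIV)"
  proof (rule has_field_derivative_series[where f'="f2" and ?x0.0=0])
    fix n :: nat and x :: real
    show "(?f1 n has_field_derivative f2 n x) (at x within UNIV)"
    proof -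
      have "((\<lambda>x. sin (real n * x)) has_field_derivative real n * cos (real n * x)) (at x within UNIV)"
        by (auto intro!: derivative_eq_intros)
      from DERIV_cmult[OF this, of "- (r ^ n * real n / (real n)\<^sup>2)"]
      show ?thesis
        by (cases "n = 0") (simp_all add: f2_def power2_eq_square mult_ac)
    qed
  qed (use g2 in auto)
  then obtain G1 where G1: "\<And>x. (\<lambda>n. ?f1 n x) sums G1 x"
     "\<And>x. (G1 has_real_derivative g2 x) (at x)" by auto
  have gG1: "g1 = G1" using G1(1) g1s by (auto intro: sums_unique2)
  have g2v: "g2 x = 1/2 - (1 - r\<^sup>2) / (2 * (1 - 2 * r * cos x + r\<^sup>2))" for x
  proof -
    have a: "(\<lambda>i. f2 i x) sums g2 x"
      using tendsto_uniform_limitI[OF g2, of x] by (simp add: sums_def)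
    \<comment> \<open>\<open>r ^ n * cos (n x)\<close> is \<open>Re (z ^ n)\<close>. The geometric
      series sums it from \<open>n = 0\<close>, so the term \<open>1\<close> has to be taken
      off.\<close>
    define z where "z = of_real r * cis x"
    have nz: "norm z < 1" using r by (simp add: z_def norm_mult)
    have "(\<lambda>n. z ^ n) sums (1 / (1 - z))" by (rule geometric_sums[OF nz])
    then have "(\<lambda>n. Re (z ^ n)) sums Re (1 / (1 - z))" by (rule sums_Re)
    moreover have "Re (z ^ n) = r ^ n * cos (real n * x)" for n
      by (simp add: z_def power_mult_distrib Complex.DeMoivre flip: of_real_power)
    ultimately have b: "(\<lambda>n. r ^ n * cos (real n * x)) sums Re (1 / (1 - z))" by simp
    have "(\<lambda>n. (if n = 0 then 1 else 0) - r ^ n * cos (real n * x)) sums (1 - Re (1 / (1 - z)))"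
      by (intro sums_diff b sums_single[of 0 "\<lambda>_. 1", simplified])
    moreover have "(\<lambda>n. (if n = 0 then 1 else 0) - r ^ n * cos (real n * x)) = (\<lambda>n. f2 n x)"
      by (auto simp: f2_def)
    ultimately have e: "g2 x = 1 - Re (1 / (1 - z))" using a sums_unique2 by metis
    have sq: "(cos x)\<^sup>2 + (sin x)\<^sup>2 = 1" by simp
    have den: "(1 - r * cos x)\<^sup>2 + (r * sin x)\<^sup>2 = 1 - 2 * r * cos x + r\<^sup>2"
      using sq by algebra
    have pos: "1 - 2 * r * cos x + r\<^sup>2 > 0"
    proof -
      have "r * cos x \<le> r" using r by (simp add: mult_left_le)
      then have "1 - r * cos x > 0" using r by linarith
      then have "(1 - r * cos x)\<^sup>2 > 0" by simp
      then show ?thesis using den by (smt (verit) zero_le_power2)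
    qed
    have "Re (1 / (1 - z)) = (1 - r * cos x) / (1 - 2 * r * cos x + r\<^sup>2)"
      using den by (simp add: z_def Re_divide cmod_power2)
    moreover define D where "D = 1 - 2 * r * cos x + r\<^sup>2"
    ultimately have "g2 x = 1 - (1 - r * cos x) / D" and "D > 0"
      using pos e by simp_all
    moreover have "2 * (1 - r * cos x) = D + (1 - r\<^sup>2)" by (simp add: D_def)
    ultimately have "g2 x = 1/2 - (1 - r\<^sup>2) / (2 * D)" by (simp add: field_simps)
    then show ?thesis by (simp only: D_def)
  qed
  show ?thesis
    by (rule exI[of _ g1]) (use G(2) G1(2) in \<open>simp only: gG g2v[symmetric] gG1[symmetric], simp\<close>)
qed

text \<open>On \<open>[0, 2 pi]\<close> the sum \<open>S\<close> is the quadratic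
  \<open>pi^2/6 - pi x/2 + x^2/4\<close>, whose second differences are \<open>d^2/2\<close>. Here
  this is reached through Abel means: for \<open>r < 1\<close> the second derivative differs from
  \<open>1/2\<close> by half a Poisson kernel, which tends to \<open>0\<close> uniformly on closed
  intervals inside \<open>(0, 2 pi)\<close>.\<close>

lemma second_difference_cosine_series:
  assumes "0 \<le> d" "d < x" "x + d < 2 * pi"
  defines "S \<equiv> \<lambda>x. \<Sum>n. cos (real n * x) / (real n)\<^sup>2"
  shows "S (x + d) + S (x - d) - 2 * S x = d\<^sup>2 / 2"
proof -
  define g where "g r x = (\<Sum>n. r ^ n * cos (real n * x) / (real n)\<^sup>2)" for r x :: real
  have lim: "((\<lambda>r. g r y) \<longlongrightarrow> S y) (at_left 1)" for y
  proof -
    have "\<forall>\<^sub>F r in at_left (1::real). 0 < r \<and> r < 1"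
      unfolding eventually_at_left_field by (rule exI[of _ 0]) auto
    then have "((\<lambda>r. \<Sum>n. r ^ n * cos (real n * y) / (real n)\<^sup>2) \<longlongrightarrow> (\<Sum>n. 1 ^ n * cos (real n * y) / (real n)\<^sup>2)) (at_left 1)"
    proof (intro tannerys_theorem[THEN conjunct2, THEN conjunct2])
      show "((\<lambda>r. r ^ k * cos (real k * y) / (real k)\<^sup>2) \<longlongrightarrow> 1 ^ k * cos (real k * y) / (real k)\<^sup>2) (at_left 1)" for k
        unfolding divide_inverse by (intro tendsto_intros)
      show "summable (\<lambda>n. 1 / (real n)\<^sup>2)" by (rule summable_inverse_square)
      assume ev: "\<forall>\<^sub>F r in at_left (1::real). 0 < r \<and> r < 1"
      show "\<forall>\<^sub>F (k, r) in at_top \<times>\<^sub>F at_left 1. norm (r ^ k * cos (real k * y) / (real k)\<^sup>2) \<le> 1 / (real k)\<^sup>2"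
        using eventually_prodI[OF eventually_True ev]
        by eventually_elim (auto simp: abs_mult intro!: divide_right_mono mult_le_one power_le_one)
    qed auto
    then show ?thesis by (simp add: g_def S_def)
  qed
  \<comment> \<open>\<open>\<kappa>\<close> keeps the denominator of the Poisson kernel away from
    \<open>0\<close> on \<open>[x - d, x + d]\<close>, which lies strictly between \<open>0\<close>
    and \<open>2 pi\<close>.\<close>
  obtain \<kappa> where \<kappa>: "\<kappa> > 0" "\<And>t. x - d \<le> t \<Longrightarrow> t \<le> x + d \<Longrightarrow> \<kappa> \<le> 1 - cos t"
  proof -
    have "\<exists>t0\<in>{x-d..x+d}. \<forall>t\<in>{x-d..x+d}. 1 - cos t0 \<le> 1 - cos t"
      using \<open>0 \<le> d\<close> by (intro continuous_attains_inf) (auto intro!: continuous_intros)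
    then obtain t0 where t0: "t0 \<in> {x-d..x+d}" "\<And>t. t\<in>{x-d..x+d} \<Longrightarrow> 1 - cos t0 \<le> 1 - cos t" by blast
    have "cos t0 \<noteq> 1"
    proof
      assume "cos t0 = 1"
      then obtain k :: int where k: "t0 = of_int k * 2 * pi" by (auto simp: cos_one_2pi_int)
      have "0 < t0" "t0 < 2 * pi" using t0 assms by auto
      then have "0 < k" "k < 1" using k by (auto simp: zero_less_mult_iff)
      then show False by simp
    qed
    then have "cos t0 < 1" using cos_le_one[of t0] by linarith
    then show thesis using t0 by (intro that[of "1 - cos t0"]) auto
  qed
  have bd: "\<bar>g r (x + d) + g r (x - d) - 2 * g r x - d\<^sup>2 / 2\<bar> \<le> 2 * d\<^sup>2 * ((1 - r\<^sup>2) / \<kappa>)"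
    if r: "1/2 < r" "r < 1" for r
  proof -
    obtain g' where g': "\<And>x. (g r has_real_derivative g' x) (at x)"
      "\<And>x. (g' has_real_derivative (1/2 - (1 - r\<^sup>2) / (2 * (1 - 2 * r * cos x + r\<^sup>2)))) (at x)"
      using abel_cosine_series[of r] r unfolding g_def[abs_def] by auto
    have "\<bar>(g r (x + d) - (x + d)\<^sup>2 / 4) + (g r (x - d) - (x - d)\<^sup>2 / 4) - 2 * (g r x - x\<^sup>2 / 4)\<bar> \<le> 2 * d\<^sup>2 * ((1 - r\<^sup>2) / \<kappa>)"
    proof (rule second_difference_bound[where h'="\<lambda>x. g' x - x / 2"
          and h''="\<lambda>x. - ((1 - r\<^sup>2) / (2 * (1 - 2 * r * cos x + r\<^sup>2)))"])
      show "((\<lambda>x. g r x - x\<^sup>2 / 4) has_real_derivative g' t - t / 2) (at t)" for t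
        by (auto intro!: derivative_eq_intros g')
      show "((\<lambda>x. g' x - x / 2) has_real_derivative - ((1 - r\<^sup>2) / (2 * (1 - 2 * r * cos t + r\<^sup>2)))) (at t)" for t
        by (rule DERIV_cong[OF DERIV_diff[OF g'(2) DERIV_cdivide[OF DERIV_ident]]]) simp
      fix t assume t: "x - d \<le> t" "t \<le> x + d"
      have r2: "r\<^sup>2 < 1" using r by (simp add: power_less_one_iff)
      \<comment> \<open>For \<open>r > 1/2\<close> the second summand alone is at least
        \<open>1 - cos t\<close>, hence at least \<open>\<kappa>\<close>.\<close>
      have "(1 - r)\<^sup>2 + 2 * r * (1 - cos t) = 1 - 2 * r * cos t + r\<^sup>2"
        by (simp add: power2_eq_square algebra_simps)
      moreover have "2 * r * (1 - cos t) \<ge> 1 * \<kappa>"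
        using r \<kappa>(1) \<kappa>(2)[OF t] by (intro mult_mono) auto
      ultimately have "1 - 2 * r * cos t + r\<^sup>2 \<ge> \<kappa>"
        by (smt (verit) zero_le_power2)
      then have "(1 - r\<^sup>2) / (2 * (1 - 2 * r * cos t + r\<^sup>2)) \<le> (1 - r\<^sup>2) / \<kappa>"
        using r2 \<kappa>(1) by (intro divide_left_mono) auto
      moreover have "(1 - r\<^sup>2) / (2 * (1 - 2 * r * cos t + r\<^sup>2)) \<ge> 0"
        using r2 \<kappa>(1) \<open>1 - 2 * r * cos t + r\<^sup>2 \<ge> \<kappa>\<close> by (intro divide_nonneg_nonneg) auto
      ultimately show "\<bar>- ((1 - r\<^sup>2) / (2 * (1 - 2 * r * cos t + r\<^sup>2)))\<bar> \<le> (1 - r\<^sup>2) / \<kappa>"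
        by (metis abs_minus_cancel abs_of_nonneg)
    qed fact
    moreover have "(g r (x + d) - (x + d)\<^sup>2 / 4) + (g r (x - d) - (x - d)\<^sup>2 / 4) - 2 * (g r x - x\<^sup>2 / 4)
       = g r (x + d) + g r (x - d) - 2 * g r x - d\<^sup>2 / 2"
      by (simp add: power2_eq_square field_simps)
    ultimately show ?thesis by simp
  qed
  have "((\<lambda>r. \<bar>g r (x + d) + g r (x - d) - 2 * g r x - d\<^sup>2 / 2\<bar>) \<longlongrightarrow> \<bar>S (x + d) + S (x - d) - 2 * S x - d\<^sup>2 / 2\<bar>) (at_left 1)"
    by (intro tendsto_intros lim)
  moreover have "((\<lambda>r. 2 * d\<^sup>2 * ((1 - r\<^sup>2) / \<kappa>)) \<longlongrightarrow> 2 * d\<^sup>2 * ((1 - 1\<^sup>2) / \<kappa>)) (at_left (1::real))"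
    using \<kappa>(1) by (intro tendsto_intros) auto
  moreover have "\<forall>\<^sub>F r in at_left (1::real). \<bar>g r (x + d) + g r (x - d) - 2 * g r x - d\<^sup>2 / 2\<bar> \<le> 2 * d\<^sup>2 * ((1 - r\<^sup>2) / \<kappa>)"
    unfolding eventually_at_left_field by (rule exI[of _ "1/2"]) (use bd in auto)
  ultimately have "\<bar>S (x + d) + S (x - d) - 2 * S x - d\<^sup>2 / 2\<bar> \<le> 2 * d\<^sup>2 * ((1 - 1\<^sup>2) / \<kappa>)"
    by (intro tendsto_le[OF _ _ _ , of "at_left 1"]) auto
  then show ?thesis by simp
qed

text \<open>The Fourier coefficients, up to normalisation, of the triangle function supported in
  \<open>[-2\<delta>, 2\<delta>]\<close>.\<close>

definition sinc2 :: "real \<Rightarrow> int \<Rightarrow> real"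
  where "sinc2 \<delta> m = (if m = 0 then 1 else (sin (of_int m * \<delta>) / (of_int m * \<delta>))\<^sup>2)"

lemma has_sum_int_symmetric:
  fixes f :: "int \<Rightarrow> 'a::banach"
  assumes "summable (\<lambda>n. norm (f (int (Suc n))))" "summable (\<lambda>n. norm (f (- int (Suc n))))"
  shows "(f has_sum (f 0 + (\<Sum>n. f (int (Suc n)) + f (- int (Suc n))))) UNIV"
proof -
  have 1: "((\<lambda>n. f (int (Suc n))) has_sum (\<Sum>n. f (int (Suc n)))) UNIV"
    using assms(1) by (intro norm_summable_imp_has_sum) (auto intro: summable_norm_cancel)
  have 2: "((\<lambda>n. f (- int (Suc n))) has_sum (\<Sum>n. f (- int (Suc n)))) UNIV"
    using assms(2) by (intro norm_summable_imp_has_sum) (auto intro: summable_norm_cancel)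
  have "bij_betw (\<lambda>n. int (Suc n)) UNIV {0<..}"
    by (rule bij_betw_byWitness[where f'="\<lambda>m. nat m - 1"]) auto
  from has_sum_reindex_bij_betw[OF this, of f] 1
  have p: "(f has_sum (\<Sum>n. f (int (Suc n)))) {0<..}" by simp
  have "bij_betw (\<lambda>n. - int (Suc n)) UNIV {..<0}"
    by (rule bij_betw_byWitness[where f'="\<lambda>m. nat (- m) - 1"]) auto
  from has_sum_reindex_bij_betw[OF this, of f] 2
  have q: "(f has_sum (\<Sum>n. f (- int (Suc n)))) {..<0}" by simp
  have 0: "(f has_sum f 0) {0}" using has_sum_finite[of "{0}" f] by simp
  have "(f has_sum (f 0 + ((\<Sum>n. f (int (Suc n))) + (\<Sum>n. f (- int (Suc n)))))) ({0} \<union> ({0<..} \<union> {..<0}))"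
    by (intro has_sum_Un_disjoint 0 p q) auto
  also have "{0} \<union> ({0<..} \<union> {..<0}) = (UNIV :: int set)" by auto
  also have "(\<Sum>n. f (int (Suc n))) + (\<Sum>n. f (- int (Suc n))) = (\<Sum>n. f (int (Suc n)) + f (- int (Suc n)))"
    using assms by (intro suminf_add) (auto intro: summable_norm_cancel)
  finally show ?thesis .
qed

lemma sinc2_minus [simp]: "sinc2 \<delta> (- m) = sinc2 \<delta> m"
  by (simp add: sinc2_def)

lemma sinc2_nonneg [simp]: "0 \<le> sinc2 \<delta> m"
  by (simp add: sinc2_def)

lemma sinc2_le_one: "0 < \<delta> \<Longrightarrow> sinc2 \<delta> m \<le> 1"
proof -
  assume "0 < \<delta>"
  have "\<bar>sin x / x\<bar> \<le> 1" for x :: real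
    using abs_sin_x_le_abs_x[of x] by (cases "x = 0") (auto simp: divide_le_eq_1)
  then show ?thesis by (auto simp: sinc2_def abs_square_le_1)
qed

lemma sinc2_le: "sinc2 \<delta> (int (Suc n)) \<le> 1 / \<delta>\<^sup>2 * (1 / (real (Suc n))\<^sup>2)"
proof -
  have "(sin (real (Suc n) * \<delta>))\<^sup>2 \<le> 1" by (simp add: abs_square_le_1)
  then have "(sin (real (Suc n) * \<delta>))\<^sup>2 / (real (Suc n) * \<delta>)\<^sup>2 \<le> 1 / (real (Suc n) * \<delta>)\<^sup>2"
    by (intro divide_right_mono) auto
  then show ?thesis by (simp add: sinc2_def power_divide power_mult_distrib mult_ac)
qed

lemma sinc2_summable_Suc: "summable (\<lambda>n. sinc2 \<delta> (int (Suc n)))"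
proof (rule summable_comparison_test')
  show "summable (\<lambda>n. 1 / \<delta>\<^sup>2 * (1 / (real (Suc n))\<^sup>2))"
    by (intro summable_mult) (use summable_inverse_square in \<open>subst summable_Suc_iff\<close>)
  show "norm (sinc2 \<delta> (int (Suc n))) \<le> 1 / \<delta>\<^sup>2 * (1 / (real (Suc n))\<^sup>2)" for n
    using sinc2_le[of \<delta> n] by simp
qed

lemma sinc2_has_sum: "(sinc2 \<delta> has_sum (1 + 2 * (\<Sum>n. sinc2 \<delta> (int (Suc n))))) UNIV"
proof -
  have "(sinc2 \<delta> has_sum (sinc2 \<delta> 0 + (\<Sum>n. sinc2 \<delta> (int (Suc n)) + sinc2 \<delta> (- int (Suc n))))) UNIV"
    by (intro has_sum_int_symmetric; simp only: sinc2_minus real_norm_def abs_of_nonneg sinc2_nonneg)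
      (intro sinc2_summable_Suc)+
  moreover have "(\<Sum>n. sinc2 \<delta> (int (Suc n)) + sinc2 \<delta> (- int (Suc n))) = 2 * (\<Sum>n. sinc2 \<delta> (int (Suc n)))"
    by (subst suminf_mult[OF sinc2_summable_Suc, symmetric]) (simp only: sinc2_minus mult_2)
  ultimately show ?thesis by (simp add: sinc2_def[of _ 0])
qed

lemma sinc2_summable: "sinc2 \<delta> summable_on A"
  using sinc2_has_sum[of \<delta>] summable_on_subset_banach[of "sinc2 \<delta>" UNIV A]
  by (auto simp: summable_on_def)

text \<open>By the double angle formula \<open>- 4 sin(m \<delta>)^2 cos(m t)\<close> is the second
  difference of \<open>cos(m t)\<close> with step \<open>2 \<delta>\<close>. Pairing
  \<open>m\<close> with \<open>- m\<close> therefore turns the terms \<open>m \<noteq> 0\<close>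
  into \<open>- 1 / (2 \<delta>^2)\<close> times the second difference \<open>2 \<delta>^2\<close>
  of the cosine series, that is \<open>- 1\<close>, which cancels the term
  \<open>m = 0\<close>.\<close>

lemma sinc2_fourier_eq_0:
  assumes "0 < \<delta>" "2 * \<delta> < t" "t < 2 * pi - 2 * \<delta>"
  shows "((\<lambda>m. of_real (sinc2 \<delta> m) * cis (of_int m * t)) has_sum 0) UNIV"
proof -
  let ?f = "\<lambda>m. of_real (sinc2 \<delta> m) * cis (of_int m * t)"
  define S where "S x = (\<Sum>n. cos (real n * x) / (real n)\<^sup>2)" for x
  have S: "(\<lambda>n. cos (real n * x) / (real n)\<^sup>2) sums S x" for x
    unfolding S_def
    by (intro summable_sums summable_comparison_test'[OF summable_inverse_square, of 0])
      (auto simp: divide_right_mono)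
  have S': "(\<lambda>n. cos (real (Suc n) * x) / (real (Suc n))\<^sup>2) sums S x" for x
    using S[of x] by (subst sums_Suc_iff) simp
  have main: "(?f has_sum (?f 0 + (\<Sum>n. ?f (int (Suc n)) + ?f (- int (Suc n))))) UNIV"
    by (intro has_sum_int_symmetric; simp only: norm_mult norm_cis norm_of_real mult_1_right
          sinc2_minus real_norm_def abs_of_nonneg sinc2_nonneg)
      (intro sinc2_summable_Suc)+
  define r where "r n = - 1 / (2 * \<delta>\<^sup>2) * (cos (real (Suc n) * (t + 2 * \<delta>)) / (real (Suc n))\<^sup>2 +
       cos (real (Suc n) * (t - 2 * \<delta>)) / (real (Suc n))\<^sup>2 - 2 * (cos (real (Suc n) * t) / (real (Suc n))\<^sup>2))" for n
  have pair: "?f (int (Suc n)) + ?f (- int (Suc n)) = of_real (r n)" for n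
  proof -
    define k where "k = real (Suc n)"
    have k: "k > 0" by (simp add: k_def)
    have "?f (int (Suc n)) + ?f (- int (Suc n)) = of_real (sinc2 \<delta> (int (Suc n))) * (cis (k * t) + cis (- (k * t)))"
      by (simp add: k_def distrib_left del: of_nat_Suc)
    also have "cis (k * t) + cis (- (k * t)) = of_real (2 * cos (k * t))"
      by (simp add: complex_eq_iff)
    finally have 1: "?f (int (Suc n)) + ?f (- int (Suc n)) = of_real (sinc2 \<delta> (int (Suc n)) * (2 * cos (k * t)))"
      by (simp only: of_real_mult)
    have s: "sinc2 \<delta> (int (Suc n)) = (sin (k * \<delta>))\<^sup>2 / (k\<^sup>2 * \<delta>\<^sup>2)"
      by (simp add: sinc2_def k_def power_divide power_mult_distrib)
    have "cos (k * (t + 2 * \<delta>)) + cos (k * (t - 2 * \<delta>)) - 2 * cos (k * t) = - 4 * (sin (k * \<delta>))\<^sup>2 * cos (k * t)"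
    proof -
      have "cos (k * (t + 2 * \<delta>)) + cos (k * (t - 2 * \<delta>)) = 2 * cos (k * t) * cos (2 * (k * \<delta>))"
        by (simp add: distrib_left right_diff_distrib cos_add cos_diff mult_ac)
      also have "cos (2 * (k * \<delta>)) = 1 - 2 * (sin (k * \<delta>))\<^sup>2"
        by (rule cos_double_sin)
      finally show ?thesis by (simp add: algebra_simps)
    qed
    then have c: "cos (k * (t + 2 * \<delta>)) / k\<^sup>2 + cos (k * (t - 2 * \<delta>)) / k\<^sup>2 - 2 * (cos (k * t) / k\<^sup>2)
       = - 4 * (sin (k * \<delta>))\<^sup>2 * cos (k * t) / k\<^sup>2"
      by (metis (no_types, lifting) add_divide_distrib diff_divide_distrib times_divide_eq_right)
    have "sinc2 \<delta> (int (Suc n)) * (2 * cos (k * t)) = - 1 / (2 * \<delta>\<^sup>2) * (- 4 * (sin (k * \<delta>))\<^sup>2 * cos (k * t) / k\<^sup>2)"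
      using k \<open>0 < \<delta>\<close> unfolding s by (simp add: field_simps)
    then show ?thesis unfolding 1 r_def k_def[symmetric] c by (simp only:)
  qed
  have "S (t + 2 * \<delta>) + S (t - 2 * \<delta>) - 2 * S t = (2 * \<delta>)\<^sup>2 / 2"
    unfolding S_def using assms by (intro second_difference_cosine_series) auto
  moreover have "r sums (- 1 / (2 * \<delta>\<^sup>2) * (S (t + 2 * \<delta>) + S (t - 2 * \<delta>) - 2 * S t))"
    unfolding r_def[abs_def] by (intro sums_mult sums_add sums_diff S')
  ultimately have "r sums - 1" using \<open>0 < \<delta>\<close> by (simp add: power2_eq_square)
  then have "(\<lambda>n. complex_of_real (r n)) sums complex_of_real (- 1)"
    by (rule sums_of_real)
  then have "(\<Sum>n. ?f (int (Suc n)) + ?f (- int (Suc n))) = - 1"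
    unfolding pair by (simp add: sums_iff)
  moreover have "?f 0 = 1" by (simp add: sinc2_def)
  ultimately show ?thesis using main by simp
qed

text \<open>The first \<open>N\<close> positive indices contribute at most \<open>1\<close> each;
  beyond them \<open>(N / n)^2\<close> is compared with the telescoping
  \<open>N^2 / (n - 1) - N^2 / n\<close>. With both signs and the central term the total is at most
  \<open>4 N + 1\<close>.\<close>

lemma sinc2_sum_le:
  assumes "N > 0"
  shows "infsum (sinc2 (1 / real N)) UNIV \<le> 5 * real N"
proof -
  have tele: "(\<Sum>n<M. sinc2 (1 / real N) (int (Suc n))) \<le> 2 * real N - (real N)\<^sup>2 / real M" if "N \<le> M" for M
    using that
  proof (induction M rule: dec_induct)
    case base
    have "(\<Sum>n<N. sinc2 (1 / real N) (int (Suc n))) \<le> (\<Sum>n<N. 1)"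
      using assms by (intro sum_mono sinc2_le_one) auto
    then show ?case using assms by (simp add: power2_eq_square)
  next
    case (step M)
    have M: "0 < real M" using step assms by simp
    have "sinc2 (1 / real N) (int (Suc M)) \<le> (real N)\<^sup>2 * (1 / (real (Suc M))\<^sup>2)"
      using sinc2_le[of "1 / real N" M] by (simp add: power_divide del: of_nat_Suc)
    also have "1 / (real (Suc M))\<^sup>2 \<le> 1 / (real M * real (Suc M))"
      using M by (intro divide_left_mono) (auto simp: power2_eq_square)
    also have "1 / (real M * real (Suc M)) = 1 / real M - 1 / real (Suc M)"
      using M by (simp add: field_simps)
    finally have "sinc2 (1 / real N) (int (Suc M)) \<le> (real N)\<^sup>2 / real M - (real N)\<^sup>2 / real (Suc M)"
      by (simp add: right_diff_distrib mult_left_mono)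
    then show ?case using step by (simp del: of_nat_Suc)
  qed
  have "(\<Sum>n. sinc2 (1 / real N) (int (Suc n))) \<le> 2 * real N"
  proof (rule suminf_le_const[OF sinc2_summable_Suc])
    fix M
    have "(\<Sum>n<M. sinc2 (1 / real N) (int (Suc n))) \<le> (\<Sum>n<max M N. sinc2 (1 / real N) (int (Suc n)))"
      by (intro sum_mono2) auto
    also have "\<dots> \<le> 2 * real N - (real N)\<^sup>2 / real (max M N)" by (rule tele) simp
    also have "\<dots> \<le> 2 * real N" by simp
    finally show "(\<Sum>n<M. sinc2 (1 / real N) (int (Suc n))) \<le> 2 * real N" .
  qed
  then have "1 + 2 * (\<Sum>n. sinc2 (1 / real N) (int (Suc n))) \<le> 1 + 2 * (2 * real N)" by simp
  also have "\<dots> \<le> 5 * real N" using assms by simp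
  finally show ?thesis using infsumI[OF sinc2_has_sum[of "1 / real N"]] by simp
qed

section \<open>Termwise integration on the circle\<close>

lemma
  fixes f :: "'i \<Rightarrow> real \<Rightarrow> 'b::banach"
  assumes cont: "\<And>i. continuous_on {a..b} (f i)"
    and le: "\<And>i t. t \<in> {a..b} \<Longrightarrow> norm (f i t) \<le> M i"
    and M: "M summable_on I"
  shows continuous_on_infsum: "continuous_on {a..b} (\<lambda>t. \<Sum>\<^sub>\<infinity>i\<in>I. f i t)"
    and has_sum_integral: "((\<lambda>i. integral {a..b} (f i)) has_sum integral {a..b} (\<lambda>t. \<Sum>\<^sub>\<infinity>i\<in>I. f i t)) I"
proof -
  have u: "uniform_limit {a..b} (\<lambda>X t. \<Sum>i\<in>X. f i t) (\<lambda>t. \<Sum>\<^sub>\<infinity>i\<in>I. f i t) (finite_subsets_at_top I)"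
    by (rule Weierstrass_m_test_general[OF le M])
  have c: "continuous_on {a..b} (\<lambda>t. \<Sum>i\<in>X. f i t)" for X
    by (intro continuous_intros cont)
  show "continuous_on {a..b} (\<lambda>t. \<Sum>\<^sub>\<infinity>i\<in>I. f i t)"
    by (rule uniform_limit_theorem[OF _ u]) (auto intro: c)
  obtain A J where A: "\<And>X. ((\<lambda>t. \<Sum>i\<in>X. f i t) has_integral A X) {a..b}"
    and J: "((\<lambda>t. \<Sum>\<^sub>\<infinity>i\<in>I. f i t) has_integral J) {a..b}"
    and lim: "(A \<longlongrightarrow> J) (finite_subsets_at_top I)"
    by (rule uniform_limit_integral[OF u c]) auto
  have "A X = (\<Sum>i\<in>X. integral {a..b} (f i))" if "finite X" for X
    using A[of X] that by (metis cont has_integral_sum has_integral_unique integrable_continuous_real integrable_integral)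
  then have "\<forall>\<^sub>F X in finite_subsets_at_top I. A X = (\<Sum>i\<in>X. integral {a..b} (f i))"
    by (auto intro: eventually_finite_subsets_at_top_weakI)
  with lim have "((\<lambda>X. \<Sum>i\<in>X. integral {a..b} (f i)) \<longlongrightarrow> J) (finite_subsets_at_top I)"
    using tendsto_cong by blast
  then show "((\<lambda>i. integral {a..b} (f i)) has_sum integral {a..b} (\<lambda>t. \<Sum>\<^sub>\<infinity>i\<in>I. f i t)) I"
    using J by (simp add: has_sum_def integral_unique)
qed

lemma integral_cis:
  "integral {- pi..pi} (\<lambda>t. cis (of_int m * t)) = (if m = 0 then 2 * pi else 0)"
proof (cases "m = 0")
  case False
  have "((\<lambda>t. cis (of_int m * t)) has_integral
     cis (of_int m * pi) / (\<i> * of_int m) - cis (of_int m * (- pi)) / (\<i> * of_int m)) {- pi..pi}"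
  proof (rule fundamental_theorem_of_calculus)
    fix t
    show "((\<lambda>t. cis (of_int m * t) / (\<i> * of_int m)) has_vector_derivative cis (of_int m * t)) (at t within {- pi..pi})"
    proof -
      have "((\<lambda>z. exp (\<i> * of_int m * z) / (\<i> * of_int m)) has_field_derivative exp (\<i> * of_int m * of_real t)) (at (of_real t))"
        using False by (auto intro!: derivative_eq_intros)
      then have "((\<lambda>t. exp (\<i> * of_int m * of_real t) / (\<i> * of_int m)) has_vector_derivative exp (\<i> * of_int m * of_real t)) (at t within {- pi..pi})"
        by (rule has_vector_derivative_real_field)
      then show ?thesis by (simp add: cis_conv_exp mult_ac)
    qed
  qed auto
  moreover have "cis (of_int m * pi) = cis (of_int m * (- pi))"
    by (simp add: complex_eq_iff sin_times_pi_eq_0)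
  ultimately show ?thesis using False by (simp add: integral_unique)
qed (simp add: scaleR_conv_of_real)

section \<open>Complex scalar multiplication as a bounded bilinear map\<close>

lemma scaleC_one [simp]: "1 *\<^sub>C x = (x :: 'a::complex_vector)"
  using scaleR_scaleC[of 1 x] by simp

lemma bounded_bilinear_scaleC:
  "bounded_bilinear (scaleC :: complex \<Rightarrow> 'b::complex_normed_vector \<Rightarrow> 'b)"
proof
  fix r :: real and a :: complex and b :: 'b
  show "(r *\<^sub>R a) *\<^sub>C b = r *\<^sub>R (a *\<^sub>C b)"
    by (simp add: scaleR_scaleC scaleC_scaleC scaleR_conv_of_real)
  show "a *\<^sub>C (r *\<^sub>R b) = r *\<^sub>R (a *\<^sub>C b)"
    by (simp add: scaleR_scaleC scaleC_scaleC mult.commute)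
qed (auto simp: scaleC_add_left scaleC_add_right norm_scaleC intro!: exI[of _ 1])

lemmas scaleC_zero_left [simp] = bounded_bilinear.zero_left[OF bounded_bilinear_scaleC]
lemmas scaleC_zero_right [simp] = bounded_bilinear.zero_right[OF bounded_bilinear_scaleC]
lemmas bounded_linear_scaleC_left = bounded_bilinear.bounded_linear_left[OF bounded_bilinear_scaleC]
lemmas bounded_linear_scaleC_right = bounded_bilinear.bounded_linear_right[OF bounded_bilinear_scaleC]
lemmas continuous_on_scaleC = bounded_bilinear.continuous_on[OF bounded_bilinear_scaleC]

text \<open>For small \<open>\<delta>\<close> this is the triangle function on the circle with
  Fourier coefficients \<open>sinc2 \<delta>\<close>, of total integral \<open>2 pi\<close>.
  Compared with the classical Fejer kernel the roles are exchanged: the coefficients are squared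
  sines and the function is a triangle.\<close>

definition fejer :: "real \<Rightarrow> real \<Rightarrow> complex"
  where "fejer \<delta> t = (\<Sum>\<^sub>\<infinity>m. of_real (sinc2 \<delta> m) * cis (of_int m * t))"

lemma fejer_has_sum:
  "((\<lambda>m. of_real (sinc2 \<delta> m) * cis (of_int m * t)) has_sum fejer \<delta> t) UNIV"
proof -
  have "(\<lambda>m. norm (of_real (sinc2 \<delta> m) * cis (of_int m * t))) summable_on UNIV"
    by (simp add: norm_mult sinc2_summable)
  then show ?thesis
    unfolding fejer_def by (rule has_sum_infsum[OF abs_summable_summable])
qed

lemma continuous_on_fejer: "continuous_on {a..b} (fejer \<delta>)"
proof -
  define f where "f m t = complex_of_real (sinc2 \<delta> m) * cis (of_int m * t)" for m t
  have "continuous_on {a..b} (\<lambda>t. \<Sum>\<^sub>\<infinity>m. f m t)"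
  proof (rule continuous_on_infsum)
    show "continuous_on {a..b} (f m)" for m unfolding f_def by (intro continuous_intros)
    show "norm (f m t) \<le> sinc2 \<delta> m" for m t by (simp add: f_def norm_mult)
  qed (rule sinc2_summable)
  then show ?thesis by (simp add: f_def fejer_def[abs_def])
qed

lemma norm_fejer_le: "norm (fejer \<delta> t) \<le> infsum (sinc2 \<delta>) UNIV"
  using norm_infsum_bound[of "\<lambda>m. of_real (sinc2 \<delta> m) * cis (of_int m * t)" UNIV]
  by (simp add: norm_mult sinc2_summable fejer_def)

lemma fejer_eq_0:
  assumes "0 < \<delta>" "2 * \<delta> < \<bar>t\<bar>" "\<bar>t\<bar> < 2 * pi - 2 * \<delta>"
  shows "fejer \<delta> t = 0"
proof (cases "t > 0")
  case True
  then show ?thesis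
    using has_sum_unique[OF fejer_has_sum sinc2_fourier_eq_0[of \<delta> t]] assms by simp
next
  case False
  have "cis (of_int m * (t + 2 * pi)) = cis (of_int m * t)" for m
  proof -
    have "cis (of_int m * (t + 2 * pi)) = cis (of_int m * t) * cis (2 * pi * of_int m)"
      by (simp add: cis_mult distrib_left mult_ac)
    then show ?thesis by (simp add: cis_multiple_2pi)
  qed
  then have "fejer \<delta> t = fejer \<delta> (t + 2 * pi)" by (simp add: fejer_def)
  also have "\<dots> = 0"
    by (rule has_sum_unique[OF fejer_has_sum sinc2_fourier_eq_0]) (use assms False in auto)
  finally show ?thesis .
qed

lemma fejer_coefficient:
  "integral {- pi..pi} (\<lambda>t. fejer \<delta> t * cis (- (of_int k * t))) = 2 * pi * sinc2 \<delta> k"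
proof -
  define f where "f m t = of_real (sinc2 \<delta> m) * cis (of_int m * t) * cis (- (of_int k * t))" for m t
  have "((\<lambda>m. integral {- pi..pi} (f m)) has_sum integral {- pi..pi} (\<lambda>t. \<Sum>\<^sub>\<infinity>m\<in>UNIV. f m t)) UNIV"
    by (rule has_sum_integral[where M="sinc2 \<delta>"])
      (auto simp: f_def norm_mult sinc2_summable intro!: continuous_intros)
  moreover have "(\<Sum>\<^sub>\<infinity>m\<in>UNIV. f m t) = fejer \<delta> t * cis (- (of_int k * t))" for t
    unfolding f_def by (intro infsumI has_sum_cmult_left fejer_has_sum)
  moreover have "integral {- pi..pi} (f m) = (if m = k then 2 * pi * sinc2 \<delta> k else 0)" for m
  proof -
    have "f m = (\<lambda>t. of_real (sinc2 \<delta> m) * cis (of_int (m - k) * t))"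
      by (simp add: f_def fun_eq_iff cis_mult left_diff_distrib)
    then show ?thesis
      by (simp add: integral_cis scaleR_conv_of_real del: of_int_diff)
  qed
  ultimately have "((\<lambda>m. complex_of_real (if m = k then 2 * pi * sinc2 \<delta> k else 0)) has_sum
     integral {- pi..pi} (\<lambda>t. fejer \<delta> t * cis (- (of_int k * t)))) UNIV" by simp
  moreover have "((\<lambda>m. complex_of_real (if m = k then 2 * pi * sinc2 \<delta> k else 0)) has_sum
     complex_of_real (2 * pi * sinc2 \<delta> k)) UNIV"
    by (rule has_sum_finite_neutralI[of "{k}"]) simp_all
  ultimately show ?thesis by (rule has_sum_unique)
qed

text \<open>The sum is, up to a constant factor, a Fourier coefficient of
  \<open>fejer \<delta> (t - \<gamma>) * fejer \<delta> t\<close>. The two factors live within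
  \<open>2 \<delta>\<close> of \<open>\<gamma>\<close> and of \<open>0\<close>; these arcs are
  disjoint because \<open>4 \<delta> < \<bar>\<gamma>\<bar>\<close>, and they stay disjoint modulo
  \<open>2 pi\<close> because \<open>\<bar>\<gamma>\<bar> \<le> pi\<close>.\<close>

lemma sinc2_convolution_eq_0:
  assumes \<delta>: "0 < \<delta>" "4 * \<delta> < \<bar>\<gamma>\<bar>" "\<bar>\<gamma>\<bar> \<le> pi"
  shows "((\<lambda>m. of_real (sinc2 \<delta> m) * of_real (sinc2 \<delta> (k - m)) * cis (- (of_int m * \<gamma>))) has_sum 0) UNIV"
proof -
  define B where "B = infsum (sinc2 \<delta>) UNIV"
  define f where "f m t = of_real (sinc2 \<delta> m) * cis (of_int m * (t - \<gamma>)) * (fejer \<delta> t * cis (- (of_int k * t)))" for m t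
  have "((\<lambda>m. integral {- pi..pi} (f m)) has_sum integral {- pi..pi} (\<lambda>t. \<Sum>\<^sub>\<infinity>m\<in>UNIV. f m t)) UNIV"
  proof (rule has_sum_integral[where M="\<lambda>m. sinc2 \<delta> m * B"])
    show "norm (f m t) \<le> sinc2 \<delta> m * B" for m t
      unfolding f_def B_def
      by (simp add: norm_mult norm_fejer_le mult_left_mono)
  qed (auto simp: f_def[abs_def] intro!: continuous_intros continuous_on_fejer summable_on_cmult_left sinc2_summable)
  moreover have zero: "(\<Sum>\<^sub>\<infinity>m\<in>UNIV. f m t) = 0" if t: "t \<in> {- pi..pi}" for t
  proof -
    have "(\<Sum>\<^sub>\<infinity>m\<in>UNIV. f m t) = fejer \<delta> (t - \<gamma>) * (fejer \<delta> t * cis (- (of_int k * t)))"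
      unfolding f_def by (intro infsumI has_sum_cmult_left fejer_has_sum)
    moreover have A: "\<bar>t\<bar> \<le> pi" "4 * \<delta> < pi" using t \<delta> by auto
    have "fejer \<delta> (t - \<gamma>) = 0 \<or> fejer \<delta> t = 0"
    proof (cases "2 * \<delta> < \<bar>t\<bar>")
      case True
      have "\<bar>t\<bar> < 2 * pi - 2 * \<delta>" using A \<delta> by linarith
      then show ?thesis using fejer_eq_0[of \<delta> t] True \<delta> by simp
    next
      case False
      have "2 * \<delta> < \<bar>t - \<gamma>\<bar>" "\<bar>t - \<gamma>\<bar> < 2 * pi - 2 * \<delta>" using A \<delta> False by linarith+
      then show ?thesis using fejer_eq_0[of \<delta> "t - \<gamma>"] \<delta> by simp
    qed
    ultimately show ?thesis by (metis mult_zero_left mult_zero_right)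
  qed
  then have "integral {- pi..pi} (\<lambda>t. \<Sum>\<^sub>\<infinity>m\<in>UNIV. f m t) = integral {- pi..pi} (\<lambda>t. 0)"
    by (intro Henstock_Kurzweil_Integration.integral_cong zero)
  moreover have "integral {- pi..pi} (f m) =
     2 * pi * (of_real (sinc2 \<delta> m) * of_real (sinc2 \<delta> (k - m)) * cis (- (of_int m * \<gamma>)))" for m
  proof -
    have "cis (of_int m * (t - \<gamma>)) * cis (- (of_int k * t)) = cis (- (of_int m * \<gamma>)) * cis (- (of_int (k - m) * t))" for t
      by (simp add: cis_mult algebra_simps)
    then have "f m t = (of_real (sinc2 \<delta> m) * cis (- (of_int m * \<gamma>))) * (fejer \<delta> t * cis (- (of_int (k - m) * t)))" for t
      unfolding f_def by (metis (no_types, lifting) mult.assoc mult.left_commute)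
    then have "f m = (\<lambda>t. (of_real (sinc2 \<delta> m) * cis (- (of_int m * \<gamma>))) * (fejer \<delta> t * cis (- (of_int (k - m) * t))))"
      by blast
    then show ?thesis by (simp only: fejer_coefficient integral_mult_right) simp
  qed
  ultimately have "((\<lambda>m. 2 * pi * (of_real (sinc2 \<delta> m) * of_real (sinc2 \<delta> (k - m)) * cis (- (of_int m * \<gamma>)))) has_sum 0) UNIV"
    by simp
  from has_sum_cmult_right[OF this, of "1 / (2 * pi)"] show ?thesis by simp
qed

lemma summable_on_product_nonneg:
  fixes a :: "'i \<Rightarrow> real" and b :: "'j \<Rightarrow> real"
  assumes "a summable_on UNIV" "b summable_on UNIV" "\<And>i. 0 \<le> a i" "\<And>j. 0 \<le> b j"
  shows "(\<lambda>(i, j). a i * b j) summable_on UNIV"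
proof -
  have "(\<lambda>(i, j). a i * b j) summable_on (UNIV \<times> UNIV)"
    by (rule summable_on_SigmaI[where g="\<lambda>i. a i * infsum b UNIV"])
      (use assms in \<open>auto intro!: has_sum_cmult_right summable_on_cmult_left has_sum_infsum\<close>)
  then show ?thesis by simp
qed

lemma tendsto_sinc2_one: "(\<lambda>N. sinc2 (1 / real N) 1) \<longlonglongrightarrow> 1"
proof -
  have "((\<lambda>h. (sin (0 + h) - sin 0) / h) \<longlongrightarrow> cos (0::real)) (at 0)"
    using DERIV_sin[of "0::real"] by (simp only: DERIV_def)
  then have "((\<lambda>h::real. sin h / h) \<longlongrightarrow> 1) (at 0)" by simp
  moreover have "filterlim (\<lambda>N. 1 / real N) (at 0) sequentially"
  proof (rule filterlim_atI)
    show "(\<lambda>N. 1 / real N) \<longlonglongrightarrow> 0" by (rule lim_1_over_n)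
    show "\<forall>\<^sub>F N in sequentially. 1 / real N \<noteq> 0"
      by (rule eventually_mono[OF eventually_gt_at_top[of 0]]) auto
  qed
  ultimately have "(\<lambda>N. sin (1 / real N) / (1 / real N)) \<longlonglongrightarrow> 1"
    by (rule filterlim_compose)
  then have "(\<lambda>N. (sin (1 / real N) / (1 / real N))\<^sup>2) \<longlonglongrightarrow> 1\<^sup>2"
    by (intro tendsto_intros)
  then show ?thesis by (simp add: sinc2_def)
qed

text \<open>The hypothesis says that the distribution on the torus with coefficients \<open>c\<close> is supported on
  the diagonal. Pairing it with triangle functions of width \<open>\<delta>\<close> gives \<open>q\<close>, which is \<open>O(1/\<delta>)\<close> and
  supported in an interval of length \<open>O(\<delta>)\<close> around \<open>0\<close>, so its integral against \<open>cis \<gamma> - 1\<close> tends to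
  \<open>0\<close> with \<open>\<delta>\<close>.\<close>

theorem bounded_double_sequence_shift:
  fixes c :: "int \<Rightarrow> int \<Rightarrow> 'b::{complex_normed_vector,banach}"
  assumes bound: "\<And>m n. norm (c m n) \<le> C"
    and zero: "\<And>f g :: int \<Rightarrow> complex. (\<lambda>m. norm (f m)) summable_on UNIV \<Longrightarrow> (\<lambda>m. norm (g m)) summable_on UNIV \<Longrightarrow>
      (\<And>k. ((\<lambda>m. f m * g (k - m)) has_sum 0) UNIV) \<Longrightarrow>
      (\<Sum>\<^sub>\<infinity>(m, n)\<in>UNIV. (f m * g n) *\<^sub>C c m n) = 0"
  shows "c 1 (-1) = c 0 0"
proof -
  have C: "0 \<le> C" using bound[of 0 0] norm_ge_zero order_trans by blast
  \<comment> \<open>Only the antidiagonal \<open>m + n = 0\<close> matters: the claim is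
    \<open>D 1 = D 0\<close>.\<close>
  define D where "D m = c m (- m)" for m
  define q where "q \<delta> \<gamma> = (\<Sum>\<^sub>\<infinity>m. (of_real ((sinc2 \<delta> m)\<^sup>2) * cis (- (of_int m * \<gamma>))) *\<^sub>C D m)" for \<delta> \<gamma>
  have q0: "q \<delta> \<gamma> = 0" if \<delta>: "0 < \<delta>" "4 * \<delta> < \<bar>\<gamma>\<bar>" "\<bar>\<gamma>\<bar> \<le> pi" for \<delta> \<gamma>
  proof -
    define x where "x = (\<lambda>(m, n). (of_real (sinc2 \<delta> m) * of_real (sinc2 \<delta> n) * cis (- (of_int m * \<gamma>))) *\<^sub>C c m n)"
    define h where "h = (\<lambda>p \<beta>. cis (- (of_int (fst p + snd p) * \<beta>)) *\<^sub>C x p)"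
    \<comment> \<open>Modulating both sequences by the same character in \<open>\<beta>\<close>
      multiplies the values of their convolution by unimodular numbers, so it stays zero and
      \<open>zero\<close> applies for every \<open>\<beta>\<close>. Integration over
      \<open>\<beta>\<close> then isolates the entries with \<open>m + n = 0\<close>.\<close>
    have Q: "(\<Sum>\<^sub>\<infinity>p\<in>UNIV. h p \<beta>) = 0" for \<beta>
    proof -
      define f where "f m = of_real (sinc2 \<delta> m) * cis (- (of_int m * (\<beta> + \<gamma>)))" for m
      define g where "g n = of_real (sinc2 \<delta> n) * cis (- (of_int n * \<beta>))" for n
      have "(\<Sum>\<^sub>\<infinity>(m, n)\<in>UNIV. (f m * g n) *\<^sub>C c m n) = 0"
      proof (rule zero)
        show "(\<lambda>m. norm (f m)) summable_on UNIV" "(\<lambda>m. norm (g m)) summable_on UNIV"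
          by (simp_all add: f_def g_def norm_mult sinc2_summable)
        fix k
        have "((\<lambda>m. cis (- (of_int k * \<beta>)) * (of_real (sinc2 \<delta> m) * of_real (sinc2 \<delta> (k - m)) * cis (- (of_int m * \<gamma>)))) has_sum
           (cis (- (of_int k * \<beta>)) * 0)) UNIV"
          by (intro has_sum_cmult_right sinc2_convolution_eq_0 \<delta>)
        moreover have "cis (- (of_int k * \<beta>)) * (of_real (sinc2 \<delta> m) * of_real (sinc2 \<delta> (k - m)) * cis (- (of_int m * \<gamma>)))
           = f m * g (k - m)" for m
        proof -
          have "cis (- (of_int k * \<beta>)) * cis (- (of_int m * \<gamma>)) = cis (- (of_int m * (\<beta> + \<gamma>))) * cis (- (of_int (k - m) * \<beta>))"
            by (simp add: cis_mult algebra_simps)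
          then show ?thesis unfolding f_def g_def by (metis (no_types, lifting) mult.assoc mult.left_commute)
        qed
        ultimately show "((\<lambda>m. f m * g (k - m)) has_sum 0) UNIV" by simp
      qed
      moreover have "(f m * g n) *\<^sub>C c m n = h (m, n) \<beta>" for m n
      proof -
        have "f m * g n = cis (- (of_int (m + n) * \<beta>)) * (of_real (sinc2 \<delta> m) * of_real (sinc2 \<delta> n) * cis (- (of_int m * \<gamma>)))"
        proof -
          have "cis (- (of_int m * (\<beta> + \<gamma>))) * cis (- (of_int n * \<beta>)) = cis (- (of_int (m + n) * \<beta>)) * cis (- (of_int m * \<gamma>))"
            by (simp add: cis_mult algebra_simps)
          then show ?thesis unfolding f_def g_def by (metis (no_types, lifting) mult.assoc mult.left_commute)
        qed
        then show ?thesis by (simp add: h_def x_def scaleC_scaleC)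
      qed
      ultimately show ?thesis by (simp add: case_prod_unfold)
    qed
    have "((\<lambda>p. integral {- pi..pi} (h p)) has_sum integral {- pi..pi} (\<lambda>\<beta>. \<Sum>\<^sub>\<infinity>p\<in>UNIV. h p \<beta>)) UNIV"
    proof (rule has_sum_integral[where M="\<lambda>(m, n). (sinc2 \<delta> m * sinc2 \<delta> n) * C"])
      show "continuous_on {- pi..pi} (h p)" for p
        unfolding h_def by (intro continuous_on_scaleC continuous_intros)
      show "norm (h p t) \<le> (case p of (m, n) \<Rightarrow> (sinc2 \<delta> m * sinc2 \<delta> n) * C)" for p t
        by (auto simp: h_def x_def norm_scaleC norm_mult bound mult_left_mono split: prod.split)
      show "(\<lambda>(m, n). (sinc2 \<delta> m * sinc2 \<delta> n) * C) summable_on UNIV"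
      proof -
        have "(\<lambda>(m, n). sinc2 \<delta> m * sinc2 \<delta> n) summable_on UNIV"
          by (intro summable_on_product_nonneg sinc2_summable sinc2_nonneg)
        from summable_on_cmult_left[OF this, of C] show ?thesis by (simp add: case_prod_unfold)
      qed
    qed
    moreover have "integral {- pi..pi} (h p) = (if fst p + snd p = 0 then (2 * pi) *\<^sub>C x p else 0)" for p
    proof -
      have "integral {- pi..pi} (h p) = integral {- pi..pi} (\<lambda>\<beta>. cis (- (of_int (fst p + snd p) * \<beta>))) *\<^sub>C x p"
        unfolding h_def
        by (rule integral_linear[OF _ bounded_linear_scaleC_left, unfolded o_def])
          (intro integrable_continuous_real continuous_intros)
      also have "integral {- pi..pi} (\<lambda>\<beta>. cis (- (of_int (fst p + snd p) * \<beta>))) = integral {- pi..pi} (\<lambda>\<beta>. cis (of_int (- (fst p + snd p)) * \<beta>))"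
        by (simp only: of_int_minus mult_minus_left)
      also have "\<dots> = (if fst p + snd p = 0 then 2 * pi else 0)"
        by (simp only: integral_cis neg_equal_0_iff_equal)
      finally show ?thesis
        using bounded_bilinear.zero_left[OF bounded_bilinear_scaleC] by auto
    qed
    ultimately have "((\<lambda>p. if fst p + snd p = 0 then (2 * pi) *\<^sub>C x p else 0) has_sum 0) UNIV"
      using Q by simp
    then have "((\<lambda>p. (2 * pi) *\<^sub>C x p) has_sum 0) (range (\<lambda>m. (m, - m)))"
      by (subst has_sum_cong_neutral[where T=UNIV and g="\<lambda>p. if fst p + snd p = 0 then (2 * pi) *\<^sub>C x p else 0"])
        (auto simp: image_iff)
    then have "((\<lambda>m. (2 * pi) *\<^sub>C x (m, - m)) has_sum 0) UNIV"
      by (subst (asm) has_sum_reindex) (auto simp: o_def inj_on_def)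
    from has_sum_bounded_linear[OF bounded_linear_scaleC_right this, of "1 / (2 * pi)"]
    have "((\<lambda>m. x (m, - m)) has_sum 0) UNIV"
      by (simp add: scaleC_scaleC)
    then show ?thesis
      unfolding q_def x_def D_def by (intro infsumI) (simp add: power2_eq_square)
  qed
  \<comment> \<open>\<open>160 = 4 * 5 * 8\<close>: on an interval of length
    \<open>8 \<delta>\<close> around \<open>0\<close> the weight \<open>cis \<gamma> - 1\<close> is
    at most \<open>4 \<delta>\<close> and \<open>q \<delta>\<close> at most \<open>5 N C\<close>,
    while \<open>\<delta> N = 1\<close>.\<close>
  have est: "norm ((of_real ((sinc2 (1 / real N) 1)\<^sup>2)) *\<^sub>C D 1 - D 0) \<le> 160 * C * (1 / real N)" if N: "N \<ge> 2" for N
  proof -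
    define \<delta> where "\<delta> = 1 / real N"
    have "\<delta> \<le> 1 / 2" using N by (simp add: \<delta>_def field_simps)
    then have "4 * \<delta> < pi" using pi_gt3 by linarith
    moreover have "0 < \<delta>" using N by (simp add: \<delta>_def)
    ultimately have \<delta>: "0 < \<delta>" "4 * \<delta> < pi" by auto
    define f where "f j m \<gamma> = (of_real ((sinc2 \<delta> m)\<^sup>2) * cis (of_int (j - m) * \<gamma>)) *\<^sub>C D m" for j m \<gamma>
    have sq: "(sinc2 \<delta> m)\<^sup>2 \<le> sinc2 \<delta> m" for m
      using sinc2_le_one[OF \<delta>(1), of m] by (simp add: power2_eq_square mult_left_le)
    have nf: "norm (f j m \<gamma>) \<le> sinc2 \<delta> m * C" for j m \<gamma>
    proof -
      have "norm (f j m \<gamma>) = (sinc2 \<delta> m)\<^sup>2 * norm (D m)"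
        by (simp add: f_def norm_scaleC norm_mult norm_power)
      also have "\<dots> \<le> sinc2 \<delta> m * C"
        using sq[of m] bound[of m "-m"] by (intro mult_mono) (auto simp: D_def)
      finally show ?thesis .
    qed
    have sf: "(\<lambda>m. sinc2 \<delta> m * C) summable_on UNIV"
      by (intro summable_on_cmult_left sinc2_summable)
    have cf: "continuous_on {- pi..pi} (f j m)" for j m
      unfolding f_def by (intro continuous_on_scaleC continuous_intros)
    have fsum: "(\<Sum>\<^sub>\<infinity>m. f j m \<gamma>) = cis (of_int j * \<gamma>) *\<^sub>C q \<delta> \<gamma>" for j \<gamma>
    proof -
      have "(\<lambda>m. f 0 m \<gamma>) summable_on UNIV"
        by (rule abs_summable_summable, rule Infinite_Sum.abs_summable_on_comparison_test'[OF sf nf])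
      then have "((\<lambda>m. f 0 m \<gamma>) has_sum q \<delta> \<gamma>) UNIV"
        unfolding q_def f_def by simp
      from has_sum_bounded_linear[OF bounded_linear_scaleC_right this, of "cis (of_int j * \<gamma>)"]
      have "((\<lambda>m. cis (of_int j * \<gamma>) *\<^sub>C f 0 m \<gamma>) has_sum cis (of_int j * \<gamma>) *\<^sub>C q \<delta> \<gamma>) UNIV" .
      moreover have "cis (of_int j * \<gamma>) *\<^sub>C f 0 m \<gamma> = f j m \<gamma>" for m
      proof -
        have "cis (of_int j * \<gamma>) * cis (of_int (0 - m) * \<gamma>) = cis (of_int (j - m) * \<gamma>)"
          by (simp add: cis_mult algebra_simps)
        then show ?thesis unfolding f_def scaleC_scaleC by (metis mult.left_commute)
      qed
      ultimately show ?thesis by (simp add: infsumI)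
    qed
    have coeff: "integral {- pi..pi} (\<lambda>\<gamma>. cis (of_int j * \<gamma>) *\<^sub>C q \<delta> \<gamma>) = (2 * pi * (sinc2 \<delta> j)\<^sup>2) *\<^sub>C D j" for j
    proof -
      have "((\<lambda>m. integral {- pi..pi} (f j m)) has_sum integral {- pi..pi} (\<lambda>\<gamma>. \<Sum>\<^sub>\<infinity>m. f j m \<gamma>)) UNIV"
        by (rule has_sum_integral[OF cf nf sf])
      moreover have "integral {- pi..pi} (f j m) = (if m = j then (2 * pi * (sinc2 \<delta> j)\<^sup>2) *\<^sub>C D j else 0)" for m
      proof -
        have "integral {- pi..pi} (f j m) = integral {- pi..pi} (\<lambda>\<gamma>. of_real ((sinc2 \<delta> m)\<^sup>2) * cis (of_int (j - m) * \<gamma>)) *\<^sub>C D m"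
          unfolding f_def
          by (rule integral_linear[OF _ bounded_linear_scaleC_left, unfolded o_def])
            (intro integrable_continuous_real continuous_intros)
        also have "\<dots> = (of_real ((sinc2 \<delta> m)\<^sup>2) * of_real (if j - m = 0 then 2 * pi else 0)) *\<^sub>C D m"
          by (simp only: integral_mult_right integral_cis)
        finally show ?thesis by (auto simp: mult_ac)
      qed
      ultimately have "((\<lambda>m. if m = j then (2 * pi * (sinc2 \<delta> j)\<^sup>2) *\<^sub>C D j else 0) has_sum
         integral {- pi..pi} (\<lambda>\<gamma>. cis (of_int j * \<gamma>) *\<^sub>C q \<delta> \<gamma>)) UNIV"
        by (simp add: fsum)
      moreover have "((\<lambda>m. if m = j then (2 * pi * (sinc2 \<delta> j)\<^sup>2) *\<^sub>C D j else 0) has_sum (2 * pi * (sinc2 \<delta> j)\<^sup>2) *\<^sub>C D j) UNIV"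
        by (rule has_sum_finite_neutralI[of "{j}"]) simp_all
      ultimately show ?thesis by (rule has_sum_unique)
    qed
    have cq: "continuous_on {- pi..pi} (\<lambda>\<gamma>. cis (of_int j * \<gamma>) *\<^sub>C q \<delta> \<gamma>)" for j
      using continuous_on_infsum[of "- pi" pi "f j", OF cf nf sf] by (simp add: fsum)
    \<comment> \<open>Multiplication by \<open>cis \<gamma>\<close> shifts Fourier coefficients by
      one, so the integral of \<open>k\<close> is the difference of the coefficients at
      \<open>1\<close> and \<open>0\<close>.\<close>
    define k where "k \<gamma> = (cis \<gamma> - 1) *\<^sub>C q \<delta> \<gamma>" for \<gamma>
    have k: "k = (\<lambda>\<gamma>. cis (of_int 1 * \<gamma>) *\<^sub>C q \<delta> \<gamma> - cis (of_int 0 * \<gamma>) *\<^sub>C q \<delta> \<gamma>)"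
      by (simp add: k_def fun_eq_iff bounded_bilinear.diff_left[OF bounded_bilinear_scaleC])
    have Ik: "(k has_integral (2 * pi * (sinc2 \<delta> 1)\<^sup>2) *\<^sub>C D 1 - (2 * pi * (sinc2 \<delta> 0)\<^sup>2) *\<^sub>C D 0) {- pi..pi}"
      unfolding k coeff[symmetric]
      by (intro has_integral_diff integrable_integral integrable_continuous_real cq)
    have "continuous_on {- pi..pi} k" unfolding k by (intro continuous_intros cq)
    then have ck: "continuous_on {- (4 * \<delta>)..4 * \<delta>} k"
      by (rule continuous_on_subset) (use \<delta> in auto)
    then obtain J where J: "(k has_integral J) {- (4 * \<delta>)..4 * \<delta>}"
      using integrable_continuous_real by blast
    \<comment> \<open>By \<open>q0\<close> the integrand vanishes on \<open>[- pi, pi]\<close>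
      outside \<open>[- 4 \<delta>, 4 \<delta>]\<close>, so the integrals over both intervals
      coincide.\<close>
    have "((\<lambda>x. if x \<in> {- (4 * \<delta>)..4 * \<delta>} then k x else 0) has_integral J) {- pi..pi}"
      using J \<delta> by (subst has_integral_restrict) auto
    then have "(k has_integral J) {- pi..pi}"
      by (rule has_integral_eq[rotated]) (use q0[OF \<delta>(1)] in \<open>auto simp: k_def\<close>)
    then have J_eq: "J = (2 * pi * (sinc2 \<delta> 1)\<^sup>2) *\<^sub>C D 1 - (2 * pi * (sinc2 \<delta> 0)\<^sup>2) *\<^sub>C D 0"
      using Ik has_integral_unique by blast
    have nq: "norm (q \<delta> \<gamma>) \<le> 5 * real N * C" for \<gamma>
    proof -
      have "(\<lambda>m. norm (f 0 m \<gamma>)) summable_on UNIV"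
        by (rule Infinite_Sum.abs_summable_on_comparison_test'[OF sf nf])
      then have "norm (\<Sum>\<^sub>\<infinity>m. f 0 m \<gamma>) \<le> (\<Sum>\<^sub>\<infinity>m. norm (f 0 m \<gamma>))" by (rule norm_infsum_bound)
      also have "\<dots> \<le> (\<Sum>\<^sub>\<infinity>m. sinc2 \<delta> m * C)"
        by (rule infsum_mono) (use \<open>(\<lambda>m. norm (f 0 m \<gamma>)) summable_on UNIV\<close> sf nf in auto)
      also have "\<dots> = infsum (sinc2 \<delta>) UNIV * C" by (rule infsum_cmult_left) (use sinc2_summable in auto)
      also have "\<dots> \<le> 5 * real N * C"
        unfolding \<delta>_def using N C by (intro mult_right_mono sinc2_sum_le) auto
      finally show ?thesis by (simp add: fsum norm_scaleC)
    qed
    have nk: "norm (k \<gamma>) \<le> 20 * C" if "\<gamma> \<in> {- (4 * \<delta>)..4 * \<delta>}" for \<gamma>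
    proof -
      have "norm (cis \<gamma> - 1) \<le> \<bar>\<gamma>\<bar>"
        using dist_exp_i_1[of \<gamma>] abs_sin_x_le_abs_x[of "\<gamma> / 2"] by (simp add: cis_conv_exp)
      then have "norm (cis \<gamma> - 1) \<le> 4 * \<delta>" using that by auto
      then have "norm (k \<gamma>) \<le> (4 * \<delta>) * (5 * real N * C)"
        unfolding k_def norm_scaleC using nq by (intro mult_mono) (use \<delta> in auto)
      also have "\<dots> = 20 * C" using N by (simp add: \<delta>_def)
      finally show ?thesis .
    qed
    have "norm J \<le> 20 * C * measure lborel {- (4 * \<delta>)..4 * \<delta>}"
      by (rule has_integral_bound_real[where f=k]) (use C J nk in auto)
    also have "measure lborel {- (4 * \<delta>)..4 * \<delta>} = 8 * \<delta>" using \<delta> by simp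
    finally have nJ: "norm J \<le> 160 * C * \<delta>" by simp
    have "J = (2 * pi) *\<^sub>C (of_real ((sinc2 \<delta> 1)\<^sup>2) *\<^sub>C D 1 - D 0)"
      unfolding J_eq bounded_bilinear.diff_right[OF bounded_bilinear_scaleC] scaleC_scaleC by (simp add: sinc2_def)
    then have "2 * pi * norm (of_real ((sinc2 \<delta> 1)\<^sup>2) *\<^sub>C D 1 - D 0) \<le> 160 * C * \<delta>"
      using nJ by (simp add: norm_scaleC norm_mult)
    moreover have "1 * norm (of_real ((sinc2 \<delta> 1)\<^sup>2) *\<^sub>C D 1 - D 0) \<le> 2 * pi * norm (of_real ((sinc2 \<delta> 1)\<^sup>2) *\<^sub>C D 1 - D 0)"
      by (rule mult_right_mono) (use pi_gt3 in auto)
    ultimately show ?thesis by (simp add: \<delta>_def)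
  qed
  have "(\<lambda>N. norm ((of_real ((sinc2 (1 / real N) 1)\<^sup>2)) *\<^sub>C D 1 - D 0)) \<longlonglongrightarrow> 0"
  proof (rule tendsto_sandwich[of "\<lambda>_. 0" _ _ "\<lambda>N. 160 * C * (1 / real N)"])
    show "(\<lambda>N. 160 * C * (1 / real N)) \<longlonglongrightarrow> 0"
      using tendsto_mult[OF tendsto_const lim_1_over_n, of "160 * C"] by simp
    show "\<forall>\<^sub>F N in sequentially. norm ((of_real ((sinc2 (1 / real N) 1)\<^sup>2)) *\<^sub>C D 1 - D 0) \<le> 160 * C * (1 / real N)"
      by (rule eventually_mono[OF eventually_ge_at_top[of 2]]) (rule est)
  qed auto
  moreover have "(\<lambda>N. norm ((of_real ((sinc2 (1 / real N) 1)\<^sup>2)) *\<^sub>C D 1 - D 0)) \<longlonglongrightarrow> norm ((of_real (1\<^sup>2)) *\<^sub>C D 1 - D 0)"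
    by (intro tendsto_intros bounded_bilinear.tendsto[OF bounded_bilinear_scaleC] tendsto_sinc2_one)
  ultimately have "norm ((of_real (1\<^sup>2)) *\<^sub>C D 1 - D 0) = 0"
    using LIMSEQ_unique by blast
  then show ?thesis by (simp add: D_def)
qed

subsection \<open>Bilinear maps vanishing on zero products\<close>

definition bounded_clinear :: "('a::complex_normed_vector \<Rightarrow> 'b::complex_normed_vector) \<Rightarrow> bool"
  where "bounded_clinear f \<longleftrightarrow> bounded_linear f \<and> (\<forall>c x. f (c *\<^sub>C x) = c *\<^sub>C f x)"

lemma bounded_clinearI: "bounded_linear f \<Longrightarrow> (\<And>c x. f (c *\<^sub>C x) = c *\<^sub>C f x) \<Longrightarrow> bounded_clinear f"
  by (simp add: bounded_clinear_def)

lemma bounded_clinear_imp_bounded_linear: "bounded_clinear f \<Longrightarrow> bounded_linear f"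
  by (simp add: bounded_clinear_def)

lemma bounded_clinear_scaleC: "bounded_clinear f \<Longrightarrow> f (c *\<^sub>C x) = c *\<^sub>C f x"
  by (simp add: bounded_clinear_def)

lemma bounded_clinear_compose:
  "bounded_clinear f \<Longrightarrow> bounded_clinear g \<Longrightarrow> bounded_clinear (\<lambda>x. f (g x))"
  by (simp add: bounded_clinear_def bounded_linear_compose)

lemma bounded_clinear_mult_left:
  "bounded_clinear f \<Longrightarrow> bounded_clinear (\<lambda>x. f x * (a :: 'a::complex_normed_algebra))"
  by (auto simp: bounded_clinear_def mult_scaleC_left intro: bounded_linear_mult_const)

lemma bounded_clinear_mult_right:
  "bounded_clinear f \<Longrightarrow> bounded_clinear (\<lambda>x. (a :: 'a::complex_normed_algebra) * f x)"
  by (auto simp: bounded_clinear_def mult_scaleC_right intro: bounded_linear_const_mult)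

lemma scaleC_minus_right: "c *\<^sub>C (- x) = - (c *\<^sub>C (x :: 'a::complex_normed_vector))"
  by (rule bounded_bilinear.minus_right[OF bounded_bilinear_scaleC])

lemma scaleC_diff_right: "c *\<^sub>C (x - y) = c *\<^sub>C x - c *\<^sub>C (y :: 'a::complex_normed_vector)"
  by (rule bounded_bilinear.diff_right[OF bounded_bilinear_scaleC])

lemma bounded_clinear_diff:
  "bounded_clinear f \<Longrightarrow> bounded_clinear g \<Longrightarrow> bounded_clinear (\<lambda>x. f x - g x)"
  by (auto simp: bounded_clinear_def scaleC_diff_right intro: bounded_linear_sub)

lemma bounded_clinear_minus:
  "bounded_clinear f \<Longrightarrow> bounded_clinear (\<lambda>x. - f x)"
  by (auto simp: bounded_clinear_def scaleC_minus_right intro: bounded_linear_minus)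

lemma bounded_clinear_ident: "bounded_clinear (\<lambda>x. x)"
  by (simp add: bounded_clinear_def)

lemma bounded_clinear_zero: "bounded_clinear (\<lambda>x. 0)"
  by (simp add: bounded_clinear_def)

lemma bounded_clinear_sum:
  assumes "bounded_clinear f"
  shows "f (\<Sum>t\<in>I. c t *\<^sub>C g t) = (\<Sum>t\<in>I. c t *\<^sub>C f (g t))"
proof -
  interpret bounded_linear f using assms by (rule bounded_clinear_imp_bounded_linear)
  show ?thesis using assms by (simp add: sum bounded_clinear_scaleC)
qed

lemma clinear_continuous_imp_bounded_clinear:
  assumes "clinear f" "continuous_on UNIV f"
  shows "bounded_clinear f"
proof (rule bounded_clinearI)
  have add: "f (x + y) = f x + f y" and sc: "f (c *\<^sub>C x) = c *\<^sub>C f x" for x y c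
    using assms(1) by (simp_all add: clinear_iff)
  then show "f (c *\<^sub>C x) = c *\<^sub>C f x" for x c by simp
  have scR: "f (r *\<^sub>R x) = r *\<^sub>R f x" for r x by (simp add: scaleR_scaleC sc)
  have f0: "f 0 = 0" using scR[of 0 0] by simp
  obtain d where d: "d > 0" "\<And>x. norm x < d \<Longrightarrow> norm (f x) < 1"
    using assms(2) f0 unfolding continuous_on_iff by (metis UNIV_I dist_0_norm dist_commute zero_less_one)
  show "bounded_linear f"
  proof (rule bounded_linear_intro[where K="2 / d"])
    fix x
    show "norm (f x) \<le> norm x * (2 / d)"
    proof (cases "x = 0")
      case False
      have "norm ((d / (2 * norm x)) *\<^sub>R x) < d" using False d(1) by simp
      from d(2)[OF this] have "d / (2 * norm x) * norm (f x) < 1"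
        using d(1) by (simp add: scR)
      then show ?thesis using False d(1) by (simp add: field_simps)
    qed (simp add: f0)
  qed (use add scR in auto)
qed

lemma
  fixes x :: "'i \<Rightarrow> 'a::banach" and y :: "'j \<Rightarrow> 'b::banach" and p :: "'a \<Rightarrow> 'b \<Rightarrow> 'c::banach"
  assumes p: "bounded_bilinear p"
    and x: "(\<lambda>i. norm (x i)) summable_on UNIV" and y: "(\<lambda>j. norm (y j)) summable_on UNIV"
  shows summable_on_bounded_bilinear: "(\<lambda>(i, j). p (x i) (y j)) summable_on UNIV"
    and infsum_bounded_bilinear: "(\<Sum>\<^sub>\<infinity>(i, j)\<in>UNIV. p (x i) (y j)) = p (infsum x UNIV) (infsum y UNIV)"
proof -
  interpret bounded_bilinear p by (rule p)
  obtain K where K: "\<And>a b. norm (p a b) \<le> norm a * norm b * K" using bounded by blast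
  have "(\<lambda>z. (case z of (i, j) \<Rightarrow> norm (x i) * norm (y j)) * K) summable_on UNIV"
    by (intro summable_on_cmult_left summable_on_product_nonneg x y) auto
  then have "(\<lambda>z. norm (case z of (i, j) \<Rightarrow> p (x i) (y j))) summable_on UNIV"
    by (rule Infinite_Sum.abs_summable_on_comparison_test') (auto intro: K)
  then show s: "(\<lambda>(i, j). p (x i) (y j)) summable_on UNIV"
    by (rule abs_summable_summable)
  have xs: "(x has_sum infsum x UNIV) UNIV" and ys: "(y has_sum infsum y UNIV) UNIV"
    using x y by (auto intro: has_sum_infsum abs_summable_summable)
  have inner: "(\<Sum>\<^sub>\<infinity>j. p (x i) (y j)) = p (x i) (infsum y UNIV)" for i
    by (intro infsumI has_sum_bounded_linear[OF bounded_linear_right ys])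
  have "(\<Sum>\<^sub>\<infinity>i. \<Sum>\<^sub>\<infinity>j. p (x i) (y j)) = (\<Sum>\<^sub>\<infinity>(i, j)\<in>UNIV \<times> UNIV. p (x i) (y j))"
    by (rule infsum_Sigma'_banach) (use s in simp)
  moreover have "(\<Sum>\<^sub>\<infinity>i. p (x i) (infsum y UNIV)) = p (infsum x UNIV) (infsum y UNIV)"
    by (intro infsumI has_sum_bounded_linear[OF bounded_linear_left xs])
  ultimately show "(\<Sum>\<^sub>\<infinity>(i, j)\<in>UNIV. p (x i) (y j)) = p (infsum x UNIV) (infsum y UNIV)"
    by (simp add: inner)
qed

definition bounded_cbilinear :: "('a::complex_normed_vector \<Rightarrow> 'b::complex_normed_vector \<Rightarrow> 'c::complex_normed_vector) \<Rightarrow> bool"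
  where "bounded_cbilinear \<psi> \<longleftrightarrow> bounded_bilinear \<psi> \<and>
    (\<forall>c a b. \<psi> (c *\<^sub>C a) b = c *\<^sub>C \<psi> a b \<and> \<psi> a (c *\<^sub>C b) = c *\<^sub>C \<psi> a b)"

text \<open>Since \<open>R m a * L n b = a * L (m + n) b\<close>, the product of the series with
  terms \<open>f m *\<^sub>C R m a\<close> and \<open>g n *\<^sub>C L n b\<close> depends on
  \<open>f\<close> and \<open>g\<close> only through their convolution. So
  \<open>bounded_double_sequence_shift\<close> applies to
  \<open>c m n = \<psi> (R m a) (L n b)\<close>.\<close>

lemma zero_product_int_action:
  fixes \<psi> :: "'a::complex_banach_algebra \<Rightarrow> 'a \<Rightarrow> 'b::complex_banach_algebra"
    and L R :: "int \<Rightarrow> 'a \<Rightarrow> 'a"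
  assumes \<psi>: "bounded_cbilinear \<psi>" and zero: "\<And>a b. a * b = 0 \<Longrightarrow> \<psi> a b = 0"
    and nL: "\<And>m a. norm (L m a) \<le> norm a" and nR: "\<And>m a. norm (R m a) \<le> norm a"
    and LR: "\<And>m a b. R m a * b = a * L m b"
    and LL: "\<And>m n a. L m (L n a) = L (m + n) a"
  shows "\<psi> (R 1 a) (L (-1) b) = \<psi> (R 0 a) (L 0 b)"
proof -
  interpret bounded_bilinear \<psi> using \<psi> by (simp add: bounded_cbilinear_def)
  have \<psi>C: "\<psi> (c *\<^sub>C a) (d *\<^sub>C b) = (c * d) *\<^sub>C \<psi> a b" for c d a b
    using \<psi> by (simp add: bounded_cbilinear_def scaleC_scaleC mult.commute)
  obtain K where K: "0 \<le> K" "\<And>a b. norm (\<psi> a b) \<le> norm a * norm b * K" using nonneg_bounded by blast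
  show ?thesis
  proof (rule bounded_double_sequence_shift[where c="\<lambda>m n. \<psi> (R m a) (L n b)" and C="norm a * norm b * K"])
    fix m n
    have "norm (\<psi> (R m a) (L n b)) \<le> norm (R m a) * norm (L n b) * K" by (rule K)
    also have "\<dots> \<le> norm a * norm b * K" using K nL nR by (intro mult_mono) auto
    finally show "norm (\<psi> (R m a) (L n b)) \<le> norm a * norm b * K" .
  next
    fix f g :: "int \<Rightarrow> complex"
    assume f: "(\<lambda>m. norm (f m)) summable_on UNIV" and g: "(\<lambda>m. norm (g m)) summable_on UNIV"
      and conv: "\<And>k. ((\<lambda>m. f m * g (k - m)) has_sum 0) UNIV"
    define x where "x m = f m *\<^sub>C R m a" for m
    define y where "y n = g n *\<^sub>C L n b" for n
    have x: "(\<lambda>m. norm (x m)) summable_on UNIV"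
      by (rule Infinite_Sum.abs_summable_on_comparison_test'[OF summable_on_cmult_left[OF f, of "norm a"]])
        (auto simp: x_def norm_scaleC intro!: mult_left_mono nR)
    have y: "(\<lambda>m. norm (y m)) summable_on UNIV"
      by (rule Infinite_Sum.abs_summable_on_comparison_test'[OF summable_on_cmult_left[OF g, of "norm b"]])
        (auto simp: y_def norm_scaleC intro!: mult_left_mono nL)
    have "infsum x UNIV * infsum y UNIV = 0"
    proof -
      define z where "z = (\<lambda>(m, n). x m * y n)"
      have z: "z summable_on UNIV" and eq: "infsum z UNIV = infsum x UNIV * infsum y UNIV"
        unfolding z_def
        using summable_on_bounded_bilinear[OF bounded_bilinear_mult x y]
          infsum_bounded_bilinear[OF bounded_bilinear_mult x y] by auto
      \<comment> \<open>The double sum is regrouped along the lines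
        \<open>m + n = k\<close>.\<close>
      define j :: "int \<times> int \<Rightarrow> int \<times> int" where "j = (\<lambda>(k, m). (m, k - m))"
      have j: "bij j"
        unfolding j_def by (rule o_bij[where g="\<lambda>(m, n). (m + n, m)"]) auto
      have zj: "(z \<circ> j) summable_on UNIV \<times> UNIV"
        using z j by (subst summable_on_reindex[symmetric]) (auto simp: bij_def)
      have inner: "(\<Sum>\<^sub>\<infinity>m. (z \<circ> j) (k, m)) = 0" for k
      proof -
        have "(z \<circ> j) (k, m) = (f m * g (k - m)) *\<^sub>C (a * L k b)" for m
          by (simp add: z_def j_def x_def y_def mult_scaleC_left mult_scaleC_right scaleC_scaleC LR LL
              mult.commute[of "g (k - m)"])
        then show ?thesis
          using infsumI[OF has_sum_bounded_linear[OF bounded_linear_scaleC_left conv[of k], of "a * L k b"]]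
          by simp
      qed
      have "infsum z UNIV = infsum (z \<circ> j) UNIV"
        using j by (subst infsum_reindex[symmetric]) (auto simp: bij_def)
      also have "\<dots> = (\<Sum>\<^sub>\<infinity>k. \<Sum>\<^sub>\<infinity>m. (z \<circ> j) (k, m))"
        using infsum_Sigma_banach[OF zj] by simp
      also have "\<dots> = 0" by (simp only: inner infsum_0_simp)
      finally show ?thesis by (simp add: eq)
    qed
    then have "\<psi> (infsum x UNIV) (infsum y UNIV) = 0" by (rule zero)
    then have "(\<Sum>\<^sub>\<infinity>(m, n)\<in>UNIV. \<psi> (x m) (y n)) = 0"
      using infsum_bounded_bilinear[OF bounded_bilinear_axioms x y] by simp
    then show "(\<Sum>\<^sub>\<infinity>(m, n)\<in>UNIV. (f m * g n) *\<^sub>C \<psi> (R m a) (L n b)) = 0"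
      by (simp add: x_def y_def \<psi>C)
  qed
qed

text \<open>The powers of \<open>s\<close>, written additively. The group need not commute, so
  additivity for exponents of mixed sign rests on the fact that multiples of one element commute
  with each other.\<close>

lemma exists_int_hom:
  fixes s :: "'g::group_add"
  shows "\<exists>h :: int \<Rightarrow> 'g. h 1 = s \<and> h 0 = 0 \<and> (\<forall>m n. h (m + n) = h m + h n)"
proof -
  define p where "p n = ((+) s ^^ n) 0" for n
  have pS: "p (Suc n) = s + p n" for n by (simp add: p_def)
  have pa: "p (m + n) = p m + p n" for m n
    by (induction m) (simp_all add: pS add.assoc, simp add: p_def)
  define h where "h m = (if 0 \<le> m then p (nat m) else - p (nat (- m)))" for m
  have diff: "h (int i - int j) = p i - p j" for i j
  proof (cases "j \<le> i")
    case True
    then have "p i = p (i - j) + p j" using pa[of "i - j" j] by simp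
    then show ?thesis using True by (simp add: h_def nat_diff_distrib')
  next
    case False
    then have "p j = p (j - i) + p i" using pa[of "j - i" i] by simp
    then show ?thesis using False by (simp add: h_def nat_diff_distrib' diff_add_eq_diff_diff_swap)
  qed
  have comm: "p i + p j = p j + p i" for i j by (metis pa add.commute)
  have comm': "- p j + p i = p i + - p j" for i j
    by (metis add.assoc comm diff_conv_add_uminus add_diff_cancel minus_add_cancel)
  have "h (m + n) = h m + h n" for m n
  proof -
    obtain i j where m: "m = int i - int j" by (metis int_diff_cases)
    obtain k l where n: "n = int k - int l" by (metis int_diff_cases)
    have "h (m + n) = p (i + k) - p (l + j)"
      unfolding m n using diff[of "i + k" "l + j"] by (simp add: algebra_simps)
    also have "\<dots> = p i + (p k + - p j) + - p l"
      by (simp add: pa diff_add_eq_diff_diff_swap add_diff_eq add.assoc)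
    also have "p k + - p j = - p j + p k" by (simp add: comm')
    also have "p i + (- p j + p k) + - p l = (p i - p j) + (p k - p l)"
      by (simp only: diff_conv_add_uminus add.assoc)
    also have "\<dots> = h m + h n" by (simp only: m n diff)
    finally show ?thesis .
  qed
  moreover have "h 1 = s" using pS[of 0] by (simp add: h_def) (simp add: p_def)
  moreover have "h 0 = 0" by (simp add: h_def p_def)
  ultimately show ?thesis by blast
qed

text \<open>For an equibounded net of additive maps, the vectors along which it converges form a
  closed set; completeness enters through Cauchy filters because the index is a net. Below, the
  \<open>x i\<close> are images of triple products converging to a given element of the
  target.\<close>

lemma net_limit_closed:
  fixes T :: "'j \<Rightarrow> 'b::banach \<Rightarrow> 'b"
  assumes bound: "\<And>j b. norm (T j b) \<le> K * norm b" and add: "\<And>j x y. T j (x - y) = T j x - T j y"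
    and lim: "(x \<longlongrightarrow> b) V" and V: "V \<noteq> bot" and U: "U \<noteq> bot"
    and conv: "\<And>i. \<exists>l. ((\<lambda>j. T j (x i)) \<longlongrightarrow> l) U"
  shows "\<exists>l. ((\<lambda>j. T j b) \<longlongrightarrow> l) U"
proof -
  have "cauchy_filter (filtermap (\<lambda>j. T j b) U)"
    unfolding cauchy_filter_metric_filtermap
  proof (intro allI impI)
    fix \<epsilon> :: real assume "\<epsilon> > 0"
    \<comment> \<open>\<open>K\<close> need not be positive, so a positive bound is taken before
      dividing.\<close>
    define M where "M = \<bar>K\<bar> + 1"
  have M: "M > 0" "K \<le> M" by (auto simp: M_def)
  define \<eta> where "\<eta> = \<epsilon> / (4 * M)"
    have \<eta>: "\<eta> > 0" using \<open>\<epsilon> > 0\<close> M by (simp add: \<eta>_def)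
    have "\<exists>i. dist (x i) b < \<eta>"
      using tendstoD[OF lim \<eta>] V by (meson eventually_happens')
    then obtain i where i: "dist (x i) b < \<eta>" by blast
    obtain l where l: "((\<lambda>j. T j (x i)) \<longlongrightarrow> l) U" using conv by blast
    have close: "dist (T j (x i)) (T j b) \<le> \<epsilon> / 4" for j
    proof -
      have "dist (T j (x i)) (T j b) = norm (T j (x i - b))" by (simp add: dist_norm add)
      also have "\<dots> \<le> K * norm (x i - b)" by (rule bound)
      also have "\<dots> \<le> M * \<eta>" using i M by (intro mult_mono) (auto simp: dist_norm)
      also have "\<dots> = \<epsilon> / 4" using M by (simp add: \<eta>_def)
      finally show ?thesis .
    qed
    show "\<exists>P. eventually P U \<and> (\<forall>j k. P j \<and> P k \<longrightarrow> dist (T j b) (T k b) < \<epsilon>)"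
    proof (intro exI conjI allI impI)
      show "\<forall>\<^sub>F j in U. dist (T j (x i)) l < \<epsilon> / 4" using tendstoD[OF l, of "\<epsilon> / 4"] \<open>\<epsilon> > 0\<close> by simp
      fix j k assume jk: "dist (T j (x i)) l < \<epsilon> / 4 \<and> dist (T k (x i)) l < \<epsilon> / 4"
      show "dist (T j b) (T k b) < \<epsilon>"
        using jk close[of j] close[of k] dist_triangle3[of "T j b" "T k b" l]
          dist_triangle3[of l "T j b" "T j (x i)"] dist_triangle3[of l "T k b" "T k (x i)"]
        by linarith
    qed
  qed
  then have "\<exists>l. filtermap (\<lambda>j. T j b) U \<le> nhds l"
    using complete_UNIV[where 'a='b] U unfolding complete_uniform by (simp add: filtermap_bot_iff)
  then show ?thesis by (simp add: filterlim_def)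
qed

lemma net_limit_zero_closed:
  fixes T :: "'j \<Rightarrow> 'b::real_normed_vector \<Rightarrow> 'b"
  assumes bound: "\<And>j b. norm (T j b) \<le> K * norm b" and add: "\<And>j x y. T j (x - y) = T j x - T j y"
    and lim: "(x \<longlongrightarrow> b) V" and V: "V \<noteq> bot"
    and conv: "\<And>i. ((\<lambda>j. T j (x i)) \<longlongrightarrow> 0) U"
  shows "((\<lambda>j. T j b) \<longlongrightarrow> 0) U"
proof (rule tendstoI)
  fix \<epsilon> :: real assume "\<epsilon> > 0"
  define M where "M = \<bar>K\<bar> + 1"
  have M: "M > 0" "K \<le> M" by (auto simp: M_def)
  define \<eta> where "\<eta> = \<epsilon> / (2 * M)"
  have \<eta>: "\<eta> > 0" using \<open>\<epsilon> > 0\<close> M by (simp add: \<eta>_def)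
  have "\<exists>i. dist (x i) b < \<eta>"
    using tendstoD[OF lim \<eta>] V by (meson eventually_happens')
  then obtain i where i: "dist (x i) b < \<eta>" by blast
  have close: "norm (T j (x i) - T j b) \<le> \<epsilon> / 2" for j
  proof -
    have "norm (T j (x i) - T j b) = norm (T j (x i - b))" by (simp add: add)
    also have "\<dots> \<le> K * norm (x i - b)" by (rule bound)
    also have "\<dots> \<le> M * \<eta>" using i M by (intro mult_mono) (auto simp: dist_norm)
    also have "\<dots> = \<epsilon> / 2" using M by (simp add: \<eta>_def)
    finally show ?thesis .
  qed
  have "\<forall>\<^sub>F j in U. dist (T j (x i)) 0 < \<epsilon> / 2" using tendstoD[OF conv, of "\<epsilon> / 2"] \<open>\<epsilon> > 0\<close> by simp
  then show "\<forall>\<^sub>F j in U. dist (T j b) 0 < \<epsilon>"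
  proof eventually_elim
    case (elim j)
    then show ?case using close[of j] norm_triangle_sub[of "T j b" "T j (x i)"]
      by (simp add: norm_minus_commute)
  qed
qed

text \<open>These pairs are bounded double centralizers of the algebra. Multiplications by an
  element and pairs of translations are the two instances, which lets one identity cover
  both.\<close>

definition multiplier :: "('a::complex_banach_algebra \<Rightarrow> 'a) \<Rightarrow> ('a \<Rightarrow> 'a) \<Rightarrow> bool"
  where "multiplier l r \<longleftrightarrow> bounded_clinear l \<and> bounded_clinear r \<and>
    (\<forall>a b. l (a * b) = l a * b \<and> r (a * b) = a * r b \<and> r a * b = a * l b)"

lemma multiplier_mult: "multiplier (\<lambda>a. x * a) (\<lambda>a. a * x)"
  using bounded_clinear_mult_left[OF bounded_clinear_ident, of x]
    bounded_clinear_mult_right[OF bounded_clinear_ident, of x]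
  by (simp add: multiplier_def mult.assoc bounded_clinear_mult_left[OF bounded_clinear_ident]
      bounded_clinear_mult_right[OF bounded_clinear_ident])

text \<open>Collects what the algebraic part of the proof requires of the group algebra. In
  \<open>approx\<close> one set of coefficients serves left and right multiplication simultaneously;
  this is what transfers identities that mix \<open>L t\<close> and \<open>R t\<close>. Note the
  reversed order in \<open>R t (R s a) = R (s + t) a\<close>.\<close>

locale translation_algebra =
  fixes L R :: "'g::group_add \<Rightarrow> 'a::complex_banach_algebra \<Rightarrow> 'a"
    and u :: "'j \<Rightarrow> 'a" and U :: "'j filter"
  assumes multiplier_LR: "multiplier (L t) (R t)"
    and norm_L: "norm (L t a) \<le> norm a" and norm_R: "norm (R t a) \<le> norm a"
    and L_0: "L 0 a = a" and R_0: "R 0 a = a"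
    and L_L: "L s (L t a) = L (s + t) a" and R_R: "R t (R s a) = R (s + t) a"
    and L_R: "L s (R t a) = R t (L s a)"
    and approx: "finite X \<Longrightarrow> 0 < \<epsilon> \<Longrightarrow> \<exists>I c. finite I \<and>
      (\<forall>a\<in>X. norm (x * a - (\<Sum>t\<in>I. c t *\<^sub>C L t a)) < \<epsilon> \<and> norm (a * x - (\<Sum>t\<in>I. c t *\<^sub>C R t a)) < \<epsilon>)"
    and bai: "bounded_approximate_identity u U"
begin

lemma bounded_clinear_L: "bounded_clinear (L t)" and bounded_clinear_R: "bounded_clinear (R t)"
  using multiplier_LR[of t] by (simp_all add: multiplier_def)

lemma L_mult: "L t (a * b) = L t a * b" and R_mult: "R t (a * b) = a * R t b"
  and LR_mult: "R t a * b = a * L t b"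
  using multiplier_LR[of t] by (simp_all add: multiplier_def)

lemma U_ne_bot: "U \<noteq> bot"
  using bai by (simp add: bounded_approximate_identity_def)

lemma tendsto_u_left: "((\<lambda>j. u j * a) \<longlongrightarrow> a) U" and tendsto_u_right: "((\<lambda>j. a * u j) \<longlongrightarrow> a) U"
  using bai by (auto simp: bounded_approximate_identity_def)

lemma u_bounded: "\<exists>M>0. \<forall>j. norm (u j) \<le> M"
  using bai by (auto simp: bounded_approximate_identity_def bounded_pos)

text \<open>An equation that is linear in the operators \<open>L t\<close> and \<open>R t\<close>
  and holds for all \<open>t\<close> passes to left and right multiplication by \<open>x\<close>,
  because both are approximated with the same coefficients. Four functionals are what
  \<open>limits_commute_Phi\<close> asks for; shorter equations put in zero maps.\<close>

lemma approx_functional: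
  fixes p1 p2 q1 q2 :: "'a \<Rightarrow> 'c::complex_normed_vector"
  assumes p: "bounded_clinear p1" "bounded_clinear p2" "bounded_clinear q1" "bounded_clinear q2"
    and zero: "\<And>t. p1 (L t a1) + p2 (L t a2) + q1 (R t b1) + q2 (R t b2) = 0"
  shows "p1 (x * a1) + p2 (x * a2) + q1 (b1 * x) + q2 (b2 * x) = 0" (is "?P = 0")
proof -
  obtain K1 K2 K3 K4 where K: "\<And>v. norm (p1 v) \<le> norm v * K1" "K1 > 0" "\<And>v. norm (p2 v) \<le> norm v * K2" "K2 > 0"
    "\<And>v. norm (q1 v) \<le> norm v * K3" "K3 > 0" "\<And>v. norm (q2 v) \<le> norm v * K4" "K4 > 0"
    using p by (meson bounded_clinear_def bounded_linear.pos_bounded)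
  have "norm ?P \<le> 0 + \<epsilon>" if "\<epsilon> > 0" for \<epsilon>
  proof -
    define \<eta> where "\<eta> = \<epsilon> / (K1 + K2 + K3 + K4)"
    have \<eta>: "\<eta> > 0" using that K by (simp add: \<eta>_def)
    obtain I c where I: "\<forall>a\<in>{a1, a2, b1, b2}. norm (x * a - (\<Sum>t\<in>I. c t *\<^sub>C L t a)) < \<eta> \<and>
        norm (a * x - (\<Sum>t\<in>I. c t *\<^sub>C R t a)) < \<eta>"
      using approx[of "{a1, a2, b1, b2}" \<eta> x] \<eta> by auto
    let ?L = "\<lambda>a. \<Sum>t\<in>I. c t *\<^sub>C L t a" and ?R = "\<lambda>a. \<Sum>t\<in>I. c t *\<^sub>C R t a"
    have "p1 (?L a1) + p2 (?L a2) + q1 (?R b1) + q2 (?R b2)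
       = (\<Sum>t\<in>I. c t *\<^sub>C (p1 (L t a1) + p2 (L t a2) + q1 (R t b1) + q2 (R t b2)))"
      by (simp add: p[THEN bounded_clinear_sum] scaleC_add_right sum.distrib)
    then have "p1 (?L a1) + p2 (?L a2) + q1 (?R b1) + q2 (?R b2) = 0" by (simp add: zero)
    then have "?P = (p1 (x * a1) - p1 (?L a1)) + (p2 (x * a2) - p2 (?L a2))
       + (q1 (b1 * x) - q1 (?R b1)) + (q2 (b2 * x) - q2 (?R b2))" by (simp add: algebra_simps)
    also have "\<dots> = p1 (x * a1 - ?L a1) + p2 (x * a2 - ?L a2) + q1 (b1 * x - ?R b1) + q2 (b2 * x - ?R b2)"
      using p[THEN bounded_clinear_imp_bounded_linear]
      by (simp add: linear_diff bounded_linear.linear)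
    also have "norm \<dots> \<le> norm (p1 (x * a1 - ?L a1)) + norm (p2 (x * a2 - ?L a2)) + norm (q1 (b1 * x - ?R b1)) + norm (q2 (b2 * x - ?R b2))"
      by (intro order_trans[OF norm_triangle_ineq] add_mono order_refl)
    also have "\<dots> \<le> \<eta> * K1 + \<eta> * K2 + \<eta> * K3 + \<eta> * K4"
      using I K by (intro add_mono order_trans[OF K(1)] order_trans[OF K(3)] order_trans[OF K(5)] order_trans[OF K(7)]
          mult_right_mono) (auto intro: less_imp_le)
    also have "\<dots> = \<eta> * (K1 + K2 + K3 + K4)" by (simp add: distrib_left)
    also have "\<dots> = \<epsilon>" using K by (simp add: \<eta>_def)
    finally show ?thesis by simp
  qed
  then have "norm ?P \<le> 0" by (rule field_le_epsilon)
  then show ?thesis by simp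
qed

lemma zero_product_translation:
  fixes \<psi> :: "'a \<Rightarrow> 'a \<Rightarrow> 'b::complex_banach_algebra"
  assumes \<psi>: "bounded_cbilinear \<psi>" and zero: "\<And>a b. a * b = 0 \<Longrightarrow> \<psi> a b = 0"
  shows "\<psi> (R t a) b = \<psi> a (L t b)"
proof -
  obtain h :: "int \<Rightarrow> 'g" where h: "h 1 = t" "h 0 = 0" "\<forall>m n. h (m + n) = h m + h n"
    using exists_int_hom[of t] by (elim exE conjE)
  then have h_add: "h (m + n) = h m + h n" for m n by simp
  \<comment> \<open>Applied with \<open>L t b\<close> in place of \<open>b\<close>: the left side
    then contains \<open>L (- t) (L t b) = b\<close>, the right side \<open>L t b\<close>.\<close>
  have "\<psi> (R (h 1) a) (L (h (-1)) (L t b)) = \<psi> (R (h 0) a) (L (h 0) (L t b))"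
  proof (rule zero_product_int_action[OF \<psi> zero, where L="\<lambda>m. L (h m)" and R="\<lambda>m. R (h m)"])
    show "L (h m) (L (h n) a) = L (h (m + n)) a" for m n a by (simp only: L_L h_add)
  qed (rule norm_L norm_R LR_mult | assumption)+
  moreover have "L (h (-1)) (L t b) = b"
    using h_add[of "-1" 1] h(1,2) by (simp add: L_L L_0)
  ultimately show ?thesis by (simp add: h(1,2) R_0 L_0)
qed

lemma zero_product_mult:
  fixes \<psi> :: "'a \<Rightarrow> 'a \<Rightarrow> 'b::complex_banach_algebra"
  assumes \<psi>: "bounded_cbilinear \<psi>" and zero: "\<And>a b. a * b = 0 \<Longrightarrow> \<psi> a b = 0"
  shows "\<psi> (a * x) b = \<psi> a (x * b)"
proof -
  interpret bounded_bilinear \<psi> using \<psi> by (simp add: bounded_cbilinear_def)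
  have 1: "bounded_clinear (\<lambda>v. \<psi> v b)" and 2: "bounded_clinear (\<lambda>v. - \<psi> a v)"
    using \<psi> by (auto simp: bounded_clinear_def bounded_cbilinear_def bounded_linear_left bounded_linear_right scaleC_minus_right
        intro: bounded_linear_minus)
  have "- \<psi> a (x * b) + 0 + \<psi> (a * x) b + 0 = 0"
    by (rule approx_functional[OF 2 bounded_clinear_zero 1 bounded_clinear_zero])
      (simp add: zero_product_translation[OF \<psi> zero])
  then show ?thesis by simp
qed

end

subsection \<open>Maps preserving two-sided zero products\<close>

locale zero_product_preserver = translation_algebra L R u U
  for L R :: "'g::group_add \<Rightarrow> 'a::complex_banach_algebra \<Rightarrow> 'a" and u :: "'j \<Rightarrow> 'a" and U :: "'j filter" +
  fixes \<Phi> :: "'a \<Rightarrow> 'b::complex_banach_algebra" and e :: "'i \<Rightarrow> 'b" and F :: "'i filter"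
  assumes bai_target: "bounded_approximate_identity e F"
    and bounded_clinear_Phi: "bounded_clinear \<Phi>"
    and surj_Phi: "surj \<Phi>"
    and preserves: "preserves_two_sided_zero_products \<Phi>"
begin

sublocale Phi: bounded_linear \<Phi>
  using bounded_clinear_Phi by (rule bounded_clinear_imp_bounded_linear)

text \<open>The property shared by translations and multiplications on which the four-term identity
  rests. The target of \<open>\<psi>\<close> is the codomain of \<open>\<Phi>\<close>, since the
  bilinear maps in question are built from products of values of \<open>\<Phi>\<close>.\<close>

definition balanced :: "('a \<Rightarrow> 'a) \<Rightarrow> ('a \<Rightarrow> 'a) \<Rightarrow> bool"
  where "balanced l r \<longleftrightarrow> multiplier l r \<and>
    (\<forall>\<psi> :: 'a \<Rightarrow> 'a \<Rightarrow> 'b. bounded_cbilinear \<psi> \<longrightarrow> (\<forall>a b. a * b = 0 \<longrightarrow> \<psi> a b = 0) \<longrightarrow>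
      (\<forall>a b. \<psi> (r a) b = \<psi> a (l b)))"

lemma balanced_LR: "balanced (L t) (R t)"
  unfolding balanced_def
  by (intro conjI allI impI multiplier_LR zero_product_translation) auto

lemma balanced_mult: "balanced (\<lambda>a. x * a) (\<lambda>a. a * x)"
  unfolding balanced_def
  by (intro conjI allI impI multiplier_mult zero_product_mult) auto

lemma bounded_cbilinear_Phi_mult:
  assumes "bounded_clinear f" "bounded_clinear g"
  shows "bounded_cbilinear (\<lambda>a b. \<Phi> (f a) * \<Phi> (g b))" "bounded_cbilinear (\<lambda>a b. \<Phi> (g b) * \<Phi> (f a))"
proof -
  have f: "bounded_linear (\<lambda>x. \<Phi> (f x))" and g: "bounded_linear (\<lambda>x. \<Phi> (g x))"
    and c: "\<Phi> (f (c *\<^sub>C x)) = c *\<^sub>C \<Phi> (f x)" "\<Phi> (g (c *\<^sub>C x')) = c *\<^sub>C \<Phi> (g x')" for c x x'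
    using assms bounded_clinear_Phi by (auto simp: bounded_clinear_def bounded_linear_compose)
  show "bounded_cbilinear (\<lambda>a b. \<Phi> (f a) * \<Phi> (g b))"
    using bounded_bilinear.comp[OF bounded_bilinear_mult f g]
    by (simp add: bounded_cbilinear_def c mult_scaleC_left mult_scaleC_right)
  show "bounded_cbilinear (\<lambda>a b. \<Phi> (g b) * \<Phi> (f a))"
    using bounded_bilinear.flip[OF bounded_bilinear.comp[OF bounded_bilinear_mult g f]]
    by (simp add: bounded_cbilinear_def c mult_scaleC_left mult_scaleC_right)
qed

lemma bounded_cbilinear_diff:
  fixes \<psi> \<theta> :: "'a \<Rightarrow> 'a \<Rightarrow> 'b"
  assumes "bounded_cbilinear \<psi>" "bounded_cbilinear \<theta>"
  shows "bounded_cbilinear (\<lambda>a b. \<psi> a b - \<theta> a b)"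
proof -
  interpret p: bounded_bilinear \<psi> using assms by (simp add: bounded_cbilinear_def)
  interpret c: bounded_bilinear \<theta> using assms by (simp add: bounded_cbilinear_def)
  obtain K K' where K: "\<And>a b. norm (\<psi> a b) \<le> norm a * norm b * K" "\<And>a b. norm (\<theta> a b) \<le> norm a * norm b * K'"
    using p.bounded c.bounded by blast
  have "bounded_bilinear (\<lambda>a b. \<psi> a b - \<theta> a b)"
  proof (rule bounded_bilinear.intro)
    show "\<exists>K. \<forall>a b. norm (\<psi> a b - \<theta> a b) \<le> norm a * norm b * K"
    proof (intro exI allI)
      fix a b
      have "norm (\<psi> a b - \<theta> a b) \<le> norm (\<psi> a b) + norm (\<theta> a b)" by (rule norm_triangle_ineq4)
      also have "\<dots> \<le> norm a * norm b * (K + K')" using K[of a b] by (simp add: distrib_left)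
      finally show "norm (\<psi> a b - \<theta> a b) \<le> norm a * norm b * (K + K')" .
    qed
  qed (simp_all add: p.add_left p.add_right c.add_left c.add_right p.scaleR_left p.scaleR_right
      c.scaleR_left c.scaleR_right scaleR_diff_right)
  then show ?thesis using assms by (simp add: bounded_cbilinear_def scaleC_diff_right)
qed

lemma Phi_zero_product: "a * b = 0 \<Longrightarrow> b * a = 0 \<Longrightarrow> \<Phi> a * \<Phi> b = 0"
  using preserves by (auto simp: preserves_two_sided_zero_products_def)

text \<open>With \<open>c * d = 0\<close> fixed, \<open>(l, r)\<close> is moved through the bilinear
  map in \<open>a\<close> and \<open>b\<close>. The resulting equation says that another bilinear
  map, in \<open>c\<close> and \<open>d\<close>, vanishes on zero products, so
  \<open>(l', r')\<close> can be moved through that one.\<close>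

lemma Phi_mult_balanced:
  assumes 1: "balanced l r" and 2: "balanced l' r'"
  shows "\<Phi> (r' B) * \<Phi> (r D) + \<Phi> (l B) * \<Phi> (l' D) = \<Phi> (r' (l B)) * \<Phi> D + \<Phi> B * \<Phi> (l' (r D))"
proof -
  have m: "bounded_clinear l" "bounded_clinear r" "bounded_clinear l'" "bounded_clinear r'"
    "\<And>a b. l (a * b) = l a * b" "\<And>a b. r (a * b) = a * r b"
    "\<And>a b. l' (a * b) = l' a * b" "\<And>a b. r' (a * b) = a * r' b"
    using 1 2 by (auto simp: balanced_def multiplier_def)
  have step1: "\<Phi> (b * c) * \<Phi> (d * r a) = \<Phi> (l b * c) * \<Phi> (d * a)" if "c * d = 0" for a b c d
  proof -
    let ?\<psi> = "\<lambda>a b. \<Phi> (b * c) * \<Phi> (d * a)"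
    have "bounded_cbilinear ?\<psi>"
      by (rule bounded_cbilinear_Phi_mult(2)) (intro bounded_clinear_mult_left bounded_clinear_mult_right bounded_clinear_ident)+
    moreover have "?\<psi> a b = 0" if "a * b = 0" for a b
    proof (rule Phi_zero_product)
      show "b * c * (d * a) = 0" using \<open>c * d = 0\<close> by (metis mult.assoc mult_zero_left mult_zero_right)
      show "d * a * (b * c) = 0" using that by (metis mult.assoc mult_zero_left mult_zero_right)
    qed
    ultimately show ?thesis using 1 unfolding balanced_def by blast
  qed
  have step2: "\<Phi> (r' (b * c)) * \<Phi> (r (d * a)) + \<Phi> (l (b * c)) * \<Phi> (l' (d * a))
      = \<Phi> (r' (l (b * c))) * \<Phi> (d * a) + \<Phi> (b * c) * \<Phi> (l' (r (d * a)))" for a b c d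
  proof -
    let ?\<theta> = "\<lambda>c d. \<Phi> (b * c) * \<Phi> (d * r a) - \<Phi> (l b * c) * \<Phi> (d * a)"
    have "bounded_cbilinear ?\<theta>"
      by (intro bounded_cbilinear_diff bounded_cbilinear_Phi_mult(1))
        (intro bounded_clinear_mult_left bounded_clinear_mult_right bounded_clinear_ident)+
    moreover have "?\<theta> c d = 0" if "c * d = 0" for c d using step1[OF that] by simp
    ultimately have "?\<theta> (r' c) d = ?\<theta> c (l' d)" using 2 unfolding balanced_def by blast
    then show ?thesis by (simp add: m algebra_simps)
  qed
  \<comment> \<open>The identity is known for products \<open>b * c\<close> and
    \<open>d * a\<close>. Taking \<open>c = a = u j\<close> and passing to the limit gives it for
    arbitrary \<open>B\<close> and \<open>D\<close>.\<close>
  have lim: "((\<lambda>j. \<Phi> (f (z * u j))) \<longlongrightarrow> \<Phi> (f z)) U" if "bounded_clinear f" for f z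
    using that tendsto_u_right
    by (intro Phi.tendsto bounded_linear.tendsto[of f]) (auto simp: bounded_clinear_def)
  note bc = m(1-4) bounded_clinear_compose[OF m(4) m(1)] bounded_clinear_compose[OF m(3) m(2)] bounded_clinear_ident
  have "((\<lambda>j. \<Phi> (r' (B * u j)) * \<Phi> (r (D * u j)) + \<Phi> (l (B * u j)) * \<Phi> (l' (D * u j))) \<longlongrightarrow>
      \<Phi> (r' B) * \<Phi> (r D) + \<Phi> (l B) * \<Phi> (l' D)) U"
    by (intro tendsto_intros lim[OF bc(1)] lim[OF bc(2)] lim[OF bc(3)] lim[OF bc(4)])
  moreover have "((\<lambda>j. \<Phi> (r' (l (B * u j))) * \<Phi> (D * u j) + \<Phi> (B * u j) * \<Phi> (l' (r (D * u j)))) \<longlongrightarrow>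
      \<Phi> (r' (l B)) * \<Phi> D + \<Phi> B * \<Phi> (l' (r D))) U"
    by (intro tendsto_intros lim[OF bc(1)] lim[OF bc(5)] lim[OF bc(6)] lim[OF bounded_clinear_ident])
  ultimately show ?thesis
    unfolding step2 by (rule tendsto_unique[OF U_ne_bot])
qed

text \<open>Limits along a net are found by substituting the net for \<open>D\<close> or for
  \<open>B\<close> and solving for the one term in which the image of the net is a separate factor;
  in the other terms the net is multiplied inside the algebra and converges.\<close>

lemma Phi_mult_identity:
  "\<Phi> (B * y) * \<Phi> (D * x) + \<Phi> (x * B) * \<Phi> (y * D) = \<Phi> (x * B * y) * \<Phi> D + \<Phi> B * \<Phi> (y * D * x)"
  using Phi_mult_balanced[OF balanced_mult[of x] balanced_mult[of y], of B D] by (simp add: mult.assoc)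

text \<open>Bounded nets converging strictly to a double centralizer \<open>(l, r)\<close>:
  \<open>u\<close> approximates the identity, and its translates approximate the translation
  operators.\<close>

definition approximates :: "('j \<Rightarrow> 'a) \<Rightarrow> ('a \<Rightarrow> 'a) \<Rightarrow> ('a \<Rightarrow> 'a) \<Rightarrow> bool"
  where "approximates p l r \<longleftrightarrow> bounded (range p) \<and>
    (\<forall>a. ((\<lambda>j. p j * a) \<longlongrightarrow> l a) U \<and> ((\<lambda>j. a * p j) \<longlongrightarrow> r a) U)"

lemma approximates_left: "approximates p l r \<Longrightarrow> ((\<lambda>j. p j * a) \<longlongrightarrow> l a) U"
  and approximates_right: "approximates p l r \<Longrightarrow> ((\<lambda>j. a * p j) \<longlongrightarrow> r a) U"
  by (simp_all add: approximates_def)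

lemma approximates_Phi_bounded:
  assumes "approximates p l r"
  shows "\<exists>K. \<forall>j. norm (\<Phi> (p j)) \<le> K"
proof -
  have "bounded (\<Phi> ` range p)"
    using assms by (intro bounded_linear_image Phi.bounded_linear_axioms) (simp add: approximates_def)
  then show ?thesis by (auto simp: bounded_iff)
qed

lemma tendsto_Phi_right:
  assumes "approximates p l r"
  shows "((\<lambda>j. \<Phi> (x * B * y) * \<Phi> (p j)) \<longlongrightarrow>
    \<Phi> (B * y) * \<Phi> (l x) + \<Phi> (x * B) * \<Phi> (r y) - \<Phi> B * \<Phi> (y * l x)) U"
proof -
  have eq: "\<Phi> (x * B * y) * \<Phi> (p j) =
      \<Phi> (B * y) * \<Phi> (p j * x) + \<Phi> (x * B) * \<Phi> (y * p j) - \<Phi> B * \<Phi> (y * (p j * x))" for j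
    using Phi_mult_identity[of B y "p j" x] by (simp add: mult.assoc algebra_simps)
  show ?thesis unfolding eq
    by (intro tendsto_intros Phi.tendsto approximates_left[OF assms] approximates_right[OF assms])
qed

lemma tendsto_Phi_left:
  assumes "approximates p l r"
  shows "((\<lambda>j. \<Phi> (p j) * \<Phi> (y * D * x)) \<longlongrightarrow>
    \<Phi> (l y) * \<Phi> (D * x) + \<Phi> (r x) * \<Phi> (y * D) - \<Phi> (x * l y) * \<Phi> D) U"
proof -
  have eq: "\<Phi> (p j) * \<Phi> (y * D * x) =
      \<Phi> (p j * y) * \<Phi> (D * x) + \<Phi> (x * p j) * \<Phi> (y * D) - \<Phi> (x * (p j * y)) * \<Phi> D" for j
    using Phi_mult_identity[of "p j" y D x] by (simp add: mult.assoc algebra_simps)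
  show ?thesis unfolding eq
    by (intro tendsto_intros Phi.tendsto approximates_left[OF assms] approximates_right[OF assms])
qed

text \<open>Limits of \<open>b * \<Phi> (p j)\<close> and \<open>\<Phi> (p j) * b\<close> are
  computable when \<open>b\<close> is the image of a triple product. This density statement, with
  surjectivity of \<open>\<Phi>\<close>, carries them over to all \<open>b\<close>.\<close>

lemma tendsto_Phi_triple: "((\<lambda>j. \<Phi> (u j * z * u j)) \<longlongrightarrow> \<Phi> z) U"
proof (intro Phi.tendsto)
  obtain M where M: "0 < M" "\<And>j. norm (u j) \<le> M" using u_bounded by blast
  have "((\<lambda>j. u j * (z * u j - z)) \<longlongrightarrow> 0) U"
  proof (rule Lim_null_comparison)
    show "\<forall>\<^sub>F j in U. norm (u j * (z * u j - z)) \<le> M * norm (z * u j - z)"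
      using M by (intro always_eventually allI order_trans[OF norm_mult_ineq] mult_right_mono) auto
    have "((\<lambda>j. M * norm (z * u j - z)) \<longlongrightarrow> M * norm (z - z)) U"
      by (intro tendsto_intros tendsto_u_right)
    then show "((\<lambda>j. M * norm (z * u j - z)) \<longlongrightarrow> 0) U" by simp
  qed
  then have "((\<lambda>j. u j * (z * u j - z) + u j * z) \<longlongrightarrow> 0 + z) U"
    by (intro tendsto_add tendsto_u_left)
  then show "((\<lambda>j. u j * z * u j) \<longlongrightarrow> z) U" by (simp add: algebra_simps)
qed

lemma ex_Phi_preimage: "\<exists>z. b = \<Phi> z"
  using surj_Phi by (metis surjD)

lemma ex_right_limit:
  assumes "approximates p l r"
  shows "\<exists>v. ((\<lambda>j. b * \<Phi> (p j)) \<longlongrightarrow> v) U"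
proof -
  obtain K where K: "\<And>j. norm (\<Phi> (p j)) \<le> K" using approximates_Phi_bounded[OF assms] by blast
  obtain z where z: "b = \<Phi> z" using ex_Phi_preimage by blast
  show ?thesis unfolding z
  proof (rule net_limit_closed[where T="\<lambda>j b. b * \<Phi> (p j)" and K=K, OF _ _ tendsto_Phi_triple U_ne_bot U_ne_bot])
    show "norm (b * \<Phi> (p j)) \<le> K * norm b" for j b
      using K[of j] norm_mult_ineq[of b "\<Phi> (p j)"]
      by (metis mult.commute mult_left_mono norm_ge_zero order_trans)
    show "\<exists>v. ((\<lambda>j. \<Phi> (u i * z * u i) * \<Phi> (p j)) \<longlongrightarrow> v) U" for i
      using tendsto_Phi_right[OF assms] by blast
  qed (simp add: left_diff_distrib)
qed

lemma ex_left_limit: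
  assumes "approximates p l r"
  shows "\<exists>v. ((\<lambda>j. \<Phi> (p j) * b) \<longlongrightarrow> v) U"
proof -
  obtain K where K: "\<And>j. norm (\<Phi> (p j)) \<le> K" using approximates_Phi_bounded[OF assms] by blast
  obtain z where z: "b = \<Phi> z" using ex_Phi_preimage by blast
  show ?thesis unfolding z
  proof (rule net_limit_closed[where T="\<lambda>j b. \<Phi> (p j) * b" and K=K, OF _ _ tendsto_Phi_triple U_ne_bot U_ne_bot])
    show "norm (\<Phi> (p j) * b) \<le> K * norm b" for j b
      using K[of j] norm_mult_ineq[of "\<Phi> (p j)" b]
      by (meson mult_right_mono norm_ge_zero order_trans)
    show "\<exists>v. ((\<lambda>j. \<Phi> (p j) * \<Phi> (u i * z * u i)) \<longlongrightarrow> v) U" for i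
      using tendsto_Phi_left[OF assms] by blast
  qed (simp add: right_diff_distrib)
qed

text \<open>With \<open>l = r = 0\<close> the limits in \<open>tendsto_Phi_right\<close> and
  \<open>tendsto_Phi_left\<close> are \<open>0\<close> on triple products, hence everywhere by
  \<open>net_limit_zero_closed\<close>.\<close>

lemma null_limits:
  assumes "approximates p (\<lambda>_. 0) (\<lambda>_. 0)"
  shows "((\<lambda>j. b * \<Phi> (p j)) \<longlongrightarrow> 0) U" "((\<lambda>j. \<Phi> (p j) * b) \<longlongrightarrow> 0) U"
proof -
  obtain K where K: "\<And>j. norm (\<Phi> (p j)) \<le> K" using approximates_Phi_bounded[OF assms] by blast
  obtain z where z: "b = \<Phi> z" using ex_Phi_preimage by blast
  show "((\<lambda>j. b * \<Phi> (p j)) \<longlongrightarrow> 0) U" unfolding z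
  proof (rule net_limit_zero_closed[where T="\<lambda>j b. b * \<Phi> (p j)" and K=K, OF _ _ tendsto_Phi_triple U_ne_bot])
    show "norm (b * \<Phi> (p j)) \<le> K * norm b" for j b
      using K[of j] norm_mult_ineq[of b "\<Phi> (p j)"]
      by (metis mult.commute mult_left_mono norm_ge_zero order_trans)
    show "((\<lambda>j. \<Phi> (u i * z * u i) * \<Phi> (p j)) \<longlongrightarrow> 0) U" for i
      using tendsto_Phi_right[OF assms, of "u i" z "u i"] by (simp add: Phi.zero)
  qed (simp add: left_diff_distrib)
  show "((\<lambda>j. \<Phi> (p j) * b) \<longlongrightarrow> 0) U" unfolding z
  proof (rule net_limit_zero_closed[where T="\<lambda>j b. \<Phi> (p j) * b" and K=K, OF _ _ tendsto_Phi_triple U_ne_bot])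
    show "norm (\<Phi> (p j) * b) \<le> K * norm b" for j b
      using K[of j] norm_mult_ineq[of "\<Phi> (p j)" b]
      by (meson mult_right_mono norm_ge_zero order_trans)
    show "((\<lambda>j. \<Phi> (p j) * \<Phi> (u i * z * u i)) \<longlongrightarrow> 0) U" for i
      using tendsto_Phi_left[OF assms, of "u i" z "u i"] by (simp add: Phi.zero)
  qed (simp add: right_diff_distrib)
qed

lemma approximates_diff:
  assumes "approximates p l r" "approximates q l r"
  shows "approximates (\<lambda>j. p j - q j) (\<lambda>_. 0) (\<lambda>_. 0)"
  unfolding approximates_def
proof (intro conjI allI)
  obtain P Q where "\<And>j. norm (p j) \<le> P" "\<And>j. norm (q j) \<le> Q"
    using assms by (auto simp: approximates_def bounded_iff)
  then have "norm (p j - q j) \<le> P + Q" for j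
    by (meson add_mono norm_triangle_ineq4 order_trans)
  then show "bounded (range (\<lambda>j. p j - q j))" by (auto simp: bounded_iff)
  fix a
  show "((\<lambda>j. (p j - q j) * a) \<longlongrightarrow> 0) U"
    using tendsto_diff[OF approximates_left[OF assms(1), of a] approximates_left[OF assms(2), of a]]
    by (simp add: left_diff_distrib)
  show "((\<lambda>j. a * (p j - q j)) \<longlongrightarrow> 0) U"
    using tendsto_diff[OF approximates_right[OF assms(1), of a] approximates_right[OF assms(2), of a]]
    by (simp add: right_diff_distrib)
qed

text \<open>One-sided limits depend only on the double centralizer that a net approximates, not on
  the net. \<open>limits_commute\<close> uses this to replace \<open>u\<close> by its conjugates
  under the group.\<close>

lemma same_limits:
  assumes "approximates p l r" "approximates q l r"
  shows "((\<lambda>j. b * \<Phi> (p j)) \<longlongrightarrow> v) U \<Longrightarrow> ((\<lambda>j. b * \<Phi> (q j)) \<longlongrightarrow> v) U"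
    and "((\<lambda>j. \<Phi> (p j) * b) \<longlongrightarrow> v) U \<Longrightarrow> ((\<lambda>j. \<Phi> (q j) * b) \<longlongrightarrow> v) U"
proof -
  note n = null_limits[OF approximates_diff[OF assms(2,1)], of b]
  show "((\<lambda>j. b * \<Phi> (q j)) \<longlongrightarrow> v) U" if "((\<lambda>j. b * \<Phi> (p j)) \<longlongrightarrow> v) U"
    using tendsto_add[OF n(1) that] by (simp add: Phi.diff right_diff_distrib)
  show "((\<lambda>j. \<Phi> (q j) * b) \<longlongrightarrow> v) U" if "((\<lambda>j. \<Phi> (p j) * b) \<longlongrightarrow> v) U"
    using tendsto_add[OF n(2) that] by (simp add: Phi.diff left_diff_distrib)
qed

lemma approximates_u: "approximates u (\<lambda>a. a) (\<lambda>a. a)"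
  using bai by (simp add: approximates_def bounded_approximate_identity_def)

text \<open>One translation is moved across the product: \<open>R t (u j) * a = u j * L t a\<close>.
  For \<open>s = - t\<close> it follows that the conjugated net is again an approximate
  identity.\<close>

lemma approximates_LR: "approximates (\<lambda>j. L s (R t (u j))) (L (s + t)) (R (s + t))"
  unfolding approximates_def
proof (intro conjI allI)
  obtain M where M: "0 < M" "\<And>j. norm (u j) \<le> M" using u_bounded by blast
  have "norm (L s (R t (u j))) \<le> M" for j by (meson M(2) norm_L norm_R order_trans)
  then show "bounded (range (\<lambda>j. L s (R t (u j))))" by (auto simp: bounded_iff)
  fix a
  have "((\<lambda>j. L s (u j * L t a)) \<longlongrightarrow> L s (L t a)) U"
    using bounded_clinear_L by (intro bounded_linear.tendsto[of "L s"] tendsto_u_left bounded_clinear_imp_bounded_linear)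
  then show "((\<lambda>j. L s (R t (u j)) * a) \<longlongrightarrow> L (s + t) a) U"
    by (simp only: L_mult[symmetric] LR_mult L_L)
  have "((\<lambda>j. R t (R s a * u j)) \<longlongrightarrow> R t (R s a)) U"
    using bounded_clinear_R by (intro bounded_linear.tendsto[of "R t"] tendsto_u_right bounded_clinear_imp_bounded_linear)
  then show "((\<lambda>j. a * L s (R t (u j))) \<longlongrightarrow> R (s + t) a) U"
    by (simp only: LR_mult[symmetric] R_mult[symmetric] R_R)
qed

lemma approximates_L: "approximates (\<lambda>j. L s (u j)) (L s) (R s)"
  using approximates_LR[of s 0] by (simp add: R_0)

definition left_limit :: "('j \<Rightarrow> 'a) \<Rightarrow> 'b \<Rightarrow> 'b"
  where "left_limit p b = Lim U (\<lambda>j. \<Phi> (p j) * b)"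

definition right_limit :: "('j \<Rightarrow> 'a) \<Rightarrow> 'b \<Rightarrow> 'b"
  where "right_limit p b = Lim U (\<lambda>j. b * \<Phi> (p j))"

lemma tendsto_left_limit: "approximates p l r \<Longrightarrow> ((\<lambda>j. \<Phi> (p j) * b) \<longlongrightarrow> left_limit p b) U"
  using ex_left_limit[of p l r b] tendsto_Lim[OF U_ne_bot] unfolding left_limit_def by blast

lemma tendsto_right_limit: "approximates p l r \<Longrightarrow> ((\<lambda>j. b * \<Phi> (p j)) \<longlongrightarrow> right_limit p b) U"
  using ex_right_limit[of p l r b] tendsto_Lim[OF U_ne_bot] unfolding right_limit_def by blast

lemma right_left_limit:
  assumes "approximates p l r"
  shows "right_limit p c * d = c * left_limit p d"
proof (rule tendsto_unique[OF U_ne_bot])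
  show "((\<lambda>j. c * \<Phi> (p j) * d) \<longlongrightarrow> right_limit p c * d) U"
    by (intro tendsto_intros tendsto_right_limit[OF assms])
  show "((\<lambda>j. c * \<Phi> (p j) * d) \<longlongrightarrow> c * left_limit p d) U"
    unfolding mult.assoc by (intro tendsto_intros tendsto_left_limit[OF assms])
qed

text \<open>Measures how far \<open>\<Phi>\<close> is from passing a translation across a product of
  two values. It may be nonzero, because \<open>\<Phi> a * \<Phi> b\<close> is only known to vanish
  when both \<open>a * b\<close> and \<open>b * a\<close> do.\<close>

definition defect :: "'g \<Rightarrow> 'a \<Rightarrow> 'a \<Rightarrow> 'b"
  where "defect t B D = \<Phi> B * \<Phi> (L t D) - \<Phi> (R t B) * \<Phi> D"

text \<open>The four-term identity for the translations by \<open>s\<close> and \<open>t\<close>,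
  regrouped.\<close>

lemma defect_shift: "defect t (L s B) D = defect t B (R s D)"
  using Phi_mult_balanced[OF balanced_LR[of s] balanced_LR[of t], of B D]
  by (simp add: defect_def algebra_simps)

text \<open>A cocycle identity in the translation; iterated along a cyclic group it gives a
  telescoping sum.\<close>

lemma defect_add: "defect (s + t) B D = defect s B (L t D) + defect t (R s B) D"
  by (simp add: defect_def L_L R_R)

text \<open>The cocycle identity splits the defect of the \<open>n\<close>-th power into
  \<open>n\<close> defects of \<open>h 1\<close>. The factor \<open>R (h (1 - int n))\<close> is put
  on \<open>D\<close> in advance so that, after \<open>defect_shift\<close> by
  \<open>h (- int i)\<close>, both arguments carry a conjugation of the form
  \<open>L (h (- k)) (R (h k) _)\<close>, under which an approximate identity remains one.\<close>

lemma defect_telescope: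
  fixes h :: "int \<Rightarrow> 'g"
  assumes h0: "h 0 = 0" and h_add: "\<And>m n. h (m + n) = h m + h n"
  shows "defect (h (int n)) B (R (h (1 - int n)) D) = (\<Sum>i<n. defect (h 1)
    (L (h (- int i)) (R (h (int i)) B)) (L (h (int n - 1 - int i)) (R (h (1 - int n + int i)) D)))"
proof -
  have "defect (h (int n)) B D = (\<Sum>i<n. defect (h 1) (R (h (int i)) B) (L (h (int n - 1 - int i)) D))" for D
  proof (induction n arbitrary: D)
    case 0
    then show ?case by (simp add: h0 defect_def L_0 R_0)
  next
    case (Suc n)
    have "defect (h (int (Suc n))) B D = defect (h (int n) + h 1) B D"
      by (simp flip: h_add add: add.commute)
    also have "\<dots> = defect (h (int n)) B (L (h 1) D) + defect (h 1) (R (h (int n)) B) D"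
      by (rule defect_add)
    also have "defect (h (int n)) B (L (h 1) D) =
       (\<Sum>i<n. defect (h 1) (R (h (int i)) B) (L (h (int (Suc n) - 1 - int i)) D))"
      unfolding Suc by (simp add: L_L flip: h_add)
    finally show ?case by (simp add: h0 L_0)
  qed
  moreover have "defect (h 1) (R (h (int i)) B) (L (h (int n - 1 - int i)) (R (h (1 - int n)) D)) =
     defect (h 1) (L (h (- int i)) (R (h (int i)) B)) (L (h (int n - 1 - int i)) (R (h (1 - int n + int i)) D))" for i
  proof -
    have "R (h (1 - int n)) D = R (h (- int i)) (R (h (1 - int n + int i)) D)"
      by (simp add: R_R flip: h_add)
    then show ?thesis by (simp only: L_R[of _ "h (- int i)"] defect_shift[of _ "h (- int i)"])
  qed
  ultimately show ?thesis by simp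
qed

text \<open>The telescoping sum of \<open>n\<close> terms, each of which tends to the difference \<open>X\<close> of the two sides, is
  bounded independently of \<open>n\<close>, so \<open>X = 0\<close>.\<close>

lemma limits_commute:
  "right_limit u c * left_limit (\<lambda>j. L s (u j)) d = right_limit (\<lambda>j. L s (u j)) c * left_limit u d"
proof -
  obtain h :: "int \<Rightarrow> 'g" where h: "h 1 = s" "h 0 = 0" "\<forall>m n. h (m + n) = h m + h n"
    using exists_int_hom[of s] by (elim exE conjE)
  then have h_add: "h (m + n) = h m + h n" for m n by simp
  obtain M where M: "0 < M" "\<And>j. norm (u j) \<le> M" using u_bounded by blast
  obtain K where K: "0 < K" "\<And>a. norm (\<Phi> a) \<le> norm a * K" using Phi.pos_bounded by blast
  define X where "X = right_limit u c * left_limit (\<lambda>j. L s (u j)) d - right_limit (\<lambda>j. L s (u j)) c * left_limit u d"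
  have id: "L 0 = (\<lambda>a. a)" "R 0 = (\<lambda>a. a)" by (simp_all add: fun_eq_iff L_0 R_0)
  \<comment> \<open>Every summand has the same limit \<open>X\<close>, whatever the exponents, since
    conjugates of \<open>u\<close> have the same one-sided limits as \<open>u\<close>.\<close>
  have lims: "((\<lambda>j. c * defect s (L (h (- m)) (R (h m) (u j))) (L (h k) (R (h (- k)) (u j))) * d) \<longlongrightarrow> X) U" for m k
  proof -
    have a: "approximates (\<lambda>j. L (h (- m)) (R (h m) (u j))) (\<lambda>a. a) (\<lambda>a. a)" for m
      using approximates_LR[of "h (- m)" "h m"] h(2) id by (simp flip: h_add)
    have b: "approximates (\<lambda>j. L s (L (h k) (R (h (- k)) (u j)))) (L s) (R s)"
    proof -
      have "s + h k + h (- k) = s" using h_add[of k "- k"] h(2) by (simp add: add.assoc)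
      then show ?thesis using approximates_LR[of "s + h k" "h (- k)"] by (simp add: L_L)
    qed
    have c: "approximates (\<lambda>j. R s (L (h (- m)) (R (h m) (u j)))) (L s) (R s)"
    proof -
      have "h (- m) + (h m + s) = s" using h_add[of "- m" m] h(2) by (simp flip: add.assoc)
      then show ?thesis using approximates_LR[of "h (- m)" "h m + s"] by (simp add: R_R flip: L_R)
    qed
    have "((\<lambda>j. (c * \<Phi> (L (h (- m)) (R (h m) (u j)))) * (\<Phi> (L s (L (h k) (R (h (- k)) (u j)))) * d)
       - (c * \<Phi> (R s (L (h (- m)) (R (h m) (u j))))) * (\<Phi> (L (h k) (R (h (- k)) (u j))) * d)) \<longlongrightarrow> X) U"
      unfolding X_def
    proof (intro tendsto_diff tendsto_mult)
      show "((\<lambda>j. c * \<Phi> (L (h (- m)) (R (h m) (u j)))) \<longlongrightarrow> right_limit u c) U"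
        by (rule same_limits(1)[OF approximates_u a tendsto_right_limit[OF approximates_u]])
      show "((\<lambda>j. \<Phi> (L (h k) (R (h (- k)) (u j))) * d) \<longlongrightarrow> left_limit u d) U"
        using same_limits(2)[OF approximates_u a[of "- k"] tendsto_left_limit[OF approximates_u]] by simp
      show "((\<lambda>j. \<Phi> (L s (L (h k) (R (h (- k)) (u j)))) * d) \<longlongrightarrow> left_limit (\<lambda>j. L s (u j)) d) U"
        by (rule same_limits(2)[OF approximates_L b tendsto_left_limit[OF approximates_L]])
      show "((\<lambda>j. c * \<Phi> (R s (L (h (- m)) (R (h m) (u j))))) \<longlongrightarrow> right_limit (\<lambda>j. L s (u j)) c) U"
        by (rule same_limits(1)[OF approximates_L c tendsto_right_limit[OF approximates_L]])
    qed
    then show ?thesis by (simp add: defect_def algebra_simps)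
  qed
  \<comment> \<open>The telescoped side is a difference of two products of values of
    \<open>\<Phi>\<close> at translates of \<open>u j\<close>; translations do not increase norms,
    so \<open>n\<close> does not enter the bound.\<close>
  define C where "C = norm c * (2 * (M * K) * (M * K)) * norm d"
  have bound: "norm (real n *\<^sub>R X) \<le> C" for n
  proof (rule tendsto_upperbound[OF tendsto_norm _ U_ne_bot])
    have "((\<lambda>j. \<Sum>i<n. c * defect s (L (h (- int i)) (R (h (int i)) (u j)))
        (L (h (int n - 1 - int i)) (R (h (- (int n - 1 - int i))) (u j))) * d) \<longlongrightarrow> (\<Sum>i<n. X)) U"
      by (intro tendsto_sum lims)
    moreover have "(\<Sum>i<n. c * defect s (L (h (- int i)) (R (h (int i)) (u j)))
        (L (h (int n - 1 - int i)) (R (h (- (int n - 1 - int i))) (u j))) * d) =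
      c * defect (h (int n)) (u j) (R (h (1 - int n)) (u j)) * d" for j
      unfolding defect_telescope[OF h(2) h_add] h(1)
      by (simp add: sum_distrib_left sum_distrib_right algebra_simps)
    ultimately show "((\<lambda>j. c * defect (h (int n)) (u j) (R (h (1 - int n)) (u j)) * d) \<longlongrightarrow> real n *\<^sub>R X) U"
      by (simp add: sum_constant_scaleR)
    have n1: "norm (\<Phi> (L t (u j))) \<le> M * K" "norm (\<Phi> (R t (u j))) \<le> M * K" "norm (\<Phi> (u j)) \<le> M * K"
      "norm (\<Phi> (L t (R t' (u j)))) \<le> M * K" for t t' j
      using K M norm_L norm_R by (meson less_imp_le mult_right_mono order_trans)+
    have "norm (defect t (u j) (R t' (u j))) \<le> 2 * (M * K) * (M * K)" for t t' j
    proof -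
      have "norm (defect t (u j) (R t' (u j))) \<le> norm (\<Phi> (u j) * \<Phi> (L t (R t' (u j)))) + norm (\<Phi> (R t (u j)) * \<Phi> (R t' (u j)))"
        unfolding defect_def by (rule norm_triangle_ineq4)
      also have "\<dots> \<le> (M * K) * (M * K) + (M * K) * (M * K)"
        using M K n1 by (intro add_mono order_trans[OF norm_mult_ineq] mult_mono) auto
      finally show ?thesis by (simp add: mult_ac)
    qed
    then have "norm (c * defect (h (int n)) (u j) (R (h (1 - int n)) (u j)) * d) \<le> C" for j
      unfolding C_def by (intro order_trans[OF norm_mult_ineq] mult_right_mono mult_left_mono) auto
    then show "\<forall>\<^sub>F j in U. norm (c * defect (h (int n)) (u j) (R (h (1 - int n)) (u j)) * d) \<le> C"
      by (intro always_eventually allI)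
  qed
  have "X = 0"
  proof (rule ccontr)
    assume "X \<noteq> 0"
    then obtain n where "C < real n * norm X"
      using reals_Archimedean3[of "norm X"] by auto
    then show False using bound[of n] by simp
  qed
  then show ?thesis by (simp add: X_def)
qed

end

text \<open>The Baire category half of the open mapping theorem: the closure of the image of some
  ball has interior, which is moved to the origin and rescaled. Approximate preimages with norm
  control are what \<open>W_bounded_below\<close> asks for.\<close>

lemma surj_approximate_preimage:
  fixes f :: "'a::real_normed_vector \<Rightarrow> 'b::banach"
  assumes f: "bounded_linear f" and "surj f"
  shows "\<exists>K>0. \<forall>b \<epsilon>. 0 < \<epsilon> \<longrightarrow> (\<exists>a. norm a \<le> K * norm b \<and> norm (f a - b) < \<epsilon>)"
proof -
  interpret bounded_linear f by (rule f)
  define T where "T n = closure (f ` cball 0 (real n))" for n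
  have "\<exists>n. interior (T n) \<noteq> {}"
  proof (rule ccontr)
    assume "\<not> ?thesis"
    then have "Met_TC.mtopology interior_of \<Union> (range T) = {}"
      by (intro Met_TC.metric_Baire_category_alt) (auto simp: complete_UNIV T_def)
    moreover have "\<Union> (range T) = UNIV"
    proof -
      have "b \<in> \<Union> (range T)" for b
      proof -
        obtain a where "b = f a" using \<open>surj f\<close> by (metis surjD)
        moreover obtain n where "norm a \<le> real n" using real_arch_simple by blast
        ultimately have "b \<in> T n" unfolding T_def using closure_subset by fastforce
        then show ?thesis by blast
      qed
      then show ?thesis by blast
    qed
    ultimately show False by simp
  qed
  then obtain n x0 r where r: "r > 0" "ball x0 r \<subseteq> T n"
    by (metis all_not_in_conv mem_interior)
  have small: "\<exists>a. norm a \<le> real n \<and> norm (f a - y) < \<epsilon>" if "norm y < r" "\<epsilon> > 0" for y \<epsilon>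
  proof -
    have near: "\<exists>a. norm a \<le> real n \<and> dist (f a) v < \<epsilon>" if "v \<in> T n" for v
      using that \<open>\<epsilon> > 0\<close> unfolding T_def closure_approachable by (auto dest!: spec[of _ \<epsilon>])
    have "x0 + y \<in> T n" "x0 - y \<in> T n" using r that by (auto simp: dist_norm)
    then obtain a1 a2 where a: "norm a1 \<le> real n" "dist (f a1) (x0 + y) < \<epsilon>" "norm a2 \<le> real n" "dist (f a2) (x0 - y) < \<epsilon>"
      using near by meson
    define p q where "p = f a1 - (x0 + y)" and "q = f a2 - (x0 - y)"
    \<comment> \<open>Half the difference of approximate preimages of \<open>x0 + y\<close> and
      \<open>x0 - y\<close> is one of \<open>y\<close>; this removes the unknown centre
      \<open>x0\<close>.\<close>
    have "(1/2) *\<^sub>R (p - q) = (1/2) *\<^sub>R ((f a1 - f a2) - 2 *\<^sub>R y)"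
      by (simp add: p_def q_def scaleR_2 algebra_simps)
    then have "f ((1/2) *\<^sub>R (a1 - a2)) - y = (1/2) *\<^sub>R (p - q)"
      by (simp only: scaleR diff scaleR_diff_right) simp
    also have "norm \<dots> \<le> (1/2) * (norm p + norm q)"
      using norm_triangle_ineq4[of p q] by simp
    also have "\<dots> < \<epsilon>" using a by (simp add: p_def q_def dist_norm)
    finally have "norm (f ((1/2) *\<^sub>R (a1 - a2)) - y) < \<epsilon>" .
    moreover have "norm ((1/2) *\<^sub>R (a1 - a2)) \<le> real n"
      using a norm_triangle_ineq4[of a1 a2] by simp
    ultimately show ?thesis by blast
  qed
  \<comment> \<open>\<open>b\<close> is rescaled to norm \<open>r / 2\<close>, inside the ball of
    radius \<open>r\<close>; \<open>n + 1\<close> instead of \<open>n\<close> keeps \<open>K\<close>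
    positive when \<open>n = 0\<close>.\<close>
  define K where "K = 2 * (real n + 1) / r"
  have "\<exists>a. norm a \<le> K * norm b \<and> norm (f a - b) < \<epsilon>" if "\<epsilon> > 0" for b \<epsilon>
  proof (cases "b = 0")
    case True
    then show ?thesis using \<open>\<epsilon> > 0\<close> by (intro exI[of _ 0]) (simp add: zero)
  next
    case False
    define s where "s = r / (2 * norm b)"
    have s: "s > 0" using False r by (simp add: s_def)
    have "norm (s *\<^sub>R b) < r" using False r by (simp add: s_def)
    from small[OF this, of "s * \<epsilon>"] s \<open>\<epsilon> > 0\<close> obtain a where a: "norm a \<le> real n" "norm (f a - s *\<^sub>R b) < s * \<epsilon>" by auto
    have "f ((1/s) *\<^sub>R a) - b = (1/s) *\<^sub>R (f a - s *\<^sub>R b)"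
      using s by (simp add: scaleR scaleR_diff_right)
    then have "norm (f ((1/s) *\<^sub>R a) - b) = norm (f a - s *\<^sub>R b) / s"
      using s by (simp only: norm_scaleR) simp
    then have "norm (f ((1/s) *\<^sub>R a) - b) < \<epsilon>"
      using a(2) s by (simp add: divide_less_eq mult.commute)
    moreover have "norm ((1/s) *\<^sub>R a) \<le> K * norm b"
    proof -
      have "norm ((1/s) *\<^sub>R a) = norm a * (2 * norm b / r)" using s r by (simp add: s_def)
      also have "\<dots> \<le> (real n + 1) * (2 * norm b / r)" using a r by (intro mult_right_mono) auto
      also have "\<dots> = K * norm b" by (simp add: K_def)
      finally show ?thesis .
    qed
    ultimately show ?thesis by blast
  qed
  moreover have "K > 0" using r by (simp add: K_def)
  ultimately show ?thesis by blast
qed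

section \<open>The centralizer \<open>W\<close> and its inverse\<close>

context zero_product_preserver
begin

lemma F_ne_bot: "F \<noteq> bot"
  and tendsto_e_left: "((\<lambda>i. e i * b) \<longlongrightarrow> b) F" and tendsto_e_right: "((\<lambda>i. b * e i) \<longlongrightarrow> b) F"
  using bai_target by (auto simp: bounded_approximate_identity_def)

lemma right_cancel: "(\<And>d. a * d = b * d) \<Longrightarrow> a = b" for a b :: 'b
proof (rule tendsto_unique[OF F_ne_bot tendsto_e_right])
  show "((\<lambda>i. a * e i) \<longlongrightarrow> b) F" if "\<And>d. a * d = b * d"
    unfolding that by (rule tendsto_e_right)
qed

lemma left_cancel: "(\<And>c. c * a = c * b) \<Longrightarrow> a = b" for a b :: 'b
proof (rule tendsto_unique[OF F_ne_bot tendsto_e_left])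
  show "((\<lambda>i. e i * a) \<longlongrightarrow> b) F" if "\<And>c. c * a = c * b"
    unfolding that by (rule tendsto_e_left)
qed

text \<open>For images of triple products the limits along \<open>L t (u j)\<close> are explicit and
  linear in \<open>L t\<close> and \<open>R t\<close>. So \<open>limits_commute\<close> is an
  equation of the kind handled by \<open>approx_functional\<close>, which replaces the translation
  by multiplication with \<open>z\<close>; \<open>Phi_mult_identity\<close> then collects the terms
  into products with \<open>\<Phi> z\<close>.\<close>

lemma limits_commute_Phi:
  "right_limit u (\<Phi> (x * B * y)) * \<Phi> z * \<Phi> (y' * D * x') = \<Phi> (x * B * y) * \<Phi> z * left_limit u (\<Phi> (y' * D * x'))"
proof -
  define V where "V = right_limit u (\<Phi> (x * B * y))"
  define W where "W = left_limit u (\<Phi> (y' * D * x'))"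
  define p1 where "p1 v = V * (\<Phi> v * \<Phi> (D * x') - \<Phi> (x' * v) * \<Phi> D)" for v
  define p2 where "p2 v = - ((\<Phi> (B * y) * \<Phi> v - \<Phi> B * \<Phi> (y * v)) * W)" for v
  define q1 where "q1 v = V * (\<Phi> v * \<Phi> (y' * D))" for v
  define q2 where "q2 v = - ((\<Phi> (x * B) * \<Phi> v) * W)" for v
  have m: "bounded_clinear (\<lambda>v. \<Phi> (a * v))" for a
    by (rule bounded_clinear_compose[OF bounded_clinear_Phi bounded_clinear_mult_right[OF bounded_clinear_ident]])
  have "p1 (z * y') + p2 (z * x) + q1 (x' * z) + q2 (y * z) = 0"
  proof (rule approx_functional)
    show "bounded_clinear p1" unfolding p1_def[abs_def]
      by (rule bounded_clinear_mult_right[OF bounded_clinear_diff[OF bounded_clinear_mult_left[OF bounded_clinear_Phi]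
              bounded_clinear_mult_left[OF m]]])
    show "bounded_clinear p2" unfolding p2_def[abs_def]
      by (rule bounded_clinear_minus[OF bounded_clinear_mult_left[OF bounded_clinear_diff[OF bounded_clinear_mult_right[OF bounded_clinear_Phi]
              bounded_clinear_mult_right[OF m]]]])
    show "bounded_clinear q1" unfolding q1_def[abs_def]
      by (rule bounded_clinear_mult_right[OF bounded_clinear_mult_left[OF bounded_clinear_Phi]])
    show "bounded_clinear q2" unfolding q2_def[abs_def]
      by (rule bounded_clinear_minus[OF bounded_clinear_mult_left[OF bounded_clinear_mult_right[OF bounded_clinear_Phi]]])
    fix t
    have l: "left_limit (\<lambda>j. L t (u j)) (\<Phi> (y' * D * x')) =
       \<Phi> (L t y') * \<Phi> (D * x') + \<Phi> (R t x') * \<Phi> (y' * D) - \<Phi> (x' * L t y') * \<Phi> D"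
      by (rule tendsto_unique[OF U_ne_bot tendsto_left_limit[OF approximates_L] tendsto_Phi_left[OF approximates_L]])
    have r: "right_limit (\<lambda>j. L t (u j)) (\<Phi> (x * B * y)) =
       \<Phi> (B * y) * \<Phi> (L t x) + \<Phi> (x * B) * \<Phi> (R t y) - \<Phi> B * \<Phi> (y * L t x)"
      by (rule tendsto_unique[OF U_ne_bot tendsto_right_limit[OF approximates_L] tendsto_Phi_right[OF approximates_L]])
    show "p1 (L t y') + p2 (L t x) + q1 (R t x') + q2 (R t y) = 0"
      using limits_commute[of "\<Phi> (x * B * y)" t "\<Phi> (y' * D * x')"]
      unfolding l r p1_def p2_def q1_def q2_def V_def W_def by (simp add: algebra_simps)
  qed
  moreover have "\<Phi> z * \<Phi> (y' * D * x') = \<Phi> (z * y') * \<Phi> (D * x') + \<Phi> (x' * z) * \<Phi> (y' * D) - \<Phi> (x' * (z * y')) * \<Phi> D"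
    using Phi_mult_identity[of z y' D x'] by (simp add: mult.assoc algebra_simps)
  moreover have "\<Phi> (x * B * y) * \<Phi> z = \<Phi> (B * y) * \<Phi> (z * x) + \<Phi> (x * B) * \<Phi> (y * z) - \<Phi> B * \<Phi> (y * (z * x))"
    using Phi_mult_identity[of B y z x] by (simp add: mult.assoc algebra_simps)
  ultimately show ?thesis
    unfolding V_def[symmetric] W_def[symmetric] mult.assoc[of V] p1_def p2_def q1_def q2_def
    by (simp only:) (simp add: algebra_simps)
qed

definition W :: "'b \<Rightarrow> 'b" where "W = left_limit u"

lemma tendsto_W: "((\<lambda>j. \<Phi> (u j) * b) \<longlongrightarrow> W b) U"
  unfolding W_def by (rule tendsto_left_limit[OF approximates_u])

lemma W_mult_right: "W (b * d) = W b * d"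
proof (rule tendsto_unique[OF U_ne_bot tendsto_W])
  show "((\<lambda>j. \<Phi> (u j) * (b * d)) \<longlongrightarrow> W b * d) U"
    unfolding mult.assoc[symmetric] by (intro tendsto_intros tendsto_W)
qed

lemma right_limit_mult: "right_limit u c * d = c * W d"
  unfolding W_def by (rule right_left_limit[OF approximates_u])

text \<open>\<open>limits_commute_Phi\<close> gives \<open>c * W b * d = c * b * W d\<close> when
  \<open>c\<close> and \<open>d\<close> are images of triple products. First \<open>c\<close>, then
  \<open>d\<close>, is freed by approximation with \<open>u j * _ * u j\<close>, and finally
  \<open>c\<close> is cancelled.\<close>

lemma W_mult_left: "b * W d = W b * d"
proof -
  obtain z where z: "b = \<Phi> z" using ex_Phi_preimage by blast
  have 1: "c * W b * \<Phi> (y' * D * x') = c * b * W (\<Phi> (y' * D * x'))" for c y' D x'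
  proof -
    obtain c' where c': "c = \<Phi> c'" using ex_Phi_preimage by blast
    have eq: "\<Phi> (u j * c' * u j) * W b * \<Phi> (y' * D * x') = \<Phi> (u j * c' * u j) * b * W (\<Phi> (y' * D * x'))" for j
      using limits_commute_Phi[of "u j" c' "u j" z y' D x'] by (simp add: z W_def right_limit_mult[unfolded W_def])
    show ?thesis
    proof (rule tendsto_unique[OF U_ne_bot])
      show "((\<lambda>j. \<Phi> (u j * c' * u j) * W b * \<Phi> (y' * D * x')) \<longlongrightarrow> c * W b * \<Phi> (y' * D * x')) U"
        unfolding c' by (intro tendsto_intros tendsto_Phi_triple)
      show "((\<lambda>j. \<Phi> (u j * c' * u j) * W b * \<Phi> (y' * D * x')) \<longlongrightarrow> c * b * W (\<Phi> (y' * D * x'))) U"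
        unfolding eq unfolding c' by (intro tendsto_intros tendsto_Phi_triple)
    qed
  qed
  \<comment> \<open>Continuity of \<open>W\<close> is not yet available, but
    \<open>c * b * W d\<close> equals \<open>right_limit u (c * b) * d\<close>, which is visibly
    continuous in \<open>d\<close>.\<close>
  have "c * W b * d = right_limit u (c * b) * d" for c
  proof -
    obtain d' where d': "d = \<Phi> d'" using ex_Phi_preimage by blast
    have eq: "c * W b * \<Phi> (u j * d' * u j) = right_limit u (c * b) * \<Phi> (u j * d' * u j)" for j
      using 1 by (simp add: right_limit_mult)
    show ?thesis
    proof (rule tendsto_unique[OF U_ne_bot])
      show "((\<lambda>j. c * W b * \<Phi> (u j * d' * u j)) \<longlongrightarrow> c * W b * d) U"
        unfolding d' by (intro tendsto_intros tendsto_Phi_triple)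
      show "((\<lambda>j. c * W b * \<Phi> (u j * d' * u j)) \<longlongrightarrow> right_limit u (c * b) * d) U"
        unfolding eq unfolding d' by (intro tendsto_intros tendsto_Phi_triple)
    qed
  qed
  then have "c * (b * W d) = c * (W b * d)" for c by (simp add: right_limit_mult mult.assoc)
  then show ?thesis by (rule left_cancel)
qed

lemma right_limit_eq_W: "right_limit u c = W c"
  by (rule right_cancel) (simp add: right_limit_mult W_mult_left)

lemma bounded_clinear_W: "bounded_clinear W"
proof -
  obtain K where K: "\<And>j. norm (\<Phi> (u j)) \<le> K" using approximates_Phi_bounded[OF approximates_u] by blast
  show ?thesis
  proof (intro bounded_clinearI bounded_linear_intro)
    show "W (x + y) = W x + W y" for x y
      by (rule tendsto_unique[OF U_ne_bot tendsto_W]) (unfold distrib_left, intro tendsto_intros tendsto_W)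
    show c: "W (c *\<^sub>C x) = c *\<^sub>C W x" for c x
      by (rule tendsto_unique[OF U_ne_bot tendsto_W])
        (unfold mult_scaleC_right, intro bounded_linear.tendsto[OF bounded_linear_scaleC_right] tendsto_W)
    show "W (r *\<^sub>R x) = r *\<^sub>R W x" for r x by (simp add: scaleR_scaleC c)
    show "norm (W x) \<le> norm x * K" for x
    proof (rule tendsto_upperbound[OF tendsto_norm[OF tendsto_W] _ U_ne_bot])
      have "norm (\<Phi> (u j) * x) \<le> norm x * K" for j
        using K[of j] norm_mult_ineq[of "\<Phi> (u j)" x]
        by (metis mult.commute mult_left_mono norm_ge_zero order_trans)
      then show "\<forall>\<^sub>F j in U. norm (\<Phi> (u j) * x) \<le> norm x * K" by simp
    qed
  qed
qed

lemma centralizer_W: "centralizer W"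
  using bounded_clinear_W
  by (auto simp: centralizer_def clinear_iff bounded_clinear_def linear_add bounded_linear.linear W_mult_right W_mult_left)

text \<open>With \<open>D = u j\<close> in \<open>tendsto_Phi_left\<close>,
  \<open>W (\<Phi> (y * u j * x))\<close> becomes a combination of three products, each convergent
  in \<open>j\<close>. The last one tends to the right limit at \<open>\<Phi> (x * y)\<close>, which
  is \<open>W (\<Phi> (x * y))\<close> because \<open>W\<close> is a centralizer.\<close>

lemma Phi_jordan: "W (\<Phi> (x \<circ>\<^sub>J y)) = \<Phi> x \<circ>\<^sub>J \<Phi> y"
proof -
  have lim: "(\<lambda>j. W (\<Phi> (y * u j * x))) = (\<lambda>j. \<Phi> y * \<Phi> (u j * x) + \<Phi> x * \<Phi> (y * u j) - \<Phi> (x * y) * \<Phi> (u j))"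
    unfolding W_def
    by (intro ext tendsto_unique[OF U_ne_bot tendsto_left_limit[OF approximates_u] tendsto_Phi_left[OF approximates_u]])
  have "((\<lambda>j. \<Phi> y * \<Phi> (u j * x) + \<Phi> x * \<Phi> (y * u j) - \<Phi> (x * y) * \<Phi> (u j)) \<longlongrightarrow>
      \<Phi> y * \<Phi> x + \<Phi> x * \<Phi> y - right_limit u (\<Phi> (x * y))) U"
    by (intro tendsto_intros Phi.tendsto tendsto_u_left tendsto_u_right tendsto_right_limit[OF approximates_u])
  then have "((\<lambda>j. W (\<Phi> (y * u j * x))) \<longlongrightarrow> \<Phi> y * \<Phi> x + \<Phi> x * \<Phi> y - W (\<Phi> (x * y))) U"
    by (simp only: lim right_limit_eq_W)
  moreover have "((\<lambda>j. W (\<Phi> (y * u j * x))) \<longlongrightarrow> W (\<Phi> (y * x))) U"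
    using bounded_clinear_W unfolding mult.assoc
    by (intro bounded_linear.tendsto[of W] Phi.tendsto tendsto_u_left
        bounded_linear.tendsto[OF bounded_linear_mult_right] bounded_clinear_imp_bounded_linear)
  ultimately have "W (\<Phi> (y * x)) = \<Phi> y * \<Phi> x + \<Phi> x * \<Phi> y - W (\<Phi> (x * y))"
    using tendsto_unique[OF U_ne_bot] by blast
  then have "W (\<Phi> (x * y)) + W (\<Phi> (y * x)) = \<Phi> x * \<Phi> y + \<Phi> y * \<Phi> x" by (simp add: algebra_simps)
  then show ?thesis
    using bounded_clinear_W by (simp add: jordan_product_def Phi.add bounded_clinear_def linear_add bounded_linear.linear)
qed

text \<open>\<open>Phi_jordan\<close> with \<open>x = y = a\<close> gives
  \<open>b * \<Phi> a * \<Phi> a = W b * \<Phi> (a * a)\<close>. If \<open>\<Phi> a\<close> is close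
  to some \<open>e i\<close> and \<open>norm a\<close> is under control, the left side is close to
  \<open>b\<close> and the right side is bounded by a multiple of \<open>norm (W b)\<close>.\<close>

lemma W_bounded_below: "\<exists>C>0. \<forall>b. C * norm b \<le> norm (W b)"
proof -
  obtain K where K: "0 < K" "\<And>b \<epsilon>. 0 < \<epsilon> \<Longrightarrow> \<exists>a. norm a \<le> K * norm b \<and> norm (\<Phi> a - b) < \<epsilon>"
    using surj_approximate_preimage[OF Phi.bounded_linear_axioms surj_Phi] by blast
  obtain M where M: "0 < M" "\<And>i. norm (e i) \<le> M"
    using bai_target by (auto simp: bounded_approximate_identity_def bounded_pos)
  obtain N where N: "0 < N" "\<And>a. norm (\<Phi> a) \<le> norm a * N" using Phi.pos_bounded by blast
  \<comment> \<open>A bound for \<open>norm (\<Phi> (a * a))\<close>, since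
    \<open>norm a \<le> K * M\<close>.\<close>
  define C where "C = (K * M) * (K * M) * N"
  have C: "C > 0" using K M N by (simp add: C_def)
  have "norm b \<le> C * norm (W b)" for b
  proof (rule field_le_epsilon)
    fix \<epsilon> :: real assume "\<epsilon> > 0"
    \<comment> \<open>Chosen so that the errors from replacing \<open>b\<close> by
      \<open>b * e i\<close>, replacing \<open>e i\<close> by \<open>\<Phi> a\<close>, and
      multiplying by \<open>\<Phi> a\<close> once more add up to
      \<open>Q * \<eta> = \<epsilon>\<close>.\<close>
    define Q where "Q = (norm b + 1) * (K * M * N + 1)"
    have Q: "Q > 0" using K M N by (simp add: Q_def add_nonneg_pos)
    define \<eta> where "\<eta> = \<epsilon> / Q"
    have \<eta>: "\<eta> > 0" using Q \<open>\<epsilon> > 0\<close> by (simp add: \<eta>_def)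
    have "\<exists>i. dist (b * e i) b < \<eta>"
      using tendstoD[OF tendsto_e_right \<eta>] F_ne_bot by (meson eventually_happens')
    then obtain i where i: "norm (b * e i - b) < \<eta>" by (auto simp: dist_norm)
    obtain a where a: "norm a \<le> K * norm (e i)" "norm (\<Phi> a - e i) < \<eta>" using K(2)[OF \<eta>] by blast
    have na: "norm a \<le> K * M" using a(1) M(2)[of i] K(1) by (meson mult_left_mono less_imp_le order_trans)
    have nPa: "norm (\<Phi> a) \<le> K * M * N" using N na by (meson mult_right_mono less_imp_le order_trans)
    have "b * \<Phi> a - b = b * (\<Phi> a - e i) + (b * e i - b)" by (simp add: algebra_simps)
    also have "norm \<dots> \<le> norm b * \<eta> + \<eta>"
      using a(2) i by (intro norm_triangle_mono order_trans[OF norm_mult_ineq] mult_left_mono) auto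
    finally have 1: "norm (b * \<Phi> a - b) \<le> (norm b + 1) * \<eta>" by (simp add: algebra_simps)
    have "b * \<Phi> a * \<Phi> a - b = (b * \<Phi> a - b) * \<Phi> a + (b * \<Phi> a - b)" by (simp add: algebra_simps)
    also have "norm \<dots> \<le> (norm b + 1) * \<eta> * (K * M * N) + (norm b + 1) * \<eta>"
      using 1 nPa \<eta> by (intro norm_triangle_mono order_trans[OF norm_mult_ineq] mult_mono) auto
    also have "\<dots> = Q * \<eta>" by (simp add: Q_def algebra_simps)
    also have "\<dots> = \<epsilon>" using Q by (simp add: \<eta>_def)
    finally have 2: "norm (b * \<Phi> a * \<Phi> a - b) \<le> \<epsilon>" .
    have "W (\<Phi> (a * a)) + W (\<Phi> (a * a)) = \<Phi> a * \<Phi> a + \<Phi> a * \<Phi> a"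
      using Phi_jordan[of a a] bounded_clinear_W
      by (simp add: jordan_product_def Phi.add bounded_clinear_def linear_add bounded_linear.linear)
    then have "W (\<Phi> (a * a)) = \<Phi> a * \<Phi> a" by (metis scaleR_2 scaleR_cancel_left zero_neq_numeral)
    then have "b * \<Phi> a * \<Phi> a = W b * \<Phi> (a * a)" by (metis W_mult_left mult.assoc)
    also have "norm \<dots> \<le> norm (W b) * ((K * M) * (K * M) * N)"
      by (intro order_trans[OF norm_mult_ineq] mult_left_mono order_trans[OF N(2)] mult_right_mono
          order_trans[OF norm_mult_ineq] mult_mono na) (use N K M in auto)
    finally have "norm (b * \<Phi> a * \<Phi> a) \<le> C * norm (W b)" by (simp add: C_def mult_ac)
    then show "norm b \<le> C * norm (W b) + \<epsilon>"
      using 2 norm_triangle_sub[of b "b * \<Phi> a * \<Phi> a"] by (simp add: norm_minus_commute)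
  qed
  then have "\<forall>b. (1 / C) * norm b \<le> norm (W b)" using C by (simp add: field_simps)
  then show ?thesis using C by (intro exI[of _ "1 / C"]) auto
qed

lemma bij_W: "bij W"
proof (rule bijI)
  interpret W: bounded_linear W using bounded_clinear_W by (rule bounded_clinear_imp_bounded_linear)
  obtain C where C: "C > 0" "\<And>b. C * norm b \<le> norm (W b)" using W_bounded_below by blast
  show "inj W"
  proof (rule injI)
    fix x y assume "W x = W y"
    then have "C * norm (x - y) \<le> 0" using C(2)[of "x - y"] by (simp add: W.diff)
    then show "x = y" using C(1) by (simp add: mult_le_0_iff)
  qed
  have "complete (range W)"
    by (rule complete_isometric_image[OF C(1) subspace_UNIV W.bounded_linear_axioms]) (auto simp: C(2) complete_UNIV)
  then have cl: "closed (range W)" by (rule complete_imp_closed)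
  \<comment> \<open>By \<open>Phi_jordan\<close> all Jordan products lie in the range of
    \<open>W\<close>; those of \<open>e i\<close> with \<open>b\<close> tend to \<open>2 b\<close>,
    and the range is closed.\<close>
  have "b \<in> range W" for b
  proof -
    have "((\<lambda>i. (1/2) *\<^sub>R (e i * b + b * e i)) \<longlongrightarrow> (1/2) *\<^sub>R (b + b)) F"
      by (intro tendsto_intros tendsto_e_left tendsto_e_right)
    also have "(1/2) *\<^sub>R (b + b) = b" by (simp flip: scaleR_2)
    finally have lim: "((\<lambda>i. (1/2) *\<^sub>R (e i * b + b * e i)) \<longlongrightarrow> b) F" .
    have "(1/2) *\<^sub>R (e i * b + b * e i) \<in> range W" for i
    proof -
      obtain x y where "e i = \<Phi> x" "b = \<Phi> y" using ex_Phi_preimage by meson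
      then have "(1/2) *\<^sub>R (e i * b + b * e i) = W ((1/2) *\<^sub>R \<Phi> (x \<circ>\<^sub>J y))"
        using Phi_jordan[of x y] by (simp add: W.scaleR jordan_product_def)
      then show ?thesis by blast
    qed
    then show ?thesis by (intro Lim_in_closed_set[OF cl _ F_ne_bot lim]) auto
  qed
  then show "surj W" by blast
qed

theorem weighted_jordan_hom_Phi: "weighted_jordan_hom \<Phi>"
proof -
  have inv: "W (inv W b) = b" for b using bij_W by (simp add: bij_is_surj surj_f_inv_f)
  have inj: "W a = W b \<Longrightarrow> a = b" for a b using bij_W by (auto simp: bij_def inj_def)
  have W_add: "W (a + b) = W a + W b" and W_scaleC: "W (c *\<^sub>C a) = c *\<^sub>C W a" for a b c
    using centralizer_W by (auto simp: centralizer_def clinear_iff)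
  have Phi_cl: "clinear \<Phi>"
    using bounded_clinear_Phi by (auto simp: clinear_iff Phi.add bounded_clinear_def)
  define \<Psi> where "\<Psi> = inv W \<circ> \<Phi>"
  have W\<Psi>: "W (\<Psi> a) = \<Phi> a" for a by (simp add: \<Psi>_def inv)
  have "clinear \<Psi>"
    unfolding clinear_iff
    by (intro conjI allI; rule inj) (simp_all add: W\<Psi> W_add W_scaleC Phi.add bounded_clinear_scaleC[OF bounded_clinear_Phi])
  moreover have "\<Psi> (a \<circ>\<^sub>J b) = \<Psi> a \<circ>\<^sub>J \<Psi> b" for a b
  proof (rule inj)
    \<comment> \<open>Each factor of \<open>\<Phi> a * \<Phi> b\<close> has the form
      \<open>W (\<Psi> _)\<close>, and both copies of the centralizer can be pulled out. Hence the
      Jordan identity is checked after applying the injective \<open>W\<close> twice.\<close>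
    have sq: "W (W (\<Psi> a * \<Psi> b)) = \<Phi> a * \<Phi> b" for a b
      by (metis W\<Psi> W_mult_left W_mult_right)
    show "W (\<Psi> (a \<circ>\<^sub>J b)) = W (\<Psi> a \<circ>\<^sub>J \<Psi> b)"
      by (rule inj) (simp add: sq W\<Psi> W_add jordan_product_def[of "\<Psi> a"] Phi_jordan jordan_product_def[of "\<Phi> a"])
  qed
  ultimately have "jordan_hom \<Psi>" by (simp add: jordan_hom_def)
  then show ?thesis
    unfolding weighted_jordan_hom_def
    by (intro conjI exI[of _ W] exI[of _ \<Psi>] Phi_cl centralizer_W bij_W) (simp_all add: fun_eq_iff W\<Psi>)
qed

end

subsection \<open>Continuous functions with compact support\<close>

definition Cc :: "('g::topological_space \<Rightarrow> 'b::{topological_space,zero}) set"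
  where "Cc = {f. continuous_on UNIV f \<and> (\<exists>K. compact K \<and> (\<forall>x. x \<notin> K \<longrightarrow> f x = 0))}"

lemma CcI: "continuous_on UNIV f \<Longrightarrow> compact K \<Longrightarrow> (\<And>x. x \<notin> K \<Longrightarrow> f x = 0) \<Longrightarrow> f \<in> Cc"
  by (auto simp: Cc_def)

lemma Cc_continuous: "f \<in> Cc \<Longrightarrow> continuous_on UNIV f"
  by (simp add: Cc_def)

lemma Cc_support: "f \<in> Cc \<Longrightarrow> \<exists>K. compact K \<and> (\<forall>x. x \<notin> K \<longrightarrow> f x = 0)"
  by (simp add: Cc_def)

lemma Cc_compose:
  assumes f: "f \<in> Cc" and h: "homeomorphism UNIV UNIV h k"
  shows "(\<lambda>x. f (h x)) \<in> Cc"
proof -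
  obtain K where K: "compact K" "\<And>x. x \<notin> K \<Longrightarrow> f x = 0" using Cc_support[OF f] by blast
  show ?thesis
  proof (rule CcI)
    show "continuous_on UNIV (\<lambda>x. f (h x))"
      using h by (intro continuous_on_compose2[OF Cc_continuous[OF f]]) (auto simp: homeomorphism_def)
    show "compact (k ` K)"
      using h K(1) by (intro compact_continuous_image) (auto simp: homeomorphism_def intro: continuous_on_subset)
    show "f (h x) = 0" if "x \<notin> k ` K" for x
      using that h by (intro K(2)) (auto simp: homeomorphism_def image_iff)
  qed
qed

lemma homeomorphism_add_left: "homeomorphism UNIV UNIV ((+) a) ((+) (- a))" for a :: "'g::topological_group_add"
  by (auto simp: homeomorphism_def image_iff add.assoc[symmetric] intro!: continuous_intros exI[of _ "- a + _"])

lemma homeomorphism_add_right: "homeomorphism UNIV UNIV (\<lambda>x. x + a) (\<lambda>x. x + - a)" for a :: "'g::topological_group_add"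
  by (auto simp: homeomorphism_def image_iff add.assoc intro!: continuous_intros exI[of _ "_ + - a"])

lemma homeomorphism_uminus: "homeomorphism UNIV UNIV uminus (uminus :: 'g::topological_group_add \<Rightarrow> 'g)"
  by (auto simp: homeomorphism_def image_iff intro!: continuous_intros exI[of _ "- _"])

lemma open_homeomorphism_image:
  "homeomorphism UNIV UNIV h k \<Longrightarrow> open U \<Longrightarrow> open (h ` U)"
  using homeomorphism_imp_open_map[of UNIV UNIV h k U] by simp

lemma compact_plus: "compact K \<Longrightarrow> compact L \<Longrightarrow> compact ((\<lambda>(x, y). x + y) ` (K \<times> L))"
  for K L :: "'g::topological_group_add set"
  by (intro compact_continuous_image compact_Times) (auto intro!: continuous_intros simp: case_prod_unfold)

lemma ex_compact_neighbourhood: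
  "\<exists>U K. open U \<and> compact K \<and> x \<in> U \<and> U \<subseteq> K" for x :: "'g::locally_compact_group"
  by (rule locally_compact)

lemma Hausdorff_space_t2: "Hausdorff_space (euclidean :: 'a::t2_space topology)"
  unfolding Hausdorff_space_def by (auto simp: disjnt_def dest!: hausdorff)

text \<open>An open \<open>W\<close> and a compact \<open>D\<close> with
  \<open>K \<subseteq> W \<subseteq> D \<subseteq> U\<close> are put in between. Complete regularity
  separates \<open>K\<close> from the complement of \<open>W\<close>, and \<open>D\<close> witnesses
  the compact support.\<close>

lemma Urysohn_Cc:
  fixes K :: "'g::locally_compact_group set"
  assumes "compact K" "open U" "K \<subseteq> U"
  shows "\<exists>f::'g \<Rightarrow> real. f \<in> Cc \<and> (\<forall>x. 0 \<le> f x \<and> f x \<le> 1) \<and> (\<forall>x\<in>K. f x = 1) \<and> (\<forall>x. x \<notin> U \<longrightarrow> f x = 0)"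
proof -
  have nb: "\<exists>V C. open V \<and> compact C \<and> x \<in> V \<and> V \<subseteq> C \<and> C \<subseteq> U" if "x \<in> K" for x
  proof -
    have "neighbourhood_base_of (compactin euclidean) (euclidean :: 'g topology)"
      using locally_compact_space_neighbourhood_base[of "euclidean :: 'g topology"] Hausdorff_space_t2[where 'a='g]
        Defs.locally_compact_space_euclidean[where 'g='g] by blast
    then show ?thesis using that assms(2,3) unfolding neighbourhood_base_of by auto
  qed
  then obtain V C where VC: "\<And>x. x \<in> K \<Longrightarrow> open (V x) \<and> compact (C x) \<and> x \<in> V x \<and> V x \<subseteq> C x \<and> C x \<subseteq> U"
    by metis
  obtain I where I: "I \<subseteq> K" "finite I" "K \<subseteq> (\<Union>x\<in>I. V x)"
    using compactE_image[OF assms(1), of K V] VC by blast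
  define W where "W = (\<Union>x\<in>I. V x)"
  define D where "D = (\<Union>x\<in>I. C x)"
  have W: "open W" "K \<subseteq> W" and D: "compact D" "W \<subseteq> D" "D \<subseteq> U"
    using I VC by (auto simp: W_def D_def intro!: compact_UN) blast+
  have "completely_regular_space (euclidean :: 'g topology)"
    using Defs.locally_compact_space_euclidean[where 'g='g] Hausdorff_space_t2[where 'a='g]
    by (intro locally_compact_regular_imp_completely_regular_space) blast+
  moreover have "compactin euclidean K" "closedin euclidean (- W)" "disjnt K (- W)"
    using assms(1) W by (auto simp: disjnt_def)
  ultimately obtain f where f: "continuous_map euclidean (top_of_set {0..1}) f" "f ` (- W) \<subseteq> {0::real}" "f ` K \<subseteq> {1}"
    using Urysohn_completely_regular_compact_closed[of 0 1 "euclidean :: 'g topology" K "- W"]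
    by (metis zero_le_one)
  have f0: "f x = 0" if "x \<notin> W" for x using f(2) that by auto
  have f1: "f x = 1" if "x \<in> K" for x using f(3) that by auto
  have fc: "continuous_on UNIV f" and fr: "0 \<le> f x \<and> f x \<le> 1" for x
    using f(1) by (auto simp: continuous_map_in_subtopology Pi_iff)
  show ?thesis
  proof (intro exI[of _ f] conjI allI ballI impI)
    show "f \<in> Cc"
      by (rule CcI[OF fc D(1)]) (use f0 D in auto)
    show "f x = 0" if "x \<notin> U" for x using that D by (intro f0) auto
  qed (use f1 fr in auto)
qed

text \<open>The compact set \<open>C\<close> is fixed before \<open>\<epsilon>\<close>, so that the
  estimate becomes an \<open>L^1\<close> estimate after integration. It consists of all
  \<open>x\<close> that some \<open>v\<close> in a compact neighbourhood of \<open>0\<close> moves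
  into \<open>K\<close>.\<close>

lemma Cc_uniformly_continuous_left:
  fixes f :: "'g::locally_compact_group \<Rightarrow> 'b::real_normed_vector"
  assumes f: "f \<in> Cc"
  shows "\<exists>C. compact C \<and> (\<forall>\<epsilon>>0. \<exists>V. open V \<and> 0 \<in> V \<and>
    (\<forall>v\<in>V. \<forall>x. norm (f (v + x) - f x) \<le> \<epsilon> * indicator C x))"
proof -
  obtain K where K: "compact K" "\<And>x. x \<notin> K \<Longrightarrow> f x = 0" using Cc_support[OF f] by blast
  obtain U0 K0 where U0: "open U0" "compact K0" "(0::'g) \<in> U0" "U0 \<subseteq> K0" using ex_compact_neighbourhood by blast
  define C where "C = (\<lambda>(x, y). x + y) ` (uminus ` K0 \<times> K)"
  have C: "compact C" unfolding C_def
    by (intro compact_plus compact_continuous_image K U0) (intro continuous_intros)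
  have zero: "f (v + x) = 0" if "v \<in> K0" "x \<notin> C" for v x
  proof (rule K(2))
    show "v + x \<notin> K"
    proof
      assume "v + x \<in> K"
      then have "- v + (v + x) \<in> C" unfolding C_def using that(1) by force
      then show False using that(2) by simp
    qed
  qed
  have "\<exists>V. open V \<and> 0 \<in> V \<and> (\<forall>v\<in>V. \<forall>x. norm (f (v + x) - f x) \<le> \<epsilon> * indicator C x)" if e: "\<epsilon> > 0" for \<epsilon>
  proof -
    have cont: "continuous_on (UNIV \<times> C) (\<lambda>(v, x). f (v + x))"
      unfolding case_prod_unfold
      by (intro continuous_on_compose2[OF Cc_continuous[OF f]] continuous_intros) auto
    have "\<exists>V. 0 \<in> V \<and> open V \<and> (\<forall>v\<in>V. \<forall>x\<in>C. dist (f (v + x)) (f (0 + x)) \<le> \<epsilon>)"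
      by (rule continuous_on_prod_compactE[OF cont C UNIV_I e, of "0::'g"]) auto
    then obtain V where V: "0 \<in> V" "open V" "\<forall>v\<in>V. \<forall>x\<in>C. dist (f (v + x)) (f (0 + x)) \<le> \<epsilon>" by blast
    show ?thesis
    proof (intro exI[of _ "V \<inter> U0"] conjI ballI allI)
      fix v x assume v: "v \<in> V \<inter> U0"
      show "norm (f (v + x) - f x) \<le> \<epsilon> * indicator C x"
      proof (cases "x \<in> C")
        case True
        then show ?thesis using V(3) v by (auto simp: dist_norm)
      next
        case False
        have "v \<in> K0" "0 \<in> K0" using v U0 by auto
        then have "f (v + x) = 0" "f (0 + x) = 0" using zero False by blast+
        then show ?thesis using False by simp
      qed
    qed (use V U0 in auto)
  qed
  then show ?thesis using C by blast
qed

text \<open>Inversion turns right translations into left ones, because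
  \<open>- (x + v) = - v + - x\<close>.\<close>

lemma Cc_uniformly_continuous_right:
  fixes f :: "'g::locally_compact_group \<Rightarrow> 'b::real_normed_vector"
  assumes f: "f \<in> Cc"
  shows "\<exists>C. compact C \<and> (\<forall>\<epsilon>>0. \<exists>V. open V \<and> 0 \<in> V \<and>
    (\<forall>v\<in>V. \<forall>x. norm (f (x + v) - f x) \<le> \<epsilon> * indicator C x))"
proof -
  have "(\<lambda>x. f (- x)) \<in> Cc" by (rule Cc_compose[OF f homeomorphism_uminus])
  from Cc_uniformly_continuous_left[OF this] obtain C where C: "compact C"
    "\<And>\<epsilon>. \<epsilon> > 0 \<Longrightarrow> \<exists>V. open V \<and> 0 \<in> V \<and> (\<forall>v\<in>V. \<forall>x. norm (f (- (v + x)) - f (- x)) \<le> \<epsilon> * indicator C x)"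
    by blast
  have "\<exists>V. open V \<and> 0 \<in> V \<and> (\<forall>v\<in>V. \<forall>x. norm (f (x + v) - f x) \<le> \<epsilon> * indicator (uminus ` C) x)" if e: "\<epsilon> > 0" for \<epsilon>
  proof -
    obtain V where V: "open V" "0 \<in> V" "\<forall>v\<in>V. \<forall>x. norm (f (- (v + x)) - f (- x)) \<le> \<epsilon> * indicator C x"
      using C(2)[OF e] by blast
    show ?thesis
    proof (intro exI[of _ "uminus ` V"] conjI ballI allI)
      show "open (uminus ` V)" by (rule open_homeomorphism_image[OF homeomorphism_uminus V(1)])
      show "0 \<in> uminus ` V" using V(2) by (metis image_eqI minus_zero)
      fix v x assume "v \<in> uminus ` V"
      then have "- v \<in> V" by auto
      then have "norm (f (- (- v + - x)) - f (- (- x))) \<le> \<epsilon> * indicator C (- x)" using V(3) by blast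
      moreover have "- (- v + - x) = x + v" by (simp add: minus_add)
      moreover have "indicator C (- x) = (indicator (uminus ` C) x :: real)"
        by (auto simp: indicator_def) (metis image_eqI minus_minus)
      ultimately show "norm (f (x + v) - f x) \<le> \<epsilon> * indicator (uminus ` C) x" by simp
    qed
  qed
  moreover have "compact (uminus ` C)" by (intro compact_continuous_image C) (intro continuous_intros)
  ultimately show ?thesis by blast
qed

subsection \<open>Haar measure\<close>

lemma haar_properties:
  fixes A :: "'g::haar_group set"
  shows space_haar [simp]: "space (haar :: 'g measure) = UNIV"
    and emeasure_haar_UNIV: "emeasure (haar :: 'g measure) UNIV \<noteq> 0"
    and emeasure_haar_compact: "compact A \<Longrightarrow> emeasure haar A < \<infinity>"
    and emeasure_haar_outer: "A \<in> sets borel \<Longrightarrow> emeasure haar A = (INF U\<in>{U. open U \<and> A \<subseteq> U}. emeasure haar U)"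
    and emeasure_haar_inner: "open A \<Longrightarrow> emeasure haar A = (SUP K\<in>{K. compact K \<and> K \<subseteq> A}. emeasure haar K)"
    and emeasure_haar_translate: "A \<in> sets borel \<Longrightarrow> emeasure haar ((+) x ` A) = emeasure haar A"
  using left_haar_measure_haar[where 'a='g] sets_haar[where 'g='g]
  unfolding left_haar_measure_def by auto

declare sets_haar [simp, measurable_cong]

lemma borel_measurable_continuous [intro]: "continuous_on UNIV f \<Longrightarrow> f \<in> borel_measurable borel"
  by (rule borel_measurable_continuous_onI)

lemma borel_measurable_haar [simp]: "borel_measurable (haar :: 'g::haar_group measure) = borel_measurable borel"
  by (intro measurable_cong_sets) auto

lemma measurable_translations [measurable]:
  "(\<lambda>x. a + x) \<in> borel_measurable borel" "(\<lambda>x. x + a) \<in> borel_measurable borel"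
  "(\<lambda>x::'g. - x) \<in> borel_measurable borel" for a :: "'g::topological_group_add"
  using homeomorphism_uminus[where 'g='g]
  by (auto intro!: borel_measurable_continuous_onI continuous_intros simp: homeomorphism_def)

lemma distr_haar_translate: "distr haar borel ((+) a) = (haar :: 'g::haar_group measure)"
proof (rule measure_eqI)
  fix A :: "'g set" assume "A \<in> sets (distr haar borel ((+) a))"
  then have A: "A \<in> sets borel" by simp
  have "(+) a -` A = (+) (- a) ` A" by (auto simp: image_iff add.assoc[symmetric] intro!: bexI[of _ "a + _"])
  then have "emeasure (distr haar borel ((+) a)) A = emeasure haar ((+) (- a) ` A)"
    using A by (subst emeasure_distr) auto
  then show "emeasure (distr haar borel ((+) a)) A = emeasure haar A"
    using A by (simp add: emeasure_haar_translate)
qed simp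

lemma nn_integral_haar_translate:
  fixes f :: "'g::haar_group \<Rightarrow> ennreal"
  assumes "f \<in> borel_measurable borel"
  shows "(\<integral>\<^sup>+x. f (a + x) \<partial>haar) = (\<integral>\<^sup>+x. f x \<partial>haar)"
proof -
  have "(\<integral>\<^sup>+x. f x \<partial>distr haar borel ((+) a)) = (\<integral>\<^sup>+x. f (a + x) \<partial>haar)"
    by (rule nn_integral_distr) (use assms in auto)
  then show ?thesis by (simp add: distr_haar_translate)
qed

lemma
  fixes f :: "'g::haar_group \<Rightarrow> 'b::{banach, second_countable_topology}"
  assumes "f \<in> borel_measurable borel"
  shows integral_haar_translate: "(\<integral>x. f (a + x) \<partial>haar) = (\<integral>x. f x \<partial>haar)"
    and integrable_haar_translate_iff: "integrable haar (\<lambda>x. f (a + x)) \<longleftrightarrow> integrable haar f"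
proof -
  have "(\<integral>x. f x \<partial>distr haar borel ((+) a)) = (\<integral>x. f (a + x) \<partial>haar)"
    by (rule integral_distr) (use assms in auto)
  then show "(\<integral>x. f (a + x) \<partial>haar) = (\<integral>x. f x \<partial>haar)" by (simp add: distr_haar_translate)
  have "integrable (distr haar borel ((+) a)) f \<longleftrightarrow> integrable haar (\<lambda>x. f (a + x))"
    by (rule integrable_distr_eq) (use assms in auto)
  then show "integrable haar (\<lambda>x. f (a + x)) \<longleftrightarrow> integrable haar f" by (simp add: distr_haar_translate)
qed

lemma AE_haar_translate:
  fixes P :: "'g::haar_group \<Rightarrow> bool"
  assumes "AE x in haar. P x"
  shows "AE x in haar. P (a + x)"
proof -
  have "AE x in distr haar borel ((+) a). P x" by (subst distr_haar_translate) (rule assms)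
  then show ?thesis by (rule AE_distrD[of "(+) a" haar borel P, rotated]) auto
qed

lemma compact_borel: "compact K \<Longrightarrow> K \<in> sets borel" for K :: "'g::t2_space set"
  by (intro borel_closed compact_imp_closed)

lemma integrable_indicator_compact: "compact K \<Longrightarrow> integrable haar (indicator K :: 'g::haar_group \<Rightarrow> real)"
  using emeasure_haar_compact[of K] compact_borel[of K] by (simp add: integrable_indicator_iff)

lemma Cc_bounded:
  fixes f :: "'g::topological_space \<Rightarrow> 'b::real_normed_vector"
  assumes "f \<in> Cc"
  shows "\<exists>B K. compact K \<and> 0 \<le> B \<and> (\<forall>x. norm (f x) \<le> B * indicator K x)"
proof -
  obtain K where K: "compact K" "\<And>x. x \<notin> K \<Longrightarrow> f x = 0" using Cc_support[OF assms] by blast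
  have "compact (f ` K)" using K(1) Cc_continuous[OF assms] by (intro compact_continuous_image continuous_on_subset[OF Cc_continuous[OF assms]]) auto
  then obtain B where B: "0 < B" "\<forall>x\<in>K. norm (f x) \<le> B" using compact_imp_bounded bounded_pos by (metis image_eqI)
  show ?thesis
    by (intro exI[of _ B] exI[of _ K]) (use B K in \<open>auto simp: indicator_def\<close>)
qed

lemma Cc_integrable:
  fixes f :: "'g::haar_group \<Rightarrow> 'b::{banach, second_countable_topology}"
  assumes "f \<in> Cc"
  shows "integrable haar f"
proof -
  obtain B K where K: "compact K" "0 \<le> B" "\<And>x. norm (f x) \<le> B * indicator K x" using Cc_bounded[OF assms] by blast
  show ?thesis
  proof (rule Bochner_Integration.integrable_bound)
    show "integrable haar (\<lambda>x. B * indicator K x)" using integrable_indicator_compact[OF K(1)] by simp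
    show "f \<in> borel_measurable haar" using Cc_continuous[OF assms] by auto
    show "AE x in haar. norm (f x) \<le> norm (B * indicator K x)"
      using K by (auto intro!: AE_I2 order_trans[OF K(3)])
  qed
qed

lemma ex_compact_subset_emeasure:
  fixes U :: "'g::haar_group set"
  assumes "open U" "emeasure haar U < \<infinity>" "0 < \<epsilon>"
  shows "\<exists>K. compact K \<and> K \<subseteq> U \<and> measure haar (U - K) < \<epsilon>"
proof (cases "emeasure haar U = 0")
  case True
  then show ?thesis using assms by (intro exI[of _ "{}"]) (simp add: measure_def)
next
  case False
  have fin: "emeasure haar U \<noteq> \<infinity>" using assms by simp
  have "emeasure haar U - ennreal \<epsilon> < emeasure haar U"
    using False assms fin by (intro ennreal_between) (auto simp: zero_less_iff_neq_zero)
  then obtain K where K: "compact K" "K \<subseteq> U" "emeasure haar U - ennreal \<epsilon> < emeasure haar K"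
    unfolding emeasure_haar_inner[OF assms(1)] less_SUP_iff by auto
  have eq: "emeasure haar (U - K) = emeasure haar U - emeasure haar K"
    using K assms emeasure_haar_compact[OF K(1)] compact_borel by (intro emeasure_Diff) auto
  have "emeasure haar K \<le> emeasure haar U" using K assms by (intro emeasure_mono) auto
  then have "measure haar (U - K) = measure haar U - measure haar K"
    using eq fin emeasure_haar_compact[OF K(1)]
    by (intro measure_Diff) (use K assms compact_borel in auto)
  moreover have "measure haar U < measure haar K + \<epsilon>"
  proof -
    have "ennreal (measure haar U - \<epsilon>) < ennreal (measure haar K)"
      using K(3) fin emeasure_haar_compact[OF K(1)] assms(3)
      by (auto simp: emeasure_eq_ennreal_measure ennreal_minus top_unique less_top)
    then have "measure haar U - \<epsilon> < measure haar K" by (metis ennreal_leI not_le)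
    then show ?thesis by simp
  qed
  ultimately show ?thesis using K by auto
qed

text \<open>\<open>A\<close> is enclosed in an open \<open>U\<close>, and a compact \<open>K\<close>
  is chosen inside \<open>U\<close> rather than inside \<open>A\<close>, since inner regularity is
  given for open sets. A Urysohn function for \<open>K\<close> and \<open>U\<close> then differs
  from the indicator only on \<open>U - A\<close> and \<open>U - K\<close>.\<close>

lemma indicator_approx_Cc:
  fixes A :: "'g::haar_group set"
  assumes A: "A \<in> sets borel" "emeasure haar A < \<infinity>" and "0 < \<epsilon>"
  shows "\<exists>h::'g \<Rightarrow> real. h \<in> Cc \<and> (\<integral>x. \<bar>indicator A x - h x\<bar> \<partial>haar) < \<epsilon>"
proof -
  have "emeasure haar A < emeasure haar A + ennreal (\<epsilon> / 2)"
    using A(2) \<open>0 < \<epsilon>\<close> by (simp add: ennreal_add_left_cancel_less[of _ 0, simplified])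
  then obtain U where U: "open U" "A \<subseteq> U" "emeasure haar U < emeasure haar A + ennreal (\<epsilon> / 2)"
    unfolding emeasure_haar_outer[OF A(1)] INF_less_iff by auto
  have Uf: "emeasure haar U < \<infinity>" using U(3) A(2) by (metis ennreal_add_eq_top ennreal_neq_top infinity_ennreal_def less_top order_less_le_trans top.extremum)
  have "measure haar (U - A) = measure haar U - measure haar A"
    using U A Uf by (intro measure_Diff) auto
  moreover have "measure haar U < measure haar A + \<epsilon> / 2"
  proof -
    have "ennreal (measure haar U) < ennreal (measure haar A + \<epsilon> / 2)"
      using U(3) A(2) Uf \<open>0 < \<epsilon>\<close> by (simp add: emeasure_eq_ennreal_measure less_top)
    then show ?thesis by (metis ennreal_leI not_le)
  qed
  ultimately have 1: "measure haar (U - A) < \<epsilon> / 2" by simp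
  obtain K where K: "compact K" "K \<subseteq> U" "measure haar (U - K) < \<epsilon> / 2"
    using ex_compact_subset_emeasure[OF U(1) Uf, of "\<epsilon> / 2"] \<open>0 < \<epsilon>\<close> by auto
  obtain h :: "'g \<Rightarrow> real" where h: "h \<in> Cc" "\<And>x. 0 \<le> h x \<and> h x \<le> 1" "\<And>x. x \<in> K \<Longrightarrow> h x = 1" "\<And>x. x \<notin> U \<Longrightarrow> h x = 0"
    using Urysohn_Cc[OF K(1) U(1) K(2)] by blast
  have fin: "emeasure haar (U - A) < \<infinity>" "emeasure haar (U - K) < \<infinity>"
    using U A K Uf compact_borel[OF K(1)]
    by (auto intro: order_le_less_trans[OF emeasure_mono[of _ U]])
  have int: "integrable haar (indicator (U - A) :: 'g \<Rightarrow> real)" "integrable haar (indicator (U - K) :: 'g \<Rightarrow> real)"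
    using fin U A K compact_borel[OF K(1)] by (auto simp: integrable_indicator_iff)
  have "(\<integral>x. \<bar>indicator A x - h x\<bar> \<partial>haar) \<le> (\<integral>x. indicator (U - A) x + indicator (U - K) x \<partial>haar)"
  proof (rule integral_mono)
    show "integrable haar (\<lambda>x. \<bar>indicator A x - h x\<bar>)"
      using A Cc_integrable[OF h(1)] by (intro integrable_abs Bochner_Integration.integrable_diff) (auto simp: integrable_indicator_iff)
    show "integrable haar (\<lambda>x. indicator (U - A) x + indicator (U - K) x :: real)"
      by (intro Bochner_Integration.integrable_add int)
    fix x
    show "\<bar>indicator A x - h x\<bar> \<le> indicator (U - A) x + indicator (U - K) x"
      using h(2)[of x] h(3)[of x] h(4)[of x] U(2) by (auto simp: indicator_def)
  qed
  also have "\<dots> = measure haar (U - A) + measure haar (U - K)"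
    using int by (subst Bochner_Integration.integral_add) auto
  also have "\<dots> < \<epsilon>" using 1 K by simp
  finally show ?thesis using h(1) by blast
qed

lemma Cc_scaleR: "h \<in> Cc \<Longrightarrow> (\<lambda>x. h x *\<^sub>R c) \<in> Cc" for c :: "'b::real_normed_vector" and h :: "_ \<Rightarrow> real"
  by (auto simp: Cc_def intro!: continuous_intros)

lemma Cc_add: "f \<in> Cc \<Longrightarrow> g \<in> Cc \<Longrightarrow> (\<lambda>x. f x + g x) \<in> Cc" for f g :: "_ \<Rightarrow> 'b::real_normed_vector"
proof -
  assume f: "f \<in> Cc" and g: "g \<in> Cc"
  obtain K where K: "compact K" "\<forall>x. x \<notin> K \<longrightarrow> f x = 0" using Cc_support[OF f] by blast
  obtain L where L: "compact L" "\<forall>x. x \<notin> L \<longrightarrow> g x = 0" using Cc_support[OF g] by blast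
  show ?thesis
  proof (rule CcI[of _ "K \<union> L"])
    show "continuous_on UNIV (\<lambda>x. f x + g x)" by (intro continuous_on_add Cc_continuous f g)
  qed (use K L in auto)
qed

lemma Cc_dense:
  fixes f :: "'g::haar_group \<Rightarrow> 'b::{banach, second_countable_topology}"
  assumes "integrable haar f" "0 < \<epsilon>"
  shows "\<exists>g\<in>Cc. (\<integral>x. norm (f x - g x) \<partial>haar) < \<epsilon>"
  using assms
proof (induction arbitrary: \<epsilon> rule: integrable_induct)
  case (base A c)
  obtain h :: "'g \<Rightarrow> real" where h: "h \<in> Cc" "(\<integral>x. \<bar>indicator A x - h x\<bar> \<partial>haar) < \<epsilon> / (norm c + 1)"
    using indicator_approx_Cc[of A "\<epsilon> / (norm c + 1)"] base by (auto simp: add_nonneg_pos)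
  have "(\<integral>x. norm (indicator A x *\<^sub>R c - h x *\<^sub>R c) \<partial>haar) = (\<integral>x. \<bar>indicator A x - h x\<bar> * norm c \<partial>haar)"
    by (simp flip: scaleR_left_diff_distrib)
  also have "\<dots> = (\<integral>x. \<bar>indicator A x - h x\<bar> \<partial>haar) * norm c" by simp
  also have "\<dots> \<le> (\<integral>x. \<bar>indicator A x - h x\<bar> \<partial>haar) * (norm c + 1)"
    by (intro mult_left_mono) auto
  also have "\<dots> < \<epsilon>" using h(2) by (simp add: pos_less_divide_eq add_nonneg_pos)
  finally show ?case by (intro bexI[OF _ Cc_scaleR[OF h(1), of c]])
next
  case (add f g)
  obtain f' g' where fg: "f' \<in> Cc" "(\<integral>x. norm (f x - f' x) \<partial>haar) < \<epsilon> / 2" "g' \<in> Cc" "(\<integral>x. norm (g x - g' x) \<partial>haar) < \<epsilon> / 2"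
    using add.IH[of "\<epsilon> / 2"] add.prems by auto
  have int: "integrable haar (\<lambda>x. norm (f x - f' x))" "integrable haar (\<lambda>x. norm (g x - g' x))"
    using add.hyps fg Cc_integrable by (auto intro!: integrable_norm Bochner_Integration.integrable_diff)
  have "(\<integral>x. norm (f x + g x - (f' x + g' x)) \<partial>haar) \<le> (\<integral>x. norm (f x - f' x) + norm (g x - g' x) \<partial>haar)"
    using add.hyps fg Cc_integrable
    by (intro integral_mono integrable_norm Bochner_Integration.integrable_diff Bochner_Integration.integrable_add int norm_diff_triangle_ineq) auto
  also have "\<dots> < \<epsilon>" using fg int by simp
  finally show ?case by (intro bexI[OF _ Cc_add[OF fg(1,3)]])
next
  case (lim f s)
  have "(\<lambda>i. \<integral>x. norm (f x - s i x) \<partial>haar) \<longlonglongrightarrow> (\<integral>x. 0 \<partial>(haar :: 'g measure))"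
  proof (rule integral_dominated_convergence[where w="\<lambda>x. 3 * norm (f x)"])
    show "AE x in haar. (\<lambda>i. norm (f x - s i x)) \<longlonglongrightarrow> 0"
    proof (rule AE_I2)
      fix x
      have "(\<lambda>i. norm (f x - s i x)) \<longlonglongrightarrow> norm (f x - f x)"
        using lim.hyps(2) by (intro tendsto_intros) auto
      then show "(\<lambda>i. norm (f x - s i x)) \<longlonglongrightarrow> 0" by simp
    qed
    show "AE x in haar. norm (norm (f x - s i x)) \<le> 3 * norm (f x)" for i
    proof (rule AE_I2)
      fix x
      show "norm (norm (f x - s i x)) \<le> 3 * norm (f x)"
        using lim.hyps(3)[of x i] norm_triangle_ineq4[of "f x" "s i x"] by simp
    qed
  qed (use lim.hyps in auto)
  then have "\<forall>\<^sub>F i in sequentially. (\<integral>x. norm (f x - s i x) \<partial>haar) < \<epsilon> / 2"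
    by (rule order_tendstoD(2)) (use lim.prems in simp)
  then obtain i where i: "(\<integral>x. norm (f x - s i x) \<partial>haar) < \<epsilon> / 2"
    using eventually_happens'[OF sequentially_bot] by blast
  obtain g where g: "g \<in> Cc" "(\<integral>x. norm (s i x - g x) \<partial>haar) < \<epsilon> / 2"
    using lim.IH[of "\<epsilon> / 2" i] lim.prems by auto
  have int: "integrable haar (\<lambda>x. norm (f x - s i x))" "integrable haar (\<lambda>x. norm (s i x - g x))"
    using lim.hyps g Cc_integrable by (auto intro!: integrable_norm Bochner_Integration.integrable_diff)
  have "(\<integral>x. norm (f x - g x) \<partial>haar) \<le> (\<integral>x. norm (f x - s i x) + norm (s i x - g x) \<partial>haar)"
    using lim.hyps g Cc_integrable
    by (intro integral_mono integrable_norm Bochner_Integration.integrable_diff Bochner_Integration.integrable_add int norm_triangle_sub[of "f _ - g _" "f _ - s i _", simplified]) (auto intro: norm_diff_triangle_le[OF order_refl order_refl])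
  also have "\<dots> < \<epsilon>" using g i int by simp
  finally show ?case using g by blast
qed

subsection \<open>Fubini's theorem without second countability\<close>

text \<open>The Borel sets of \<open>G \<times> G\<close> need not be generated by rectangles, but continuous functions are
  measurable for the product sigma-algebra on compact rectangles, where they are uniformly
  approximated by finite sums of products.\<close>

lemma continuous_measurable_compact_rectangle:
  fixes F :: "'g::t2_space \<times> 'h::t2_space \<Rightarrow> 'b::{real_normed_vector, second_countable_topology}"
  assumes F: "continuous_on UNIV F" and K: "compact K" and L: "compact L"
  shows "(\<lambda>z. (indicator K (fst z) * indicator L (snd z)) *\<^sub>R F z) \<in> borel_measurable (borel \<Otimes>\<^sub>M borel)"
proof -
  have slice: "(\<lambda>y. F (x, y)) \<in> borel_measurable borel" for x
    by (intro borel_measurable_continuous_onI continuous_on_compose2[OF F] continuous_intros) auto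
  have "\<exists>G\<in>borel_measurable (borel \<Otimes>\<^sub>M borel). \<forall>x\<in>K. \<forall>y\<in>L. norm (G (x, y) - F (x, y)) \<le> 1 / real (Suc n)" for n
  proof -
    define \<epsilon> where "\<epsilon> = 1 / real (Suc n)"
    have "\<epsilon> > 0" by (simp add: \<epsilon>_def)
    have F': "continuous_on (UNIV \<times> L) F" using F continuous_on_subset by blast
    have "\<exists>U. x \<in> U \<and> open U \<and> (\<forall>x'\<in>U. \<forall>y\<in>L. dist (F (x', y)) (F (x, y)) \<le> \<epsilon>)" for x
      by (rule continuous_on_prod_compactE[OF F' L UNIV_I \<open>\<epsilon> > 0\<close>, of x]) auto
    then obtain U where U: "\<And>x. x \<in> U x" "\<And>x. open (U x)" "\<And>x x' y. x' \<in> U x \<Longrightarrow> y \<in> L \<Longrightarrow> dist (F (x', y)) (F (x, y)) \<le> \<epsilon>"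
      by metis
    have "\<exists>I. finite I \<and> K \<subseteq> (\<Union>x\<in>I. U x)"
      by (rule compactE_image[OF K, of UNIV U]) (use U in auto)
    then obtain I where I: "finite I" "K \<subseteq> (\<Union>x\<in>I. U x)" by blast
    have "\<exists>G\<in>borel_measurable (borel \<Otimes>\<^sub>M borel). \<forall>x\<in>(\<Union>i\<in>I. U i). \<forall>y\<in>L. norm (G (x, y) - F (x, y)) \<le> \<epsilon>"
      using I(1)
    proof induction
      case empty
      show ?case by (intro bexI[of _ "\<lambda>_. 0"]) auto
    next
      case (insert i I)
      obtain G where G: "G \<in> borel_measurable (borel \<Otimes>\<^sub>M borel)" "\<forall>x\<in>(\<Union>i\<in>I. U i). \<forall>y\<in>L. norm (G (x, y) - F (x, y)) \<le> \<epsilon>"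
        using insert.IH by blast
      \<comment> \<open>For \<open>x\<close> in \<open>U i\<close> and \<open>y\<close> in
        \<open>L\<close>, \<open>F (x, y)\<close> is within \<open>\<epsilon>\<close> of
        \<open>F (i, y)\<close>; on this strip a function of \<open>y\<close> alone is used.\<close>
      define G' where "G' z = (if fst z \<in> U i then F (i, snd z) else G z)" for z
      have "{z \<in> space (borel \<Otimes>\<^sub>M borel). fst z \<in> U i} \<in> sets (borel \<Otimes>\<^sub>M borel)"
        using borel_open[OF U(2)] by measurable
      moreover have "(\<lambda>z. F (i, snd z)) \<in> borel_measurable (borel \<Otimes>\<^sub>M borel)"
        using slice by measurable
      ultimately have "G' \<in> borel_measurable (borel \<Otimes>\<^sub>M borel)"
        unfolding G'_def by (intro measurable_If G(1))
      moreover have "\<forall>x\<in>(\<Union>i\<in>insert i I. U i). \<forall>y\<in>L. norm (G' (x, y) - F (x, y)) \<le> \<epsilon>"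
        using G(2) U(3) by (auto simp: G'_def dist_norm norm_minus_commute)
      ultimately show ?case by blast
    qed
    then show ?thesis using I(2) unfolding \<epsilon>_def by blast
  qed
  then obtain G where G: "\<And>n. G n \<in> borel_measurable (borel \<Otimes>\<^sub>M borel)"
    "\<And>n x y. x \<in> K \<Longrightarrow> y \<in> L \<Longrightarrow> norm (G n (x, y) - F (x, y)) \<le> 1 / real (Suc n)" by metis
  show ?thesis
  proof (rule borel_measurable_LIMSEQ_metric)
    have KL: "K \<in> sets borel" "L \<in> sets borel" using K L by (auto intro: borel_closed compact_imp_closed)
    show "(\<lambda>z. (indicator K (fst z) * indicator L (snd z)) *\<^sub>R G n z) \<in> borel_measurable (borel \<Otimes>\<^sub>M borel)" for n
      using G(1)[of n] KL by measurable
    fix z :: "'g \<times> 'h"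
    show "(\<lambda>n. (indicator K (fst z) * indicator L (snd z)) *\<^sub>R G n z) \<longlonglongrightarrow> (indicator K (fst z) * indicator L (snd z)) *\<^sub>R F z"
    proof (cases "fst z \<in> K \<and> snd z \<in> L")
      case True
      have "(\<lambda>n. G n z - F z) \<longlonglongrightarrow> 0"
        by (rule Lim_null_comparison[OF _ LIMSEQ_inverse_real_of_nat])
          (use True G(2)[of "fst z" "snd z"] in \<open>auto simp: inverse_eq_divide\<close>)
      then have "(\<lambda>n. G n z) \<longlonglongrightarrow> F z" by (rule LIM_zero_cancel)
      then show ?thesis by (rule tendsto_scaleR[OF tendsto_const])
    qed (auto simp: indicator_def)
  qed
qed

definition sigma_compact :: "'g::topological_space set \<Rightarrow> bool"
  where "sigma_compact S \<longleftrightarrow> (\<exists>K::nat \<Rightarrow> 'g set. (\<forall>n. compact (K n)) \<and> S = (\<Union>n. K n))"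

lemma compact_imp_sigma_compact: "compact K \<Longrightarrow> sigma_compact K"
  unfolding sigma_compact_def by (intro exI[of _ "\<lambda>_. K"]) auto

lemma sigma_compact_borel: "sigma_compact S \<Longrightarrow> S \<in> sets borel" for S :: "'g::t2_space set"
proof -
  assume "sigma_compact S"
  then obtain K where K: "\<And>n::nat. compact (K n)" "S = (\<Union>n. K n)" by (auto simp: sigma_compact_def)
  moreover have "K n \<in> sets borel" for n by (intro borel_closed compact_imp_closed K)
  ultimately show ?thesis by simp
qed

lemma sigma_compact_countable_UN:
  fixes A :: "'i \<Rightarrow> 'g::topological_space set"
  assumes "countable I" "\<And>i. i \<in> I \<Longrightarrow> sigma_compact (A i)"
  shows "sigma_compact (\<Union>i\<in>I. A i)"
proof -
  have "\<forall>i\<in>I. \<exists>K::nat \<Rightarrow> 'g set. (\<forall>n. compact (K n)) \<and> A i = (\<Union>n. K n)"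
    using assms(2) by (simp add: sigma_compact_def)
  then obtain K where K: "\<And>i n. i \<in> I \<Longrightarrow> compact (K i n)" "\<And>i. i \<in> I \<Longrightarrow> A i = (\<Union>n::nat. K i n)"
    by metis
  \<comment> \<open>The empty set is added so that the family is nonempty and
    \<open>from_nat_into\<close> enumerates exactly it, even when \<open>I\<close> is empty.\<close>
  define \<K> where "\<K> = insert {} ((\<lambda>(i, n). K i n) ` (I \<times> UNIV))"
  have "countable \<K>" using assms(1) by (simp add: \<K>_def)
  then have "range (from_nat_into \<K>) = \<K>" by (intro range_from_nat_into) (auto simp: \<K>_def)
  moreover have "compact X" if "X \<in> \<K>" for X using that K by (auto simp: \<K>_def)
  moreover have "(\<Union>i\<in>I. A i) = \<Union> \<K>" using K by (auto simp: \<K>_def)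
  ultimately show ?thesis unfolding sigma_compact_def
    by (intro exI[of _ "from_nat_into \<K>"]) auto
qed

lemma sigma_compact_Un:
  assumes "sigma_compact S" "sigma_compact T"
  shows "sigma_compact (S \<union> T)"
proof -
  have "sigma_compact (\<Union>X\<in>{S, T}. X)"
    by (rule sigma_compact_countable_UN) (use assms in auto)
  then show ?thesis by simp
qed

lemma sigma_compact_plus:
  fixes S T :: "'g::topological_group_add set"
  assumes "sigma_compact S" "sigma_compact T"
  shows "sigma_compact ((\<lambda>(x, y). x + y) ` (S \<times> T))"
proof -
  obtain K L where KL: "\<And>n::nat. compact (K n)" "S = (\<Union>n. K n)" "\<And>n::nat. compact (L n)" "T = (\<Union>n. L n)"
    using assms by (auto simp: sigma_compact_def)
  have "(\<lambda>(x, y). x + y) ` (S \<times> T) = (\<Union>(m, n)\<in>UNIV. (\<lambda>(x, y). x + y) ` (K m \<times> L n))"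
    unfolding KL by fastforce
  moreover have "sigma_compact \<dots>"
    using compact_plus KL by (intro sigma_compact_countable_UN) (auto intro!: compact_imp_sigma_compact)
  ultimately show ?thesis by simp
qed

lemma continuous_measurable_sigma_compact_rectangle:
  fixes F :: "'g::t2_space \<times> 'h::t2_space \<Rightarrow> 'b::{real_normed_vector, second_countable_topology}"
  assumes F: "continuous_on UNIV F" and S: "sigma_compact S" and T: "sigma_compact T"
  shows "(\<lambda>z. (indicator S (fst z) * indicator T (snd z)) *\<^sub>R F z) \<in> borel_measurable (borel \<Otimes>\<^sub>M borel)"
proof -
  obtain K L where KL: "\<And>n::nat. compact (K n)" "S = (\<Union>n. K n)" "\<And>n::nat. compact (L n)" "T = (\<Union>n. L n)"
    using S T by (auto simp: sigma_compact_def)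
  show ?thesis
  proof (rule borel_measurable_LIMSEQ_metric)
    show "(\<lambda>z. (indicator (\<Union>i<n. K i) (fst z) * indicator (\<Union>i<n. L i) (snd z)) *\<^sub>R F z) \<in> borel_measurable (borel \<Otimes>\<^sub>M borel)" for n
      using KL by (intro continuous_measurable_compact_rectangle F compact_UN) auto
    show "(\<lambda>n. (indicator (\<Union>i<n. K i) (fst z) * indicator (\<Union>i<n. L i) (snd z)) *\<^sub>R F z) \<longlonglongrightarrow>
        (indicator S (fst z) * indicator T (snd z)) *\<^sub>R F z" for z
      unfolding KL by (intro tendsto_intros LIMSEQ_indicator_UN)
  qed
qed

text \<open>Haar measure need not be sigma-finite, so Tonelli's theorem is only available after restriction
  to sigma-compact sets.\<close>

definition haar_on :: "'g::haar_group set \<Rightarrow> 'g measure"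
  where "haar_on S = density haar (\<lambda>x. ennreal (indicator S x))"

lemma sets_haar_on [simp, measurable_cong]: "sets (haar_on S) = sets borel"
  and space_haar_on [simp]: "space (haar_on S) = UNIV"
  by (simp_all add: haar_on_def)

lemma sigma_finite_haar_on:
  assumes "sigma_compact S"
  shows "sigma_finite_measure (haar_on S)"
proof -
  obtain K where K: "\<And>n::nat. compact (K n)" "S = (\<Union>n. K n)" using assms by (auto simp: sigma_compact_def)
  have S: "S \<in> sets borel" by (rule sigma_compact_borel[OF assms])
  show ?thesis
  proof (rule sigma_finite_measure.intro, intro exI conjI)
    show "countable (insert (- S) (range K))" by simp
    show "insert (- S) (range K) \<subseteq> sets (haar_on S)" using S compact_borel K by auto
    show "\<Union> (insert (- S) (range K)) = space (haar_on S)" using K by auto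
    have "emeasure (haar_on S) (- S) = 0"
    proof -
      have "(\<lambda>x. ennreal (indicator S x) * indicator (- S) x) = (\<lambda>x. 0)"
        by (auto simp: indicator_def)
      then show ?thesis using S by (simp add: haar_on_def emeasure_density)
    qed
    moreover have "emeasure (haar_on S) (K n) \<noteq> \<infinity>" for n
    proof -
      have "emeasure (haar_on S) (K n) = (\<integral>\<^sup>+x. ennreal (indicator S x) * indicator (K n) x \<partial>haar)"
        using S compact_borel[OF K(1)[of n]] by (simp add: haar_on_def emeasure_density)
      also have "\<dots> \<le> (\<integral>\<^sup>+x. indicator (K n) x \<partial>haar)"
        by (intro nn_integral_mono) (auto simp: indicator_def)
      also have "\<dots> = emeasure haar (K n)" using compact_borel[OF K(1)[of n]] by simp
      also have "\<dots> < \<infinity>" by (rule emeasure_haar_compact[OF K(1)])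
      finally show ?thesis by simp
    qed
    ultimately show "\<forall>a\<in>insert (- S) (range K). emeasure (haar_on S) a \<noteq> \<infinity>" by auto
  qed
qed

lemma nn_integral_haar_on:
  assumes "S \<in> sets borel" "f \<in> borel_measurable borel" "\<And>x. x \<notin> S \<Longrightarrow> f x = 0"
  shows "(\<integral>\<^sup>+x. f x \<partial>haar_on S) = (\<integral>\<^sup>+x. f x \<partial>haar)"
proof -
  have "(\<integral>\<^sup>+x. f x \<partial>haar_on S) = (\<integral>\<^sup>+x. ennreal (indicator S x) * f x \<partial>haar)"
    unfolding haar_on_def using assms by (intro nn_integral_density) auto
  also have "\<dots> = (\<integral>\<^sup>+x. f x \<partial>haar)"
    using assms(3) by (intro nn_integral_cong) (auto simp: indicator_def)
  finally show ?thesis .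
qed

lemma
  fixes f :: "'g::haar_group \<Rightarrow> 'b::{banach, second_countable_topology}"
  assumes "S \<in> sets borel" "f \<in> borel_measurable borel" "\<And>x. x \<notin> S \<Longrightarrow> f x = 0"
  shows integrable_haar_on: "integrable (haar_on S) f \<longleftrightarrow> integrable haar f"
    and integral_haar_on: "(\<integral>x. f x \<partial>haar_on S) = (\<integral>x. f x \<partial>haar)"
proof -
  have eq: "(\<lambda>x. indicator S x *\<^sub>R f x) = f" using assms(3) by (auto simp: indicator_def fun_eq_iff)
  show "integrable (haar_on S) f \<longleftrightarrow> integrable haar f"
    unfolding haar_on_def using assms by (subst integrable_density) (auto simp: eq)
  show "(\<integral>x. f x \<partial>haar_on S) = (\<integral>x. f x \<partial>haar)"
    unfolding haar_on_def using assms by (subst integral_density) (auto simp: eq)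
qed

lemma Fubini_haar_nn:
  fixes H :: "'g::haar_group \<times> 'g \<Rightarrow> ennreal"
  assumes H: "H \<in> borel_measurable (borel \<Otimes>\<^sub>M borel)" and S: "sigma_compact S" and T: "sigma_compact T"
    and zero: "\<And>x y. x \<notin> S \<or> y \<notin> T \<Longrightarrow> H (x, y) = 0"
  shows "(\<integral>\<^sup>+x. \<integral>\<^sup>+y. H (x, y) \<partial>haar \<partial>haar) = (\<integral>\<^sup>+y. \<integral>\<^sup>+x. H (x, y) \<partial>haar \<partial>haar)"
    and "(\<lambda>x. \<integral>\<^sup>+y. H (x, y) \<partial>haar) \<in> borel_measurable borel"
proof -
  interpret S: sigma_finite_measure "haar_on S" by (rule sigma_finite_haar_on[OF S])
  interpret T: sigma_finite_measure "haar_on T" by (rule sigma_finite_haar_on[OF T])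
  interpret P: pair_sigma_finite "haar_on S" "haar_on T" ..
  have [measurable]: "H \<in> borel_measurable (haar_on S \<Otimes>\<^sub>M haar_on T)" using H by simp
  have sec: "(\<lambda>y. H (x, y)) \<in> borel_measurable borel" "(\<lambda>x. H (x, y)) \<in> borel_measurable borel" for x y
    using H by auto
  have inner: "(\<integral>\<^sup>+y. H (x, y) \<partial>haar_on T) = (\<integral>\<^sup>+y. H (x, y) \<partial>haar)"
    "(\<integral>\<^sup>+x. H (x, y) \<partial>haar_on S) = (\<integral>\<^sup>+x. H (x, y) \<partial>haar)" for x y
    using zero by (intro nn_integral_haar_on sigma_compact_borel S T sec; auto)+
  have "(\<lambda>x. \<integral>\<^sup>+y. H (x, y) \<partial>haar_on T) \<in> borel_measurable (haar_on S)" by measurable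
  then show m1: "(\<lambda>x. \<integral>\<^sup>+y. H (x, y) \<partial>haar) \<in> borel_measurable borel" by (simp add: inner cong: measurable_cong_sets)
  have "(\<lambda>y. \<integral>\<^sup>+x. H (x, y) \<partial>haar_on S) \<in> borel_measurable (haar_on T)" by measurable
  then have m2: "(\<lambda>y. \<integral>\<^sup>+x. H (x, y) \<partial>haar) \<in> borel_measurable borel" by (simp add: inner cong: measurable_cong_sets)
  have "(\<integral>\<^sup>+y. \<integral>\<^sup>+x. H (x, y) \<partial>haar_on S \<partial>haar_on T) = (\<integral>\<^sup>+x. \<integral>\<^sup>+y. H (x, y) \<partial>haar_on T \<partial>haar_on S)"
    by (rule P.Fubini') simp
  moreover have "(\<integral>\<^sup>+y. \<integral>\<^sup>+x. H (x, y) \<partial>haar \<partial>haar_on T) = (\<integral>\<^sup>+y. \<integral>\<^sup>+x. H (x, y) \<partial>haar \<partial>haar)"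
    using zero by (intro nn_integral_haar_on sigma_compact_borel T m2) simp
  moreover have "(\<integral>\<^sup>+x. \<integral>\<^sup>+y. H (x, y) \<partial>haar \<partial>haar_on S) = (\<integral>\<^sup>+x. \<integral>\<^sup>+y. H (x, y) \<partial>haar \<partial>haar)"
    using zero by (intro nn_integral_haar_on sigma_compact_borel S m1) simp
  ultimately show "(\<integral>\<^sup>+x. \<integral>\<^sup>+y. H (x, y) \<partial>haar \<partial>haar) = (\<integral>\<^sup>+y. \<integral>\<^sup>+x. H (x, y) \<partial>haar \<partial>haar)"
    by (simp add: inner)
qed

lemma
  fixes H :: "'g::haar_group \<times> 'g \<Rightarrow> 'b::{banach, second_countable_topology}"
  assumes H: "H \<in> borel_measurable (borel \<Otimes>\<^sub>M borel)" and S: "sigma_compact S" and T: "sigma_compact T"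
    and zero: "\<And>x y. x \<notin> S \<or> y \<notin> T \<Longrightarrow> H (x, y) = 0"
    and fin: "(\<integral>\<^sup>+x. \<integral>\<^sup>+y. norm (H (x, y)) \<partial>haar \<partial>haar) < \<infinity>"
  shows Fubini_haar_AE_fst: "AE x in haar. integrable haar (\<lambda>y. H (x, y))"
    and Fubini_haar_integrable_fst: "integrable haar (\<lambda>x. \<integral>y. H (x, y) \<partial>haar)"
    and Fubini_haar: "(\<integral>x. \<integral>y. H (x, y) \<partial>haar \<partial>haar) = (\<integral>y. \<integral>x. H (x, y) \<partial>haar \<partial>haar)"
proof -
  interpret S: sigma_finite_measure "haar_on S" by (rule sigma_finite_haar_on[OF S])
  interpret T: sigma_finite_measure "haar_on T" by (rule sigma_finite_haar_on[OF T])
  interpret P: pair_sigma_finite "haar_on S" "haar_on T" ..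
  have Hm [measurable]: "H \<in> borel_measurable (haar_on S \<Otimes>\<^sub>M haar_on T)" using H by simp
  have sec: "(\<lambda>y. H (x, y)) \<in> borel_measurable borel" "(\<lambda>x. H (x, y)) \<in> borel_measurable borel" for x y
    using H by auto
  note Sb = sigma_compact_borel[OF S] and Tb = sigma_compact_borel[OF T]
  have nn: "(\<integral>\<^sup>+y. norm (H (x, y)) \<partial>haar_on T) = (\<integral>\<^sup>+y. norm (H (x, y)) \<partial>haar)" for x
    using zero sec by (intro nn_integral_haar_on Tb) auto
  have "(\<lambda>x. \<integral>\<^sup>+y. norm (H (x, y)) \<partial>haar) \<in> borel_measurable borel"
    using H zero by (intro Fubini_haar_nn(2)[OF _ S T]) auto
  then have "(\<integral>\<^sup>+x. \<integral>\<^sup>+y. norm (H (x, y)) \<partial>haar \<partial>haar_on S) = (\<integral>\<^sup>+x. \<integral>\<^sup>+y. norm (H (x, y)) \<partial>haar \<partial>haar)"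
    using zero by (intro nn_integral_haar_on Sb) auto
  then have "(\<integral>\<^sup>+z. norm (H z) \<partial>(haar_on S \<Otimes>\<^sub>M haar_on T)) < \<infinity>"
    using fin by (subst T.nn_integral_fst[symmetric]) (auto simp: nn)
  then have int: "integrable (haar_on S \<Otimes>\<^sub>M haar_on T) H" by (simp add: integrable_iff_bounded)
  have inner: "integrable (haar_on T) (\<lambda>y. H (x, y)) \<longleftrightarrow> integrable haar (\<lambda>y. H (x, y))"
    "integrable (haar_on S) (\<lambda>x. H (x, y)) \<longleftrightarrow> integrable haar (\<lambda>x. H (x, y))"
    "(\<integral>y. H (x, y) \<partial>haar_on T) = (\<integral>y. H (x, y) \<partial>haar)"
    "(\<integral>x. H (x, y) \<partial>haar_on S) = (\<integral>x. H (x, y) \<partial>haar)" for x y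
    using zero by (intro integrable_haar_on integral_haar_on Sb Tb sec; auto)+
  \<comment> \<open>An almost everywhere statement for \<open>haar_on A\<close> says nothing outside
    \<open>A\<close>, so the property must hold pointwise there.\<close>
  have AE_on: "AE x in haar. P x" if "AE x in haar_on A. P x" "A \<in> sets borel" "\<And>x. x \<notin> A \<Longrightarrow> P x" for A and P :: "'g \<Rightarrow> bool"
  proof -
    have "AE x in haar. 0 < ennreal (indicator A x) \<longrightarrow> P x"
      using that(1,2) unfolding haar_on_def by (subst (asm) AE_density) auto
    then show ?thesis by eventually_elim (use that(3) in \<open>auto simp: indicator_def split: if_splits\<close>)
  qed
  show "AE x in haar. integrable haar (\<lambda>y. H (x, y))"
    using P.AE_integrable_fst'[OF int] zero by (intro AE_on[OF _ Sb]) (auto simp: inner)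
  have i1: "integrable (haar_on S) (\<lambda>x. \<integral>y. H (x, y) \<partial>haar)"
    using P.integrable_fst'[OF int] by (simp add: inner)
  have i2: "integrable (haar_on T) (\<lambda>y. \<integral>x. H (x, y) \<partial>haar)"
    using P.integrable_snd[of "\<lambda>x y. H (x, y)"] int by (simp add: inner)
  have m1: "(\<lambda>x. \<integral>y. H (x, y) \<partial>haar) \<in> borel_measurable borel" "(\<lambda>y. \<integral>x. H (x, y) \<partial>haar) \<in> borel_measurable borel"
    using borel_measurable_integrable[OF i1] borel_measurable_integrable[OF i2] by (simp_all cong: measurable_cong_sets)
  have z1: "(\<integral>y. H (x, y) \<partial>haar) = 0" if "x \<notin> S" for x using zero that by simp
  have z2: "(\<integral>x. H (x, y) \<partial>haar) = 0" if "y \<notin> T" for y using zero that by simp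
  show "integrable haar (\<lambda>x. \<integral>y. H (x, y) \<partial>haar)"
    using integrable_haar_on[OF Sb m1(1) z1] i1 by simp
  have "(\<integral>y. \<integral>x. H (x, y) \<partial>haar_on S \<partial>haar_on T) = (\<integral>x. \<integral>y. H (x, y) \<partial>haar_on T \<partial>haar_on S)"
    using P.Fubini_integral[of "\<lambda>x y. H (x, y)"] int by simp
  then show "(\<integral>x. \<integral>y. H (x, y) \<partial>haar \<partial>haar) = (\<integral>y. \<integral>x. H (x, y) \<partial>haar \<partial>haar)"
    using integral_haar_on[OF Sb m1(1) z1] integral_haar_on[OF Tb m1(2) z2] by (simp add: inner)
qed

subsection \<open>The modular function\<close>

text \<open>Finitely many translates of a null open set would cover any compact set, and by inner
  regularity the whole group would be null.\<close>

lemma emeasure_haar_open_pos: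
  fixes U :: "'g::haar_group set"
  assumes "open U" "x \<in> U"
  shows "emeasure haar U \<noteq> 0"
proof
  assume null: "emeasure haar U = 0"
  have "emeasure haar K = 0" if K: "compact K" for K :: "'g set"
  proof -
    have tr: "open ((+) t ` U)" for t by (rule open_homeomorphism_image[OF homeomorphism_add_left assms(1)])
    have "K \<subseteq> (\<Union>t. (+) t ` U)"
    proof
      fix k assume "k \<in> K"
      have "k = (k + - x) + x" by (simp add: add.assoc)
      then show "k \<in> (\<Union>t. (+) t ` U)" using assms(2) by blast
    qed
    then obtain I where "I \<subseteq> UNIV" and I: "finite I" "K \<subseteq> (\<Union>t\<in>I. (+) t ` U)"
      by (rule compactE_image[OF K tr])
    have "emeasure haar K \<le> emeasure haar (\<Union>t\<in>I. (+) t ` U)"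
      using I tr by (intro emeasure_mono) (auto intro!: borel_open)
    also have "\<dots> \<le> (\<Sum>t\<in>I. emeasure haar ((+) t ` U))"
      using I tr by (intro emeasure_subadditive_finite) (auto intro!: borel_open)
    also have "\<dots> = 0" using null assms(1) by (simp add: emeasure_haar_translate)
    finally show ?thesis by simp
  qed
  then have "emeasure (haar :: 'g measure) UNIV = 0"
    by (subst emeasure_haar_inner) (auto intro!: antisym SUP_least)
  then show False using emeasure_haar_UNIV by blast
qed

lemma integral_Cc_pos:
  fixes f :: "'g::haar_group \<Rightarrow> real"
  assumes f: "f \<in> Cc" and nonneg: "\<And>x. 0 \<le> f x" and pos: "0 < f a"
  shows "0 < (\<integral>x. f x \<partial>haar)"
proof (rule ccontr)
  assume "\<not> ?thesis"
  then have "(\<integral>x. f x \<partial>haar) = 0"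
    using nonneg by (intro antisym integral_nonneg_AE) auto
  then have "AE x in haar. f x = 0"
    using integral_nonneg_eq_0_iff_AE[OF Cc_integrable[OF f]] nonneg by auto
  moreover have op: "open {x. 0 < f x}"
    using open_Collect_less[OF continuous_on_const Cc_continuous[OF f]] by simp
  ultimately have "{x. 0 < f x} \<in> null_sets haar"
    by (subst AE_iff_null_sets) (auto elim!: eventually_mono)
  then have "emeasure haar {x. 0 < f x} = 0" by auto
  then show False using emeasure_haar_open_pos[OF op, of a] pos by simp
qed

lemma Cc_cmult: "f \<in> Cc \<Longrightarrow> (\<lambda>x. c * f x) \<in> Cc" for f :: "_ \<Rightarrow> real"
  by (auto simp: Cc_def intro!: continuous_intros)

text \<open>An approximate delta function at \<open>0\<close>. The symmetry replaces
  \<open>u (- z)\<close> by \<open>u z\<close> after substitutions, so that no modular factor from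
  inverting the integration variable appears.\<close>

definition bump :: "'g::haar_group set \<Rightarrow> ('g \<Rightarrow> real) \<Rightarrow> bool"
  where "bump V u \<longleftrightarrow> u \<in> Cc \<and> (\<forall>x. 0 \<le> u x) \<and> (\<forall>x. u (- x) = u x) \<and> (\<forall>x. x \<notin> V \<longrightarrow> u x = 0) \<and>
    (\<integral>x. u x \<partial>haar) = 1"

lemma bumpD:
  assumes "bump V u"
  shows "u \<in> Cc" "0 \<le> u x" "u (- x) = u x" "x \<notin> V \<Longrightarrow> u x = 0" "(\<integral>x. u x \<partial>haar) = 1"
  using assms by (auto simp: bump_def)

lemma bump_mono: "bump V u \<Longrightarrow> V \<subseteq> W \<Longrightarrow> bump W u"
  by (auto simp: bump_def)

lemma ex_bump:
  fixes V :: "'g::haar_group set"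
  assumes "open V" "0 \<in> V"
  shows "\<exists>u. bump V u"
proof -
  define V' where "V' = V \<inter> uminus ` V"
  have V': "open V'" "0 \<in> V'"
    using assms open_homeomorphism_image[OF homeomorphism_uminus assms(1)]
    by (auto simp: V'_def intro!: image_eqI[of _ _ 0])
  have "\<exists>h::'g \<Rightarrow> real. h \<in> Cc \<and> (\<forall>x. 0 \<le> h x \<and> h x \<le> 1) \<and> (\<forall>x\<in>{0}. h x = 1) \<and> (\<forall>x. x \<notin> V' \<longrightarrow> h x = 0)"
    by (rule Urysohn_Cc) (use V' in auto)
  then obtain h :: "'g \<Rightarrow> real" where h: "h \<in> Cc" "\<And>x. 0 \<le> h x" "h 0 = 1" "\<And>x. x \<notin> V' \<Longrightarrow> h x = 0"
    by auto
  define w where "w x = h x + h (- x)" for x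
  have w: "w \<in> Cc"
    unfolding w_def[abs_def] by (intro Cc_add h(1) Cc_compose[OF h(1) homeomorphism_uminus])
  have wpos: "0 < (\<integral>x. w x \<partial>haar)"
    by (rule integral_Cc_pos[OF w, of 0]) (use h in \<open>auto simp: w_def\<close>)
  define u where "u x = (1 / (\<integral>x. w x \<partial>haar)) * w x" for x
  show ?thesis
    unfolding bump_def
  proof (intro exI[of _ u] conjI allI impI)
    show "u \<in> Cc" unfolding u_def[abs_def] by (rule Cc_cmult[OF w])
    show "0 \<le> u x" for x using h wpos by (simp add: u_def w_def)
    show "u (- x) = u x" for x by (simp add: u_def w_def add.commute)
    show "u x = 0" if "x \<notin> V" for x
    proof -
      have "- x \<notin> uminus ` V" using that by auto
      then have "h x = 0" "h (- x) = 0" using that by (auto intro!: h(4) simp: V'_def)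
      then show ?thesis by (simp add: u_def w_def)
    qed
    show "(\<integral>x. u x \<partial>haar) = 1" using wpos by (simp add: u_def)
  qed
qed

lemma
  fixes H :: "'g::haar_group \<times> 'g \<Rightarrow> 'b::{banach, second_countable_topology}"
  assumes H: "continuous_on UNIV H" and S: "compact S" and T: "compact T"
    and zero: "\<And>x y. x \<notin> S \<or> y \<notin> T \<Longrightarrow> H (x, y) = 0"
  shows compact_support_measurable: "H \<in> borel_measurable (borel \<Otimes>\<^sub>M borel)"
    and compact_support_finite: "(\<integral>\<^sup>+x. \<integral>\<^sup>+y. norm (H (x, y)) \<partial>haar \<partial>haar) < \<infinity>"
proof -
  have "(\<lambda>z. (indicator S (fst z) * indicator T (snd z)) *\<^sub>R H z) = H"
    using zero by (fastforce simp: indicator_def fun_eq_iff)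
  then show "H \<in> borel_measurable (borel \<Otimes>\<^sub>M borel)"
    using continuous_measurable_compact_rectangle[OF H S T] by simp
  have "compact (H ` (S \<times> T))"
    using H by (intro compact_continuous_image compact_Times S T) (auto intro: continuous_on_subset)
  then obtain B where B: "0 < B" "\<forall>z\<in>S \<times> T. norm (H z) \<le> B"
    using compact_imp_bounded bounded_pos by (metis image_eqI)
  have "(\<integral>\<^sup>+x. \<integral>\<^sup>+y. norm (H (x, y)) \<partial>haar \<partial>haar) \<le> (\<integral>\<^sup>+x. \<integral>\<^sup>+y. ennreal B * indicator S x * indicator T y \<partial>haar \<partial>haar)"
  proof (intro nn_integral_mono)
    fix x y
    show "ennreal (norm (H (x, y))) \<le> ennreal B * indicator S x * indicator T y"
      using B zero[of x y] by (cases "x \<in> S \<and> y \<in> T") (auto simp: ennreal_leI)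
  qed
  also have "\<dots> = ennreal B * emeasure haar S * emeasure haar T"
    using compact_borel[OF S] compact_borel[OF T]
    by (simp add: nn_integral_cmult nn_integral_multc mult_ac)
  also have "\<dots> < \<infinity>" using emeasure_haar_compact[OF S] emeasure_haar_compact[OF T]
    by (simp add: ennreal_mult_less_top)
  finally show "(\<integral>\<^sup>+x. \<integral>\<^sup>+y. norm (H (x, y)) \<partial>haar \<partial>haar) < \<infinity>" .
qed

lemma compact_image_add_right: "compact K \<Longrightarrow> compact ((\<lambda>x. x + a) ` K)" for a :: "'g::topological_group_add"
  by (intro compact_continuous_image continuous_intros)

text \<open>Turns a pointwise bound on a fixed compact set into an \<open>L^1\<close> bound. The
  \<open>1\<close> added in \<open>m\<close> covers the case that \<open>C\<close> is null.\<close>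

lemma ex_small_multiple_indicator:
  fixes C :: "'g::haar_group set"
  assumes C: "compact C" and \<epsilon>: "0 < \<epsilon>"
  shows "\<exists>\<delta>>0. \<forall>F::'g \<Rightarrow> real. integrable haar F \<longrightarrow> (\<forall>x. F x \<le> \<delta> * indicator C x) \<longrightarrow> (\<integral>x. F x \<partial>haar) \<le> \<epsilon>"
proof -
  define m where "m = (\<integral>x. indicator C x \<partial>(haar :: 'g measure)) + (1::real)"
  have m: "0 < m" unfolding m_def by (intro add_nonneg_pos integral_nonneg_AE) auto
  have "(\<integral>x. F x \<partial>haar) \<le> \<epsilon>" if F: "integrable haar F" "\<And>x. F x \<le> \<epsilon> / m * indicator C x" for F :: "'g \<Rightarrow> real"
  proof -
    have "(\<integral>x. F x \<partial>haar) \<le> (\<integral>x. \<epsilon> / m * indicator C x \<partial>haar)"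
      by (intro integral_mono F) (use integrable_indicator_compact[OF C] in auto)
    also have "\<dots> = \<epsilon> / m * (m - 1)" by (simp add: m_def)
    also have "\<dots> \<le> \<epsilon> / m * m" using \<epsilon> m by (intro mult_left_mono) auto
    also have "\<dots> = \<epsilon>" using m by simp
    finally show ?thesis .
  qed
  then show ?thesis using \<epsilon> m by (intro exI[of _ "\<epsilon> / m"]) simp
qed

text \<open>Integrate \<open>f(y) u(y\<^sup>-\<^sup>1 x s)\<close> over \<open>x\<close> and \<open>y\<close> in both orders; for \<open>u\<close> concentrated near the
  identity the integral over \<open>y\<close> is close to \<open>f(x s)\<close>.\<close>

lemma right_translate_estimate:
  fixes f :: "'g::haar_group \<Rightarrow> real"
  assumes f: "f \<in> Cc" and \<epsilon>: "0 < \<epsilon>"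
  shows "\<exists>V. open V \<and> 0 \<in> V \<and> (\<forall>u. bump V u \<longrightarrow>
    \<bar>(\<integral>x. f x \<partial>haar) * (\<integral>x. u (x + s) \<partial>haar) - (\<integral>x. f (x + s) \<partial>haar)\<bar> \<le> \<epsilon>)"
proof -
  obtain C where C: "compact C" "\<And>\<epsilon>. 0 < \<epsilon> \<Longrightarrow> \<exists>V. open V \<and> 0 \<in> V \<and> (\<forall>v\<in>V. \<forall>x. norm (f (x + v) - f x) \<le> \<epsilon> * indicator C x)"
    using Cc_uniformly_continuous_right[OF f] by blast
  obtain K where K: "compact K" "\<And>x. x \<notin> K \<Longrightarrow> f x = 0" using Cc_support[OF f] by blast
  define C' where "C' = (\<lambda>x. x + - s) ` C"
  have C': "compact C'" unfolding C'_def by (rule compact_image_add_right[OF C(1)])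
  have indC: "indicator C (x + s) = (indicator C' x :: real)" for x
    by (auto simp: C'_def indicator_def image_iff add.assoc intro!: bexI[of _ "x + s"])
  obtain \<delta> where \<delta>: "0 < \<delta>" "\<And>F::'g \<Rightarrow> real. integrable haar F \<Longrightarrow> (\<forall>x. F x \<le> \<delta> * indicator C' x) \<Longrightarrow> (\<integral>x. F x \<partial>haar) \<le> \<epsilon>"
    using ex_small_multiple_indicator[OF C' \<epsilon>] by blast
  obtain V where V0: "open V" "0 \<in> V" and V: "\<forall>v\<in>V. \<forall>x. norm (f (x + v) - f x) \<le> \<delta> * indicator C x"
    using C(2)[OF \<delta>(1)] by blast
  have fs: "(\<lambda>x. f (x + s)) \<in> Cc" by (rule Cc_compose[OF f homeomorphism_add_right])
  have main: "\<bar>(\<integral>x. f x \<partial>haar) * (\<integral>x. u (x + s) \<partial>haar) - (\<integral>x. f (x + s) \<partial>haar)\<bar> \<le> \<epsilon>" if "bump V u" for u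
  proof -
    note u = bumpD[OF that]
    obtain L where L: "compact L" "\<And>x. x \<notin> L \<Longrightarrow> u x = 0" using Cc_support[OF u(1)] by blast
    define H where "H = (\<lambda>(x, y). f y * u (- y + (x + s)))"
    define S where "S = (\<lambda>x. x + - s) ` ((\<lambda>(x, y). x + y) ` (K \<times> L))"
    have S: "compact S" unfolding S_def by (intro compact_image_add_right compact_plus K L)
    have Hc: "continuous_on UNIV H" unfolding H_def case_prod_unfold
      by (intro continuous_on_mult continuous_on_compose2[OF Cc_continuous[OF f]] continuous_on_compose2[OF Cc_continuous[OF u(1)]] continuous_intros) auto
    have Hz: "H (x, y) = 0" if "x \<notin> S \<or> y \<notin> K" for x y
    proof (rule ccontr)
      assume "H (x, y) \<noteq> 0"
      then have "y \<in> K" "- y + (x + s) \<in> L" using K(2) L(2) by (auto simp: H_def)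
      then have "y + (- y + (x + s)) + - s \<in> S" unfolding S_def by force
      then have "x \<in> S" by (simp add: add.assoc)
      then show False using that \<open>y \<in> K\<close> by blast
    qed
    note F = compact_support_measurable[OF Hc S K(1) Hz] compact_imp_sigma_compact[OF S] compact_imp_sigma_compact[OF K(1)] Hz
      compact_support_finite[OF Hc S K(1) Hz]
    have swap: "(\<integral>x. \<integral>y. H (x, y) \<partial>haar \<partial>haar) = (\<integral>y. \<integral>x. H (x, y) \<partial>haar \<partial>haar)"
      by (rule Fubini_haar[OF F])
    have int1: "integrable haar (\<lambda>x. \<integral>y. H (x, y) \<partial>haar)" by (rule Fubini_haar_integrable_fst[OF F])
    have us: "(\<lambda>x. u (x + s)) \<in> Cc" by (rule Cc_compose[OF u(1) homeomorphism_add_right])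
    have "(\<integral>x. H (x, y) \<partial>haar) = f y * (\<integral>x. u (x + s) \<partial>haar)" for y
      using integral_haar_translate[of "\<lambda>x. u (x + s)" "- y"] Cc_continuous[OF us]
      by (simp add: H_def add.assoc borel_measurable_continuous)
    then have snd: "(\<integral>y. \<integral>x. H (x, y) \<partial>haar \<partial>haar) = (\<integral>x. f x \<partial>haar) * (\<integral>x. u (x + s) \<partial>haar)"
      by simp
    \<comment> \<open>The substitution \<open>y = x + s + z\<close> and the symmetry of
      \<open>u\<close> turn the inner integral into an average of \<open>f\<close> near
      \<open>x + s\<close>.\<close>
    have fst: "(\<integral>y. H (x, y) \<partial>haar) = (\<integral>z. f (x + s + z) * u z \<partial>haar)" for x
    proof -
      have "(\<lambda>y. H (x, y)) \<in> borel_measurable borel" using F(1) by auto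
      from integral_haar_translate[OF this, of "x + s"]
      have "(\<integral>y. H (x, y) \<partial>haar) = (\<integral>z. H (x, x + s + z) \<partial>haar)" by simp
      moreover have "H (x, x + s + z) = f (x + s + z) * u z" for z
      proof -
        have "- (x + s + z) + (x + s) = - z" by (simp only: minus_add add.assoc) (simp flip: add.assoc)
        then show ?thesis by (simp add: H_def u(3))
      qed
      ultimately show ?thesis by simp
    qed
    have est: "\<bar>(\<integral>y. H (x, y) \<partial>haar) - f (x + s)\<bar> \<le> \<delta> * indicator C' x" for x
    proof -
      have i1: "integrable haar (\<lambda>z. f (x + s + z) * u z)"
      proof (rule Cc_integrable, rule CcI[OF _ L(1)])
        show "continuous_on UNIV (\<lambda>z. f (x + s + z) * u z)"
          by (intro continuous_on_mult continuous_on_compose2[OF Cc_continuous[OF f]] Cc_continuous[OF u(1)] continuous_intros) auto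
      qed (use L in auto)
      have iu: "integrable haar u" by (rule Cc_integrable[OF u(1)])
      have "(\<integral>y. H (x, y) \<partial>haar) - f (x + s) = (\<integral>z. f (x + s + z) * u z - f (x + s) * u z \<partial>haar)"
        using i1 iu u(5) by (simp add: fst)
      also have "\<bar>\<dots>\<bar> \<le> (\<integral>z. \<bar>f (x + s + z) * u z - f (x + s) * u z\<bar> \<partial>haar)"
        by (rule integral_abs_bound)
      also have "\<dots> \<le> (\<integral>z. \<delta> * indicator C' x * u z \<partial>haar)"
      proof (rule integral_mono)
        show "integrable haar (\<lambda>z. \<bar>f (x + s + z) * u z - f (x + s) * u z\<bar>)" using i1 iu by auto
        show "integrable haar (\<lambda>z. \<delta> * indicator C' x * u z)" using iu by auto
        fix z
        show "\<bar>f (x + s + z) * u z - f (x + s) * u z\<bar> \<le> \<delta> * indicator C' x * u z"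
        proof (cases "z \<in> V")
          case True
          then have "norm (f (x + s + z) - f (x + s)) \<le> \<delta> * indicator C (x + s)" using V by blast
          then have "\<bar>f (x + s + z) - f (x + s)\<bar> \<le> \<delta> * indicator C' x" by (simp add: indC)
          then have "\<bar>f (x + s + z) - f (x + s)\<bar> * u z \<le> \<delta> * indicator C' x * u z" using u(2) by (rule mult_right_mono)
          then show ?thesis using u(2)[of z] by (simp add: abs_mult flip: left_diff_distrib)
        qed (simp add: u(4))
      qed
      also have "\<dots> = \<delta> * indicator C' x" using u(5) by simp
      finally show ?thesis .
    qed
    have ifs: "integrable haar (\<lambda>x. f (x + s))" by (rule Cc_integrable[OF fs])
    have "(\<integral>x. f x \<partial>haar) * (\<integral>x. u (x + s) \<partial>haar) - (\<integral>x. f (x + s) \<partial>haar) =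
        (\<integral>x. (\<integral>y. H (x, y) \<partial>haar) - f (x + s) \<partial>haar)"
      using int1 ifs by (simp add: swap snd)
    also have "\<bar>\<dots>\<bar> \<le> (\<integral>x. \<bar>(\<integral>y. H (x, y) \<partial>haar) - f (x + s)\<bar> \<partial>haar)" by (rule integral_abs_bound)
    also have "\<dots> \<le> \<epsilon>" by (rule \<delta>(2)) (use int1 ifs est in auto)
    finally show ?thesis .
  qed
  show ?thesis by (intro exI[of _ V] conjI V0 allI impI main)
qed

lemma abs_cross_le: "\<bar>a * y - b * x\<bar> \<le> \<bar>b\<bar> * \<bar>a * j - x\<bar> + \<bar>a\<bar> * \<bar>b * j - y\<bar>" for a b x y j :: real
proof -
  have "a * y - b * x = b * (a * j - x) - a * (b * j - y)" by (simp add: algebra_simps)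
  also have "\<bar>\<dots>\<bar> \<le> \<bar>b\<bar> * \<bar>a * j - x\<bar> + \<bar>a\<bar> * \<bar>b * j - y\<bar>"
    by (rule order_trans[OF abs_triangle_ineq4]) (simp only: abs_mult order_refl)
  finally show ?thesis .
qed

text \<open>Writing \<open>I\<close> and \<open>J\<close> for the integral and the integral of the
  translate, \<open>right_translate_estimate\<close> gives \<open>J f\<close> close to
  \<open>I f * J u\<close> and \<open>J g\<close> close to \<open>I g * J u\<close> for a common
  bump \<open>u\<close>. Eliminating \<open>J u\<close> yields \<open>I f * J g = I g * J f\<close>,
  so the ratio of \<open>J\<close> to \<open>I\<close> is a constant.\<close>

lemma ex_modular:
  fixes s :: "'g::haar_group"
  shows "\<exists>c>0. \<forall>f::'g \<Rightarrow> real. f \<in> Cc \<longrightarrow> (\<integral>x. f (x + s) \<partial>haar) = c * (\<integral>x. f x \<partial>haar)"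
proof -
  let ?I = "\<lambda>f::'g \<Rightarrow> real. \<integral>x. f x \<partial>haar" and ?J = "\<lambda>f::'g \<Rightarrow> real. \<integral>x. f (x + s) \<partial>haar"
  have eq: "?I f * ?J g = ?I g * ?J f" if f: "f \<in> Cc" and g: "g \<in> Cc" for f g
  proof -
    have "\<bar>?I f * ?J g - ?I g * ?J f\<bar> \<le> 0 + \<eta>" if "\<eta> > 0" for \<eta>
    proof -
      define M where "M = \<bar>?I f\<bar> + \<bar>?I g\<bar> + 1"
      have M: "M > 0" by (simp add: M_def add_nonneg_pos)
      define \<epsilon> where "\<epsilon> = \<eta> / M"
      have \<epsilon>: "\<epsilon> > 0" using that M by (simp add: \<epsilon>_def)
      obtain V where V: "open V" "0 \<in> V" "\<forall>u. bump V u \<longrightarrow> \<bar>?I f * ?J u - ?J f\<bar> \<le> \<epsilon>"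
        using right_translate_estimate[OF f \<epsilon>] by blast
      obtain V' where V': "open V'" "0 \<in> V'" "\<forall>u. bump V' u \<longrightarrow> \<bar>?I g * ?J u - ?J g\<bar> \<le> \<epsilon>"
        using right_translate_estimate[OF g \<epsilon>] by blast
      obtain u where u: "bump (V \<inter> V') u" using ex_bump[of "V \<inter> V'"] V V' by blast
      have 1: "\<bar>?I f * ?J u - ?J f\<bar> \<le> \<epsilon>" using V(3) bump_mono[OF u] by simp
      have 2: "\<bar>?I g * ?J u - ?J g\<bar> \<le> \<epsilon>" using V'(3) bump_mono[OF u] by simp
      have "\<bar>?I f * ?J g - ?I g * ?J f\<bar> \<le> \<bar>?I g\<bar> * \<bar>?I f * ?J u - ?J f\<bar> + \<bar>?I f\<bar> * \<bar>?I g * ?J u - ?J g\<bar>"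
        by (rule abs_cross_le)
      also have "\<dots> \<le> \<bar>?I g\<bar> * \<epsilon> + \<bar>?I f\<bar> * \<epsilon>"
        by (rule add_mono[OF mult_left_mono[OF 1 abs_ge_zero] mult_left_mono[OF 2 abs_ge_zero]])
      also have "\<dots> = \<epsilon> * (M - 1)" by (simp add: M_def algebra_simps)
      also have "\<dots> \<le> \<epsilon> * M" using \<epsilon> by (intro mult_left_mono) auto
      also have "\<dots> = \<eta>" using M by (simp add: \<epsilon>_def)
      finally show ?thesis by simp
    qed
    then have "\<bar>?I f * ?J g - ?I g * ?J f\<bar> \<le> 0" by (rule field_le_epsilon)
    then show ?thesis by simp
  qed
  obtain u :: "'g \<Rightarrow> real" where "bump UNIV u" using ex_bump[of UNIV] by auto
  note u = bumpD(1,2,5)[OF this]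
  have "\<exists>a. 0 < u a"
  proof (rule ccontr)
    assume "\<nexists>a. 0 < u a"
    then have "u a = 0" for a using u(2)[of a] by (meson antisym not_less)
    then show False using u(3) by simp
  qed
  then obtain a where a: "0 < u a" by blast
  have "0 < ?J u"
    using integral_Cc_pos[OF Cc_compose[OF u(1) homeomorphism_add_right[of s]] u(2), of "a + - s"] a
    by (simp add: add.assoc)
  then show ?thesis using eq[OF u(1)] u(3) by (intro exI[of _ "?J u"]) (simp add: mult.commute)
qed

text \<open>The modular function, normalised so that translating a set by \<open>- s\<close> on the
  right multiplies its measure by \<open>modular s\<close>; some texts use the reciprocal.\<close>

definition modular :: "'g::haar_group \<Rightarrow> real"
  where "modular s = (SOME c. c > 0 \<and> (\<forall>f::'g \<Rightarrow> real. f \<in> Cc \<longrightarrow> (\<integral>x. f (x + s) \<partial>haar) = c * (\<integral>x. f x \<partial>haar)))"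

lemma
  fixes s :: "'g::haar_group"
  shows modular_pos: "0 < modular s"
    and integral_Cc_right_translate: "f \<in> Cc \<Longrightarrow> (\<integral>x. f (x + s) \<partial>haar) = modular s * (\<integral>x. f x \<partial>haar)"
proof -
  have "modular s > 0 \<and> (\<forall>f::'g \<Rightarrow> real. f \<in> Cc \<longrightarrow> (\<integral>x. f (x + s) \<partial>haar) = modular s * (\<integral>x. f x \<partial>haar))"
    unfolding modular_def using ex_modular[of s] by (rule someI_ex)
  then show "0 < modular s" "f \<in> Cc \<Longrightarrow> (\<integral>x. f (x + s) \<partial>haar) = modular s * (\<integral>x. f x \<partial>haar)" by auto
qed

lemma modular_add: "modular (s + t) = modular s * modular t" for s :: "'g::haar_group"
proof -
  obtain u :: "'g \<Rightarrow> real" where "bump UNIV u" using ex_bump[of UNIV] by auto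
  note u = bumpD(1,5)[OF this]
  have "modular (s + t) = (\<integral>x. u (x + (s + t)) \<partial>haar)"
    using integral_Cc_right_translate[OF u(1), of "s + t"] u(2) by simp
  also have "\<dots> = modular s * (\<integral>x. u (x + t) \<partial>haar)"
    using integral_Cc_right_translate[OF Cc_compose[OF u(1) homeomorphism_add_right[of t]], of s]
    by (simp add: add.assoc)
  also have "\<dots> = modular s * modular t"
    using integral_Cc_right_translate[OF u(1), of t] u(2) by simp
  finally show ?thesis .
qed

lemma modular_zero [simp]: "modular (0::'g::haar_group) = 1"
  using modular_add[of "0::'g" 0] modular_pos[of "0::'g"] by simp

lemma modular_uminus: "modular (- s) * modular s = 1" for s :: "'g::haar_group"
  by (simp flip: modular_add)

lemma open_right_translate: "open U \<Longrightarrow> open ((\<lambda>x. x + s) -` U)" for s :: "'g::topological_group_add"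
  by (intro open_vimage continuous_intros)

lemma right_translate_vimage_uminus: "(\<lambda>x. x + - s) -` (\<lambda>x. x + s) -` U = U" for s :: "'g::group_add"
  by (simp add: vimage_def add.assoc)

text \<open>Urysohn functions and inner regularity carry the relation from \<open>Cc\<close> to open
  sets as an inequality; the reverse one will come from applying it to \<open>- s\<close>.\<close>

lemma emeasure_haar_right_translate_open:
  fixes U :: "'g::haar_group set"
  assumes U: "open U"
  shows "ennreal (modular s) * emeasure haar U \<le> emeasure haar ((\<lambda>x. x + s) -` U)"
proof -
  note U' = open_right_translate[OF U, of s]
  have "ennreal (modular s) * emeasure haar K \<le> emeasure haar ((\<lambda>x. x + s) -` U)"
    if K: "compact K" "K \<subseteq> U" for K
  proof -
    obtain f :: "'g \<Rightarrow> real" where f: "f \<in> Cc" "\<And>x. 0 \<le> f x \<and> f x \<le> 1" "\<And>x. x \<in> K \<Longrightarrow> f x = 1" "\<And>x. x \<notin> U \<Longrightarrow> f x = 0"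
      using Urysohn_Cc[OF K(1) U K(2)] by blast
    note fs = Cc_compose[OF f(1) homeomorphism_add_right[of s]]
    have "emeasure haar K = (\<integral>\<^sup>+x. indicator K x \<partial>haar)" using compact_borel[OF K(1)] by simp
    also have "\<dots> \<le> (\<integral>\<^sup>+x. ennreal (f x) \<partial>haar)"
      using f by (intro nn_integral_mono) (auto simp: indicator_def)
    also have "\<dots> = ennreal (\<integral>x. f x \<partial>haar)"
      using Cc_integrable[OF f(1)] f(2) by (intro nn_integral_eq_integral) auto
    finally have "ennreal (modular s) * emeasure haar K \<le> ennreal (modular s) * ennreal (\<integral>x. f x \<partial>haar)"
      by (rule mult_left_mono) simp
    also have "\<dots> = ennreal (\<integral>x. f (x + s) \<partial>haar)"
      using modular_pos[of s] f(2) by (simp add: integral_Cc_right_translate[OF f(1)] ennreal_mult integral_nonneg_AE)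
    also have "\<dots> = (\<integral>\<^sup>+x. ennreal (f (x + s)) \<partial>haar)"
      using Cc_integrable[OF fs] f(2) by (intro nn_integral_eq_integral[symmetric]) auto
    also have "\<dots> \<le> (\<integral>\<^sup>+x. indicator ((\<lambda>x. x + s) -` U) x \<partial>haar)"
      using f by (intro nn_integral_mono) (auto simp: indicator_def)
    also have "\<dots> = emeasure haar ((\<lambda>x. x + s) -` U)" using borel_open[OF U'] by simp
    finally show ?thesis .
  qed
  then have "(SUP K\<in>{K. compact K \<and> K \<subseteq> U}. ennreal (modular s) * emeasure haar K) \<le> emeasure haar ((\<lambda>x. x + s) -` U)"
    by (intro SUP_least) auto
  moreover have "(SUP K\<in>{K. compact K \<and> K \<subseteq> U}. ennreal (modular s) * emeasure haar K) = ennreal (modular s) * emeasure haar U"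
    unfolding emeasure_haar_inner[OF U] by (rule SUP_mult_left_ennreal[symmetric])
  ultimately show ?thesis by simp
qed

lemma borel_right_translate: "A \<in> sets borel \<Longrightarrow> (\<lambda>x. x + s) -` A \<in> sets borel" for s :: "'g::topological_group_add"
  using measurable_sets[OF measurable_translations(2)[of s], of A] by simp

lemma ennreal_modular_uminus: "ennreal (modular (- s)) * (ennreal (modular s) * x) = x"
    "ennreal (modular s) * (ennreal (modular (- s)) * x) = x" for s :: "'g::haar_group"
proof -
  have eq: "ennreal (modular (- s)) * ennreal (modular s) = 1" "ennreal (modular s) * ennreal (modular (- s)) = 1"
    using modular_uminus[of s] modular_uminus[of "- s"] modular_pos[of s] modular_pos[of "- s"]
    by (simp_all flip: ennreal_mult)
  show "ennreal (modular (- s)) * (ennreal (modular s) * x) = x" "ennreal (modular s) * (ennreal (modular (- s)) * x) = x"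
    by (simp_all only: mult.assoc[symmetric] eq mult_1_left)
qed

text \<open>Outer regularity carries the inequality for open sets, used with \<open>- s\<close>, to
  an upper bound for Borel sets. The upper bounds for \<open>s\<close> and for \<open>- s\<close>
  together give equality.\<close>

lemma emeasure_haar_right_translate:
  fixes A :: "'g::haar_group set"
  assumes A: "A \<in> sets borel"
  shows "emeasure haar ((\<lambda>x. x + s) -` A) = ennreal (modular s) * emeasure haar A"
proof -
  have le: "emeasure haar ((\<lambda>x. x + s) -` A) \<le> ennreal (modular s) * emeasure haar A"
    if A: "A \<in> sets borel" for A and s :: 'g
  proof -
    have "ennreal (modular (- s)) * emeasure haar ((\<lambda>x. x + s) -` A) \<le> emeasure haar A"
      unfolding emeasure_haar_outer[OF A]
    proof (rule INF_greatest, clarify)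
      fix U assume U: "open U" "A \<subseteq> U"
      have "ennreal (modular (- s)) * emeasure haar ((\<lambda>x. x + s) -` A) \<le> ennreal (modular (- s)) * emeasure haar ((\<lambda>x. x + s) -` U)"
        using U borel_open[OF open_right_translate[OF U(1), of s]] by (intro mult_left_mono emeasure_mono) auto
      also have "\<dots> \<le> emeasure haar U"
        using emeasure_haar_right_translate_open[OF open_right_translate[OF U(1), of s], of "- s"]
        unfolding right_translate_vimage_uminus .
      finally show "ennreal (modular (- s)) * emeasure haar ((\<lambda>x. x + s) -` A) \<le> emeasure haar U" .
    qed
    from mult_left_mono[OF this, of "ennreal (modular s)"] show ?thesis by (simp add: ennreal_modular_uminus)
  qed
  have "emeasure haar A \<le> ennreal (modular (- s)) * emeasure haar ((\<lambda>x. x + s) -` A)"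
    using le[OF borel_right_translate[OF A, of s], of "- s"] unfolding right_translate_vimage_uminus .
  from mult_left_mono[OF this, of "ennreal (modular s)"] le[OF A, of s] show ?thesis
    by (intro antisym) (simp_all add: ennreal_modular_uminus)
qed

lemma distr_haar_right_translate:
  "distr haar borel (\<lambda>x. x + s) = density (haar :: 'g::haar_group measure) (\<lambda>_. ennreal (modular s))"
proof (rule measure_eqI)
  fix A :: "'g set" assume "A \<in> sets (distr haar borel (\<lambda>x. x + s))"
  then show "emeasure (distr haar borel (\<lambda>x. x + s)) A = emeasure (density haar (\<lambda>_. ennreal (modular s))) A"
    by (simp add: emeasure_distr emeasure_density_const emeasure_haar_right_translate)
qed simp

lemma
  fixes f :: "'g::haar_group \<Rightarrow> 'b::{banach, second_countable_topology}"
  assumes f: "f \<in> borel_measurable borel"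
  shows integral_haar_right_translate: "(\<integral>x. f (x + s) \<partial>haar) = modular s *\<^sub>R (\<integral>x. f x \<partial>haar)"
    and integrable_haar_right_translate_iff: "integrable haar (\<lambda>x. f (x + s)) \<longleftrightarrow> integrable haar f"
proof -
  have "(\<integral>x. f (x + s) \<partial>haar) = (\<integral>x. f x \<partial>distr haar borel (\<lambda>x. x + s))"
    using f by (subst integral_distr) auto
  also have "\<dots> = modular s *\<^sub>R (\<integral>x. f x \<partial>haar)"
    using f modular_pos[of s] unfolding distr_haar_right_translate by (simp add: integral_density less_imp_le)
  finally show "(\<integral>x. f (x + s) \<partial>haar) = modular s *\<^sub>R (\<integral>x. f x \<partial>haar)" .
  have "integrable haar (\<lambda>x. modular s *\<^sub>R f x) \<longleftrightarrow> integrable haar f"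
  proof
    assume "integrable haar (\<lambda>x. modular s *\<^sub>R f x)"
    from integrable_scaleR_right[OF this, of "inverse (modular s)"]
    show "integrable haar f" using modular_pos[of s] by simp
  qed simp
  moreover have "integrable haar (\<lambda>x. f (x + s)) \<longleftrightarrow> integrable (distr haar borel (\<lambda>x. x + s)) f"
    using f by (subst integrable_distr_eq) auto
  moreover have "\<dots> \<longleftrightarrow> integrable haar (\<lambda>x. modular s *\<^sub>R f x)"
    using f modular_pos[of s] unfolding distr_haar_right_translate
    by (subst integrable_density) (auto intro: less_imp_le)
  ultimately show "integrable haar (\<lambda>x. f (x + s)) \<longleftrightarrow> integrable haar f" by simp
qed

lemma AE_haar_right_translate:
  fixes P :: "'g::haar_group \<Rightarrow> bool"
  assumes "AE x in haar. P x"
  shows "AE x in haar. P (x + s)"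
proof -
  obtain N where "{x \<in> space haar. \<not> P x} \<subseteq> N" "emeasure haar N = 0" "N \<in> sets haar"
    by (rule AE_E[OF assms])
  then have N: "N \<in> sets borel" "emeasure haar N = 0" "{x. \<not> P x} \<subseteq> N" by simp_all
  have "emeasure haar ((\<lambda>x. x + s) -` N) = 0" using N by (simp add: emeasure_haar_right_translate)
  moreover have "{x. \<not> P (x + s)} \<subseteq> (\<lambda>x. x + s) -` N" using N by auto
  ultimately show ?thesis using borel_right_translate[OF N(1), of s] by (intro AE_I') auto
qed

text \<open>Convolution evaluates a function at \<open>- y + x\<close>, so inversion has to respect
  null sets, although it need not preserve Haar measure. Integrating over \<open>x\<close> shows
  that for almost every \<open>x\<close> the part of \<open>- K\<close> that \<open>x\<close>
  translates into \<open>P\<close> is null; finitely many such parts exhaust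
  \<open>- K\<close>.\<close>

lemma null_compact_uminus:
  fixes K :: "'g::haar_group set"
  assumes K: "compact K" and null: "emeasure haar K = 0"
  shows "emeasure haar (uminus ` K) = 0"
proof -
  obtain P P' :: "'g set" where P: "open P" "compact P'" "0 \<in> P" "P \<subseteq> P'"
    using ex_compact_neighbourhood[of 0] by blast
  obtain p :: "'g \<Rightarrow> real" where p: "p \<in> Cc" "\<And>x. 0 \<le> p x \<and> p x \<le> 1" "\<And>x. x \<in> P' \<Longrightarrow> p x = 1"
    using Urysohn_Cc[OF P(2) open_UNIV] by auto
  obtain L where L: "compact L" "\<And>x. x \<notin> L \<Longrightarrow> p x = 0" using Cc_support[OF p(1)] by blast
  have mK: "uminus ` K \<in> sets borel"
    by (intro compact_borel compact_continuous_image K continuous_intros)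
  have mV: "(\<lambda>y. - x + y) ` A \<in> sets borel" if "open A" for x and A :: "'g set"
    by (intro borel_open open_homeomorphism_image[OF homeomorphism_add_left] that)
  define F where "F h x = (\<integral>\<^sup>+y. ennreal (p y * h (- y + x)) \<partial>haar)" for h :: "'g \<Rightarrow> real" and x
  have F: "F h \<in> borel_measurable borel" "(\<integral>\<^sup>+x. F h x \<partial>haar) = (\<integral>\<^sup>+y. ennreal (p y) \<partial>haar) * (\<integral>\<^sup>+x. ennreal (h x) \<partial>haar)"
    if h: "h \<in> Cc" "\<And>x. 0 \<le> h x" for h
  proof -
    obtain M where M: "compact M" "\<And>x. x \<notin> M \<Longrightarrow> h x = 0" using Cc_support[OF h(1)] by blast
    define H where "H = (\<lambda>(x, y). p y * h (- y + x))"
    define S where "S = (\<lambda>(x, y). x + y) ` (L \<times> M)"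
    have S: "compact S" unfolding S_def by (intro compact_plus L M)
    have Hc: "continuous_on UNIV H" unfolding H_def case_prod_unfold
      by (intro continuous_on_mult continuous_on_compose2[OF Cc_continuous[OF p(1)]] continuous_on_compose2[OF Cc_continuous[OF h(1)]] continuous_intros) auto
    have Hz: "H (x, y) = 0" if "x \<notin> S \<or> y \<notin> L" for x y
    proof (rule ccontr)
      assume "H (x, y) \<noteq> 0"
      then have "y \<in> L" "- y + x \<in> M" using L(2) M(2) by (auto simp: H_def)
      then have "y + (- y + x) \<in> S" unfolding S_def by force
      then show False using that \<open>y \<in> L\<close> by (simp add: add.assoc)
    qed
    have meas: "(\<lambda>z. ennreal (H z)) \<in> borel_measurable (borel \<Otimes>\<^sub>M borel)"
      using compact_support_measurable[OF Hc S L(1) Hz] by simp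
    have z: "ennreal (H (x, y)) = 0" if "x \<notin> S \<or> y \<notin> L" for x y using Hz[OF that] by simp
    note Fub = Fubini_haar_nn[OF meas compact_imp_sigma_compact[OF S] compact_imp_sigma_compact[OF L(1)] z]
    show "F h \<in> borel_measurable borel" using Fub(2) by (simp add: F_def[abs_def] H_def)
    have mh: "(\<lambda>x. ennreal (h x)) \<in> borel_measurable borel" using borel_measurable_continuous[OF Cc_continuous[OF h(1)]] by simp
    have mp: "(\<lambda>x. ennreal (p x)) \<in> borel_measurable borel" using borel_measurable_continuous[OF Cc_continuous[OF p(1)]] by simp
    have "(\<integral>\<^sup>+x. F h x \<partial>haar) = (\<integral>\<^sup>+y. \<integral>\<^sup>+x. ennreal (H (x, y)) \<partial>haar \<partial>haar)"
      using Fub(1) by (simp add: F_def H_def)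
    also have "\<dots> = (\<integral>\<^sup>+y. ennreal (p y) * (\<integral>\<^sup>+x. ennreal (h x) \<partial>haar) \<partial>haar)"
    proof (rule nn_integral_cong)
      fix y
      have "(\<integral>\<^sup>+x. ennreal (H (x, y)) \<partial>haar) = ennreal (p y) * (\<integral>\<^sup>+x. ennreal (h (- y + x)) \<partial>haar)"
        using mh p(2) h(2) by (simp add: H_def ennreal_mult nn_integral_cmult)
      then show "(\<integral>\<^sup>+x. ennreal (H (x, y)) \<partial>haar) = ennreal (p y) * (\<integral>\<^sup>+x. ennreal (h x) \<partial>haar)"
        using nn_integral_haar_translate[OF mh, of "- y"] by simp
    qed
    also have "\<dots> = (\<integral>\<^sup>+y. ennreal (p y) \<partial>haar) * (\<integral>\<^sup>+x. ennreal (h x) \<partial>haar)"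
      using mp by (simp add: nn_integral_multc)
    finally show "(\<integral>\<^sup>+x. F h x \<partial>haar) = (\<integral>\<^sup>+y. ennreal (p y) \<partial>haar) * (\<integral>\<^sup>+x. ennreal (h x) \<partial>haar)" .
  qed
  \<comment> \<open>Continuous majorants replace the indicator of \<open>K\<close>, whose kernel
    \<open>- y + x \<in> K\<close> need not be measurable for the product sigma-algebra.\<close>
  have "\<exists>h::'g \<Rightarrow> real. h \<in> Cc \<and> (\<forall>x. 0 \<le> h x) \<and> (\<forall>x\<in>K. h x = 1) \<and> (\<integral>\<^sup>+x. ennreal (h x) \<partial>haar) \<le> ennreal (1 / Suc n)" for n
  proof -
    have "emeasure haar K < ennreal (1 / Suc n)" using null by simp
    then obtain U where U: "open U" "K \<subseteq> U" "emeasure haar U < ennreal (1 / Suc n)"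
      unfolding emeasure_haar_outer[OF compact_borel[OF K]] INF_less_iff by auto
    obtain h :: "'g \<Rightarrow> real" where h: "h \<in> Cc" "\<And>x. 0 \<le> h x \<and> h x \<le> 1" "\<And>x. x \<in> K \<Longrightarrow> h x = 1" "\<And>x. x \<notin> U \<Longrightarrow> h x = 0"
      using Urysohn_Cc[OF K U(1,2)] by blast
    have "(\<integral>\<^sup>+x. ennreal (h x) \<partial>haar) \<le> (\<integral>\<^sup>+x. indicator U x \<partial>haar)"
      using h by (intro nn_integral_mono) (auto simp: indicator_def)
    also have "\<dots> = emeasure haar U" using borel_open[OF U(1)] by simp
    finally have "(\<integral>\<^sup>+x. ennreal (h x) \<partial>haar) \<le> ennreal (1 / Suc n)" using U(3) by simp
    then show ?thesis using h by (intro exI[of _ h]) auto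
  qed
  then obtain h :: "nat \<Rightarrow> 'g \<Rightarrow> real" where h: "\<And>n. h n \<in> Cc" "\<And>n x. 0 \<le> h n x" "\<And>n x. x \<in> K \<Longrightarrow> h n x = 1"
      "\<And>n. (\<integral>\<^sup>+x. ennreal (h n x) \<partial>haar) \<le> ennreal (1 / Suc n)"
    by metis
  have ip: "(\<integral>\<^sup>+y. ennreal (p y) \<partial>haar) = ennreal (\<integral>y. p y \<partial>haar)"
    using Cc_integrable[OF p(1)] p(2) by (intro nn_integral_eq_integral) auto
  define c where "c = (\<integral>y. p y \<partial>haar)"
  have c: "0 \<le> c" using p(2) by (auto simp: c_def)
  define G where "G x = (INF n. F (h n) x)" for x
  have G: "G \<in> borel_measurable borel" unfolding G_def[abs_def] using F(1) h(1,2) by (intro borel_measurable_INF) auto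
  have bd: "(\<integral>\<^sup>+x. G x \<partial>haar) \<le> ennreal (c * (1 / Suc n))" for n
  proof -
    have "(\<integral>\<^sup>+x. G x \<partial>haar) \<le> (\<integral>\<^sup>+x. F (h n) x \<partial>haar)" unfolding G_def by (intro nn_integral_mono INF_lower) auto
    also have "\<dots> = ennreal c * (\<integral>\<^sup>+x. ennreal (h n x) \<partial>haar)" using F(2)[OF h(1,2)] ip by (simp add: c_def)
    also have "\<dots> \<le> ennreal c * ennreal (1 / Suc n)" by (intro mult_left_mono h(4)) simp
    also have "\<dots> = ennreal (c * (1 / Suc n))" by (rule ennreal_mult[symmetric]) (use c in auto)
    finally show ?thesis .
  qed
  have lim: "(\<lambda>n. ennreal (c * (1 / Suc n))) \<longlonglongrightarrow> ennreal (c * 0)"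
    by (intro tendsto_ennrealI tendsto_mult tendsto_const LIMSEQ_Suc[OF lim_1_over_n])
  have "(\<integral>\<^sup>+x. G x \<partial>haar) \<le> ennreal (c * 0)"
    by (rule LIMSEQ_le_const[OF lim]) (use bd in blast)
  then have AEG: "AE x in haar. G x = 0" using G by (simp add: nn_integral_0_iff_AE)
  \<comment> \<open>Translating \<open>B x\<close> by \<open>x\<close> puts it into
    \<open>P\<close>, where \<open>p = 1\<close>, and on the translate
    \<open>h n (- y + x) = 1\<close>. So \<open>F (h n) x\<close> bounds the measure of
    \<open>B x\<close> for every \<open>n\<close>.\<close>
  define B where "B x = uminus ` K \<inter> (\<lambda>y. - x + y) ` P" for x
  have mB: "B x \<in> sets borel" for x using mK mV[OF P(1)] by (simp add: B_def)
  have GB: "emeasure haar (B x) \<le> G x" for x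
    unfolding G_def
  proof (rule INF_greatest)
    fix n
    have mt: "(+) x ` B x \<in> sets borel"
    proof -
      have "(+) x ` B x = (\<lambda>y. - x + y) -` B x" by (force simp: add.assoc[symmetric])
      then show ?thesis using measurable_sets[OF measurable_translations(1)[of "- x"] mB[of x]] by simp
    qed
    have "emeasure haar (B x) = emeasure haar ((+) x ` B x)" using emeasure_haar_translate[OF mB] by simp
    also have "\<dots> = (\<integral>\<^sup>+y. indicator ((+) x ` B x) y \<partial>haar)" using mt by simp
    also have "\<dots> \<le> F (h n) x" unfolding F_def
    proof (rule nn_integral_mono)
      fix y
      show "indicator ((+) x ` B x) y \<le> ennreal (p y * h n (- y + x))"
      proof (cases "y \<in> (+) x ` B x")
        case True
        then obtain z where z: "y = x + z" "z \<in> B x" by blast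
        then have "y \<in> P" by (auto simp: B_def add.assoc[symmetric])
        moreover have "- y + x = - z" using z(1) by (simp add: minus_add add.assoc)
        moreover have "- z \<in> K"
        proof -
          have "z \<in> uminus ` K" using z(2) by (simp add: B_def)
          then obtain k where "k \<in> K" "z = - k" by blast
          then show ?thesis by simp
        qed
        ultimately have "p y = 1" "h n (- y + x) = 1" using P(4) p(3) h(3) by auto
        then show ?thesis by (simp add: indicator_def)
      qed simp
    qed
    finally show "emeasure haar (B x) \<le> F (h n) x" .
  qed
  define D where "D = {x. emeasure haar (B x) = 0}"
  have AED: "AE x in haar. x \<in> D" using AEG
  proof (rule AE_mp, intro AE_I2 impI)
    fix x assume "G x = 0"
    then show "x \<in> D" using GB[of x] by (simp add: D_def)
  qed
  \<comment> \<open>A conull set meets every nonempty open set, so for each \<open>k\<close> in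
    \<open>K\<close> there is an \<open>x\<close> in \<open>D\<close> with \<open>x + - k\<close> in
    \<open>P\<close>.\<close>
  have cover: "uminus ` K \<subseteq> (\<Union>x\<in>D. (\<lambda>y. - x + y) ` P)"
  proof
    fix k' assume "k' \<in> uminus ` K"
    then obtain k where k: "k \<in> K" "k' = - k" by blast
    have op: "open ((\<lambda>y. y + k) ` P)" by (intro open_homeomorphism_image[OF homeomorphism_add_right] P)
    have "\<exists>x\<in>D. x \<in> (\<lambda>y. y + k) ` P"
    proof (rule ccontr)
      assume "\<not> ?thesis"
      then have "AE x in haar. x \<notin> (\<lambda>y. y + k) ` P" using AED by (auto elim!: eventually_mono)
      then have "emeasure haar ((\<lambda>y. y + k) ` P) = 0"
        using AE_iff_measurable[of "(\<lambda>y. y + k) ` P" haar "\<lambda>x. x \<notin> (\<lambda>y. y + k) ` P"] borel_open[OF op] by auto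
      then show False using emeasure_haar_open_pos[OF op, of "0 + k"] P(3) by blast
    qed
    then obtain y where y: "y \<in> P" "y + k \<in> D" by blast
    moreover have "k' = - (y + k) + y" using k(2) by (simp add: minus_add add.assoc)
    ultimately show "k' \<in> (\<Union>x\<in>D. (\<lambda>y. - x + y) ` P)" by blast
  qed
  have cK: "compact (uminus ` K)" by (intro compact_continuous_image K continuous_intros)
  obtain I where I: "I \<subseteq> D" "finite I" "uminus ` K \<subseteq> (\<Union>x\<in>I. (\<lambda>y. - x + y) ` P)"
    by (rule compactE_image[OF cK _ cover]) (rule open_homeomorphism_image[OF homeomorphism_add_left P(1)])
  have "uminus ` K \<subseteq> (\<Union>x\<in>I. B x)" using I(3) by (auto simp: B_def)
  then have "emeasure haar (uminus ` K) \<le> emeasure haar (\<Union>x\<in>I. B x)"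
    using I(2) mB by (intro emeasure_mono) auto
  also have "\<dots> \<le> (\<Sum>x\<in>I. emeasure haar (B x))"
    using I(2) mB by (intro emeasure_subadditive_finite) auto
  also have "\<dots> = 0" using I(1) by (intro sum.neutral) (auto simp: D_def)
  finally show ?thesis by simp
qed

text \<open>Outer regularity of \<open>C - A\<close> acts as inner regularity of \<open>A\<close>:
  if \<open>U\<close> is open around \<open>C - A\<close> with little excess, then
  \<open>C - U\<close> is a compact subset of \<open>A\<close>, hence null, and \<open>A\<close> is
  at most as large as the excess.\<close>

lemma null_if_compact_subsets_null:
  fixes A :: "'g::haar_group set"
  assumes A: "A \<in> sets borel" and C: "compact C" "A \<subseteq> C"
    and null: "\<And>K. compact K \<Longrightarrow> K \<subseteq> A \<Longrightarrow> emeasure haar K = 0"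
  shows "emeasure haar A = 0"
proof -
  have mCA: "C - A \<in> sets borel" using compact_borel[OF C(1)] A by auto
  have fin: "emeasure haar (C - A) < \<infinity>" using emeasure_haar_compact[OF C(1)] compact_borel[OF C(1)]
    by (auto intro: order_le_less_trans[OF emeasure_mono[of _ C]])
  have le: "emeasure haar A \<le> ennreal \<epsilon>" if "\<epsilon> > 0" for \<epsilon>
  proof -
    have "emeasure haar (C - A) < emeasure haar (C - A) + ennreal \<epsilon>"
      using fin \<open>0 < \<epsilon>\<close> by (simp add: ennreal_add_left_cancel_less[of _ 0, simplified])
    then obtain U where U: "open U" "C - A \<subseteq> U" "emeasure haar U < emeasure haar (C - A) + ennreal \<epsilon>"
      unfolding emeasure_haar_outer[OF mCA] INF_less_iff by auto
    have K: "compact (C - U)" by (rule compact_diff[OF C(1) U(1)])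
    have "emeasure haar A + emeasure haar (C - A) = emeasure haar (A \<union> (C - A))"
      using A mCA by (intro plus_emeasure) auto
    also have "\<dots> \<le> emeasure haar (U \<union> (C - U))"
      using C(2) compact_borel[OF K] U(1) by (intro emeasure_mono sets.Un) auto
    also have "\<dots> \<le> emeasure haar U + emeasure haar (C - U)"
      using compact_borel[OF K] U(1) by (intro emeasure_subadditive) auto
    also have "emeasure haar (C - U) = 0" using U(2) by (intro null K) auto
    also have "emeasure haar U + 0 \<le> emeasure haar (C - A) + ennreal \<epsilon>" using U(3) by simp
    finally have "emeasure haar (C - A) + emeasure haar A \<le> emeasure haar (C - A) + ennreal \<epsilon>" by (simp add: add.commute)
    then show ?thesis using fin by (auto simp: ennreal_add_left_cancel_le)
  qed
  have "emeasure haar A \<le> 0" by (rule ennreal_le_epsilon) (simp add: le)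
  then show ?thesis by simp
qed

text \<open>Inside a compact set it is enough to look at compact subsets, and these are treated by
  \<open>null_compact_uminus\<close>. Countable unions then give sigma-compact
  \<open>C\<close>.\<close>

lemma null_uminus:
  fixes N :: "'g::haar_group set"
  assumes N: "N \<in> sets borel" "emeasure haar N = 0" and C: "sigma_compact C"
  shows "emeasure haar (uminus -` N \<inter> C) = 0"
proof -
  have mN: "uminus -` N \<in> sets borel"
    using measurable_sets[OF measurable_translations(3), of N] N(1) by simp
  have compact_case: "emeasure haar (uminus -` N \<inter> C) = 0" if C: "compact C" for C
  proof (rule null_if_compact_subsets_null[OF _ C])
    show "uminus -` N \<inter> C \<in> sets borel" using mN compact_borel[OF C] by auto
    fix K assume K: "compact K" "K \<subseteq> uminus -` N \<inter> C"
    have cK: "compact (uminus ` K)" by (intro compact_continuous_image K continuous_intros)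
    have "emeasure haar (uminus ` K) \<le> emeasure haar N" using K N by (intro emeasure_mono) auto
    then have "emeasure haar (uminus ` uminus ` K) = 0" using N(2) null_compact_uminus[OF cK] by simp
    then show "emeasure haar K = 0" by (simp add: image_image)
  qed auto
  obtain K :: "nat \<Rightarrow> 'g set" where K: "\<And>n. compact (K n)" "C = (\<Union>n. K n)"
    using C unfolding sigma_compact_def by blast
  have "uminus -` N \<inter> K n \<in> null_sets haar" for n
    using compact_case[OF K(1)[of n]] mN compact_borel[OF K(1)[of n]] by auto
  then have "(\<Union>n. uminus -` N \<inter> K n) \<in> null_sets haar" by (rule null_sets_UN)
  moreover have "(\<Union>n. uminus -` N \<inter> K n) = uminus -` N \<inter> C" using K(2) by auto
  ultimately show ?thesis by auto
qed

subsection \<open>Convolution\<close>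

text \<open>For a Borel function \<open>g\<close> the kernel \<open>g(y\<^sup>-\<^sup>1 x)\<close> need not be measurable for the product
  sigma-algebra; for pointwise limits of continuous functions it is.\<close>

definition tame :: "('g::topological_space \<Rightarrow> complex) \<Rightarrow> bool"
  where "tame g \<longleftrightarrow> (\<exists>gs::nat \<Rightarrow> 'g \<Rightarrow> complex. (\<forall>n. gs n \<in> Cc) \<and> g = (\<lambda>x. lim (\<lambda>n. gs n x)))"

lemma tame_measurable: "tame g \<Longrightarrow> g \<in> borel_measurable borel"
  unfolding tame_def
  by (elim exE conjE, simp only:) (blast intro: borel_measurable_lim_metric borel_measurable_continuous Cc_continuous)

lemma tame_support:
  assumes "tame g"
  shows "\<exists>S. sigma_compact S \<and> (\<forall>x. x \<notin> S \<longrightarrow> g x = 0)"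
proof -
  obtain gs :: "nat \<Rightarrow> _" where gs: "\<And>n. gs n \<in> Cc" "g = (\<lambda>x. lim (\<lambda>n. gs n x))"
    using assms unfolding tame_def by blast
  obtain K where K: "\<And>n. compact (K n)" "\<And>n x. x \<notin> K n \<Longrightarrow> gs n x = 0"
    using Cc_support[OF gs(1)] by metis
  show ?thesis
  proof (intro exI conjI allI impI)
    show "sigma_compact (\<Union>n. K n)" unfolding sigma_compact_def using K(1) by blast
    fix x assume "x \<notin> (\<Union>n. K n)"
    then have "(\<lambda>n. gs n x) = (\<lambda>_. 0)" using K(2) by auto
    then show "g x = 0" by (simp add: gs(2))
  qed
qed

lemma tame_kernel_measurable:
  fixes g :: "'g::haar_group \<Rightarrow> complex"
  assumes "tame g" and S: "sigma_compact S" and T: "sigma_compact T"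
  shows "(\<lambda>z. (indicator S (fst z) * indicator T (snd z)) *\<^sub>R g (- snd z + fst z)) \<in> borel_measurable (borel \<Otimes>\<^sub>M borel)"
proof -
  obtain gs :: "nat \<Rightarrow> _" where gs: "\<And>n. gs n \<in> Cc" "g = (\<lambda>x. lim (\<lambda>n. gs n x))"
    using assms unfolding tame_def by blast
  have "(\<lambda>z. lim (\<lambda>n. (indicator S (fst z) * indicator T (snd z)) *\<^sub>R gs n (- snd z + fst z))) \<in> borel_measurable (borel \<Otimes>\<^sub>M borel)"
  proof (rule borel_measurable_lim_metric)
    fix n
    show "(\<lambda>z. (indicator S (fst z) * indicator T (snd z)) *\<^sub>R gs n (- snd z + fst z)) \<in> borel_measurable (borel \<Otimes>\<^sub>M borel)"
      by (rule continuous_measurable_sigma_compact_rectangle[OF _ S T])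
        (intro continuous_on_compose2[OF Cc_continuous[OF gs(1)]] continuous_intros, auto)
  qed
  \<comment> \<open>On the rectangle the factor is \<open>1\<close>, so both sides agree even where
    the sequence diverges and \<open>lim\<close> is arbitrary; off the rectangle both are
    \<open>0\<close>.\<close>
  moreover have "lim (\<lambda>n. (indicator S (fst z) * indicator T (snd z)) *\<^sub>R gs n (- snd z + fst z)) =
      (indicator S (fst z) * indicator T (snd z)) *\<^sub>R g (- snd z + fst z)" for z
    by (cases "fst z \<in> S \<and> snd z \<in> T") (auto simp: gs(2))
  ultimately show ?thesis by simp
qed

text \<open>\<open>Cc\<close> is dense, and an \<open>L^1\<close>-convergent sequence has a
  subsequence converging almost everywhere; the pointwise \<open>lim\<close> of the latter is
  tame.\<close>

lemma ex_tame_AE_eq: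
  fixes f :: "'g::haar_group \<Rightarrow> complex"
  assumes f: "integrable haar f"
  shows "\<exists>g. tame g \<and> integrable haar g \<and> (AE x in haar. f x = g x)"
proof -
  have "\<exists>g\<in>Cc. (\<integral>x. norm (f x - g x) \<partial>haar) < 1 / real (Suc n)" for n
    by (rule Cc_dense[OF f]) simp
  then obtain h where h: "\<And>n. h n \<in> Cc" "\<And>n. (\<integral>x. norm (f x - h n x) \<partial>haar) < 1 / real (Suc n)" by metis
  have "(\<lambda>n. \<integral>x. norm (f x - h n x) \<partial>haar) \<longlonglongrightarrow> 0"
    by (rule tendsto_sandwich[OF _ _ tendsto_const LIMSEQ_Suc[OF lim_1_over_n]])
      (use h(2) in \<open>auto intro!: always_eventually integral_nonneg_AE less_imp_le\<close>)
  from tendsto_L1_AE_subseq[OF Bochner_Integration.integrable_diff[OF f Cc_integrable[OF h(1)]] this]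
  obtain r :: "nat \<Rightarrow> nat" where r: "AE x in haar. (\<lambda>n. f x - h (r n) x) \<longlonglongrightarrow> 0" by blast
  define g where "g = (\<lambda>x. lim (\<lambda>n. h (r n) x))"
  have g: "tame g" unfolding tame_def g_def using h(1) by (intro exI[of _ "\<lambda>n. h (r n)"]) simp
  have AE: "AE x in haar. f x = g x"
    using r
  proof eventually_elim
    case (elim x)
    from tendsto_diff[OF tendsto_const[of "f x"] elim] have "(\<lambda>n. h (r n) x) \<longlonglongrightarrow> f x" by simp
    then show ?case by (simp add: g_def limI)
  qed
  have "integrable haar g"
    using integrable_cong_AE_imp[OF f _ AE] tame_measurable[OF g] by simp
  then show ?thesis using g AE by blast
qed

text \<open>For fixed \<open>x\<close> the exceptional \<open>y\<close> form a translate of an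
  inverted null set, which is null on sigma-compact sets by \<open>null_uminus\<close>. Off the
  sigma-compact support of a tame representative of \<open>f\<close>, both sides vanish almost
  everywhere. Since this holds for every \<open>x\<close>, convolutions of equivalent functions
  agree pointwise.\<close>

lemma convolution_integrand_AE_cong:
  fixes f f' g g' :: "'g::haar_group \<Rightarrow> complex"
  assumes f: "integrable haar f" and ff: "AE x in haar. f x = f' x" and gg: "AE x in haar. g x = g' x"
  shows "AE y in haar. f y * g (- y + x) = f' y * g' (- y + x)"
proof -
  obtain f0 where f0: "tame f0" "AE x in haar. f x = f0 x" using ex_tame_AE_eq[OF f] by blast
  obtain S where S: "sigma_compact S" "\<And>x. x \<notin> S \<Longrightarrow> f0 x = 0" using tame_support[OF f0(1)] by blast
  obtain N where "{x \<in> space haar. \<not> g x = g' x} \<subseteq> N" "emeasure haar N = 0" "N \<in> sets haar"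
    by (rule AE_E[OF gg])
  then have N: "N \<in> sets borel" "emeasure haar N = 0" "\<And>x. x \<notin> N \<Longrightarrow> g x = g' x" by auto
  define S' where "S' = (\<lambda>y. - x + y) ` S"
  have "S' = (\<lambda>(x, y). x + y) ` ({- x} \<times> S)" by (auto simp: S'_def)
  then have S': "sigma_compact S'"
    using sigma_compact_plus[OF compact_imp_sigma_compact[of "{- x}"] S(1)] by simp
  have null: "emeasure haar (uminus -` N \<inter> S') = 0" by (rule null_uminus[OF N(1,2) S'])
  have "uminus -` N \<inter> S' \<in> sets borel"
    using measurable_sets[OF measurable_translations(3), of N] N(1) sigma_compact_borel[OF S'] by auto
  then have "AE y in haar. y \<notin> uminus -` N \<inter> S'"
    using null by (intro AE_I'[of "uminus -` N \<inter> S'"]) auto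
  then have "AE y in haar. - x + y \<notin> uminus -` N \<inter> S'" by (rule AE_haar_translate)
  with f0(2) ff show ?thesis
  proof eventually_elim
    case (elim y)
    show ?case
    proof (cases "y \<in> S")
      case True
      then have "- x + y \<in> S'" by (simp add: S'_def)
      then have "- (- x + y) \<notin> N" using elim by auto
      then have "g (- y + x) = g' (- y + x)" using N(3)[of "- (- x + y)"] by (simp add: minus_add)
      then show ?thesis using elim by simp
    next
      case False
      then show ?thesis using S(2) elim by simp
    qed
  qed
qed

lemma convolution_integrand_measurable:
  fixes f g :: "'g::haar_group \<Rightarrow> complex"
  assumes "f \<in> borel_measurable borel" "g \<in> borel_measurable borel"
  shows "(\<lambda>y. f y * g (- y + x)) \<in> borel_measurable borel"
proof -
  have "(\<lambda>y::'g. - y + x) \<in> borel_measurable borel"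
    by (intro borel_measurable_continuous continuous_intros)
  from measurable_compose[OF this assms(2)] show ?thesis using assms(1) by simp
qed

lemma convolution_cong_AE:
  fixes f f' g g' :: "'g::haar_group \<Rightarrow> complex"
  assumes "integrable haar f" "integrable haar f'" "integrable haar g" "integrable haar g'"
    and "AE x in haar. f x = f' x" "AE x in haar. g x = g' x"
  shows "convolution f g = convolution f' g'"
proof
  fix x
  show "convolution f g x = convolution f' g' x"
    unfolding convolution_def
  proof (rule integral_cong_AE)
    show "AE y in haar. f y * g (- y + x) = f' y * g' (- y + x)"
      by (rule convolution_integrand_AE_cong) (use assms in auto)
  qed (use assms in \<open>auto intro!: convolution_integrand_measurable dest: borel_measurable_integrable\<close>)
qed

lemma tame_convolution:
  fixes f g :: "'g::haar_group \<Rightarrow> complex"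
  assumes f: "integrable haar f" "tame f" and g: "integrable haar g" "tame g"
  shows "AE x in haar. integrable haar (\<lambda>y. f y * g (- y + x))"
    and "integrable haar (convolution f g)"
    and "(\<integral>x. norm (convolution f g x) \<partial>haar) \<le> (\<integral>x. norm (f x) \<partial>haar) * (\<integral>x. norm (g x) \<partial>haar)"
proof -
  obtain T where T: "sigma_compact T" "\<And>x. x \<notin> T \<Longrightarrow> f x = 0" using tame_support[OF f(2)] by blast
  obtain T' where T': "sigma_compact T'" "\<And>x. x \<notin> T' \<Longrightarrow> g x = 0" using tame_support[OF g(2)] by blast
  define S where "S = (\<lambda>(x, y). x + y) ` (T \<times> T')"
  have S: "sigma_compact S" unfolding S_def by (rule sigma_compact_plus[OF T(1) T'(1)])
  note mf = tame_measurable[OF f(2)] and mg = tame_measurable[OF g(2)]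
  define H where "H = (\<lambda>(x, y). f y * g (- y + x))"
  have zero: "H (x, y) = 0" if "x \<notin> S \<or> y \<notin> T" for x y
  proof (rule ccontr)
    assume "H (x, y) \<noteq> 0"
    then have "y \<in> T" "- y + x \<in> T'" using T(2) T'(2) by (auto simp: H_def)
    then have "y + (- y + x) \<in> S" unfolding S_def by force
    then show False using that \<open>y \<in> T\<close> by (simp flip: add.assoc)
  qed
  have "H = (\<lambda>z. f (snd z) * ((indicator S (fst z) * indicator T (snd z)) *\<^sub>R g (- snd z + fst z)))"
  proof
    fix z show "H z = f (snd z) * ((indicator S (fst z) * indicator T (snd z)) *\<^sub>R g (- snd z + fst z))"
      using zero[of "fst z" "snd z"] by (cases z) (auto simp: H_def indicator_def)
  qed
  moreover have "(\<lambda>z. f (snd z)) \<in> borel_measurable (borel \<Otimes>\<^sub>M borel)" using mf by simp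
  ultimately have H: "H \<in> borel_measurable (borel \<Otimes>\<^sub>M borel)"
    using borel_measurable_times[OF _ tame_kernel_measurable[OF g(2) S T(1)]] by (simp only:)
  have gn: "(\<lambda>x. ennreal (norm (g x))) \<in> borel_measurable borel" and fn: "(\<lambda>x. ennreal (norm (f x))) \<in> borel_measurable borel"
    using mg mf by auto
  have Hn: "(\<lambda>z. ennreal (norm (H z))) \<in> borel_measurable (borel \<Otimes>\<^sub>M borel)" using H by simp
  have zn: "ennreal (norm (H (x, y))) = 0" if "x \<notin> S \<or> y \<notin> T" for x y using zero[OF that] by simp
  have "(\<integral>\<^sup>+x. \<integral>\<^sup>+y. ennreal (norm (H (x, y))) \<partial>haar \<partial>haar) = (\<integral>\<^sup>+y. \<integral>\<^sup>+x. ennreal (norm (H (x, y))) \<partial>haar \<partial>haar)"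
    by (rule Fubini_haar_nn(1)[OF Hn S T(1) zn])
  also have "\<dots> = (\<integral>\<^sup>+y. ennreal (norm (f y)) * (\<integral>\<^sup>+x. ennreal (norm (g x)) \<partial>haar) \<partial>haar)"
  proof (rule nn_integral_cong)
    fix y
    have "(\<integral>\<^sup>+x. ennreal (norm (H (x, y))) \<partial>haar) = ennreal (norm (f y)) * (\<integral>\<^sup>+x. ennreal (norm (g (- y + x))) \<partial>haar)"
      using gn by (simp add: H_def norm_mult ennreal_mult nn_integral_cmult)
    then show "(\<integral>\<^sup>+x. ennreal (norm (H (x, y))) \<partial>haar) = ennreal (norm (f y)) * (\<integral>\<^sup>+x. ennreal (norm (g x)) \<partial>haar)"
      using nn_integral_haar_translate[OF gn, of "- y"] by simp
  qed
  also have "\<dots> = ennreal ((\<integral>x. norm (f x) \<partial>haar) * (\<integral>x. norm (g x) \<partial>haar))"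
    using fn f g by (simp add: nn_integral_multc nn_integral_eq_integral ennreal_mult integral_nonneg_AE)
  finally have eq: "(\<integral>\<^sup>+x. \<integral>\<^sup>+y. ennreal (norm (H (x, y))) \<partial>haar \<partial>haar) = ennreal ((\<integral>x. norm (f x) \<partial>haar) * (\<integral>x. norm (g x) \<partial>haar))" .
  then have fin: "(\<integral>\<^sup>+x. \<integral>\<^sup>+y. norm (H (x, y)) \<partial>haar \<partial>haar) < \<infinity>" by simp
  show AE: "AE x in haar. integrable haar (\<lambda>y. f y * g (- y + x))"
    using Fubini_haar_AE_fst[OF H S T(1) zero fin] by (simp add: H_def)
  show int: "integrable haar (convolution f g)"
    using Fubini_haar_integrable_fst[OF H S T(1) zero fin] by (simp add: H_def convolution_def[abs_def])
  have "ennreal (\<integral>x. norm (convolution f g x) \<partial>haar) = (\<integral>\<^sup>+x. ennreal (norm (convolution f g x)) \<partial>haar)"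
    using int by (intro nn_integral_eq_integral[symmetric]) auto
  also have "\<dots> \<le> (\<integral>\<^sup>+x. \<integral>\<^sup>+y. ennreal (norm (H (x, y))) \<partial>haar \<partial>haar)"
  proof (rule nn_integral_mono)
    fix x
    \<comment> \<open>Where the integrand is not integrable, the Bochner integral is
      \<open>0\<close> by default and the bound is trivial.\<close>
    show "ennreal (norm (convolution f g x)) \<le> (\<integral>\<^sup>+y. ennreal (norm (H (x, y))) \<partial>haar)"
      using integral_norm_bound_ennreal[of haar "\<lambda>y. H (x, y)"] not_integrable_integral_eq[of haar "\<lambda>y. H (x, y)"]
      by (cases "integrable haar (\<lambda>y. H (x, y))") (auto simp: convolution_def H_def)
  qed
  finally show "(\<integral>x. norm (convolution f g x) \<partial>haar) \<le> (\<integral>x. norm (f x) \<partial>haar) * (\<integral>x. norm (g x) \<partial>haar)"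
    unfolding eq by (simp add: ennreal_le_iff integral_nonneg_AE)
qed

lemma
  fixes f g :: "'g::haar_group \<Rightarrow> complex"
  assumes f: "integrable haar f" and g: "integrable haar g"
  shows convolution_integrand_integrable: "AE x in haar. integrable haar (\<lambda>y. f y * g (- y + x))"
    and integrable_convolution: "integrable haar (convolution f g)"
    and norm_convolution_le: "(\<integral>x. norm (convolution f g x) \<partial>haar) \<le> (\<integral>x. norm (f x) \<partial>haar) * (\<integral>x. norm (g x) \<partial>haar)"
proof -
  obtain f' where f': "tame f'" "integrable haar f'" "AE x in haar. f x = f' x" using ex_tame_AE_eq[OF f] by blast
  obtain g' where g': "tame g'" "integrable haar g'" "AE x in haar. g x = g' x" using ex_tame_AE_eq[OF g] by blast
  have eq: "convolution f g = convolution f' g'" by (rule convolution_cong_AE[OF f f'(2) g g'(2) f'(3) g'(3)])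
  have m: "f \<in> borel_measurable borel" "g \<in> borel_measurable borel" "f' \<in> borel_measurable borel" "g' \<in> borel_measurable borel"
    using f g f' g' by (auto dest: borel_measurable_integrable)
  note T = tame_convolution[OF f'(2,1) g'(2,1)]
  have iff: "integrable haar (\<lambda>y. f y * g (- y + x)) \<longleftrightarrow> integrable haar (\<lambda>y. f' y * g' (- y + x))" for x
    by (rule integrable_cong_AE)
      (use m convolution_integrand_AE_cong[OF f f'(3) g'(3)] in \<open>auto intro!: convolution_integrand_measurable\<close>)
  show "AE x in haar. integrable haar (\<lambda>y. f y * g (- y + x))" unfolding iff by (rule T(1))
  show "integrable haar (convolution f g)" unfolding eq by (rule T(2))
  have "(\<integral>x. norm (f x) \<partial>haar) = (\<integral>x. norm (f' x) \<partial>haar)" "(\<integral>x. norm (g x) \<partial>haar) = (\<integral>x. norm (g' x) \<partial>haar)"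
    using f'(3) g'(3) m by (auto intro!: integral_cong_AE)
  then show "(\<integral>x. norm (convolution f g x) \<partial>haar) \<le> (\<integral>x. norm (f x) \<partial>haar) * (\<integral>x. norm (g x) \<partial>haar)"
    unfolding eq using T(3) by simp
qed

subsection \<open>The group algebra\<close>

lemma integrable_rep_L1: "integrable haar (rep_L1 a)"
  using Quotient_rep_reflp[OF Quotient_L1, of a] by blast

lemma abs_rep_L1: "abs_L1 (rep_L1 a) = a"
  by (rule Quotient_abs_rep[OF Quotient_L1])

lemma rep_abs_L1_AE: "integrable haar f \<Longrightarrow> AE x in haar. rep_L1 (abs_L1 f) x = f x"
  using Quotient_rep_abs[OF Quotient_L1, of f] by simp

lemma abs_L1_cong: "integrable haar f \<Longrightarrow> integrable haar g \<Longrightarrow> AE x in haar. f x = g x \<Longrightarrow> abs_L1 f = abs_L1 g"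
  using Quotient_rel[OF Quotient_L1, of f g] by blast

lemma
  assumes f: "integrable haar f"
  shows norm_abs_L1: "norm (abs_L1 f) = (\<integral>x. norm (f x) \<partial>haar)"
    and scaleC_abs_L1: "c *\<^sub>C abs_L1 f = abs_L1 (\<lambda>x. c * f x)"
    and scaleR_abs_L1: "r *\<^sub>R abs_L1 f = abs_L1 (\<lambda>x. r *\<^sub>R f x)"
  using f by (simp_all add: norm_L1.abs_eq scaleC_L1.abs_eq scaleR_L1.abs_eq)

lemma
  assumes f: "integrable haar f" and g: "integrable haar g"
  shows add_abs_L1: "abs_L1 f + abs_L1 g = abs_L1 (\<lambda>x. f x + g x)"
    and diff_abs_L1: "abs_L1 f - abs_L1 g = abs_L1 (\<lambda>x. f x - g x)"
  using f g by (simp_all add: plus_L1.abs_eq minus_L1.abs_eq)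

lemma mult_abs_L1:
  assumes f: "integrable haar f" and g: "integrable haar g"
  shows "abs_L1 f * abs_L1 g = abs_L1 (convolution f g)"
  unfolding times_L1_def
  using convolution_cong_AE[OF integrable_rep_L1 f integrable_rep_L1 g rep_abs_L1_AE[OF f] rep_abs_L1_AE[OF g]] by simp

lemma L1_cases:
  obtains f where "integrable haar f" "a = abs_L1 f"
  using integrable_rep_L1 abs_rep_L1 by metis

lemma L1_tame_cases:
  fixes a :: "'g::haar_group L1"
  obtains f where "integrable haar f" "tame f" "a = abs_L1 f"
proof -
  obtain g where g: "integrable haar g" "a = abs_L1 g" by (rule L1_cases)
  obtain f where f: "tame f" "integrable haar f" "AE x in haar. g x = f x" using ex_tame_AE_eq[OF g(1)] by blast
  show ?thesis by (rule that[OF f(2,1)]) (simp add: g(2) abs_L1_cong[OF g(1) f(2,3)])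
qed

section \<open>Bilinearity and submultiplicativity of convolution\<close>

lemma L1_mult_add_left: "(a + b) * c = a * c + b * c" for a b c :: "'g::haar_group L1"
proof -
  obtain f g h where fgh: "integrable haar f" "a = abs_L1 f" "integrable haar g" "b = abs_L1 g" "integrable haar h" "c = abs_L1 h"
    by (metis L1_cases)
  have "AE x in haar. convolution (\<lambda>x. f x + g x) h x = convolution f h x + convolution g h x"
    using convolution_integrand_integrable[OF fgh(1,5)] convolution_integrand_integrable[OF fgh(3,5)]
    by eventually_elim (simp add: convolution_def distrib_right)
  then have "abs_L1 (convolution (\<lambda>x. f x + g x) h) = abs_L1 (\<lambda>x. convolution f h x + convolution g h x)"
    by (rule abs_L1_cong[rotated 2]) (use fgh in \<open>auto intro!: integrable_convolution\<close>)
  then show ?thesis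
    using fgh integrable_convolution[OF fgh(1,5)] integrable_convolution[OF fgh(3,5)]
    by (simp add: add_abs_L1 mult_abs_L1)
qed

lemma L1_mult_add_right: "c * (a + b) = c * a + c * b" for a b c :: "'g::haar_group L1"
proof -
  obtain f g h where fgh: "integrable haar f" "a = abs_L1 f" "integrable haar g" "b = abs_L1 g" "integrable haar h" "c = abs_L1 h"
    by (metis L1_cases)
  have "AE x in haar. convolution h (\<lambda>x. f x + g x) x = convolution h f x + convolution h g x"
    using convolution_integrand_integrable[OF fgh(5,1)] convolution_integrand_integrable[OF fgh(5,3)]
    by eventually_elim (simp add: convolution_def distrib_left)
  then have "abs_L1 (convolution h (\<lambda>x. f x + g x)) = abs_L1 (\<lambda>x. convolution h f x + convolution h g x)"
    by (rule abs_L1_cong[rotated 2]) (use fgh in \<open>auto intro!: integrable_convolution\<close>)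
  then show ?thesis
    using fgh integrable_convolution[OF fgh(5,1)] integrable_convolution[OF fgh(5,3)]
    by (simp add: add_abs_L1 mult_abs_L1)
qed

lemma L1_mult_scaleC_left: "(z *\<^sub>C a) * b = z *\<^sub>C (a * b)" for a b :: "'g::haar_group L1"
proof -
  obtain f g where fg: "integrable haar f" "a = abs_L1 f" "integrable haar g" "b = abs_L1 g"
    by (metis L1_cases)
  have "convolution (\<lambda>x. z * f x) g = (\<lambda>x. z * convolution f g x)"
    by (simp add: convolution_def[abs_def] mult.assoc)
  then show ?thesis
    using fg integrable_convolution[OF fg(1,3)] by (simp add: scaleC_abs_L1 mult_abs_L1)
qed

lemma L1_mult_scaleC_right: "a * (z *\<^sub>C b) = z *\<^sub>C (a * b)" for a b :: "'g::haar_group L1"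
proof -
  obtain f g where fg: "integrable haar f" "a = abs_L1 f" "integrable haar g" "b = abs_L1 g"
    by (metis L1_cases)
  have "convolution f (\<lambda>x. z * g x) = (\<lambda>x. z * convolution f g x)"
    by (simp add: convolution_def[abs_def] mult.left_commute)
  then show ?thesis
    using fg integrable_convolution[OF fg(1,3)] by (simp add: scaleC_abs_L1 mult_abs_L1)
qed

lemma L1_norm_mult_le: "norm (a * b) \<le> norm a * norm b" for a b :: "'g::haar_group L1"
proof -
  obtain f g where fg: "integrable haar f" "a = abs_L1 f" "integrable haar g" "b = abs_L1 g"
    by (metis L1_cases)
  then show ?thesis
    using integrable_convolution[OF fg(1,3)] norm_convolution_le[OF fg(1,3)]
    by (simp add: mult_abs_L1 norm_abs_L1)
qed

lemma L1_mult_diff_left: "(a - b) * c = a * c - b * c" for a b c :: "'g::haar_group L1"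
  by (metis L1_mult_add_left add_diff_cancel_right' diff_add_cancel)

lemma L1_mult_diff_right: "c * (a - b) = c * a - c * b" for a b c :: "'g::haar_group L1"
  by (metis L1_mult_add_right add_diff_cancel_right' diff_add_cancel)

section \<open>Translation operators on the group algebra\<close>

definition ltrans :: "'g::haar_group \<Rightarrow> 'g L1 \<Rightarrow> 'g L1"
  where "ltrans t a = abs_L1 (\<lambda>x. rep_L1 a (- t + x))"

text \<open>The factor \<open>modular t\<close> makes this an isometry, because the integral of
  \<open>f (x + - t)\<close> is \<open>modular (- t)\<close> times that of \<open>f\<close>. It is
  also the factor that makes \<open>rtrans t a * b = a * ltrans t b\<close> hold.\<close>

definition rtrans :: "'g::haar_group \<Rightarrow> 'g L1 \<Rightarrow> 'g L1"
  where "rtrans t a = abs_L1 (\<lambda>x. modular t *\<^sub>R rep_L1 a (x + - t))"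

lemma integrable_ltranslate: "integrable haar f \<Longrightarrow> integrable haar (\<lambda>x. f (t + x))"
  for f :: "'g::haar_group \<Rightarrow> 'b::{banach, second_countable_topology}"
  by (subst integrable_haar_translate_iff) auto

lemma integrable_rtranslate: "integrable haar f \<Longrightarrow> integrable haar (\<lambda>x. f (x + t))"
  for f :: "'g::haar_group \<Rightarrow> 'b::{banach, second_countable_topology}"
  by (subst integrable_haar_right_translate_iff) auto

lemma ltrans_abs_L1:
  assumes f: "integrable haar f"
  shows "ltrans t (abs_L1 f) = abs_L1 (\<lambda>x. f (- t + x))"
  unfolding ltrans_def
  by (intro abs_L1_cong integrable_ltranslate integrable_rep_L1 f AE_haar_translate rep_abs_L1_AE)

lemma rtrans_abs_L1:
  assumes f: "integrable haar f"
  shows "rtrans t (abs_L1 f) = abs_L1 (\<lambda>x. modular t *\<^sub>R f (x + - t))"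
  unfolding rtrans_def
proof (intro abs_L1_cong integrable_scaleR_right integrable_rtranslate integrable_rep_L1 f)
  show "AE x in haar. modular t *\<^sub>R rep_L1 (abs_L1 f) (x + - t) = modular t *\<^sub>R f (x + - t)"
    using AE_haar_right_translate[OF rep_abs_L1_AE[OF f], of "- t"] by eventually_elim simp
qed

lemma norm_ltrans: "norm (ltrans t a) = norm a"
proof -
  obtain f where f: "integrable haar f" "a = abs_L1 f" by (rule L1_cases)
  then show ?thesis
    using integral_haar_translate[of "\<lambda>x. norm (f x)" "- t"] integrable_ltranslate[OF f(1), of "- t"]
    by (simp add: ltrans_abs_L1 norm_abs_L1)
qed

lemma norm_rtrans: "norm (rtrans t a) = norm a"
proof -
  obtain f where f: "integrable haar f" "a = abs_L1 f" by (rule L1_cases)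
  have "norm (rtrans t a) = modular t * (\<integral>x. norm (f (x + - t)) \<partial>haar)"
    using f integrable_rtranslate[OF f(1), of "- t"] modular_pos[of t]
    by (simp add: rtrans_abs_L1 norm_abs_L1)
  also have "\<dots> = modular t * (modular (- t) * (\<integral>x. norm (f x) \<partial>haar))"
    using f(1) by (subst integral_haar_right_translate) auto
  also have "\<dots> = norm a" using modular_uminus[of "- t"] f by (simp add: norm_abs_L1 flip: mult.assoc)
  finally show ?thesis .
qed

lemma ltrans_add: "ltrans t (a + b) = ltrans t a + ltrans t b"
proof -
  obtain f g where fg: "integrable haar f" "a = abs_L1 f" "integrable haar g" "b = abs_L1 g"
    by (metis L1_cases)
  then show ?thesis using integrable_ltranslate[OF fg(1), of "- t"] integrable_ltranslate[OF fg(3), of "- t"]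
    by (simp add: add_abs_L1 ltrans_abs_L1)
qed

lemma rtrans_add: "rtrans t (a + b) = rtrans t a + rtrans t b"
proof -
  obtain f g where fg: "integrable haar f" "a = abs_L1 f" "integrable haar g" "b = abs_L1 g"
    by (metis L1_cases)
  then show ?thesis using integrable_rtranslate[OF fg(1), of "- t"] integrable_rtranslate[OF fg(3), of "- t"]
    by (simp add: add_abs_L1 rtrans_abs_L1 scaleR_add_right)
qed

lemma ltrans_scaleC: "ltrans t (c *\<^sub>C a) = c *\<^sub>C ltrans t a"
proof -
  obtain f where f: "integrable haar f" "a = abs_L1 f" by (rule L1_cases)
  then show ?thesis using integrable_ltranslate[OF f(1), of "- t"]
    by (simp add: scaleC_abs_L1 ltrans_abs_L1)
qed

lemma rtrans_scaleC: "rtrans t (c *\<^sub>C a) = c *\<^sub>C rtrans t a"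
proof -
  obtain f where f: "integrable haar f" "a = abs_L1 f" by (rule L1_cases)
  then show ?thesis using integrable_rtranslate[OF f(1), of "- t"]
    by (simp add: scaleC_abs_L1 rtrans_abs_L1)
qed

lemma ltrans_diff: "ltrans t (a - b) = ltrans t a - ltrans t b"
  by (metis ltrans_add add_diff_cancel_right' diff_add_cancel)

lemma rtrans_diff: "rtrans t (a - b) = rtrans t a - rtrans t b"
  by (metis rtrans_add add_diff_cancel_right' diff_add_cancel)

lemma ltrans_zero: "ltrans 0 a = a"
  by (simp add: ltrans_def abs_rep_L1)

lemma rtrans_zero: "rtrans 0 a = a"
  by (simp add: rtrans_def abs_rep_L1)

lemma ltrans_ltrans: "ltrans s (ltrans t a) = ltrans (s + t) a"
proof -
  obtain f where f: "integrable haar f" "a = abs_L1 f" by (rule L1_cases)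
  then show ?thesis using integrable_ltranslate[OF f(1), of "- t"]
    by (simp add: ltrans_abs_L1 minus_add add.assoc del: add_uminus_conv_diff)
qed

lemma rtrans_rtrans: "rtrans t (rtrans s a) = rtrans (s + t) a"
proof -
  obtain f where f: "integrable haar f" "a = abs_L1 f" by (rule L1_cases)
  have "rtrans t (rtrans s a) = abs_L1 (\<lambda>x. modular t *\<^sub>R modular s *\<^sub>R f (x + - t + - s))"
    using f integrable_rtranslate[OF f(1), of "- s"] by (simp add: rtrans_abs_L1)
  also have "\<dots> = rtrans (s + t) a"
    using f by (simp add: rtrans_abs_L1 modular_add mult.commute minus_add add.assoc del: add_uminus_conv_diff)
  finally show ?thesis .
qed

lemma ltrans_rtrans: "ltrans s (rtrans t a) = rtrans t (ltrans s a)"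
proof -
  obtain f where f: "integrable haar f" "a = abs_L1 f" by (rule L1_cases)
  then show ?thesis using integrable_ltranslate[OF f(1), of "- s"] integrable_rtranslate[OF f(1), of "- t"]
    by (simp add: ltrans_abs_L1 rtrans_abs_L1 add.assoc del: add_uminus_conv_diff)
qed

lemma ltrans_mult: "ltrans t (a * b) = ltrans t a * b"
proof -
  obtain f g where fg: "integrable haar f" "a = abs_L1 f" "integrable haar g" "b = abs_L1 g"
    by (metis L1_cases)
  have "convolution (\<lambda>x. f (- t + x)) g x = convolution f g (- t + x)" for x
  proof -
    have "(\<lambda>y. f y * g (- y + (- t + x))) \<in> borel_measurable borel"
      using fg by (intro convolution_integrand_measurable) auto
    from integral_haar_translate[OF this, of "- t"] show ?thesis
      by (simp add: convolution_def minus_add add.assoc del: add_uminus_conv_diff)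
  qed
  then have "convolution (\<lambda>x. f (- t + x)) g = (\<lambda>x. convolution f g (- t + x))" by (rule ext)
  then show ?thesis
    using fg integrable_convolution[OF fg(1,3)] integrable_ltranslate[OF fg(1), of "- t"]
    by (simp add: mult_abs_L1 ltrans_abs_L1)
qed

lemma rtrans_mult: "rtrans t (a * b) = a * rtrans t b"
proof -
  obtain f g where fg: "integrable haar f" "a = abs_L1 f" "integrable haar g" "b = abs_L1 g"
    by (metis L1_cases)
  have "convolution f (\<lambda>x. modular t *\<^sub>R g (x + - t)) x = modular t *\<^sub>R convolution f g (x + - t)" for x
    by (simp add: convolution_def add.assoc del: add_uminus_conv_diff)
  then have "convolution f (\<lambda>x. modular t *\<^sub>R g (x + - t)) = (\<lambda>x. modular t *\<^sub>R convolution f g (x + - t))" by (rule ext)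
  then show ?thesis
    using fg integrable_convolution[OF fg(1,3)] integrable_rtranslate[OF fg(3), of "- t"]
    by (simp add: mult_abs_L1 rtrans_abs_L1)
qed

text \<open>Right translation of the integration variable by \<open>- t\<close> produces
  \<open>modular (- t)\<close>, which cancels the factor built into \<open>rtrans\<close>.\<close>

lemma rtrans_mult_eq_mult_ltrans: "rtrans t a * b = a * ltrans t b"
proof -
  obtain f g where fg: "integrable haar f" "a = abs_L1 f" "integrable haar g" "b = abs_L1 g"
    by (metis L1_cases)
  have "convolution (\<lambda>x. modular t *\<^sub>R f (x + - t)) g x = convolution f (\<lambda>x. g (- t + x)) x" for x
  proof -
    have m: "(\<lambda>y. f y * g (- t + (- y + x))) \<in> borel_measurable borel"
      using fg by (intro convolution_integrand_measurable[where g = "\<lambda>x. g (- t + x)"]) auto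
    have "convolution (\<lambda>x. modular t *\<^sub>R f (x + - t)) g x = modular t *\<^sub>R (\<integral>y. f (y + - t) * g (- t + (- (y + - t) + x)) \<partial>haar)"
      by (simp add: convolution_def minus_add add.assoc del: add_uminus_conv_diff)
    also have "\<dots> = (modular t * modular (- t)) *\<^sub>R (\<integral>y. f y * g (- t + (- y + x)) \<partial>haar)"
      using integral_haar_right_translate[OF m, of "- t"] by simp
    also have "\<dots> = convolution f (\<lambda>x. g (- t + x)) x"
      using modular_uminus[of "- t"] by (simp add: convolution_def)
    finally show ?thesis .
  qed
  then have "convolution (\<lambda>x. modular t *\<^sub>R f (x + - t)) g = convolution f (\<lambda>x. g (- t + x))" by (rule ext)
  then show ?thesis
    using fg integrable_ltranslate[OF fg(3), of "- t"] integrable_rtranslate[OF fg(1), of "- t"]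
    by (simp add: mult_abs_L1 rtrans_abs_L1 ltrans_abs_L1)
qed

text \<open>Formally \<open>f * b\<close> is the integral of \<open>f y\<close> times
  \<open>ltrans y b\<close>, and replacing \<open>ltrans y b\<close> by \<open>ltrans t b\<close>
  costs at most \<open>\<eta>\<close>. The estimate is carried out by Tonelli's theorem for the
  scalar kernel \<open>H\<close>.\<close>

lemma norm_mult_minus_ltrans_le:
  fixes f :: "'g::haar_group \<Rightarrow> complex"
  assumes f: "integrable haar f" and \<eta>: "0 \<le> \<eta>"
    and near: "\<And>y. f y \<noteq> 0 \<Longrightarrow> norm (ltrans y b - ltrans t b) \<le> \<eta>"
  shows "norm (abs_L1 f * b - (\<integral>x. f x \<partial>haar) *\<^sub>C ltrans t b) \<le> \<eta> * norm (abs_L1 f)"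
proof -
  obtain f' where f': "tame f'" "integrable haar f'" "AE x in haar. f x = f' x" using ex_tame_AE_eq[OF f] by blast
  obtain T where T: "sigma_compact T" "\<And>x. x \<notin> T \<Longrightarrow> f' x = 0" using tame_support[OF f'(1)] by blast
  \<comment> \<open>The tame representative could be nonzero where \<open>f\<close> is zero and so
    violate \<open>near\<close>. Cutting \<open>f\<close> down to the support of the tame one keeps
    \<open>near\<close> and makes the support sigma-compact.\<close>
  define k where "k x = indicator T x *\<^sub>R f x" for x
  have k: "integrable haar k" unfolding k_def
    using integrable_mult_indicator[OF _ f, of T] sigma_compact_borel[OF T(1)] by simp
  have kf: "AE x in haar. f x = k x" using f'(3) by eventually_elim (auto simp: k_def T(2) indicator_def)
  have k0: "k x = 0" if "x \<notin> T" for x using that by (simp add: k_def)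
  have knear: "norm (ltrans y b - ltrans t b) \<le> \<eta>" if "k y \<noteq> 0" for y
    using that near[of y] by (auto simp: k_def)
  have fk: "abs_L1 f = abs_L1 k" by (rule abs_L1_cong[OF f k kf])
  have ik: "(\<integral>x. f x \<partial>haar) = (\<integral>x. k x \<partial>haar)" using f k kf by (intro integral_cong_AE) auto
  obtain g where g: "integrable haar g" "tame g" "b = abs_L1 g" by (rule L1_tame_cases)
  obtain T' where T': "sigma_compact T'" "\<And>x. x \<notin> T' \<Longrightarrow> g x = 0" using tame_support[OF g(2)] by blast
  define S where "S = (\<lambda>(x, y). x + y) ` (T \<times> T') \<union> (\<lambda>(x, y). x + y) ` ({t} \<times> T')"
  have S: "sigma_compact S" unfolding S_def
    by (intro sigma_compact_Un sigma_compact_plus T(1) T'(1) compact_imp_sigma_compact) simp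
  have mk: "k \<in> borel_measurable borel" using k by auto
  note mg = tame_measurable[OF g(2)]
  define H where "H = (\<lambda>(x, y). k y * (g (- y + x) - g (- t + x)))"
  have zero: "H (x, y) = 0" if "x \<notin> S \<or> y \<notin> T" for x y
  proof (rule ccontr)
    assume "H (x, y) \<noteq> 0"
    then have "k y \<noteq> 0" "g (- y + x) \<noteq> 0 \<or> g (- t + x) \<noteq> 0" by (auto simp: H_def)
    then have y: "y \<in> T" "- y + x \<in> T' \<or> - t + x \<in> T'" using k0 T'(2) by blast+
    then have "y + (- y + x) \<in> S \<or> t + (- t + x) \<in> S" unfolding S_def by force
    then show False using that \<open>y \<in> T\<close> by (simp flip: add.assoc)
  qed
  have "H = (\<lambda>z. k (snd z) * ((indicator S (fst z) * indicator T (snd z)) *\<^sub>R g (- snd z + fst z) -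
      (indicator S (fst z) * indicator T (snd z)) *\<^sub>R g (- t + fst z)))"
  proof
    fix z show "H z = k (snd z) * ((indicator S (fst z) * indicator T (snd z)) *\<^sub>R g (- snd z + fst z) -
      (indicator S (fst z) * indicator T (snd z)) *\<^sub>R g (- t + fst z))"
      using zero[of "fst z" "snd z"] by (cases z) (auto simp: H_def indicator_def)
  qed
  moreover have "(\<lambda>z. k (snd z)) \<in> borel_measurable (borel \<Otimes>\<^sub>M borel)" using mk by simp
  moreover have "(\<lambda>z. (indicator S (fst z) * indicator T (snd z)) *\<^sub>R g (- t + fst z)) \<in> borel_measurable (borel \<Otimes>\<^sub>M borel)"
    using mg sigma_compact_borel[OF S] sigma_compact_borel[OF T(1)] by measurable
  ultimately have H: "H \<in> borel_measurable (borel \<Otimes>\<^sub>M borel)"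
    using borel_measurable_times[OF _ borel_measurable_diff[OF tame_kernel_measurable[OF g(2) S T(1)]]] by (simp only:)
  have Hn: "(\<lambda>z. ennreal (norm (H z))) \<in> borel_measurable (borel \<Otimes>\<^sub>M borel)" using H by simp
  have zn: "ennreal (norm (H (x, y))) = 0" if "x \<notin> S \<or> y \<notin> T" for x y using zero[OF that] by simp
  define D where "D x = convolution k g x - (\<integral>x. k x \<partial>haar) * g (- t + x)" for x
  note ig = integrable_ltranslate[OF g(1)] and ic = integrable_convolution[OF k g(1)]
  have D: "integrable haar D" unfolding D_def using ic ig by auto
  have "abs_L1 f * b - (\<integral>x. f x \<partial>haar) *\<^sub>C ltrans t b = abs_L1 D"
    unfolding fk ik g(3) ltrans_abs_L1[OF g(1)] mult_abs_L1[OF k g(1)] scaleC_abs_L1[OF ig] D_def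
    by (rule diff_abs_L1) (use ic ig in auto)
  then have "ennreal (norm (abs_L1 f * b - (\<integral>x. f x \<partial>haar) *\<^sub>C ltrans t b)) = (\<integral>\<^sup>+x. ennreal (norm (D x)) \<partial>haar)"
    using D by (simp add: norm_abs_L1 nn_integral_eq_integral)
  also have "\<dots> \<le> (\<integral>\<^sup>+x. \<integral>\<^sup>+y. ennreal (norm (H (x, y))) \<partial>haar \<partial>haar)"
  proof (rule nn_integral_mono_AE)
    show "AE x in haar. ennreal (norm (D x)) \<le> (\<integral>\<^sup>+y. ennreal (norm (H (x, y))) \<partial>haar)"
      using convolution_integrand_integrable[OF k g(1)]
    proof eventually_elim
      case (elim x)
      have int: "integrable haar (\<lambda>y. k y * g (- y + x) - k y * g (- t + x))" using elim k by auto
      have "D x = (\<integral>y. k y * g (- y + x) - k y * g (- t + x) \<partial>haar)"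
        using elim k by (simp add: D_def convolution_def)
      also have "\<dots> = (\<integral>y. H (x, y) \<partial>haar)" by (simp add: H_def right_diff_distrib)
      finally have Dx: "D x = (\<integral>y. H (x, y) \<partial>haar)" .
      have "integrable haar (\<lambda>y. H (x, y))" using int by (simp add: H_def right_diff_distrib)
      then show ?case unfolding Dx by (rule integral_norm_bound_ennreal)
    qed
  qed
  also have "\<dots> = (\<integral>\<^sup>+y. \<integral>\<^sup>+x. ennreal (norm (H (x, y))) \<partial>haar \<partial>haar)"
    by (rule Fubini_haar_nn(1)[OF Hn S T(1) zn])
  also have "\<dots> \<le> (\<integral>\<^sup>+y. ennreal \<eta> * ennreal (norm (k y)) \<partial>haar)"
  proof (rule nn_integral_mono)
    fix y
    have ig2: "integrable haar (\<lambda>x. g (- y + x) - g (- t + x))" using ig by auto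
    have "(\<integral>\<^sup>+x. ennreal (norm (H (x, y))) \<partial>haar) = ennreal (norm (k y)) * (\<integral>\<^sup>+x. ennreal (norm (g (- y + x) - g (- t + x))) \<partial>haar)"
      using ig2 by (simp add: H_def norm_mult ennreal_mult nn_integral_cmult)
    also have "(\<integral>\<^sup>+x. ennreal (norm (g (- y + x) - g (- t + x))) \<partial>haar) = ennreal (norm (ltrans y b - ltrans t b))"
      unfolding g(3) ltrans_abs_L1[OF g(1)] diff_abs_L1[OF ig ig] norm_abs_L1[OF ig2]
      using ig2 by (simp add: nn_integral_eq_integral)
    also have "ennreal (norm (k y)) * ennreal (norm (ltrans y b - ltrans t b)) \<le> ennreal (norm (k y)) * ennreal \<eta>"
      using knear[of y] by (cases "k y = 0") (auto intro!: mult_left_mono ennreal_leI)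
    finally show "(\<integral>\<^sup>+x. ennreal (norm (H (x, y))) \<partial>haar) \<le> ennreal \<eta> * ennreal (norm (k y))"
      by (simp add: mult.commute)
  qed
  also have "\<dots> = ennreal (\<eta> * norm (abs_L1 f))"
    using k \<eta> by (simp add: fk norm_abs_L1 nn_integral_cmult nn_integral_eq_integral ennreal_mult integral_nonneg_AE)
  finally show ?thesis using \<eta> by (simp add: ennreal_le_iff)
qed

section \<open>Strong continuity of translations\<close>

lemma L1_Cc_dense:
  fixes a :: "'g::haar_group L1"
  assumes "0 < \<epsilon>"
  shows "\<exists>f\<in>Cc. norm (a - abs_L1 f) < \<epsilon>"
proof -
  obtain f where f: "integrable haar f" "a = abs_L1 f" by (rule L1_cases)
  obtain h where h: "h \<in> Cc" "(\<integral>x. norm (f x - h x) \<partial>haar) < \<epsilon>"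
    using Cc_dense[OF f(1) assms] by auto
  then show ?thesis using f Cc_integrable[OF h(1)] by (auto simp: diff_abs_L1 norm_abs_L1 intro!: bexI[of _ h])
qed

text \<open>Isometries inherit continuity at \<open>0\<close> from the dense set \<open>Cc\<close>.
  The hypothesis is stated for \<open>T (- v)\<close> to match the translates
  \<open>h (v + x)\<close> and \<open>h (x + v)\<close>, so the neighbourhood is inverted at the
  end.\<close>

lemma isometric_family_continuous:
  fixes T :: "'g::haar_group \<Rightarrow> 'g L1 \<Rightarrow> 'g L1"
  assumes T: "\<And>v a b. T v (a - b) = T v a - T v b" "\<And>v a. norm (T v a) = norm a"
    and cont: "\<And>h \<epsilon>. h \<in> Cc \<Longrightarrow> 0 < \<epsilon> \<Longrightarrow> \<exists>V. open V \<and> 0 \<in> V \<and> (\<forall>v\<in>V. norm (T (- v) (abs_L1 h) - abs_L1 h) \<le> \<epsilon>)"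
    and X: "finite X" and \<epsilon>: "0 < \<epsilon>"
  shows "\<exists>V. open V \<and> 0 \<in> V \<and> (\<forall>a\<in>X. \<forall>v\<in>V. norm (T v a - a) < \<epsilon>)"
proof -
  have "\<exists>V. open V \<and> 0 \<in> V \<and> (\<forall>v\<in>V. norm (T v a - a) < \<epsilon>)" for a
  proof -
    obtain h where h: "h \<in> Cc" "norm (a - abs_L1 h) < \<epsilon> / 3" using L1_Cc_dense[of "\<epsilon> / 3" a] \<epsilon> by auto
    obtain V where V: "open V" "0 \<in> V" "\<And>v. v \<in> V \<Longrightarrow> norm (T (- v) (abs_L1 h) - abs_L1 h) \<le> \<epsilon> / 3"
      using cont[OF h(1), of "\<epsilon> / 3"] \<epsilon> by auto
    show ?thesis
    proof (intro exI conjI ballI)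
      show "open (uminus ` V)" by (rule open_homeomorphism_image[OF homeomorphism_uminus V(1)])
      show "0 \<in> uminus ` V" using V(2) by (auto intro!: image_eqI[of _ _ 0])
      fix v assume "v \<in> uminus ` V"
      then have v: "norm (T v (abs_L1 h) - abs_L1 h) \<le> \<epsilon> / 3" using V(3) by auto
      have "T v a - a = T v (a - abs_L1 h) + (T v (abs_L1 h) - abs_L1 h) - (a - abs_L1 h)" by (simp add: T(1))
      also have "norm \<dots> \<le> norm (T v (a - abs_L1 h)) + norm (T v (abs_L1 h) - abs_L1 h) + norm (a - abs_L1 h)"
        by (rule order_trans[OF norm_triangle_ineq4 add_right_mono[OF norm_triangle_ineq]])
      also have "\<dots> < \<epsilon>" using h(2) v by (simp add: T(2))
      finally show "norm (T v a - a) < \<epsilon>" .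
    qed
  qed
  then obtain V where V: "\<And>a. open (V a) \<and> 0 \<in> V a \<and> (\<forall>v\<in>V a. norm (T v a - a) < \<epsilon>)" by metis
  show ?thesis using V X by (intro exI[of _ "\<Inter>a\<in>X. V a"]) (auto intro!: open_INT)
qed

lemma ltrans_continuous:
  fixes X :: "'g::haar_group L1 set"
  assumes "finite X" "0 < \<epsilon>"
  shows "\<exists>V. open V \<and> 0 \<in> V \<and> (\<forall>a\<in>X. \<forall>v\<in>V. norm (ltrans v a - a) < \<epsilon>)"
proof (rule isometric_family_continuous[OF ltrans_diff norm_ltrans _ assms])
  fix h :: "'g \<Rightarrow> complex" and \<epsilon> :: real assume h: "h \<in> Cc" and \<epsilon>: "0 < \<epsilon>"
  note ih = Cc_integrable[OF h]
  obtain C where C: "compact C" "\<And>\<epsilon>. 0 < \<epsilon> \<Longrightarrow> \<exists>V. open V \<and> 0 \<in> V \<and> (\<forall>v\<in>V. \<forall>x. norm (h (v + x) - h x) \<le> \<epsilon> * indicator C x)"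
    using Cc_uniformly_continuous_left[OF h] by blast
  obtain \<delta> where \<delta>: "0 < \<delta>" "\<And>F::'g \<Rightarrow> real. integrable haar F \<Longrightarrow> (\<forall>x. F x \<le> \<delta> * indicator C x) \<Longrightarrow> (\<integral>x. F x \<partial>haar) \<le> \<epsilon>"
    using ex_small_multiple_indicator[OF C(1) \<epsilon>] by blast
  obtain V where V: "open V" "0 \<in> V" "\<And>v x. v \<in> V \<Longrightarrow> norm (h (v + x) - h x) \<le> \<delta> * indicator C x"
    using C(2)[OF \<delta>(1)] by blast
  have "norm (ltrans (- v) (abs_L1 h) - abs_L1 h) \<le> \<epsilon>" if v: "v \<in> V" for v
  proof -
    have "norm (ltrans (- v) (abs_L1 h) - abs_L1 h) = (\<integral>x. norm (h (v + x) - h x) \<partial>haar)"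
      using ih integrable_ltranslate[OF ih, of v] by (simp add: ltrans_abs_L1 diff_abs_L1 norm_abs_L1)
    also have "\<dots> \<le> \<epsilon>" by (rule \<delta>(2)) (use V(3)[OF v] ih integrable_ltranslate[OF ih, of v] in auto)
    finally show ?thesis .
  qed
  then show "\<exists>V. open V \<and> 0 \<in> V \<and> (\<forall>v\<in>V. norm (ltrans (- v) (abs_L1 h) - abs_L1 h) \<le> \<epsilon>)" using V by blast
qed

lemma rtrans_continuous:
  fixes X :: "'g::haar_group L1 set"
  assumes "finite X" "0 < \<epsilon>"
  shows "\<exists>V. open V \<and> 0 \<in> V \<and> (\<forall>a\<in>X. \<forall>v\<in>V. norm (rtrans v a - a) < \<epsilon>)"
proof (rule isometric_family_continuous[OF rtrans_diff norm_rtrans _ assms])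
  fix h :: "'g \<Rightarrow> complex" and \<epsilon> :: real assume h: "h \<in> Cc" and \<epsilon>: "0 < \<epsilon>"
  note ih = Cc_integrable[OF h]
  obtain C where C: "compact C" "\<And>\<epsilon>. 0 < \<epsilon> \<Longrightarrow> \<exists>V. open V \<and> 0 \<in> V \<and> (\<forall>v\<in>V. \<forall>x. norm (h (x + v) - h x) \<le> \<epsilon> * indicator C x)"
    using Cc_uniformly_continuous_right[OF h] by blast
  obtain \<delta> where \<delta>: "0 < \<delta>" "\<And>F::'g \<Rightarrow> real. integrable haar F \<Longrightarrow> (\<forall>x. F x \<le> \<delta> * indicator C x) \<Longrightarrow> (\<integral>x. F x \<partial>haar) \<le> \<epsilon> / 2"
    using ex_small_multiple_indicator[OF C(1), of "\<epsilon> / 2"] \<epsilon> by auto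
  obtain V where V: "open V" "0 \<in> V" "\<And>v x. v \<in> V \<Longrightarrow> norm (h (x + v) - h x) \<le> \<delta> * indicator C x"
    using C(2)[OF \<delta>(1)] by blast
  define b where "b = abs_L1 h"
  have "norm (rtrans (- v) b - b) \<le> \<epsilon>" if v: "v \<in> V" for v
  proof -
    define b' where "b' = abs_L1 (\<lambda>x. h (x + v))"
    note ihv = integrable_rtranslate[OF ih, of v]
    have r: "rtrans (- v) b = modular (- v) *\<^sub>R b'" using ih ihv by (simp add: b_def b'_def rtrans_abs_L1 scaleR_abs_L1)
    then have nb: "norm b = modular (- v) * norm b'" using norm_rtrans[of "- v" b] modular_pos[of "- v"] by simp
    have "norm (b' - b) = (\<integral>x. norm (h (x + v) - h x) \<partial>haar)"
      using ih ihv by (simp add: b_def b'_def diff_abs_L1 norm_abs_L1)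
    also have "\<dots> \<le> \<epsilon> / 2" by (rule \<delta>(2)) (use V(3)[OF v] ih ihv in auto)
    finally have bb: "norm (b' - b) \<le> \<epsilon> / 2" .
    have "rtrans (- v) b - b = (modular (- v) - 1) *\<^sub>R b' + (b' - b)" by (simp add: r scaleR_left_diff_distrib)
    also have "norm \<dots> \<le> \<bar>modular (- v) - 1\<bar> * norm b' + norm (b' - b)"
      by (rule order_trans[OF norm_triangle_ineq]) simp
    \<comment> \<open>The isometry property gives \<open>norm b = modular (- v) * norm b'\<close>,
      which turns the term with the modular function into a difference of norms.\<close>
    also have "\<bar>modular (- v) - 1\<bar> * norm b' = \<bar>norm b - norm b'\<bar>"
      unfolding nb using abs_mult[of "modular (- v) - 1" "norm b'"] by (simp add: left_diff_distrib)
    also have "\<dots> \<le> norm (b' - b)" by (metis norm_triangle_ineq3 norm_minus_commute)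
    finally show ?thesis using bb by simp
  qed
  then show "\<exists>V. open V \<and> 0 \<in> V \<and> (\<forall>v\<in>V. norm (rtrans (- v) (abs_L1 h) - abs_L1 h) \<le> \<epsilon>)" using V by (auto simp: b_def)
qed

subsection \<open>Approximation by translations\<close>

lemma L1_zero_mult: "0 * a = 0" "a * 0 = 0" for a :: "'g::haar_group L1"
  using L1_mult_diff_left[of 0 0 a] L1_mult_diff_right[of a 0 0] by simp_all

text \<open>\<open>f\<close> is cut along the translates \<open>t + V\<close> one at a time, and
  \<open>c t\<close> is the integral of the piece belonging to \<open>t\<close>. The pieces are
  disjoint, so their norms, and with them the errors, add up; the coefficients do not depend on
  \<open>b\<close>.\<close>

lemma ltrans_combination:
  fixes f :: "'g::haar_group \<Rightarrow> complex"
  assumes "finite I" and V: "open V"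
    and "integrable haar f" "\<And>x. f x \<noteq> 0 \<Longrightarrow> x \<in> (\<Union>t\<in>I. (+) t ` V)"
  shows "\<exists>c. (\<Sum>t\<in>I. norm (c t)) \<le> norm (abs_L1 f) \<and> (\<forall>b \<eta>. 0 \<le> \<eta> \<longrightarrow> (\<forall>v\<in>V. norm (ltrans v b - b) \<le> \<eta>) \<longrightarrow>
    norm (abs_L1 f * b - (\<Sum>t\<in>I. c t *\<^sub>C ltrans t b)) \<le> \<eta> * norm (abs_L1 f))"
  using assms(1,3,4)
proof (induction I arbitrary: f rule: finite_induct)
  case empty
  then have "f = (\<lambda>_. 0)" by auto
  then have "abs_L1 f = 0" by (simp add: zero_L1_def)
  then show ?case by (simp add: L1_zero_mult)
next
  case (insert t I)
  define E where "E = (+) t ` V"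
  have E: "E \<in> sets borel" unfolding E_def
    by (intro borel_open open_homeomorphism_image[OF homeomorphism_add_left V])
  define f1 f2 where "f1 x = indicator E x *\<^sub>R f x" and "f2 x = indicator (- E) x *\<^sub>R f x" for x
  have f12: "integrable haar f1" "integrable haar f2" unfolding f1_def f2_def
    using integrable_mult_indicator[OF _ insert.prems(1)] E by simp_all
  have sum: "abs_L1 f = abs_L1 f1 + abs_L1 f2"
    unfolding add_abs_L1[OF f12] by (intro arg_cong[where f = abs_L1]) (auto simp: f1_def f2_def indicator_def)
  have "norm (abs_L1 f1) + norm (abs_L1 f2) = (\<integral>x. norm (f1 x) + norm (f2 x) \<partial>haar)"
    using f12 by (simp add: norm_abs_L1)
  also have "\<dots> = norm (abs_L1 f)" unfolding norm_abs_L1[OF insert.prems(1)]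
    by (intro Bochner_Integration.integral_cong refl) (auto simp: f1_def f2_def indicator_def)
  finally have nsum: "norm (abs_L1 f1) + norm (abs_L1 f2) = norm (abs_L1 f)" .
  have "x \<in> (\<Union>t\<in>I. (+) t ` V)" if "f2 x \<noteq> 0" for x
  proof -
    have "f x \<noteq> 0" "x \<notin> E" using that by (auto simp: f2_def indicator_def split: if_splits)
    then show ?thesis using insert.prems(2)[of x] by (simp add: E_def)
  qed
  from insert.IH[OF f12(2) this] obtain c where c: "(\<Sum>t\<in>I. norm (c t)) \<le> norm (abs_L1 f2)"
    "\<And>b \<eta>. 0 \<le> \<eta> \<Longrightarrow> (\<forall>v\<in>V. norm (ltrans v b - b) \<le> \<eta>) \<Longrightarrow>
      norm (abs_L1 f2 * b - (\<Sum>t\<in>I. c t *\<^sub>C ltrans t b)) \<le> \<eta> * norm (abs_L1 f2)" by blast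
  define c' where "c' = c(t := \<integral>x. f1 x \<partial>haar)"
  have c': "c' t = (\<integral>x. f1 x \<partial>haar)" "\<And>s. s \<in> I \<Longrightarrow> c' s = c s" using insert.hyps(2) by (auto simp: c'_def)
  show ?case
  proof (intro exI[of _ c'] conjI allI impI)
    have "norm (c' t) \<le> norm (abs_L1 f1)" unfolding c'(1) norm_abs_L1[OF f12(1)] by (rule integral_norm_bound)
    then show "(\<Sum>t\<in>insert t I. norm (c' t)) \<le> norm (abs_L1 f)"
      using c(1) insert.hyps c'(2) nsum by simp
    fix b \<eta> assume \<eta>: "(0::real) \<le> \<eta>" and near: "\<forall>v\<in>V. norm (ltrans v b - b) \<le> \<eta>"
    have "norm (ltrans y b - ltrans t b) \<le> \<eta>" if "f1 y \<noteq> 0" for y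
    proof -
      have "y \<in> E" using that by (auto simp: f1_def indicator_def split: if_splits)
      then obtain v where v: "v \<in> V" "y = t + v" by (auto simp: E_def)
      then have "ltrans y b - ltrans t b = ltrans t (ltrans v b - b)" by (simp add: ltrans_diff ltrans_ltrans)
      then show ?thesis using near v by (simp add: norm_ltrans)
    qed
    note 1 = norm_mult_minus_ltrans_le[OF f12(1) \<eta> this]
    have "abs_L1 f * b - (\<Sum>t\<in>insert t I. c' t *\<^sub>C ltrans t b) =
      (abs_L1 f1 * b - (\<integral>x. f1 x \<partial>haar) *\<^sub>C ltrans t b) + (abs_L1 f2 * b - (\<Sum>t\<in>I. c t *\<^sub>C ltrans t b))"
      using insert.hyps c' by (simp add: sum L1_mult_add_left)
    also have "norm \<dots> \<le> \<eta> * norm (abs_L1 f1) + \<eta> * norm (abs_L1 f2)"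
      by (rule norm_triangle_le[OF add_mono[OF 1 c(2)[OF \<eta> near]]])
    also have "\<dots> = \<eta> * norm (abs_L1 f)" using nsum by (simp flip: distrib_left)
    finally show "norm (abs_L1 f * b - (\<Sum>t\<in>insert t I. c' t *\<^sub>C ltrans t b)) \<le> \<eta> * norm (abs_L1 f)" .
  qed
qed

lemma compact_cover_translates:
  fixes K V :: "'g::topological_group_add set"
  assumes K: "compact K" and V: "open V" "0 \<in> V"
  shows "\<exists>I. finite I \<and> I \<subseteq> K \<and> K \<subseteq> (\<Union>t\<in>I. (+) t ` V)"
proof -
  have "K \<subseteq> (\<Union>t\<in>K. (+) t ` V)" using V(2) by (force intro: image_eqI[of _ _ 0])
  then show ?thesis
    using compactE_image[OF K, of K "\<lambda>t. (+) t ` V"] open_homeomorphism_image[OF homeomorphism_add_left V(1)] by metis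
qed

text \<open>\<open>I \<subseteq> K\<close> and the bound on the coefficients are recorded for
  \<open>translation_approx\<close>, where an error uniform over \<open>K\<close> is summed against
  them.\<close>

lemma Cc_mult_approx:
  fixes f :: "'g::haar_group \<Rightarrow> complex"
  assumes f: "f \<in> Cc" and K: "compact K" "\<And>x. x \<notin> K \<Longrightarrow> f x = 0" and X: "finite X" and \<eta>: "0 < \<eta>"
  shows "\<exists>I c. finite I \<and> I \<subseteq> K \<and> (\<Sum>t\<in>I. norm (c t)) \<le> norm (abs_L1 f) \<and>
    (\<forall>b\<in>X. norm (abs_L1 f * b - (\<Sum>t\<in>I. c t *\<^sub>C ltrans t b)) \<le> \<eta> * norm (abs_L1 f))"
proof -
  obtain V where V: "open V" "0 \<in> V" "\<And>a v. a \<in> X \<Longrightarrow> v \<in> V \<Longrightarrow> norm (ltrans v a - a) < \<eta>"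
    using ltrans_continuous[OF X \<eta>] by blast
  obtain I where I: "finite I" "I \<subseteq> K" "K \<subseteq> (\<Union>t\<in>I. (+) t ` V)"
    using compact_cover_translates[OF K(1) V(1,2)] by blast
  have "x \<in> (\<Union>t\<in>I. (+) t ` V)" if "f x \<noteq> 0" for x using that K(2)[of x] I(3) by blast
  from ltrans_combination[OF I(1) V(1) Cc_integrable[OF f] this]
  obtain c where c: "(\<Sum>t\<in>I. norm (c t)) \<le> norm (abs_L1 f)" "\<And>b \<eta>. 0 \<le> \<eta> \<Longrightarrow> (\<forall>v\<in>V. norm (ltrans v b - b) \<le> \<eta>) \<Longrightarrow>
    norm (abs_L1 f * b - (\<Sum>t\<in>I. c t *\<^sub>C ltrans t b)) \<le> \<eta> * norm (abs_L1 f)" by blast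
  show ?thesis
    by (intro exI[of _ I] exI[of _ c] conjI I c ballI) (use \<eta> V(3) in \<open>auto intro: less_imp_le\<close>)
qed

lemma L1_mult_approx:
  fixes a :: "'g::haar_group L1"
  assumes X: "finite X" and \<epsilon>: "0 < \<epsilon>"
  shows "\<exists>I c. finite I \<and> (\<forall>b\<in>X. norm (a * b - (\<Sum>t\<in>I. c t *\<^sub>C ltrans t b)) < \<epsilon>)"
proof -
  define M where "M = Max (insert 0 (norm ` X))"
  have M: "0 \<le> M" "\<And>b. b \<in> X \<Longrightarrow> norm b \<le> M" using X by (auto simp: M_def)
  obtain f where f: "f \<in> Cc" "norm (a - abs_L1 f) < \<epsilon> / (2 * (M + 1))"
    using L1_Cc_dense[of "\<epsilon> / (2 * (M + 1))" a] \<epsilon> M(1) by auto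
  obtain K where K: "compact K" "\<And>x. x \<notin> K \<Longrightarrow> f x = 0" using Cc_support[OF f(1)] by blast
  define \<eta> where "\<eta> = \<epsilon> / (2 * (norm (abs_L1 f) + 1))"
  have \<eta>: "0 < \<eta>" using \<epsilon> by (simp add: \<eta>_def add_nonneg_pos)
  obtain I c where I: "finite I" "\<And>b. b \<in> X \<Longrightarrow> norm (abs_L1 f * b - (\<Sum>t\<in>I. c t *\<^sub>C ltrans t b)) \<le> \<eta> * norm (abs_L1 f)"
    using Cc_mult_approx[OF f(1) K X \<eta>] by metis
  have \<eta>2: "\<eta> * norm (abs_L1 f) \<le> \<epsilon> / 2"
  proof -
    have "\<eta> * norm (abs_L1 f) \<le> \<eta> * (norm (abs_L1 f) + 1)" using \<eta> by (intro mult_left_mono) auto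
    also have "\<dots> = \<epsilon> / 2" unfolding \<eta>_def using norm_ge_zero[of "abs_L1 f"] by (simp add: field_simps add_nonneg_eq_0_iff)
    finally show ?thesis .
  qed
  show ?thesis
  proof (intro exI[of _ I] exI[of _ c] conjI I ballI)
    fix b assume b: "b \<in> X"
    have "norm ((a - abs_L1 f) * b) \<le> norm (a - abs_L1 f) * norm b" by (rule L1_norm_mult_le)
    also have "\<dots> \<le> norm (a - abs_L1 f) * (M + 1)" using M(2)[OF b] by (intro mult_left_mono) auto
    also have "\<dots> < \<epsilon> / (2 * (M + 1)) * (M + 1)" using f(2) M(1) by (intro mult_strict_right_mono) auto
    also have "\<dots> = \<epsilon> / 2" using M(1) by (simp add: field_simps)
    finally have 1: "norm ((a - abs_L1 f) * b) < \<epsilon> / 2" .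
    have "a * b - (\<Sum>t\<in>I. c t *\<^sub>C ltrans t b) = (a - abs_L1 f) * b + (abs_L1 f * b - (\<Sum>t\<in>I. c t *\<^sub>C ltrans t b))"
      by (simp add: L1_mult_diff_left)
    also have "norm \<dots> \<le> norm ((a - abs_L1 f) * b) + norm (abs_L1 f * b - (\<Sum>t\<in>I. c t *\<^sub>C ltrans t b))"
      by (rule norm_triangle_ineq)
    also have "\<dots> < \<epsilon>" using 1 I(2)[OF b] \<eta>2 by simp
    finally show "norm (a * b - (\<Sum>t\<in>I. c t *\<^sub>C ltrans t b)) < \<epsilon>" .
  qed
qed

lemma L1_sum_mult: "(\<Sum>t\<in>I. c t *\<^sub>C ltrans t b) * d = (\<Sum>t\<in>I. c t *\<^sub>C ltrans t (b * d))"
  by (induction I rule: infinite_finite_induct)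
    (simp_all add: L1_zero_mult L1_mult_add_left L1_mult_scaleC_left ltrans_mult)

text \<open>Left multiplication by \<open>a\<close> is approximated by combinations of left
  translations, and these commute with right multiplication by \<open>d\<close>. The same
  coefficients are used for \<open>b\<close> and for \<open>b * d\<close>.\<close>

lemma L1_mult_assoc: "(a * b) * d = a * (b * d)" for a b d :: "'g::haar_group L1"
proof -
  have "norm ((a * b) * d - a * (b * d)) \<le> 0 + \<epsilon>" if "0 < \<epsilon>" for \<epsilon>
  proof -
    define \<delta> where "\<delta> = \<epsilon> / (norm d + 1)"
    have nd: "0 < norm d + 1" by (simp add: add_nonneg_pos)
    have \<delta>: "0 < \<delta>" using that nd by (simp add: \<delta>_def)
    obtain I c where I: "norm (a * b - (\<Sum>t\<in>I. c t *\<^sub>C ltrans t b)) < \<delta>"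
        "norm (a * (b * d) - (\<Sum>t\<in>I. c t *\<^sub>C ltrans t (b * d))) < \<delta>"
      using L1_mult_approx[of "{b, b * d}" \<delta> a] \<delta> by auto
    have "(a * b) * d - a * (b * d) = (a * b - (\<Sum>t\<in>I. c t *\<^sub>C ltrans t b)) * d - (a * (b * d) - (\<Sum>t\<in>I. c t *\<^sub>C ltrans t (b * d)))"
      by (simp add: L1_mult_diff_left L1_sum_mult)
    also have "norm \<dots> \<le> norm (a * b - (\<Sum>t\<in>I. c t *\<^sub>C ltrans t b)) * norm d + norm (a * (b * d) - (\<Sum>t\<in>I. c t *\<^sub>C ltrans t (b * d)))"
      by (rule order_trans[OF norm_triangle_ineq4 add_right_mono[OF L1_norm_mult_le]])
    also have "\<dots> \<le> \<delta> * norm d + \<delta>" using I by (intro add_mono mult_right_mono) auto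
    also have "\<dots> = \<delta> * (norm d + 1)" by (simp add: distrib_left)
    also have "\<dots> = \<epsilon>" using nd by (simp add: \<delta>_def)
    finally show ?thesis by simp
  qed
  then have "norm ((a * b) * d - a * (b * d)) \<le> 0" by (rule field_le_epsilon)
  then show ?thesis by simp
qed

instance L1 :: (haar_group) complex_normed_algebra
proof
  fix a b c :: "'a L1" and r :: real and z :: complex
  show "a * b * c = a * (b * c)" by (rule L1_mult_assoc)
  show "(a + b) * c = a * c + b * c" by (rule L1_mult_add_left)
  show "a * (b + c) = a * b + a * c" by (rule L1_mult_add_right)
  show "r *\<^sub>R a * b = r *\<^sub>R (a * b)" by (simp add: scaleR_scaleC L1_mult_scaleC_left)
  show "a * r *\<^sub>R b = r *\<^sub>R (a * b)" by (simp add: scaleR_scaleC L1_mult_scaleC_right)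
  show "norm (a * b) \<le> norm a * norm b" by (rule L1_norm_mult_le)
  show "(z *\<^sub>C a) * b = z *\<^sub>C (a * b)" by (rule L1_mult_scaleC_left)
  show "a * (z *\<^sub>C b) = z *\<^sub>C (a * b)" by (rule L1_mult_scaleC_right)
qed

section \<open>Completeness of the group algebra\<close>

lemma L1_absolutely_convergent:
  fixes Y :: "nat \<Rightarrow> 'g::haar_group L1"
  assumes sm: "summable (\<lambda>n. norm (Y n))"
  shows "convergent (\<lambda>n. \<Sum>i<n. Y i)"
proof -
  define f where "f n = rep_L1 (Y n)" for n
  have f: "integrable haar (f n)" "Y n = abs_L1 (f n)" for n by (simp_all add: f_def integrable_rep_L1 abs_rep_L1)
  have nY: "norm (Y n) = (\<integral>x. norm (f n x) \<partial>haar)" for n using f by (simp add: norm_abs_L1)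
  have "(\<integral>\<^sup>+x. (\<Sum>i. ennreal (norm (f i x))) \<partial>haar) = (\<Sum>i. \<integral>\<^sup>+x. ennreal (norm (f i x)) \<partial>haar)"
    by (rule nn_integral_suminf) (use f(1) in \<open>auto dest: borel_measurable_integrable\<close>)
  also have "\<dots> = (\<Sum>i. ennreal (norm (Y i)))" using f(1) by (simp add: nY nn_integral_eq_integral)
  also have "\<dots> \<noteq> \<infinity>" using sm by (simp add: ennreal_suminf_neq_top)
  finally have "(\<integral>\<^sup>+x. (\<Sum>i. ennreal (norm (f i x))) \<partial>haar) \<noteq> \<infinity>" .
  then have "AE x in haar. (\<Sum>i. ennreal (norm (f i x))) \<noteq> \<infinity>"
    by (intro nn_integral_PInf_AE) (use f(1) in \<open>auto dest: borel_measurable_integrable\<close>)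
  then have AE: "AE x in haar. summable (\<lambda>i. norm (f i x))"
    by eventually_elim (auto intro!: summable_suminf_not_top)
  have w: "integrable haar (\<lambda>x. \<Sum>i. norm (f i x))"
    by (rule integrable_suminf) (use f(1) AE sm in \<open>auto simp: nY\<close>)
  have F: "integrable haar (\<lambda>x. \<Sum>i. f i x)"
    by (rule integrable_suminf) (use f(1) AE sm in \<open>auto simp: nY\<close>)
  have part: "integrable haar (\<lambda>x. \<Sum>i<n. f i x)" for n using f(1) by (intro Bochner_Integration.integrable_sum)
  have "abs_L1 (\<lambda>x. \<Sum>i<n. f i x) = (\<Sum>i<n. Y i)" for n
  proof (induction n)
    case (Suc n)
    then show ?case using add_abs_L1[OF part f(1), of n n] by (simp add: f(2))
  qed (simp add: zero_L1_def)
  then have "norm ((\<Sum>i<n. Y i) - abs_L1 (\<lambda>x. \<Sum>i. f i x)) = (\<integral>x. norm ((\<Sum>i<n. f i x) - (\<Sum>i. f i x)) \<partial>haar)" for n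
    using diff_abs_L1[OF part F, of n] norm_abs_L1[OF Bochner_Integration.integrable_diff[OF part F], of n] by simp
  moreover have "(\<lambda>n. \<integral>x. norm ((\<Sum>i<n. f i x) - (\<Sum>i. f i x)) \<partial>haar) \<longlonglongrightarrow> (\<integral>x. 0 \<partial>(haar :: 'g measure))"
  proof (rule integral_dominated_convergence[OF _ _ w])
    show "AE x in haar. (\<lambda>n. norm ((\<Sum>i<n. f i x) - (\<Sum>i. f i x))) \<longlonglongrightarrow> 0" using AE
    proof eventually_elim
      case (elim x)
      from summable_LIMSEQ[OF summable_norm_cancel[OF elim]] show ?case
        by (intro tendsto_norm_zero LIM_zero)
    qed
    fix n
    show "AE x in haar. norm (norm ((\<Sum>i<n. f i x) - (\<Sum>i. f i x))) \<le> (\<Sum>i. norm (f i x))" using AE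
    proof eventually_elim
      case (elim x)
      have "(\<Sum>i. f (i + n) x) = (\<Sum>i. f i x) - (\<Sum>i<n. f i x)"
        by (rule suminf_minus_initial_segment[OF summable_norm_cancel[OF elim]])
      then have "norm ((\<Sum>i<n. f i x) - (\<Sum>i. f i x)) = norm (\<Sum>i. f (i + n) x)" by (simp add: norm_minus_commute)
      also have "\<dots> \<le> (\<Sum>i. norm (f (i + n) x))"
        using summable_ignore_initial_segment[OF elim, of n] by (intro summable_norm)
      also have "\<dots> = (\<Sum>i. norm (f i x)) - (\<Sum>i<n. norm (f i x))"
        by (rule suminf_minus_initial_segment[OF elim])
      also have "\<dots> \<le> (\<Sum>i. norm (f i x))" by (simp add: sum_nonneg)
      finally show ?case by simp
    qed
  qed (use part[THEN borel_measurable_integrable] F[THEN borel_measurable_integrable] in auto)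
  ultimately have "(\<lambda>n. norm ((\<Sum>i<n. Y i) - abs_L1 (\<lambda>x. \<Sum>i. f i x))) \<longlonglongrightarrow> 0" by simp
  then have "(\<lambda>n. (\<Sum>i<n. Y i) - abs_L1 (\<lambda>x. \<Sum>i. f i x)) \<longlonglongrightarrow> 0" by (rule tendsto_norm_zero_cancel)
  then show ?thesis by (rule convergentI[OF LIM_zero_cancel])
qed

instance L1 :: (haar_group) complex_banach_algebra
proof
  fix X :: "nat \<Rightarrow> 'a L1" assume X: "Cauchy X"
  have "\<exists>N. \<forall>m\<ge>N. \<forall>n\<ge>N. dist (X m) (X n) < (1 / 2) ^ k" for k :: nat
    using X unfolding Cauchy_def by simp
  then obtain N where N: "\<And>k m n. N k \<le> m \<Longrightarrow> N k \<le> n \<Longrightarrow> dist (X m) (X n) < (1 / 2) ^ k" by metis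
  \<comment> \<open>Summing the thresholds makes both \<open>r k\<close> and
    \<open>r (Suc k)\<close> at least \<open>N k\<close>.\<close>
  define r where "r k = (\<Sum>i\<le>k. N i)" for k
  have r: "N k \<le> r k" "N k \<le> r (Suc k)" for k unfolding r_def by (auto intro: member_le_sum trans_le_add1)
  have "summable (\<lambda>k. norm (X (r (Suc k)) - X (r k)))"
  proof (rule summable_comparison_test'[of "\<lambda>k. (1 / 2) ^ k" 0])
    show "norm (norm (X (r (Suc k)) - X (r k))) \<le> (1 / 2) ^ k" for k
      using N[OF r(2,1), of k] by (simp add: dist_norm less_imp_le)
  qed (simp add: summable_geometric)
  then have "convergent (\<lambda>n. \<Sum>i<n. X (r (Suc i)) - X (r i))" by (rule L1_absolutely_convergent)
  then obtain l where "(\<lambda>n. \<Sum>i<n. X (r (Suc i)) - X (r i)) \<longlonglongrightarrow> l" unfolding convergent_def by blast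
  then have "(\<lambda>n. X (r n) - X (r 0)) \<longlonglongrightarrow> l" by (simp add: sum_lessThan_telescope[of "\<lambda>n. X (r n)"])
  from tendsto_add[OF this tendsto_const[of "X (r 0)"]] have l: "(\<lambda>n. X (r n)) \<longlonglongrightarrow> l + X (r 0)" by simp
  have "X \<longlonglongrightarrow> l + X (r 0)"
  proof (rule metric_LIMSEQ_I)
    fix \<epsilon> :: real assume \<epsilon>: "0 < \<epsilon>"
    obtain k0 where k0: "(1 / 2) ^ k0 < \<epsilon> / 2" using real_arch_pow_inv[of "\<epsilon> / 2" "1 / 2"] \<epsilon> by auto
    obtain k1 where k1: "\<And>k. k \<ge> k1 \<Longrightarrow> dist (X (r k)) (l + X (r 0)) < \<epsilon> / 2"
      using metric_LIMSEQ_D[OF l, of "\<epsilon> / 2"] \<epsilon> by auto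
    define k where "k = max k0 k1"
    have "(1 / 2 :: real) ^ k \<le> (1 / 2) ^ k0" by (intro power_decreasing) (auto simp: k_def)
    then have k0': "(1 / 2 :: real) ^ k < \<epsilon> / 2" using k0 by linarith
    have k1': "dist (X (r k)) (l + X (r 0)) < \<epsilon> / 2" by (rule k1) (simp add: k_def)
    have "dist (X n) (l + X (r 0)) < \<epsilon>" if "N k \<le> n" for n
      using N[OF that r(1)] k0' k1' dist_triangle[of "X n" "l + X (r 0)" "X (r k)"] by linarith
    then show "\<exists>no. \<forall>n\<ge>no. dist (X n) (l + X (r 0)) < \<epsilon>" by blast
  qed
  then show "convergent X" by (rule convergentI)
qed

section \<open>Approximate units\<close>

lemma Cc_mult_bump:
  fixes h :: "'g::haar_group \<Rightarrow> complex"
  assumes h: "h \<in> Cc" and \<epsilon>: "0 < \<epsilon>"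
  shows "\<exists>V. open V \<and> 0 \<in> V \<and> (\<forall>u. bump V u \<longrightarrow>
    norm (abs_L1 h * abs_L1 (\<lambda>x. complex_of_real (u x)) - abs_L1 h) \<le> \<epsilon>)"
proof -
  obtain C where C: "compact C" "\<And>\<epsilon>. 0 < \<epsilon> \<Longrightarrow> \<exists>V. open V \<and> 0 \<in> V \<and> (\<forall>v\<in>V. \<forall>x. norm (h (x + v) - h x) \<le> \<epsilon> * indicator C x)"
    using Cc_uniformly_continuous_right[OF h] by blast
  obtain \<delta> where \<delta>: "0 < \<delta>" "\<And>F::'g \<Rightarrow> real. integrable haar F \<Longrightarrow> (\<forall>x. F x \<le> \<delta> * indicator C x) \<Longrightarrow> (\<integral>x. F x \<partial>haar) \<le> \<epsilon>"
    using ex_small_multiple_indicator[OF C(1) \<epsilon>] by blast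
  obtain V where V: "open V" "0 \<in> V" "\<And>v x. v \<in> V \<Longrightarrow> norm (h (x + v) - h x) \<le> \<delta> * indicator C x"
    using C(2)[OF \<delta>(1)] by blast
  note ih = Cc_integrable[OF h]
  have main: "norm (abs_L1 h * abs_L1 (\<lambda>x. complex_of_real (u x)) - abs_L1 h) \<le> \<epsilon>" if "bump V u" for u
  proof -
    note u = bumpD[OF that]
    obtain L where L: "compact L" "\<And>x. x \<notin> L \<Longrightarrow> u x = 0" using Cc_support[OF u(1)] by blast
    define w where "w x = complex_of_real (u x)" for x
    have iu: "integrable haar u" by (rule Cc_integrable[OF u(1)])
    then have iw: "integrable haar w" by (simp add: w_def[abs_def])
    have w1: "(\<integral>x. w x \<partial>haar) = 1" unfolding w_def using u(5) by simp
    \<comment> \<open>After the substitution \<open>y = x + z\<close>, the symmetry of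
      \<open>u\<close> makes \<open>convolution h w x\<close> an average of \<open>h (x + z)\<close>
      over \<open>z\<close> near \<open>0\<close>.\<close>
    have est: "norm (convolution h w x - h x) \<le> \<delta> * indicator C x" for x
    proof -
      have "(\<lambda>y. h y * w (- y + x)) \<in> borel_measurable borel"
        using ih iw by (intro convolution_integrand_measurable) auto
      from integral_haar_translate[OF this, of x]
      have "convolution h w x = (\<integral>z. h (x + z) * w (- (x + z) + x) \<partial>haar)" by (simp add: convolution_def)
      also have "\<dots> = (\<integral>z. h (x + z) * w z \<partial>haar)"
        by (simp add: minus_add add.assoc w_def u(3) del: add_uminus_conv_diff)
      finally have conv: "convolution h w x = (\<integral>z. h (x + z) * w z \<partial>haar)" .
      have i1: "integrable haar (\<lambda>z. h (x + z) * w z)"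
      proof (rule Cc_integrable, rule CcI[OF _ L(1)])
        show "continuous_on UNIV (\<lambda>z. h (x + z) * w z)" unfolding w_def
          by (intro continuous_on_mult continuous_on_of_real continuous_on_compose2[OF Cc_continuous[OF h]] Cc_continuous[OF u(1)] continuous_intros) auto
      qed (use L in \<open>auto simp: w_def\<close>)
      have "convolution h w x - h x = (\<integral>z. h (x + z) * w z - h x * w z \<partial>haar)"
        using i1 iw w1 by (simp add: conv)
      also have "norm \<dots> \<le> (\<integral>z. norm (h (x + z) * w z - h x * w z) \<partial>haar)"
        by (rule integral_norm_bound)
      also have "\<dots> \<le> (\<integral>z. \<delta> * indicator C x * u z \<partial>haar)"
      proof (rule integral_mono)
        show "integrable haar (\<lambda>z. norm (h (x + z) * w z - h x * w z))" using i1 iw by auto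
        show "integrable haar (\<lambda>z. \<delta> * indicator C x * u z)" using iu by auto
        fix z
        have "norm (h (x + z) * w z - h x * w z) = norm (h (x + z) - h x) * u z"
          using u(2)[of z] by (simp add: w_def norm_mult flip: left_diff_distrib)
        also have "\<dots> \<le> \<delta> * indicator C x * u z"
        proof (cases "z \<in> V")
          case True
          from mult_right_mono[OF V(3)[OF True] u(2)] show ?thesis .
        qed (simp add: u(4))
        finally show "norm (h (x + z) * w z - h x * w z) \<le> \<delta> * indicator C x * u z" .
      qed
      also have "\<dots> = \<delta> * indicator C x" using u(5) by simp
      finally show ?thesis .
    qed
    note ic = integrable_convolution[OF ih iw]
    have "norm (abs_L1 h * abs_L1 w - abs_L1 h) = (\<integral>x. norm (convolution h w x - h x) \<partial>haar)"
      using ih iw ic by (simp add: mult_abs_L1 diff_abs_L1 norm_abs_L1)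
    also have "\<dots> \<le> \<epsilon>" by (rule \<delta>(2)) (use est ih ic in auto)
    finally show ?thesis by (simp add: w_def[abs_def])
  qed
  show ?thesis by (intro exI[of _ V] conjI allI impI V(1,2) main)
qed

text \<open>For a bump \<open>v\<close> near \<open>0\<close>, \<open>v * a\<close> is an average of
  left translates of \<open>a\<close> and is handled by \<open>norm_mult_minus_ltrans_le\<close>.
  For \<open>a * v\<close> one passes to an approximation of \<open>a\<close> in \<open>Cc\<close>
  and uses \<open>Cc_mult_bump\<close>.\<close>

lemma ex_approximate_unit:
  fixes X :: "'g::haar_group L1 set"
  assumes X: "finite X" and \<epsilon>: "0 < \<epsilon>"
  shows "\<exists>v. norm v \<le> 1 \<and> (\<forall>a\<in>X. norm (v * a - a) < \<epsilon> \<and> norm (a * v - a) < \<epsilon>)"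
proof -
  have "\<exists>h\<in>Cc. norm (a - abs_L1 h) < \<epsilon> / 3" for a :: "'g L1" by (rule L1_Cc_dense) (use \<epsilon> in simp)
  then obtain h where h: "\<And>a :: 'g L1. h a \<in> Cc" "\<And>a. norm (a - abs_L1 (h a)) < \<epsilon> / 3" by metis
  have "\<exists>V. open V \<and> 0 \<in> V \<and> (\<forall>u. bump V u \<longrightarrow>
    norm (abs_L1 (h a) * abs_L1 (\<lambda>x. complex_of_real (u x)) - abs_L1 (h a)) \<le> \<epsilon> / 3)" for a
    by (rule Cc_mult_bump[OF h(1)]) (use \<epsilon> in simp)
  then obtain W where W: "\<And>a. open (W a) \<and> 0 \<in> W a"
    "\<And>a u. bump (W a) u \<Longrightarrow> norm (abs_L1 (h a) * abs_L1 (\<lambda>x. complex_of_real (u x)) - abs_L1 (h a)) \<le> \<epsilon> / 3" by metis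
  obtain V where V: "open V" "0 \<in> V" "\<And>a v. a \<in> X \<Longrightarrow> v \<in> V \<Longrightarrow> norm (ltrans v a - a) < \<epsilon> / 2"
    using ltrans_continuous[OF X, of "\<epsilon> / 2"] \<epsilon> by auto
  define V' where "V' = V \<inter> (\<Inter>a\<in>X. W a)"
  have V': "open V'" "0 \<in> V'" using V W(1) X by (auto simp: V'_def intro!: open_Int open_INT)
  obtain u where bump: "bump V' u" using ex_bump[OF V'] by blast
  note u = bumpD[OF bump]
  define w where "w x = complex_of_real (u x)" for x
  have iw: "integrable haar w" using Cc_integrable[OF u(1)] by (simp add: w_def[abs_def])
  have w1: "(\<integral>x. w x \<partial>haar) = 1" unfolding w_def using u(5) by simp
  define v where "v = abs_L1 w"
  have nv: "norm v = 1" using iw u by (simp add: v_def norm_abs_L1 w_def)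
  show ?thesis
  proof (intro exI[of _ v] conjI ballI)
    show "norm v \<le> 1" using nv by simp
    fix a assume a: "a \<in> X"
    have near: "norm (ltrans y a - ltrans 0 a) \<le> \<epsilon> / 2" if "w y \<noteq> 0" for y
    proof -
      have "y \<in> V" using that u(4) by (auto simp: w_def V'_def)
      then show ?thesis using V(3)[OF a] by (simp add: ltrans_zero less_imp_le)
    qed
    have "norm (v * a - (\<integral>x. w x \<partial>haar) *\<^sub>C ltrans 0 a) \<le> \<epsilon> / 2 * norm v"
      unfolding v_def by (rule norm_mult_minus_ltrans_le[OF iw _ near]) (use \<epsilon> in auto)
    then show "norm (v * a - a) < \<epsilon>" using \<epsilon> nv by (simp add: w1 ltrans_zero)
    have u': "bump (W a) u" using bump a by (auto simp: V'_def intro: bump_mono)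
    define b where "b = abs_L1 (h a)"
    have "norm (b * v - b) \<le> \<epsilon> / 3"
      using W(2)[OF u'] by (simp add: b_def v_def w_def[abs_def])
    moreover have "norm ((a - b) * v) \<le> norm (a - b)" using norm_mult_ineq[of "a - b" v] nv by simp
    moreover have "norm (a - b) < \<epsilon> / 3" unfolding b_def by (rule h(2))
    moreover have "norm (a * v - a) \<le> norm ((a - b) * v) + norm (b * v - b) + norm (a - b)"
    proof -
      have "a * v - a = (a - b) * v + (b * v - b) - (a - b)" by (simp add: left_diff_distrib)
      then show ?thesis by (simp only: order_trans[OF norm_triangle_ineq4 add_right_mono[OF norm_triangle_ineq]])
    qed
    ultimately show "norm (a * v - a) < \<epsilon>" by linarith
  qed
qed

lemma compact_cover_right_translates:
  fixes K V :: "'g::topological_group_add set"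
  assumes K: "compact K" and V: "open V" "0 \<in> V"
  shows "\<exists>I. finite I \<and> K \<subseteq> (\<Union>t\<in>I. (\<lambda>v. v + t) ` V)"
proof -
  have "K \<subseteq> (\<Union>t\<in>K. (\<lambda>v. v + t) ` V)" using V(2) by (force intro: image_eqI[of _ _ 0])
  then show ?thesis
    using compactE_image[OF K, of K "\<lambda>t. (\<lambda>v. v + t) ` V"] open_homeomorphism_image[OF homeomorphism_add_right V(1)] by metis
qed

text \<open>Uniformity over \<open>K\<close> is required because in
  \<open>translation_approx\<close> the unit \<open>v\<close> is chosen before the translations that
  it must serve. Finitely many right translates of \<open>V\<close> cover \<open>K\<close>, and
  \<open>rtrans (w + s) a = rtrans s (rtrans w a)\<close> is close to \<open>rtrans s a\<close> for
  \<open>w\<close> in \<open>V\<close>.\<close>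

lemma ex_approximate_unit_rtrans:
  fixes X Y :: "'g::haar_group L1 set"
  assumes X: "finite X" and Y: "finite Y" and K: "compact K" and \<epsilon>: "0 < \<epsilon>"
  shows "\<exists>v. norm v \<le> 1 \<and> (\<forall>a\<in>X. \<forall>t\<in>K. norm (rtrans t a * v - rtrans t a) < \<epsilon>) \<and> (\<forall>y\<in>Y. norm (y * v - y) < \<epsilon>)"
proof -
  obtain V where V: "open V" "0 \<in> V" "\<And>a v. a \<in> X \<Longrightarrow> v \<in> V \<Longrightarrow> norm (rtrans v a - a) < \<epsilon> / 3"
    using rtrans_continuous[OF X, of "\<epsilon> / 3"] \<epsilon> by auto
  obtain J where J: "finite J" "K \<subseteq> (\<Union>t\<in>J. (\<lambda>v. v + t) ` V)"
    using compact_cover_right_translates[OF K V(1,2)] by blast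
  define Z where "Z = Y \<union> (\<lambda>(t, a). rtrans t a) ` (J \<times> X)"
  have "finite Z" using X Y J by (simp add: Z_def)
  then obtain v where v: "norm v \<le> 1" "\<And>z. z \<in> Z \<Longrightarrow> norm (z * v - z) < \<epsilon> / 3"
    using ex_approximate_unit[of Z "\<epsilon> / 3"] \<epsilon> by auto
  show ?thesis
  proof (intro exI[of _ v] conjI ballI v(1))
    show "norm (y * v - y) < \<epsilon>" if "y \<in> Y" for y using v(2)[of y] that \<epsilon> by (simp add: Z_def)
    fix a t assume a: "a \<in> X" and "t \<in> K"
    then obtain s w where s: "s \<in> J" "w \<in> V" "t = w + s" using J(2) by blast
    define z where "z = rtrans s a"
    define d where "d = rtrans t a - z"
    have "rtrans t a - rtrans s a = rtrans s (rtrans w a - a)" by (simp add: s(3) rtrans_diff rtrans_rtrans)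
    then have d: "norm d < \<epsilon> / 3" using V(3)[OF a s(2)] by (simp add: d_def z_def norm_rtrans)
    have "z \<in> Z" using s(1) a by (auto simp: Z_def z_def)
    then have z: "norm (z * v - z) < \<epsilon> / 3" by (rule v(2))
    have dv: "norm (d * v) \<le> norm d" using norm_mult_ineq[of d v] v(1) mult_left_mono[of "norm v" 1 "norm d"] by simp
    have "rtrans t a * v - rtrans t a = d * v + (z * v - z) - d" by (simp add: d_def left_diff_distrib)
    also have "norm \<dots> \<le> norm (d * v) + norm (z * v - z) + norm d"
      by (rule order_trans[OF norm_triangle_ineq4 add_right_mono[OF norm_triangle_ineq]])
    finally show "norm (rtrans t a * v - rtrans t a) < \<epsilon>" using d dv z by linarith
  qed
qed

text \<open>The left half is a Riemann sum estimate. For the right half with the same coefficients,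
  \<open>a * x\<close> is compared with \<open>a * (f * v)\<close>, then \<open>f * v\<close> with
  its Riemann sum; the translations of \<open>v\<close> move over to \<open>a\<close> by
  \<open>rtrans_mult_eq_mult_ltrans\<close>, and \<open>v\<close> is dropped. Hence \<open>v\<close>
  is fixed first, and the Riemann sum is taken for \<open>X\<close> and \<open>v\<close> at
  once.\<close>

lemma translation_approx:
  fixes x :: "'g::haar_group L1"
  assumes X: "finite X" and \<epsilon>: "0 < \<epsilon>"
  shows "\<exists>I c. finite I \<and> (\<forall>a\<in>X. norm (x * a - (\<Sum>t\<in>I. c t *\<^sub>C ltrans t a)) < \<epsilon> \<and>
    norm (a * x - (\<Sum>t\<in>I. c t *\<^sub>C rtrans t a)) < \<epsilon>)"
proof -
  define M where "M = Max (insert 0 (norm ` X))"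
  have M: "0 \<le> M" "\<And>b. b \<in> X \<Longrightarrow> norm b \<le> M" using X by (auto simp: M_def)
  obtain h where h: "h \<in> Cc" "norm (x - abs_L1 h) < \<epsilon> / (4 * (M + 1))"
    using L1_Cc_dense[of "\<epsilon> / (4 * (M + 1))" x] \<epsilon> M(1) by auto
  obtain K where K: "compact K" "\<And>x. x \<notin> K \<Longrightarrow> h x = 0" using Cc_support[OF h(1)] by blast
  define f where "f = abs_L1 h"
  define N where "N = norm f"
  have N: "0 \<le> N" by (simp add: N_def)
  \<comment> \<open>The errors \<open>M * \<delta>\<close> and \<open>N * \<delta>\<close> together
    do not exceed \<open>\<epsilon> / 12\<close>; the other two are at most
    \<open>\<epsilon> / 4\<close> each.\<close>
  define \<delta> where "\<delta> = \<epsilon> / (12 * (M + N + 1))"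
  have "\<delta> * (12 * (M + N + 1)) = \<epsilon>" using M(1) N by (simp add: \<delta>_def)
  moreover have "0 < \<delta>" using \<epsilon> M(1) N by (simp add: \<delta>_def)
  ultimately have \<delta>: "0 < \<delta>" "12 * (M * \<delta>) + 12 * (N * \<delta>) \<le> \<epsilon>" by (simp_all add: algebra_simps)
  define \<eta> where "\<eta> = \<epsilon> / (4 * ((M + 1) * (N + 1)))"
  have pos: "0 < (M + 1) * (N + 1)" using M(1) N by (intro mult_pos_pos) auto
  have \<eta>: "0 < \<eta>" using \<epsilon> pos by (simp add: \<eta>_def)
  have \<eta>N: "(M + 1) * (\<eta> * N) \<le> \<epsilon> / 4"
  proof -
    have "(M + 1) * (\<eta> * N) \<le> (M + 1) * (\<eta> * (N + 1))" using M(1) \<eta> by (intro mult_left_mono) auto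
    also have "\<dots> = \<eta> * ((M + 1) * (N + 1))" by (simp add: mult_ac)
    also have "\<dots> = \<epsilon> / 4"
    proof -
      have "\<epsilon> / (4 * P) * P = \<epsilon> / 4" if "0 < P" for P using that by simp
      from this[OF pos] show ?thesis by (simp only: \<eta>_def)
    qed
    finally show ?thesis .
  qed
  obtain v where v: "norm v \<le> 1" "\<And>a t. a \<in> X \<Longrightarrow> t \<in> K \<Longrightarrow> norm (rtrans t a * v - rtrans t a) < \<delta>" "norm (f * v - f) < \<delta>"
    using ex_approximate_unit_rtrans[OF X _ K(1) \<delta>(1), of "{f}"] by auto
  obtain I c where I: "finite I" "I \<subseteq> K" "(\<Sum>t\<in>I. norm (c t)) \<le> N"
    "\<And>b. b \<in> insert v X \<Longrightarrow> norm (f * b - (\<Sum>t\<in>I. c t *\<^sub>C ltrans t b)) \<le> \<eta> * N"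
    using Cc_mult_approx[OF h(1) K _ \<eta>, of "insert v X"] X unfolding f_def N_def by blast
  have xf: "norm (x - f) * (M + 1) < \<epsilon> / 4"
    using h(2) M(1) by (simp add: f_def field_simps)
  have \<eta>N': "\<eta> * N \<le> \<epsilon> / 4"
  proof -
    have "0 \<le> M * (\<eta> * N)" using M(1) \<eta> N by simp
    then show ?thesis using \<eta>N by (simp add: distrib_right)
  qed
  show ?thesis
  proof (intro exI[of _ I] exI[of _ c] conjI ballI I(1))
    fix a assume a: "a \<in> X"
    have na: "norm a \<le> M" by (rule M(2)[OF a])
    have xfa: "norm (x - f) * norm a < \<epsilon> / 4"
    proof -
      have "norm (x - f) * norm a \<le> norm (x - f) * (M + 1)" using na by (intro mult_left_mono) auto
      then show ?thesis using xf by linarith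
    qed
    have "x * a - (\<Sum>t\<in>I. c t *\<^sub>C ltrans t a) = (x - f) * a + (f * a - (\<Sum>t\<in>I. c t *\<^sub>C ltrans t a))"
      by (simp add: left_diff_distrib)
    also have "norm \<dots> \<le> norm (x - f) * norm a + \<eta> * N"
      by (rule norm_triangle_le[OF add_mono[OF norm_mult_ineq I(4)]]) (use a in simp)
    finally show "norm (x * a - (\<Sum>t\<in>I. c t *\<^sub>C ltrans t a)) < \<epsilon>" using xfa \<eta>N' \<epsilon> by linarith
    have eq: "a * (\<Sum>t\<in>I. c t *\<^sub>C ltrans t v) = (\<Sum>t\<in>I. c t *\<^sub>C (rtrans t a * v))"
      by (simp add: sum_distrib_left L1_mult_scaleC_right rtrans_mult_eq_mult_ltrans)
    have "a * x - (\<Sum>t\<in>I. c t *\<^sub>C rtrans t a) =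
      a * (x - f) + (a * (f - f * v) + (a * (f * v - (\<Sum>t\<in>I. c t *\<^sub>C ltrans t v)) + (\<Sum>t\<in>I. c t *\<^sub>C (rtrans t a * v - rtrans t a))))"
      by (simp add: right_diff_distrib eq sum_subtractf scaleC_diff_right)
    also have "norm \<dots> \<le> norm a * norm (x - f) + (norm a * norm (f - f * v) + (norm a * norm (f * v - (\<Sum>t\<in>I. c t *\<^sub>C ltrans t v)) +
        norm (\<Sum>t\<in>I. c t *\<^sub>C (rtrans t a * v - rtrans t a))))"
      by (intro norm_triangle_le add_mono norm_mult_ineq order_refl)
    also have "norm a * norm (f - f * v) \<le> M * \<delta>"
      using na v(3) M(1) by (intro mult_mono) (auto simp: norm_minus_commute)
    also have "norm a * norm (f * v - (\<Sum>t\<in>I. c t *\<^sub>C ltrans t v)) \<le> (M + 1) * (\<eta> * N)"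
      using na M(1) by (intro mult_mono I(4)) auto
    also have "norm (\<Sum>t\<in>I. c t *\<^sub>C (rtrans t a * v - rtrans t a)) \<le> N * \<delta>"
    proof -
      have "norm (\<Sum>t\<in>I. c t *\<^sub>C (rtrans t a * v - rtrans t a)) \<le> (\<Sum>t\<in>I. norm (c t) * \<delta>)"
        using I(2) by (intro sum_norm_le) (auto simp: norm_scaleC intro!: mult_left_mono less_imp_le[OF v(2)[OF a]])
      also have "\<dots> \<le> N * \<delta>" using I(3) \<delta>(1) by (simp flip: sum_distrib_right)
      finally show ?thesis .
    qed
    finally have "norm (a * x - (\<Sum>t\<in>I. c t *\<^sub>C rtrans t a)) \<le> norm a * norm (x - f) + (M * \<delta> + ((M + 1) * (\<eta> * N) + N * \<delta>))"
      by simp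
    then show "norm (a * x - (\<Sum>t\<in>I. c t *\<^sub>C rtrans t a)) < \<epsilon>"
      using xfa \<eta>N \<delta> \<epsilon> by (simp only: mult.commute[of "norm a"])
  qed
qed

section \<open>A bounded approximate identity of the group algebra\<close>

definition approximate_units :: "'g::haar_group L1 set \<Rightarrow> real \<Rightarrow> 'g L1 set"
  where "approximate_units X \<epsilon> = {v. norm v \<le> 1 \<and> (\<forall>a\<in>X. norm (v * a - a) < \<epsilon> \<and> norm (a * v - a) < \<epsilon>)}"

text \<open>The net is indexed by the algebra itself; the sets
  \<open>approximate_units X \<epsilon>\<close> form a base of the filter, because two of them
  contain the one for the union and the smaller tolerance.\<close>

definition approximate_unit_filter :: "'g::haar_group L1 filter"
  where "approximate_unit_filter = (INF (X, \<epsilon>)\<in>{(X, \<epsilon>). finite X \<and> 0 < \<epsilon>}. principal (approximate_units X \<epsilon>))"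

text \<open>\<open>bounded_approximate_identity\<close> demands boundedness on the whole index type.
  The \<open>if\<close> truncates the identity map, and the filter does not notice this because its
  basic sets lie in the unit ball.\<close>

lemma approximate_unit_filter_bai:
  "bounded_approximate_identity (\<lambda>v::'g::haar_group L1. if norm v \<le> 1 then v else 0) approximate_unit_filter"
  unfolding bounded_approximate_identity_def
proof (intro conjI allI)
  have ev: "eventually P approximate_unit_filter \<longleftrightarrow>
      (\<exists>X \<epsilon>. finite X \<and> 0 < \<epsilon> \<and> (\<forall>v\<in>approximate_units X \<epsilon>. P v))" for P :: "'g L1 \<Rightarrow> bool"
    unfolding approximate_unit_filter_def
  proof (subst eventually_INF_base)
    show "{(X::'g L1 set, \<epsilon>::real). finite X \<and> 0 < \<epsilon>} \<noteq> {}" by (auto intro!: exI[of _ "{}"] exI[of _ 1])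
    show "\<exists>z\<in>{(X, \<epsilon>). finite X \<and> 0 < \<epsilon>}. (case z of (X, \<epsilon>) \<Rightarrow> principal (approximate_units X \<epsilon>)) \<le>
        inf (case p of (X, \<epsilon>) \<Rightarrow> principal (approximate_units X \<epsilon>)) (case q of (X, \<epsilon>) \<Rightarrow> principal (approximate_units X \<epsilon>))"
      if "p \<in> {(X, \<epsilon>). finite X \<and> 0 < \<epsilon>}" "q \<in> {(X, \<epsilon>). finite X \<and> 0 < \<epsilon>}" for p q :: "'g L1 set \<times> real"
      using that
      by (intro bexI[of _ "(fst p \<union> fst q, min (snd p) (snd q))"]) (auto simp: approximate_units_def)
  qed (auto simp: eventually_principal)
  show "approximate_unit_filter \<noteq> (bot :: 'g L1 filter)"
    unfolding trivial_limit_def ev using ex_approximate_unit by (fastforce simp: approximate_units_def)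
  show "bounded (range (\<lambda>v::'g L1. if norm v \<le> 1 then v else 0))"
    by (rule boundedI[of _ 1]) auto
  fix a :: "'g L1"
  have *: "eventually (\<lambda>v. norm ((if norm v \<le> 1 then v else 0) * a - a) < \<epsilon> \<and> norm (a * (if norm v \<le> 1 then v else 0) - a) < \<epsilon>)
      approximate_unit_filter" if "0 < \<epsilon>" for \<epsilon>
    unfolding ev using that by (intro exI[of _ "{a}"] exI[of _ \<epsilon>]) (auto simp: approximate_units_def)
  show "((\<lambda>v. (if norm v \<le> 1 then v else 0) * a) \<longlongrightarrow> a) approximate_unit_filter"
    "((\<lambda>v. a * (if norm v \<le> 1 then v else 0)) \<longlongrightarrow> a) approximate_unit_filter"
    by (rule tendstoI, drule *, erule eventually_mono, simp add: dist_norm)+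
qed

lemma bounded_clinear_ltrans: "bounded_clinear (ltrans t)"
  by (intro bounded_clinearI bounded_linear_intro[of _ 1]) (simp_all add: ltrans_add ltrans_scaleC scaleR_scaleC norm_ltrans)

lemma bounded_clinear_rtrans: "bounded_clinear (rtrans t)"
  by (intro bounded_clinearI bounded_linear_intro[of _ 1]) (simp_all add: rtrans_add rtrans_scaleC scaleR_scaleC norm_rtrans)

theorem corollary2p6:
  fixes \<Phi> :: "'g::haar_group L1 \<Rightarrow> 'b::complex_banach_algebra"
    and e :: "'i \<Rightarrow> 'b" and F :: "'i filter"
  assumes "bounded_approximate_identity e F"
    and "clinear \<Phi>"
    and "continuous_on UNIV \<Phi>"
    and "surj \<Phi>"
    and "preserves_two_sided_zero_products \<Phi>"
  shows "weighted_jordan_hom \<Phi>"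
proof -
  interpret zero_product_preserver ltrans rtrans "\<lambda>v. if norm v \<le> 1 then v else 0" approximate_unit_filter \<Phi> e F
  proof
    show "multiplier (ltrans t) (rtrans t)" for t :: 'g
      by (simp add: multiplier_def bounded_clinear_ltrans bounded_clinear_rtrans ltrans_mult rtrans_mult rtrans_mult_eq_mult_ltrans)
    show "\<exists>I c. finite I \<and> (\<forall>a\<in>X. norm (x * a - (\<Sum>t\<in>I. c t *\<^sub>C ltrans t a)) < \<epsilon> \<and>
        norm (a * x - (\<Sum>t\<in>I. c t *\<^sub>C rtrans t a)) < \<epsilon>)" if "finite X" "0 < \<epsilon>" for X \<epsilon> and x :: "'g L1"
      by (rule translation_approx[OF that])
  qed (use assms in \<open>simp_all add: norm_ltrans norm_rtrans ltrans_zero rtrans_zero ltrans_ltrans rtrans_rtrans ltrans_rtrans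
    approximate_unit_filter_bai clinear_continuous_imp_bounded_clinear\<close>)
  show ?thesis by (rule weighted_jordan_hom_Phi)
qed

end
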